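(* The sets $\mathcal E$ and $\mathcal E_0$ are closed with respect to weak convergence in $X_{p,q}(\Omega)$ (i.e. weak limits of sequences in $\mathcal E$, respectively $\mathcal E_0$, belong to $\mathcal E$, respectively $\mathcal E_0$). Furthermore, there is a constant $c_{\mathcal E}$, which may depend on $h_N$, $g_D$, $f$, $n$, $p$, $q$, $\Omega$, $\Gamma_D$ and $\Gamma_N$, such that $$\int_\Omega F\cdot P\,dx\le c_{\mathcal E}\|(F,P)\|_{X_{p,q}(\Omega)}+c_{\mathcal E}\qquad\text{for all }(F,P)\in\mathcal E_0 .$$
   Context: Setting. $n\in\mathbb N$ is the space dimension, $\mathbb R^{n\times n}_{\mathrm{sym}}$ denotes the symmetric matrices, and $\cdot$ is the Euclidean scalar product (for matrices $A\cdot B=\sum_{ij}A_{ij}B_{ij}$). $\Omega\subseteq\mathbb R^n$ is bounded, connected, open, Lipschitz with outer normal $\nu$. $\Gamma_D,\Gamma_N\subseteq\partial\Omega$ are disjoint relatively open subsets of $\partial\Omega$ with $\overline\Gamma_D\cup\overline\Gamma_N=\partial\Omega$, $\mathcal H^{n-1}(\overline\Gamma_N\setminus\Gamma_N)=\mathcal H^{n-1}(\overline\Gamma_D\setminus\Gamma_D)=0$, $\Gamma_D\neq\emptyset$. $p,q\in(1,\infty)$ with $1/p+1/q=1$. Given are $f\in L^q(\Omega;\mathbb R^n)$, $g_D\in W^{1/q,p}(\partial\Omega;\mathbb R^n)$, $h_N\in W^{-1/q,q}(\partial\Omega;\mathbb R^n)$. Trace spaces. $W^{1/q,p}(\partial\Omega;\mathbb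 R^n)=W^{1-1/p,p}(\partial\Omega;\mathbb R^n)$ is the fractional Sobolev space of $L^p(\partial\Omega;\mathbb R^n)$ functions with finite seminorm $[\varphi]^p=\int_{\partial\Omega\times\partial\Omega}|\varphi(x)-\varphi(y)|^p|x-y|^{-(n+p-2)}d\mathcal H^{n-1}(x)d\mathcal H^{n-1}(y)$ (the trace space of $W^{1,p}(\Omega;\mathbb R^n)$), and $W^{-1/q,q}(\partial\Omega;\mathbb R^n)$ is its dual, with pairing $\langle\cdot,\cdot\rangle$. $B:W^{1,p}(\Omega;\mathbb R^n)\to W^{1/q,p}(\partial\Omega;\mathbb R^n)$ is the trace operator. For $v\in L^q(\Omega;\mathbb R^{n\times n})$ with $\mathrm{div}\,v\in L^q(\Omega;\mathbb R^n)$ (divergence taken rowwise, $(\mathrm{div}\,v)_i=\sum_j\partial_jv_{ij}$), the normal trace $B_\nu v\in W^{-1/q,q}(\partial\Omega;\mathbb R^n)$ is defined by $\langle B_\nu v,Bu\rangle=\int_\Omega v\cdot Du\,dx+\int_\Omega u\cdot\mathrm{div}\,v\,dx$ for all $u\in W^{1,p}(\Omega;\mathbb R^n)$. Phase space. $X_{p,q}(\Omega):=L^p(\Omega;\mathbb R^{n\times n})\times L^q(\Omega;\mathbb R^{n\times n})$ with norm $\|(F,P)\|_{X_{p,q}(\Omega)}=\|F\|_{L^p}+\|P\|_{L^q}$. Constraint sets. $\mathcal E_0$ is the set of $(F,P)\in X_{p,q}(\Omega)$ such that there is $u\in W^{1,p}(\Omega;\mathbb R^n)$ with $F=Du$ in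 $\Omega$, $u=g_D$ on $\Gamma_D$, and $\mathrm{div}\,P+f=0$ in $\Omega$, $P\nu=h_N$ on $\Gamma_N$. Here $u=g_D$ on $\Gamma_D$ means $Bu=g_D$ $\mathcal H^{n-1}$-a.e. on $\Gamma_D$, and $P\nu=h_N$ on $\Gamma_N$ means $\langle B_\nu P,\psi\rangle=\langle h_N,\psi\rangle$ for all $\psi\in W^{1/q,p}(\partial\Omega;\mathbb R^n)$ with $\psi=0$ $\mathcal H^{n-1}$-a.e. on $\partial\Omega\setminus\Gamma_N$. $\mathcal E:=\{(F,P)\in\mathcal E_0: FP^T\in\mathbb R^{n\times n}_{\mathrm{sym}}\text{ a.e. in }\Omega\}$. *)

theory Defs
  imports "HOL-Analysis.Analysis"
begin

text \<open>
  Elements of function spaces are represented by functions on the whole space; only their values on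
  the domain in question matter, and equality in the space is equality almost everywhere. The space
  dimension is \<open>CARD('n)\<close>. The library inner product and norm on \<open>real ^ 'n ^ 'n\<close> are the
  Frobenius ones, and \<open>A $ i $ j\<close> is the entry in row \<open>i\<close> and column \<open>j\<close>.
\<close>

type_synonym 'n vfield = "real ^ 'n \<Rightarrow> real ^ 'n"
type_synonym 'n mfield = "real ^ 'n \<Rightarrow> real ^ 'n ^ 'n"


section \<open>Lebesgue spaces\<close>

definition Lp :: "'a measure \<Rightarrow> real \<Rightarrow> ('a \<Rightarrow> 'b::euclidean_space) set" where
  "Lp M p = {f. f \<in> borel_measurable M \<and> integrable M (\<lambda>x. norm (f x) powr p)}"

definition Lp_norm :: "'a measure \<Rightarrow> real \<Rightarrow> ('a \<Rightarrow> 'b::euclidean_space) \<Rightarrow> real" where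
  "Lp_norm M p f = (LINT x|M. norm (f x) powr p) powr (1 / p)"


section \<open>Hausdorff measure and Lipschitz domains\<close>

text \<open>The case distinction matters only for \<open>m = 0\<close>: a point has \<open>(diameter)\<^sup>0 = 1\<close>, while the
  empty set must contribute nothing.\<close>

definition hausdorff_pre :: "nat \<Rightarrow> real \<Rightarrow> 'a::metric_space set \<Rightarrow> ennreal" where
  "hausdorff_pre m \<delta> A =
     (INF C \<in> {C :: nat \<Rightarrow> 'a set.
                 A \<subseteq> (\<Union>i. C i) \<and> (\<forall>i. bounded (C i) \<and> diameter (C i) \<le> \<delta>)}.
        \<Sum>i. if C i = {} then 0
             else ennreal (unit_ball_vol (real m) * (diameter (C i) / 2) ^ m))"

definition hausdorff_outer :: "nat \<Rightarrow> 'a::metric_space set \<Rightarrow> ennreal" where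
  "hausdorff_outer m A = (SUP \<delta> \<in> {0<..}. hausdorff_pre m \<delta> A)"

definition hausdorff_measure :: "nat \<Rightarrow> 'a::metric_space measure" where
  "hausdorff_measure m = measure_of UNIV (sets borel) (hausdorff_outer m)"

definition surface_measure :: "(real ^ 'n) set \<Rightarrow> (real ^ 'n) measure" where
  "surface_measure \<Omega> = restrict_space (hausdorff_measure (CARD('n) - 1)) (frontier \<Omega>)"

text \<open>Near each boundary point the set is the strict epigraph, in direction \<open>e\<close>, of a Lipschitz
  function of the orthogonal projection onto the hyperplane normal to \<open>e\<close>. This form also covers
  dimension one, where the hyperplane is a point.\<close>

definition lipschitz_boundary :: "(real ^ 'n) set \<Rightarrow> bool" where
  "lipschitz_boundary \<Omega> \<longleftrightarrow>
     (\<forall>x0 \<in> frontier \<Omega>. \<exists>e \<gamma> L r. norm e = 1 \<and> 0 < r \<and> L-lipschitz_on {y. y \<bullet> e = 0} \<gamma> \<and>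
        \<Omega> \<inter> ball x0 r = {x \<in> ball x0 r. \<gamma> (x - (x \<bullet> e) *\<^sub>R e) < x \<bullet> e})"


section \<open>Weak derivatives and Sobolev spaces\<close>

definition partial :: "'n \<Rightarrow> (real ^ 'n \<Rightarrow> real) \<Rightarrow> real ^ 'n \<Rightarrow> real" where
  "partial j \<phi> x = frechet_derivative \<phi> (at x) (axis j 1)"

primrec Ck :: "nat \<Rightarrow> (real ^ 'n \<Rightarrow> real) \<Rightarrow> bool" where
  "Ck 0 \<phi> \<longleftrightarrow> continuous_on UNIV \<phi>"
| "Ck (Suc k) \<phi> \<longleftrightarrow> \<phi> differentiable_on UNIV \<and> (\<forall>j. Ck k (partial j \<phi>))"

definition test_functions :: "(real ^ 'n) set \<Rightarrow> (real ^ 'n \<Rightarrow> real) set" where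
  "test_functions \<Omega> =
     {\<phi>. (\<forall>k. Ck k \<phi>) \<and> compact (closure {x. \<phi> x \<noteq> 0}) \<and> closure {x. \<phi> x \<noteq> 0} \<subseteq> \<Omega>}"

definition loc_integrable :: "(real ^ 'n) set \<Rightarrow> (real ^ 'n \<Rightarrow> 'b::euclidean_space) \<Rightarrow> bool" where
  "loc_integrable \<Omega> u \<longleftrightarrow> (\<forall>K. compact K \<and> K \<subseteq> \<Omega> \<longrightarrow> integrable (lebesgue_on K) u)"

definition is_weak_gradient :: "(real ^ 'n) set \<Rightarrow> 'n vfield \<Rightarrow> 'n mfield \<Rightarrow> bool" where
  "is_weak_gradient \<Omega> u G \<longleftrightarrow> loc_integrable \<Omega> u \<and> loc_integrable \<Omega> G \<and>
     (\<forall>\<phi> \<in> test_functions \<Omega>. \<forall>i j.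
        (LINT x|lebesgue_on \<Omega>. u x $ i * partial j \<phi> x)
          = - (LINT x|lebesgue_on \<Omega>. G x $ i $ j * \<phi> x))"

definition is_weak_divergence :: "(real ^ 'n) set \<Rightarrow> 'n mfield \<Rightarrow> 'n vfield \<Rightarrow> bool" where
  "is_weak_divergence \<Omega> v g \<longleftrightarrow> loc_integrable \<Omega> v \<and> loc_integrable \<Omega> g \<and>
     (\<forall>\<phi> \<in> test_functions \<Omega>. \<forall>i.
        (LINT x|lebesgue_on \<Omega>. (\<Sum>j\<in>UNIV. v x $ i $ j * partial j \<phi> x))
          = - (LINT x|lebesgue_on \<Omega>. g x $ i * \<phi> x))"

text \<open>The following choices are unique up to null sets.\<close>

definition weak_gradient :: "(real ^ 'n) set \<Rightarrow> 'n vfield \<Rightarrow> 'n mfield" where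
  "weak_gradient \<Omega> u = (SOME G. is_weak_gradient \<Omega> u G)"

definition weak_divergence :: "(real ^ 'n) set \<Rightarrow> 'n mfield \<Rightarrow> 'n vfield" where
  "weak_divergence \<Omega> v = (SOME g. is_weak_divergence \<Omega> v g)"

definition W1p :: "(real ^ 'n) set \<Rightarrow> real \<Rightarrow> 'n vfield set" where
  "W1p \<Omega> p = {u \<in> Lp (lebesgue_on \<Omega>) p. \<exists>G \<in> Lp (lebesgue_on \<Omega>) p. is_weak_gradient \<Omega> u G}"

definition W1p_norm :: "(real ^ 'n) set \<Rightarrow> real \<Rightarrow> 'n vfield \<Rightarrow> real" where
  "W1p_norm \<Omega> p u =
     Lp_norm (lebesgue_on \<Omega>) p u + Lp_norm (lebesgue_on \<Omega>) p (weak_gradient \<Omega> u)"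


section \<open>Trace spaces, the trace operator and the normal trace\<close>

text \<open>On the diagonal the integrand vanishes, since \<open>0 powr a = 0\<close> for every \<open>a\<close>.\<close>

definition gagliardo_integrand :: "real \<Rightarrow> 'n vfield \<Rightarrow> (real ^ 'n) \<times> (real ^ 'n) \<Rightarrow> real" where
  "gagliardo_integrand p \<phi> = (\<lambda>(x, y).
     norm (\<phi> x - \<phi> y) powr p * norm (x - y) powr (- (real CARD('n) + p - 2)))"

text \<open>The space \<open>W\<^bsup>1-1/p,p\<^esup>(\<partial>\<Omega>)\<close>.\<close>

definition Wtr :: "(real ^ 'n) set \<Rightarrow> real \<Rightarrow> 'n vfield set" where
  "Wtr \<Omega> p = {\<phi> \<in> Lp (surface_measure \<Omega>) p.
     integrable (surface_measure \<Omega> \<Otimes>\<^sub>M surface_measure \<Omega>) (gagliardo_integrand p \<phi>)}"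

definition Wtr_seminorm :: "(real ^ 'n) set \<Rightarrow> real \<Rightarrow> 'n vfield \<Rightarrow> real" where
  "Wtr_seminorm \<Omega> p \<phi> =
     (LINT z|(surface_measure \<Omega> \<Otimes>\<^sub>M surface_measure \<Omega>). gagliardo_integrand p \<phi> z) powr (1 / p)"

definition Wtr_norm :: "(real ^ 'n) set \<Rightarrow> real \<Rightarrow> 'n vfield \<Rightarrow> real" where
  "Wtr_norm \<Omega> p \<phi> = Lp_norm (surface_measure \<Omega>) p \<phi> + Wtr_seminorm \<Omega> p \<phi>"

text \<open>With \<open>1/p + 1/q = 1\<close> this is \<open>W\<^bsup>-1/q,q\<^esup>(\<partial>\<Omega>)\<close>; the pairing of \<open>l\<close> with \<open>\<psi>\<close> is \<open>l \<psi>\<close>.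
  Boundedness by the norm makes \<open>l\<close> invariant under changes of \<open>\<psi>\<close> on null sets.\<close>

definition Wtr_dual :: "(real ^ 'n) set \<Rightarrow> real \<Rightarrow> ('n vfield \<Rightarrow> real) set" where
  "Wtr_dual \<Omega> p = {l.
     (\<forall>\<phi> \<in> Wtr \<Omega> p. \<forall>\<psi> \<in> Wtr \<Omega> p. l (\<lambda>x. \<phi> x + \<psi> x) = l \<phi> + l \<psi>) \<and>
     (\<forall>c. \<forall>\<phi> \<in> Wtr \<Omega> p. l (\<lambda>x. c *\<^sub>R \<phi> x) = c * l \<phi>) \<and>
     (\<exists>C. \<forall>\<phi> \<in> Wtr \<Omega> p. \<bar>l \<phi>\<bar> \<le> C * Wtr_norm \<Omega> p \<phi>)}"

text \<open>The trace operator is the bounded linear operator that restricts functions continuous up to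
  the boundary to the boundary. On a bounded Lipschitz domain it exists and is unique (up to null
  sets), because such functions are dense in \<open>W\<^bsup>1,p\<^esup>(\<Omega>)\<close>.\<close>

definition is_trace_operator ::
    "(real ^ 'n) set \<Rightarrow> real \<Rightarrow> ('n vfield \<Rightarrow> 'n vfield) \<Rightarrow> bool" where
  "is_trace_operator \<Omega> p B \<longleftrightarrow>
     (\<forall>u \<in> W1p \<Omega> p. B u \<in> Wtr \<Omega> p) \<and>
     (\<forall>u \<in> W1p \<Omega> p. \<forall>w \<in> W1p \<Omega> p.
        AE x in surface_measure \<Omega>. B (\<lambda>y. u y + w y) x = B u x + B w x) \<and>
     (\<forall>c. \<forall>u \<in> W1p \<Omega> p. AE x in surface_measure \<Omega>. B (\<lambda>y. c *\<^sub>R u y) x = c *\<^sub>R B u x) \<and>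
     (\<exists>C. \<forall>u \<in> W1p \<Omega> p. Wtr_norm \<Omega> p (B u) \<le> C * W1p_norm \<Omega> p u) \<and>
     (\<forall>u \<in> W1p \<Omega> p. continuous_on (closure \<Omega>) u \<longrightarrow>
        (AE x in surface_measure \<Omega>. B u x = u x))"

text \<open>\<open>normal_trace \<Omega> p B v \<psi>\<close> is the pairing of the normal trace of \<open>v\<close> with \<open>\<psi>\<close>: the value common
  to all \<open>u\<close> in \<open>W\<^bsup>1,p\<^esup>(\<Omega>)\<close> with trace \<open>\<psi>\<close>. For \<open>v\<close> and its divergence in \<open>L\<^sup>q\<close> it is well
  defined, since the trace operator is onto and its kernel is the closure of the test functions.\<close>

definition normal_trace ::
    "(real ^ 'n) set \<Rightarrow> real \<Rightarrow> ('n vfield \<Rightarrow> 'n vfield) \<Rightarrow> 'n mfield \<Rightarrow> 'n vfield \<Rightarrow> real" where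
  "normal_trace \<Omega> p B v \<psi> = (THE c. \<forall>u \<in> W1p \<Omega> p.
     (AE x in surface_measure \<Omega>. B u x = \<psi> x) \<longrightarrow>
       c = (LINT x|lebesgue_on \<Omega>. v x \<bullet> weak_gradient \<Omega> u x)
         + (LINT x|lebesgue_on \<Omega>. u x \<bullet> weak_divergence \<Omega> v x))"


section \<open>Phase space and weak convergence\<close>

definition Xpq :: "(real ^ 'n) set \<Rightarrow> real \<Rightarrow> real \<Rightarrow> ('n mfield \<times> 'n mfield) set" where
  "Xpq \<Omega> p q = Lp (lebesgue_on \<Omega>) p \<times> Lp (lebesgue_on \<Omega>) q"

definition Xpq_norm :: "(real ^ 'n) set \<Rightarrow> real \<Rightarrow> real \<Rightarrow> 'n mfield \<times> 'n mfield \<Rightarrow> real" where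
  "Xpq_norm \<Omega> p q = (\<lambda>(F, P). Lp_norm (lebesgue_on \<Omega>) p F + Lp_norm (lebesgue_on \<Omega>) q P)"

definition Xpq_dual :: "(real ^ 'n) set \<Rightarrow> real \<Rightarrow> real \<Rightarrow> ('n mfield \<times> 'n mfield \<Rightarrow> real) set" where
  "Xpq_dual \<Omega> p q = {l.
     (\<forall>(F, P) \<in> Xpq \<Omega> p q. \<forall>(G, Q) \<in> Xpq \<Omega> p q.
        l (\<lambda>x. F x + G x, \<lambda>x. P x + Q x) = l (F, P) + l (G, Q)) \<and>
     (\<forall>c. \<forall>(F, P) \<in> Xpq \<Omega> p q. l (\<lambda>x. c *\<^sub>R F x, \<lambda>x. c *\<^sub>R P x) = c * l (F, P)) \<and>
     (\<exists>C. \<forall>z \<in> Xpq \<Omega> p q. \<bar>l z\<bar> \<le> C * Xpq_norm \<Omega> p q z)}"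

definition weakly_converges_Xpq ::
    "(real ^ 'n) set \<Rightarrow> real \<Rightarrow> real \<Rightarrow> (nat \<Rightarrow> 'n mfield \<times> 'n mfield) \<Rightarrow> 'n mfield \<times> 'n mfield \<Rightarrow> bool"
  where
  "weakly_converges_Xpq \<Omega> p q Z z \<longleftrightarrow> (\<forall>k. Z k \<in> Xpq \<Omega> p q) \<and> z \<in> Xpq \<Omega> p q \<and>
     (\<forall>l \<in> Xpq_dual \<Omega> p q. (\<lambda>k. l (Z k)) \<longlonglongrightarrow> l z)"

definition weakly_closed_Xpq ::
    "(real ^ 'n) set \<Rightarrow> real \<Rightarrow> real \<Rightarrow> ('n mfield \<times> 'n mfield) set \<Rightarrow> bool" where
  "weakly_closed_Xpq \<Omega> p q S \<longleftrightarrow>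
     (\<forall>Z z. (\<forall>k. Z k \<in> S) \<and> weakly_converges_Xpq \<Omega> p q Z z \<longrightarrow> z \<in> S)"


section \<open>Constraint sets\<close>

definition E0_set ::
    "(real ^ 'n) set \<Rightarrow> (real ^ 'n) set \<Rightarrow> (real ^ 'n) set \<Rightarrow> real \<Rightarrow> real \<Rightarrow> ('n vfield \<Rightarrow> 'n vfield)
      \<Rightarrow> 'n vfield \<Rightarrow> 'n vfield \<Rightarrow> ('n vfield \<Rightarrow> real) \<Rightarrow> ('n mfield \<times> 'n mfield) set" where
  "E0_set \<Omega> \<Gamma>D \<Gamma>N p q B f gD hN = {(F, P) \<in> Xpq \<Omega> p q.
     (\<exists>u \<in> W1p \<Omega> p. is_weak_gradient \<Omega> u F \<and>
        (AE x in surface_measure \<Omega>. x \<in> \<Gamma>D \<longrightarrow> B u x = gD x)) \<and>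
     is_weak_divergence \<Omega> P (\<lambda>x. - f x) \<and>
     (\<forall>\<psi> \<in> Wtr \<Omega> p. (AE x in surface_measure \<Omega>. x \<notin> \<Gamma>N \<longrightarrow> \<psi> x = 0) \<longrightarrow>
        normal_trace \<Omega> p B P \<psi> = hN \<psi>)}"

definition E_set ::
    "(real ^ 'n) set \<Rightarrow> (real ^ 'n) set \<Rightarrow> (real ^ 'n) set \<Rightarrow> real \<Rightarrow> real \<Rightarrow> ('n vfield \<Rightarrow> 'n vfield)
      \<Rightarrow> 'n vfield \<Rightarrow> 'n vfield \<Rightarrow> ('n vfield \<Rightarrow> real) \<Rightarrow> ('n mfield \<times> 'n mfield) set" where
  "E_set \<Omega> \<Gamma>D \<Gamma>N p q B f gD hN = {(F, P) \<in> E0_set \<Omega> \<Gamma>D \<Gamma>N p q B f gD hN.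
     AE x in lebesgue_on \<Omega>. transpose (F x ** transpose (P x)) = F x ** transpose (P x)}"

end

theory Submission
  imports Defs
begin

text \<open>
  The gradients \<open>Du\<close> with \<open>u = g\<^sub>D\<close> on \<open>\<Gamma>\<^sub>D\<close> form a convex set, strongly closed by the Poincare
  inequality and hence weakly closed by Mazur's theorem. The conditions on \<open>P\<close> are linear:
  \<open>div P + f = 0\<close> passes to the limit against test functions, and for a trace \<open>\<psi> = B u\<close> the normal trace
  is the weakly continuous expression \<open>\<integral> P \<bullet> Du - \<integral> f \<bullet> u\<close>. That this does not depend on \<open>u\<close> is Green's formula
  for \<open>u\<close> with vanishing trace: such a \<open>u\<close> is \<open>O(\<delta>)\<close> in \<open>L\<^sup>p\<close> of the boundary layer of width \<open>\<delta>\<close>, which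
  compensates the gradient \<open>O(1/\<delta>)\<close> of a cut-off. Layers are controlled by comparing Lebesgue measure
  above a Lipschitz graph with the Hausdorff measure of the graph.

  For the inequality fix \<open>(F\<^sub>0, P\<^sub>0)\<close> in \<open>\<E>\<^sub>0\<close> with potential \<open>u\<^sub>0\<close>. The trace of \<open>u - u\<^sub>0\<close> vanishes off
  \<open>\<Gamma>\<^sub>N\<close>, so \<open>\<integral> F \<bullet> P = \<integral> F\<^sub>0 \<bullet> P + \<langle>h\<^sub>N, B (u - u\<^sub>0)\<rangle> + \<integral> f \<bullet> (u - u\<^sub>0)\<close>, and the right-hand side grows linearly by
  the Poincare inequality. The entries of \<open>F P\<^sup>T\<close> are products of the gradient of a component of
  \<open>u\<close> with a row of \<open>P\<close>, whose divergence is fixed, so by the div-curl argument and Rellich compactness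
  they converge in the sense of distributions and symmetry survives in the limit.
\<close>

section \<open>Lebesgue spaces\<close>

text \<open>Three features of the setting shape the work. \<open>is_trace_operator\<close> offers
  only linearity up to null sets, boundedness and agreement with functions continuous up to the
  boundary. So facts about traces are proved for globally smooth fields, whose boundary values are
  visible, and carried over by density; volume is compared with surface in one direction only, so no
  area formula enters. \<open>hausdorff_measure\<close> is a \<open>measure_of\<close>, which
  carries information only once Caratheodory's theorem has identified it with the outer measure on
  Borel sets. And \<open>normal_trace\<close> is a definite description: at a trace it is computed
  by Green's formula, elsewhere its value is arbitrary but the same for all \<open>P\<close>.

  The symmetry constraint is quadratic, so convexity settles \<open>E0_set\<close> only. For
  \<open>E_set\<close> a product of two weakly convergent sequences has to pass to the limit; this
  works because one factor has fixed divergence and the potential of the other converges strongly on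
  compact sets. Weak convergence of the potentials, where compactness starts, has to be recovered
  from that of the gradients.\<close>

lemma powr_bernoulli:
  fixes s r p :: real
  assumes "s \<ge> 0" "r > 0" "p \<ge> 1"
  shows "s powr p \<ge> r powr p + p * r powr (p - 1) * (s - r)"
\<comment> \<open>Convexity of the power is available on the open half line only; at
  \<open>s = 0\<close> the claim reduces to \<open>p \<ge> 1\<close>.\<close>
proof (cases "s = 0")
  case True
  have "r powr p = r powr (p - 1) * r" using assms by (simp add: powr_diff)
  then show ?thesis using True assms by (simp add: algebra_simps) 
next
  case False
  have "\<And>x y. 0 < x \<Longrightarrow> 0 < y \<Longrightarrow> p * x powr (p - 1) * (y - x) \<le> y powr p - x powr p"
    using assms
    by (intro convex_on_imp_above_tangent[of "{0<..}" "\<lambda>x. x powr p", OF powr_convex])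
       (auto intro!: derivative_eq_intros simp: interior_open has_field_derivative_at_within)
  from this[of r s] show ?thesis using assms False by simp
qed

text \<open>The function \<open>norm x powr p\<close> is convex with gradient
  \<open>p * norm x powr (p - 2)\<close> times \<open>x\<close>. Cauchy-Schwarz reduces its tangent
  inequality to the scalar one. It becomes the descent estimate in the proof of Mazur's
  theorem.\<close>

lemma norm_powr_tangent:
  fixes x y :: "'b::euclidean_space"
  assumes "p \<ge> 1"
  shows "norm y powr p \<ge> norm x powr p + p * (norm x powr (p - 2) * (x \<bullet> (y - x)))"
proof (cases "x = 0")
  case False
  have "x \<bullet> (y - x) \<le> norm x * (norm y - norm x)"
    using norm_cauchy_schwarz[of x y] by (simp add: inner_diff_right dot_square_norm power2_eq_square algebra_simps)
  then have "norm x powr (p - 2) * (x \<bullet> (y - x)) \<le> norm x powr (p - 2) * (norm x * (norm y - norm x))"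
    by (intro mult_left_mono) auto
  also have "\<dots> = norm x powr (p - 1) * (norm y - norm x)"
    using False by (simp add: powr_diff power2_eq_square field_simps powr_numeral flip: powr_realpow)
  finally have "p * (norm x powr (p - 2) * (x \<bullet> (y - x))) \<le> p * (norm x powr (p - 1) * (norm y - norm x))"
    using assms by (intro mult_left_mono) auto
  moreover have "norm x powr p + p * (norm x powr (p - 1) * (norm y - norm x)) \<le> norm y powr p"
    using powr_bernoulli[of "norm y" "norm x" p] False assms by (simp add: mult.assoc)
  ultimately show ?thesis by linarith
qed auto

lemma powr_sum_le:
  fixes a b p :: real
  assumes "a \<ge> 0" "b \<ge> 0" "p \<ge> 1"
  shows "(a + b) powr p \<le> 2 powr p * (a powr p + b powr p)"
proof -
  have "(a + b) powr p \<le> (2 * max a b) powr p" using assms by (intro powr_mono2) auto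
  also have "\<dots> = 2 powr p * max a b powr p" using assms by (simp add: powr_mult)
  also have "\<dots> \<le> 2 powr p * (a powr p + b powr p)"
    by (intro mult_left_mono) (auto simp: max_def)
  finally show ?thesis .
qed

lemma norm_powr_add_le:
  fixes a b :: "'b::real_normed_vector"
  assumes "p \<ge> 1"
  shows "norm (a + b) powr p \<le> 2 powr p * (norm a powr p + norm b powr p)"
proof -
  have "norm (a + b) powr p \<le> (norm a + norm b) powr p"
    using assms by (intro powr_mono2 norm_triangle_ineq) auto
  also have "\<dots> \<le> 2 powr p * (norm a powr p + norm b powr p)" using assms by (intro powr_sum_le) auto
  finally show ?thesis .
qed

lemma Lp_measurable: "f \<in> Lp M p \<Longrightarrow> f \<in> borel_measurable M"
  and Lp_integrable: "f \<in> Lp M p \<Longrightarrow> integrable M (\<lambda>x. norm (f x) powr p)"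
  by (auto simp: Lp_def)

lemma LpI: "f \<in> borel_measurable M \<Longrightarrow> integrable M (\<lambda>x. norm (f x) powr p) \<Longrightarrow> f \<in> Lp M p"
  by (auto simp: Lp_def)

lemma Lp_norm_nonneg [simp]: "Lp_norm M p f \<ge> 0"
  by (simp add: Lp_norm_def)

lemma Lp_norm_powr: "p > 0 \<Longrightarrow> Lp_norm M p f powr p = (LINT x|M. norm (f x) powr p)"
  by (simp add: Lp_norm_def powr_powr)

lemma Lp_bound:
  assumes "g \<in> borel_measurable M" "integrable M h" "AE x in M. norm (g x) powr p \<le> h x"
  shows "g \<in> Lp M p"
proof (rule LpI)
  show "integrable M (\<lambda>x. norm (g x) powr p)"
    by (rule Bochner_Integration.integrable_bound[OF assms(2)]) (use assms in auto)
qed fact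

lemma Lp_add:
  fixes f g :: "'a \<Rightarrow> 'b::euclidean_space"
  assumes "f \<in> Lp M p" "g \<in> Lp M p" "p \<ge> 1"
  shows "(\<lambda>x. f x + g x) \<in> Lp M p"
  using assms by (intro Lp_bound[where h = "\<lambda>x. 2 powr p * (norm (f x) powr p + norm (g x) powr p)"])
    (auto simp: Lp_def norm_powr_add_le)

lemma Lp_bounded_mult:
  assumes "f \<in> Lp M p" "c \<ge> 0" "p > 0" "g \<in> borel_measurable M" 
    "AE x in M. norm (g x) \<le> c * norm (f x)"
  shows "g \<in> Lp M p" "Lp_norm M p g \<le> c * Lp_norm M p f"
proof -
  have *: "AE x in M. norm (g x) powr p \<le> c powr p * norm (f x) powr p"
    using assms(5) by eventually_elim (use assms in \<open>auto simp flip: powr_mult intro!: powr_mono2\<close>)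
  show g: "g \<in> Lp M p"
    by (rule Lp_bound[OF assms(4) _ *]) (use assms in \<open>auto simp: Lp_def\<close>)
  have "(LINT x|M. norm (g x) powr p) \<le> (LINT x|M. c powr p * norm (f x) powr p)"
    using * g assms by (intro integral_mono_AE) (auto simp: Lp_def)
  then have "(LINT x|M. norm (g x) powr p) powr (1/p) \<le> (c powr p * (LINT x|M. norm (f x) powr p)) powr (1/p)"
    using assms by (intro powr_mono2) (auto intro: integral_nonneg_AE)
  then show "Lp_norm M p g \<le> c * Lp_norm M p f"
    using assms by (simp add: Lp_norm_def powr_mult powr_powr)
qed

lemma Lp_scaleR:
  assumes "f \<in> Lp M p" "p > 0"
  shows "(\<lambda>x. c *\<^sub>R f x) \<in> Lp M p"
  using assms by (intro Lp_bounded_mult(1)[OF assms(1), of "\<bar>c\<bar>"]) (auto simp: Lp_def)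

lemma Lp_norm_scaleR:
  assumes "p > 0"
  shows "Lp_norm M p (\<lambda>x. c *\<^sub>R f x) = \<bar>c\<bar> * Lp_norm M p f"
  using assms by (simp add: Lp_norm_def powr_mult powr_powr)

abbreviation Lp_lim :: "'a measure \<Rightarrow> real \<Rightarrow> (nat \<Rightarrow> 'a \<Rightarrow> 'b::euclidean_space) \<Rightarrow> ('a \<Rightarrow> 'b) \<Rightarrow> bool" where
  "Lp_lim M p f g \<equiv> (\<lambda>n. Lp_norm M p (\<lambda>x. f n x - g x)) \<longlonglongrightarrow> 0"

lemma Lp_zero: "(\<lambda>x. 0) \<in> Lp M p"
  by (auto simp: Lp_def)

lemma Lp_diff:
  fixes f g :: "'a \<Rightarrow> 'b::euclidean_space"
  assumes "f \<in> Lp M p" "g \<in> Lp M p" "p \<ge> 1"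
  shows "(\<lambda>x. f x - g x) \<in> Lp M p"
  using Lp_add[OF assms(1) Lp_scaleR[OF assms(2), of "-1"] assms(3)] assms(3) by simp

lemma Lp_sum:
  fixes f :: "'i \<Rightarrow> 'a \<Rightarrow> 'b::euclidean_space"
  assumes "\<And>i. i \<in> I \<Longrightarrow> f i \<in> Lp M p" "p \<ge> 1"
  shows "(\<lambda>x. \<Sum>i\<in>I. f i x) \<in> Lp M p"
proof (cases "finite I")
  case True then show ?thesis using assms(1)
    by (induction I) (auto simp: Lp_zero intro!: Lp_add assms(2))
qed (auto simp: Lp_zero)

lemma Lp_norm_cong_AE:
  assumes "f \<in> borel_measurable M" "g \<in> borel_measurable M" "AE x in M. f x = g x"
  shows "Lp_norm M p f = Lp_norm M p g"
proof -
  have "(LINT x|M. norm (f x) powr p) = (LINT x|M. norm (g x) powr p)"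
    using assms by (intro integral_cong_AE) (auto elim: eventually_mono)
  then show ?thesis by (simp add: Lp_norm_def)
qed

lemma Lp_cong_AE:
  assumes "f \<in> Lp M p" "g \<in> borel_measurable M" "AE x in M. f x = g x"
  shows "g \<in> Lp M p"
  using assms by (intro Lp_bound[where h = "\<lambda>x. norm (f x) powr p"]) (auto simp: Lp_def)

lemma Lp_norm_eq_0_iff:
  assumes "f \<in> Lp M p" "p > 0"
  shows "Lp_norm M p f = 0 \<longleftrightarrow> (AE x in M. f x = 0)"
proof -
  have "Lp_norm M p f = 0 \<longleftrightarrow> (LINT x|M. norm (f x) powr p) = 0"
    by (simp add: Lp_norm_def)
  also have "\<dots> \<longleftrightarrow> (AE x in M. norm (f x) powr p = 0)"
    using Lp_integrable[OF assms(1)] by (intro integral_nonneg_eq_0_iff_AE) auto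
  finally show ?thesis by simp
qed

lemma Lp_norm_le_iff:
  assumes "p > 0" "c \<ge> 0"
  shows "Lp_norm M p f \<le> c \<longleftrightarrow> (LINT x|M. norm (f x) powr p) \<le> c powr p"
proof
  assume "Lp_norm M p f \<le> c"
  then have "Lp_norm M p f powr p \<le> c powr p" using assms by (intro powr_mono2) auto
  then show "(LINT x|M. norm (f x) powr p) \<le> c powr p" using assms by (simp add: Lp_norm_powr)
next
  assume "(LINT x|M. norm (f x) powr p) \<le> c powr p"
  then have "(LINT x|M. norm (f x) powr p) powr (1/p) \<le> (c powr p) powr (1/p)"
    using assms by (intro powr_mono2) (auto intro: integral_nonneg_AE)
  then show "Lp_norm M p f \<le> c" using assms by (simp add: Lp_norm_def powr_powr)
qed

text \<open>The tangent inequalities at the mean \<open>m\<close>, added with weights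
  \<open>l\<close> and \<open>1 - l\<close>, lose their linear terms.\<close>

lemma powr_convex_combination:
  fixes a b l p :: real
  assumes "p \<ge> 1" "0 \<le> l" "l \<le> 1" "a \<ge> 0" "b \<ge> 0"
  shows "(l * a + (1 - l) * b) powr p \<le> l * a powr p + (1 - l) * b powr p"
proof (cases "l * a + (1 - l) * b = 0")
  case False
  define m where "m = l * a + (1 - l) * b"
  have m: "m > 0" using False assms unfolding m_def by (simp add: order_less_le)
  have A: "a powr p \<ge> m powr p + p * m powr (p - 1) * (a - m)" using powr_bernoulli assms m by simp
  have B: "b powr p \<ge> m powr p + p * m powr (p - 1) * (b - m)" using powr_bernoulli assms m by simp
  have "l * a powr p + (1 - l) * b powr p \<ge> 
     l * (m powr p + p * m powr (p - 1) * (a - m)) + (1 - l) * (m powr p + p * m powr (p - 1) * (b - m))"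
    using A B assms by (intro add_mono mult_left_mono) auto
  also have "l * (m powr p + p * m powr (p - 1) * (a - m)) + (1 - l) * (m powr p + p * m powr (p - 1) * (b - m))
      = m powr p + p * m powr (p - 1) * (l * a + (1 - l) * b - m)" by (simp add: algebra_simps)
  finally show ?thesis by (simp add: m_def)
qed (use assms in auto)

text \<open>Minkowski's inequality from convexity: \<open>norm (f x) + norm (g x)\<close> is
  \<open>a + b\<close> times a convex combination of \<open>norm (f x) / a\<close> and
  \<open>norm (g x) / b\<close>. The summands \<open>e / 2\<close> keep \<open>a\<close> and
  \<open>b\<close> positive when a norm vanishes.\<close>

lemma Lp_norm_triangle:
  fixes f g :: "'a \<Rightarrow> 'b::euclidean_space"
  assumes f: "f \<in> Lp M p" and g: "g \<in> Lp M p" and p: "p \<ge> 1"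
  shows "Lp_norm M p (\<lambda>x. f x + g x) \<le> Lp_norm M p f + Lp_norm M p g"
proof (rule field_le_epsilon)
  fix e :: real assume e: "e > 0"
  define a where "a = Lp_norm M p f + e / 2"
  define b where "b = Lp_norm M p g + e / 2"
  have ab: "a > 0" "b > 0" using e by (auto simp: a_def b_def add_nonneg_pos)
  define l where "l = a / (a + b)"
  have l: "0 \<le> l" "l \<le> 1" "1 - l = b / (a + b)" using ab by (auto simp: l_def field_simps)
  have *: "norm (f x + g x) powr p \<le> (a + b) powr p * (l * (norm (f x) powr p / a powr p) 
     + (1 - l) * (norm (g x) powr p / b powr p))" for x
  proof -
    have "norm (f x + g x) powr p \<le> (norm (f x) + norm (g x)) powr p"
      using p by (intro powr_mono2 norm_triangle_ineq) auto
    also have "norm (f x) + norm (g x) = (a + b) * (l * (norm (f x) / a) + (1 - l) * (norm (g x) / b))"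
    proof -
      have "l * (u / a) = u / (a + b)" "(1 - l) * (u / b) = u / (a + b)" for u
        using ab unfolding l(3) by (simp_all add: l_def)
      then show ?thesis using ab by (simp add: distrib_left)
    qed
    also have "\<dots> powr p = (a + b) powr p * (l * (norm (f x) / a) + (1 - l) * (norm (g x) / b)) powr p"
      using ab l by (intro powr_mult)
    also have "\<dots> \<le> (a + b) powr p * (l * (norm (f x) / a) powr p + (1 - l) * (norm (g x) / b) powr p)"
      using ab l p by (intro mult_left_mono powr_convex_combination) auto
    finally show ?thesis using ab by (simp add: powr_divide)
  qed
  have ia: "(LINT x|M. norm (f x) powr p) \<le> a powr p" "(LINT x|M. norm (g x) powr p) \<le> b powr p"
    using p ab e Lp_norm_le_iff[of p a M f] Lp_norm_le_iff[of p b M g] by (simp_all add: a_def b_def)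
  have "(LINT x|M. norm (f x + g x) powr p) \<le> (LINT x|M. (a + b) powr p * (l * (norm (f x) powr p / a powr p) 
     + (1 - l) * (norm (g x) powr p / b powr p)))"
    using Lp_integrable[OF Lp_add[OF f g p]] Lp_integrable[OF f] Lp_integrable[OF g]
    by (intro integral_mono *) auto
  also have "\<dots> = (a + b) powr p * (l * ((LINT x|M. norm (f x) powr p) / a powr p) + (1 - l) * ((LINT x|M. norm (g x) powr p) / b powr p))"
    using Lp_integrable[OF f] Lp_integrable[OF g] by simp
  also have "\<dots> \<le> (a + b) powr p * (l * 1 + (1 - l) * 1)"
    using l(1,2) ab ia by (intro mult_left_mono add_mono) auto
  finally have "Lp_norm M p (\<lambda>x. f x + g x) \<le> a + b" using p ab by (subst Lp_norm_le_iff) auto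
  then show "Lp_norm M p (\<lambda>x. f x + g x) \<le> Lp_norm M p f + Lp_norm M p g + e" by (simp add: a_def b_def)
qed

lemma Lp_norm_diff_commute: "Lp_norm M p (\<lambda>x. f x - g x) = Lp_norm M p (\<lambda>x. g x - f x)"
  by (simp add: Lp_norm_def norm_minus_commute)

lemma Lp_norm_diff_triangle:
  fixes f g h :: "'a \<Rightarrow> 'b::euclidean_space"
  assumes "f \<in> Lp M p" "g \<in> Lp M p" "h \<in> Lp M p" "p \<ge> 1"
  shows "Lp_norm M p (\<lambda>x. f x - h x) \<le> Lp_norm M p (\<lambda>x. f x - g x) + Lp_norm M p (\<lambda>x. g x - h x)"
  using Lp_norm_triangle[OF Lp_diff[OF assms(1,2,4)] Lp_diff[OF assms(2,3,4)] assms(4)] by simp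

lemma Lp_norm_sum_le:
  fixes f :: "'i \<Rightarrow> 'a \<Rightarrow> 'b::euclidean_space"
  assumes "\<And>i. i \<in> I \<Longrightarrow> f i \<in> Lp M p" "p \<ge> 1"
  shows "Lp_norm M p (\<lambda>x. \<Sum>i\<in>I. f i x) \<le> (\<Sum>i\<in>I. Lp_norm M p (f i))"
proof -
  have z: "Lp_norm M p (\<lambda>x. 0::'b) = 0" by (simp add: Lp_norm_def)
  show ?thesis
  proof (cases "finite I")
    case True then show ?thesis using assms(1)
    proof (induction I)
      case (insert i I)
      have "Lp_norm M p (\<lambda>x. f i x + (\<Sum>i\<in>I. f i x)) \<le> Lp_norm M p (f i) + Lp_norm M p (\<lambda>x. \<Sum>i\<in>I. f i x)"
        using insert assms(2) by (intro Lp_norm_triangle Lp_sum) auto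
      then show ?case using insert by fastforce
    qed (auto simp: z)
  qed (auto simp: z)
qed

text \<open>Young's inequality is used twice: for \<open>f\<close> and \<open>g\<close> themselves,
  which gives integrability of the product, and after division by the two norms, which gives the
  sharp constant.\<close>

lemma Hoelder_inequality:
  fixes f g :: "'a \<Rightarrow> 'b::euclidean_space" and p q :: real
  assumes f: "f \<in> Lp M p" and g: "g \<in> Lp M q" and pq: "p > 1" "q > 1" "1/p + 1/q = 1"
  shows "integrable M (\<lambda>x. norm (f x) * norm (g x))"
    and "(LINT x|M. norm (f x) * norm (g x)) \<le> Lp_norm M p f * Lp_norm M q g"
proof -
  note [measurable] = Lp_measurable[OF f] Lp_measurable[OF g]
  have Y: "norm (f x) * norm (g x) \<le> norm (f x) powr p / p + norm (g x) powr q / q" for x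
    using Youngs_inequality[of p q "norm (f x)" "norm (g x)"] pq by (simp add: algebra_simps)
  show int: "integrable M (\<lambda>x. norm (f x) * norm (g x))"
    by (rule Bochner_Integration.integrable_bound[where f = "\<lambda>x. norm (f x) powr p / p + norm (g x) powr q / q"])
       (use Lp_integrable[OF f] Lp_integrable[OF g] Y pq in auto)
  define a where "a = Lp_norm M p f"
  define b where "b = Lp_norm M q g"
  have ab: "a \<ge> 0" "b \<ge> 0" by (auto simp: a_def b_def)
  have "(LINT x|M. norm (f x) * norm (g x)) \<le> a * b"
  proof (cases "a = 0 \<or> b = 0")
    case True
    then have "(AE x in M. f x = 0) \<or> (AE x in M. g x = 0)"
      using Lp_norm_eq_0_iff[OF f] Lp_norm_eq_0_iff[OF g] pq by (auto simp: a_def b_def)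
    then have "(LINT x|M. norm (f x) * norm (g x)) = (LINT x|M. 0)"
      by (intro integral_cong_AE) (auto elim: eventually_mono)
    then show ?thesis using ab by simp
  next
    case False
    with ab have ab: "a > 0" "b > 0" by auto
    have *: "norm (f x) * norm (g x) \<le> a * b * (norm (f x) powr p / a powr p / p + norm (g x) powr q / b powr q / q)" for x
    proof -
      have "norm (f x) / a * (norm (g x) / b) \<le> (norm (f x) / a) powr p / p + (norm (g x) / b) powr q / q"
        using Youngs_inequality[of p q "norm (f x) / a" "norm (g x) / b"] pq ab by (simp add: algebra_simps)
      then have "a * b * (norm (f x) / a * (norm (g x) / b)) \<le> a * b * ((norm (f x) / a) powr p / p + (norm (g x) / b) powr q / q)"
        using ab by (intro mult_left_mono) auto
      then show ?thesis using ab by (simp add: powr_divide)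
    qed
    have ia: "(LINT x|M. norm (f x) powr p) = a powr p" "(LINT x|M. norm (g x) powr q) = b powr q"
      using pq by (simp_all add: a_def b_def Lp_norm_powr)
    have "(LINT x|M. norm (f x) * norm (g x)) \<le>
       (LINT x|M. a * b * (norm (f x) powr p / a powr p / p + norm (g x) powr q / b powr q / q))"
      using int Lp_integrable[OF f] Lp_integrable[OF g] by (intro integral_mono *) auto
    also have "\<dots> = a * b * (1/p + 1/q)"
      using Lp_integrable[OF f] Lp_integrable[OF g] ab by (simp add: ia)
    finally show ?thesis using pq by simp
  qed
  then show "(LINT x|M. norm (f x) * norm (g x)) \<le> Lp_norm M p f * Lp_norm M q g"
    by (simp add: a_def b_def)
qed

lemma Hoelder_inner:
  fixes f g :: "'a \<Rightarrow> 'b::euclidean_space" and p q :: real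
  assumes f: "f \<in> Lp M p" and g: "g \<in> Lp M q" and pq: "p > 1" "q > 1" "1/p + 1/q = 1"
  shows "integrable M (\<lambda>x. f x \<bullet> g x)"
    and "\<bar>LINT x|M. f x \<bullet> g x\<bar> \<le> Lp_norm M p f * Lp_norm M q g"
proof -
  note [measurable] = Lp_measurable[OF f] Lp_measurable[OF g]
  show int: "integrable M (\<lambda>x. f x \<bullet> g x)"
    by (rule Bochner_Integration.integrable_bound[OF Hoelder_inequality(1)[OF assms]])
       (auto simp: Cauchy_Schwarz_ineq2)
  have "\<bar>LINT x|M. f x \<bullet> g x\<bar> \<le> (LINT x|M. \<bar>f x \<bullet> g x\<bar>)"
    by (rule integral_abs_bound)
  also have "\<dots> \<le> (LINT x|M. norm (f x) * norm (g x))"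
    using int Hoelder_inequality(1)[OF assms] by (intro integral_mono) (auto simp: Cauchy_Schwarz_ineq2)
  also have "\<dots> \<le> Lp_norm M p f * Lp_norm M q g" by (rule Hoelder_inequality[OF assms])
  finally show "\<bar>LINT x|M. f x \<bullet> g x\<bar> \<le> Lp_norm M p f * Lp_norm M q g" .
qed

lemma Lp_norm_tendsto_iff:
  assumes "p > 0"
  shows "(\<lambda>n. Lp_norm M p (f n)) \<longlonglongrightarrow> 0 \<longleftrightarrow> (\<lambda>n. LINT x|M. norm (f n x) powr p) \<longlonglongrightarrow> 0"
proof
  assume "(\<lambda>n. Lp_norm M p (f n)) \<longlonglongrightarrow> 0"
  then have "(\<lambda>n. Lp_norm M p (f n) powr p) \<longlonglongrightarrow> 0 powr p"
    using assms by (intro tendsto_powr') auto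
  then show "(\<lambda>n. LINT x|M. norm (f n x) powr p) \<longlonglongrightarrow> 0" using assms by (simp add: Lp_norm_powr)
next
  assume "(\<lambda>n. LINT x|M. norm (f n x) powr p) \<longlonglongrightarrow> 0"
  then have "(\<lambda>n. (LINT x|M. norm (f n x) powr p) powr (1/p)) \<longlonglongrightarrow> 0 powr (1/p)"
    using assms by (intro tendsto_powr') auto
  then show "(\<lambda>n. Lp_norm M p (f n)) \<longlonglongrightarrow> 0" by (simp add: Lp_norm_def)
qed

text \<open>Fatou's lemma for the extended integral yields integrability of the limit and the bound
  on its norm at once.\<close>

lemma Lp_Fatou:
  fixes f :: "nat \<Rightarrow> 'a \<Rightarrow> 'b::euclidean_space"
  assumes f: "\<And>n. f n \<in> Lp M p" and g: "g \<in> borel_measurable M" and p: "p > 0"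
    and lim: "AE x in M. (\<lambda>n. f n x) \<longlonglongrightarrow> g x" and le: "eventually (\<lambda>n. Lp_norm M p (f n) \<le> c) sequentially"
  shows "g \<in> Lp M p" "Lp_norm M p g \<le> c"
proof -
  note [measurable] = Lp_measurable[OF f] g
  obtain N where N: "\<And>n. n \<ge> N \<Longrightarrow> Lp_norm M p (f n) \<le> c" using le by (auto simp: eventually_sequentially)
  have c: "c \<ge> 0" using N[of N] Lp_norm_nonneg order_trans by blast
  have "(\<integral>\<^sup>+x. norm (g x) powr p \<partial>M) = (\<integral>\<^sup>+x. liminf (\<lambda>n. ennreal (norm (f n x) powr p)) \<partial>M)"
  proof (rule nn_integral_cong_AE, use lim in eventually_elim)
    fix x assume "(\<lambda>n. f n x) \<longlonglongrightarrow> g x"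
    then have "(\<lambda>n. ennreal (norm (f n x) powr p)) \<longlonglongrightarrow> ennreal (norm (g x) powr p)"
      using p by (intro tendsto_ennrealI tendsto_powr' tendsto_norm) auto
    then show "ennreal (norm (g x) powr p) = liminf (\<lambda>n. ennreal (norm (f n x) powr p))"
      by (rule lim_imp_Liminf[OF trivial_limit_sequentially, symmetric])
  qed
  also have "\<dots> \<le> liminf (\<lambda>n. \<integral>\<^sup>+x. norm (f n x) powr p \<partial>M)"
    by (intro nn_integral_liminf) auto
  also have "\<dots> \<le> ennreal (c powr p)"
  proof -
    have "(\<integral>\<^sup>+x. norm (f n x) powr p \<partial>M) \<le> ennreal (c powr p)" if "n \<ge> N" for n
      using N[OF that] Lp_integrable[OF f] p c
      by (subst nn_integral_eq_integral) (auto simp: Lp_norm_le_iff)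
    then have "eventually (\<lambda>n. (\<integral>\<^sup>+x. norm (f n x) powr p \<partial>M) \<le> ennreal (c powr p)) sequentially"
      by (auto simp: eventually_sequentially)
    then show ?thesis by (intro Liminf_le) auto
  qed
  finally have *: "(\<integral>\<^sup>+x. norm (g x) powr p \<partial>M) \<le> ennreal (c powr p)" .
  have int: "integrable M (\<lambda>x. norm (g x) powr p)"
    by (intro integrableI_bounded) (use * in \<open>auto simp: order_le_less_trans\<close>)
  then show "g \<in> Lp M p" by (intro LpI g)
  have "ennreal (LINT x|M. norm (g x) powr p) \<le> ennreal (c powr p)"
    using * int by (subst (asm) nn_integral_eq_integral) auto
  then show "Lp_norm M p g \<le> c" using p c by (simp add: Lp_norm_le_iff)
qed

text \<open>Riesz-Fischer. The Cauchy condition is stated with a null sequence \<open>a\<close>, the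
  form in which triangle inequalities deliver it.\<close>

theorem Lp_complete:
  fixes f :: "nat \<Rightarrow> 'a \<Rightarrow> 'b::euclidean_space"
  assumes f: "\<And>n. f n \<in> Lp M p" and p: "p \<ge> 1"
    and le: "\<And>m n. Lp_norm M p (\<lambda>x. f m x - f n x) \<le> a m + a n" and a: "a \<longlonglongrightarrow> (0::real)"
  obtains g where "g \<in> Lp M p" "Lp_lim M p f g"
proof -
  note [measurable] = Lp_measurable[OF f]
  have "\<exists>N. \<forall>n\<ge>N. a n < (1/2)^k / 2" for k
    using order_tendstoD(2)[OF a, of "(1/2)^k / 2"] by (simp add: eventually_sequentially)
  then obtain N where aN: "\<And>k n. n \<ge> N k \<Longrightarrow> a n < (1/2)^k / 2" by metis
  have N: "Lp_norm M p (\<lambda>x. f m x - f n x) < (1/2)^k" if "m \<ge> N k" "n \<ge> N k" for k m n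
    using le[of m n] aN[OF that(1)] aN[OF that(2)] by simp
  \<comment> \<open>Partial sums of \<open>N\<close> are increasing and dominate \<open>N k\<close>,
    so they serve as the indices of a fast subsequence.\<close>
  define r where "r k = (\<Sum>i\<le>k. N i)" for k
  have rN: "r k \<ge> N k" "r (Suc k) \<ge> r k" for k
    unfolding r_def by (auto intro: member_le_sum)
  have rm: "r j \<ge> r i" if "i \<le> j" for i j
    using rN(2) that by (rule lift_Suc_mono_le)
  define D where "D k x = norm (f (r (Suc k)) x - f (r k) x)" for k x
  define h where "h n x = (\<Sum>k<n. D k x)" for n x
  have D: "D k \<in> Lp M p" "Lp_norm M p (D k) \<le> (1/2)^k" for k
  proof -
    have "Lp_norm M p (\<lambda>x. f (r (Suc k)) x - f (r k) x) \<le> (1/2)^k"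
      by (rule less_imp_le[OF N]) (use rN[of k] in auto)
    then show "Lp_norm M p (D k) \<le> (1/2)^k" unfolding D_def Lp_norm_def by simp
    show "D k \<in> Lp M p" unfolding D_def using Lp_diff[OF f f p] by (auto simp: Lp_def)
  qed
  have hL: "h n \<in> Lp M p" for n unfolding h_def by (intro Lp_sum D p)
  have hn: "Lp_norm M p (h n) \<le> 2" for n
  proof -
    have "Lp_norm M p (h n) \<le> (\<Sum>k<n. Lp_norm M p (D k))" unfolding h_def by (intro Lp_norm_sum_le D p)
    also have "\<dots> \<le> (\<Sum>k<n. (1/2)^k)" by (intro sum_mono D)
    also have "\<dots> \<le> 2" by (simp add: geometric_sum)
    finally show ?thesis .
  qed
  note [measurable] = Lp_measurable[OF hL]
  have h0: "h n x \<ge> 0" for n x by (auto simp: h_def D_def intro: sum_nonneg)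
  have hmono: "h n x \<le> h (Suc n) x" for n x by (auto simp: h_def D_def)
  have "(\<integral>\<^sup>+x. (SUP n. ennreal (h n x powr p)) \<partial>M) = (SUP n. \<integral>\<^sup>+x. ennreal (h n x powr p) \<partial>M)"
    using hmono h0 p
    by (intro nn_integral_monotone_convergence_SUP) (auto simp: incseq_Suc_iff le_fun_def intro!: ennreal_leI powr_mono2)
  also have "\<dots> \<le> ennreal (2 powr p)"
  proof (rule SUP_least)
    fix n
    show "(\<integral>\<^sup>+x. ennreal (h n x powr p) \<partial>M) \<le> ennreal (2 powr p)"
      using hn[of n] Lp_integrable[OF hL[of n]] p h0
      by (subst nn_integral_eq_integral) (auto simp: Lp_norm_le_iff)
  qed
  finally have "(\<integral>\<^sup>+x. (SUP n. ennreal (h n x powr p)) \<partial>M) \<noteq> \<infinity>"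
    by (metis ennreal_neq_top infinity_ennreal_def neq_top_trans)
  then have "AE x in M. (SUP n. ennreal (h n x powr p)) \<noteq> \<infinity>"
    by (intro nn_integral_noteq_infinite) auto
  \<comment> \<open>The increments along the subsequence have total norm at most 2, so their sum is
    finite almost everywhere and the telescoping series converges there.\<close>
  then have conv: "AE x in M. convergent (\<lambda>n. f (r n) x)"
  proof eventually_elim
    fix x assume "(SUP n. ennreal (h n x powr p)) \<noteq> \<infinity>"
    then obtain c where c: "(SUP n. ennreal (h n x powr p)) = ennreal c" "c \<ge> 0"
      by (metis ennreal_cases infinity_ennreal_def)
    have "h n x \<le> c powr (1/p)" for n
    proof -
      have "ennreal (h n x powr p) \<le> ennreal c" unfolding c(1)[symmetric] by (intro SUP_upper) auto
      then have "h n x powr p \<le> c" using c by simp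
      then have "(h n x powr p) powr (1/p) \<le> c powr (1/p)" using p c by (intro powr_mono2) auto
      then show ?thesis using p h0 by (simp add: powr_powr)
    qed
    then have "summable (\<lambda>k. D k x)" unfolding h_def
      by (intro summableI_nonneg_bounded[where x = "c powr (1/p)"]) (auto simp: D_def)
    then have "summable (\<lambda>k. f (r (Suc k)) x - f (r k) x)"
      unfolding D_def by (rule summable_norm_cancel)
    then have "convergent (\<lambda>n. \<Sum>k<n. f (r (Suc k)) x - f (r k) x)"
      by (simp add: summable_iff_convergent)
    then have "convergent (\<lambda>n. (f (r n) x - f (r 0) x) + f (r 0) x)"
      unfolding sum_lessThan_telescope[of "\<lambda>n. f (r n) x"] by (intro convergent_add convergent_const)
    then show "convergent (\<lambda>n. f (r n) x)" by simp
  qed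
  define g where "g x = lim (\<lambda>n. f (r n) x)" for x
  have gm [measurable]: "g \<in> borel_measurable M" unfolding g_def by measurable
  have lim: "AE x in M. (\<lambda>n. f (r n) x) \<longlonglongrightarrow> g x"
    using conv by eventually_elim (auto simp: g_def convergent_LIMSEQ_iff)
  \<comment> \<open>Fatou along the subsequence turns the Cauchy estimate into an estimate of the
    distance from the limit.\<close>
  have est: "(\<lambda>x. f m x - g x) \<in> Lp M p \<and> Lp_norm M p (\<lambda>x. f m x - g x) \<le> (1/2)^k" if "m \<ge> r k" for m k
  proof -
    have "AE x in M. (\<lambda>n. f m x - f (r n) x) \<longlonglongrightarrow> f m x - g x"
      using lim by eventually_elim (intro tendsto_intros)
    moreover have "Lp_norm M p (\<lambda>x. f m x - f (r n) x) \<le> (1/2)^k" if "n \<ge> k" for n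
      using rm[OF that] rN[of k] \<open>m \<ge> r k\<close> by (intro less_imp_le[OF N]) auto
    then have "eventually (\<lambda>n. Lp_norm M p (\<lambda>x. f m x - f (r n) x) \<le> (1/2)^k) sequentially"
      by (auto simp: eventually_sequentially)
    ultimately show ?thesis
      using Lp_Fatou[of "\<lambda>n x. f m x - f (r n) x" M p "\<lambda>x. f m x - g x"] Lp_diff[OF f f p] p by auto
  qed
  have gL: "g \<in> Lp M p"
    using Lp_diff[OF f[of "r 0"] conjunct1[OF est[of 0 "r 0"]] p] by simp
  show thesis
  proof (rule that[OF gL])
    show "Lp_lim M p f g"
    proof (rule LIMSEQ_I)
      fix e :: real assume "e > 0"
      then obtain k where "(1/2::real)^k < e" using real_arch_pow_inv[of e "1/2"] by auto
      then show "\<exists>no. \<forall>n\<ge>no. norm (Lp_norm M p (\<lambda>x. f n x - g x) - 0) < e"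
        using est by (intro exI[of _ "r k"]) (force intro: order_le_less_trans)
    qed
  qed
qed

section \<open>Weak convergence in Lebesgue spaces\<close>

text \<open>The gradient of \<open>norm a powr p / p\<close>. Its value at the origin is 0 for every
  \<open>p\<close>, since the scalar multiplies \<open>a\<close> itself.\<close>

definition duality_map :: "real \<Rightarrow> 'b::real_normed_vector \<Rightarrow> 'b" where
  "duality_map p a = norm a powr (p - 2) *\<^sub>R a"

lemma norm_duality_map: "norm (duality_map p a) = norm a powr (p - 1)"
  by (cases "a = 0") (auto simp: duality_map_def powr_diff power2_eq_square field_simps powr_numeral simp flip: powr_realpow)

lemma inner_duality_map:
  fixes a :: "'b::euclidean_space"
  shows "a \<bullet> duality_map p a = norm a powr p"
  by (cases "a = 0") (auto simp: duality_map_def powr_diff powr_numeral dot_square_norm)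

lemma duality_map_measurable [measurable]: 
  "(duality_map p :: 'b::euclidean_space \<Rightarrow> 'b) \<in> borel_measurable borel"
  unfolding duality_map_def by measurable

text \<open>For \<open>p < 2\<close> the scalar factor is unbounded near the origin, so continuity
  there is read off from the norm \<open>norm a powr (p - 1)\<close> of the value; this is where
  \<open>p > 1\<close> enters.\<close>

lemma tendsto_duality_map:
  fixes a :: "'b::euclidean_space"
  assumes "(f \<longlongrightarrow> a) F" "p > 1"
  shows "((\<lambda>n. duality_map p (f n)) \<longlongrightarrow> duality_map p a) F"
proof (cases "a = 0")
  case True
  have "((\<lambda>n. norm (f n) powr (p - 1)) \<longlongrightarrow> 0 powr (p - 1)) F"
    using assms True tendsto_norm[OF assms(1)] by (intro tendsto_powr') auto
  then have "((\<lambda>n. norm (duality_map p (f n))) \<longlongrightarrow> 0) F" by (simp add: norm_duality_map)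
  from tendsto_norm_zero_cancel[OF this] show ?thesis using True by (simp add: duality_map_def)
next
  case False
  then show ?thesis unfolding duality_map_def by (intro tendsto_intros assms) auto
qed

text \<open>The exponents match because \<open>(p - 1) * q = p\<close>.\<close>

lemma duality_map_Lp:
  fixes f :: "'a \<Rightarrow> 'b::euclidean_space"
  assumes "f \<in> Lp M p" "p > 1" "q > 1" "1/p + 1/q = 1"
  shows "(\<lambda>x. duality_map p (f x)) \<in> Lp M q" "Lp_norm M q (\<lambda>x. duality_map p (f x)) = Lp_norm M p f powr (p - 1)"
proof -
  have pq: "(p - 1) * q = p" using assms by (auto simp: field_simps)
  then have pq': "(p - 1) / p = 1 / q" using assms by (auto simp: field_simps)
  have *: "norm (duality_map p (f x)) powr q = norm (f x) powr p" for x
    by (simp add: norm_duality_map powr_powr pq)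
  show "(\<lambda>x. duality_map p (f x)) \<in> Lp M q"
    using assms by (auto simp: Lp_def *)
  show "Lp_norm M q (\<lambda>x. duality_map p (f x)) = Lp_norm M p f powr (p - 1)"
    using assms pq' by (simp add: Lp_norm_def * powr_powr)
qed

text \<open>The normalised duality map of \<open>f\<close> is the case of equality in Hoelder's
  inequality.\<close>

lemma Lp_norming_function:
  fixes f :: "'a \<Rightarrow> 'b::euclidean_space"
  assumes f: "f \<in> Lp M p" and pq: "p > 1" "q > 1" "1/p + 1/q = 1"
  obtains g where "g \<in> Lp M q" "Lp_norm M q g \<le> 1" "(LINT x|M. f x \<bullet> g x) = Lp_norm M p f"
proof (cases "Lp_norm M p f = 0")
  case True
  have "\<bar>LINT x|M. f x \<bullet> (0::'b)\<bar> = 0" by simp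
  then show thesis using that[of "\<lambda>_. 0"] True by (auto simp: Lp_zero Lp_norm_def)
next
  case False
  define a where "a = Lp_norm M p f"
  have a: "a > 0" using False unfolding a_def by (simp add: order_less_le)
  define g where "g x = (1 / a powr (p - 1)) *\<^sub>R duality_map p (f x)" for x
  have "(LINT x|M. f x \<bullet> g x) = 1 / a powr (p - 1) * a powr p"
    using pq by (simp add: g_def inner_duality_map a_def Lp_norm_powr)
  also have "\<dots> = a" using a by (simp add: powr_diff)
  finally have "(LINT x|M. f x \<bullet> g x) = a" .
  moreover have "g \<in> Lp M q" unfolding g_def using duality_map_Lp[OF f pq] pq by (intro Lp_scaleR) auto
  moreover have "Lp_norm M q g = 1 / a powr (p - 1) * Lp_norm M q (\<lambda>x. duality_map p (f x))"
    unfolding g_def using pq a by (subst Lp_norm_scaleR) auto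
  then have "Lp_norm M q g \<le> 1" using duality_map_Lp(2)[OF f pq] a by (simp add: a_def)
  ultimately show thesis using that by (auto simp: a_def)
qed

text \<open>Sokal's gliding hump: at each step move by \<open>3\<^sup>-\<^sup>n\<close> in whichever of the two directions
  \<open>\<plusminus>H\<^sub>n\<close> makes the pairing with \<open>F\<^sub>n\<close> large; the later steps are too short to undo this.\<close>

theorem Lp_weakly_bounded_imp_bounded:
  fixes F :: "nat \<Rightarrow> 'a \<Rightarrow> 'b::euclidean_space"
  assumes F: "\<And>n. F n \<in> Lp M p" and pq: "p > 1" "q > 1" "1/p + 1/q = 1"
    and bdd: "\<And>G. G \<in> Lp M q \<Longrightarrow> \<exists>c. \<forall>n. \<bar>LINT x|M. F n x \<bullet> G x\<bar> \<le> c"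
  shows "\<exists>c. \<forall>n. Lp_norm M p (F n) \<le> c"
proof (rule ccontr)
  assume "\<not> ?thesis"
  \<comment> \<open>Growth \<open>4^n\<close> beats the step length \<open>(1/3)^n\<close>: the
    pairing with the limit will be at least \<open>(4/3)^n / 2\<close>.\<close>
  then have "\<exists>k. Lp_norm M p (F k) > 4^n" for n :: nat by (meson not_le)
  then obtain k where k: "\<And>n::nat. Lp_norm M p (F (k n)) > 4^n" by metis
  define L where "L n G = (LINT x|M. F (k n) x \<bullet> G x)" for n G
  define N where "N n = Lp_norm M p (F (k n))" for n
  have Lbound: "\<bar>L n G\<bar> \<le> N n * Lp_norm M q G" if "G \<in> Lp M q" for n G
    unfolding L_def N_def by (rule Hoelder_inner[OF F that pq])
  have Ladd: "L n (\<lambda>x. G x + c *\<^sub>R H x) = L n G + c * L n H" if "G \<in> Lp M q" "H \<in> Lp M q" for n G H c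
    unfolding L_def using Hoelder_inner(1)[OF F that(1) pq] Hoelder_inner(1)[OF F that(2) pq]
    by (simp add: inner_add_right)
  have "\<forall>n. \<exists>H. H \<in> Lp M q \<and> Lp_norm M q H \<le> 1 \<and> L n H = N n"
    using Lp_norming_function[OF F pq] unfolding L_def N_def by metis
  then obtain H where H: "\<And>n. H n \<in> Lp M q" "\<And>n. Lp_norm M q (H n) \<le> 1" "\<And>n. L n (H n) = N n" by metis
  have step: "\<exists>G'. G' \<in> Lp M q \<and> Lp_norm M q (\<lambda>x. G' x - G x) \<le> (1/3)^n \<and> \<bar>L n G'\<bar> \<ge> (1/3)^n * N n"
    if G: "G \<in> Lp M q" for G n
  proof -
    have "\<exists>s\<in>{1,-1}. \<bar>L n G + (s * (1/3)^n) * N n\<bar> \<ge> (1/3)^n * N n"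
      by (cases "L n G \<ge> 0") (auto simp: N_def)
    then obtain s where s: "s \<in> {1,-1}" "\<bar>L n G + (s * (1/3)^n) * N n\<bar> \<ge> (1/3)^n * N n" by blast
    define G' where "G' x = G x + (s * (1/3)^n) *\<^sub>R H n x" for x
    have "G' \<in> Lp M q" unfolding G'_def using G H pq by (intro Lp_add Lp_scaleR) auto
    moreover have "Lp_norm M q (\<lambda>x. G' x - G x) = \<bar>s * (1/3)^n\<bar> * Lp_norm M q (H n)"
      unfolding G'_def using pq by (simp add: Lp_norm_scaleR)
    then have "Lp_norm M q (\<lambda>x. G' x - G x) \<le> (1/3)^n"
      using s H(2)[of n] by (auto simp: abs_mult power_abs mult_left_le field_simps)
    moreover have "L n G' = L n G + (s * (1/3)^n) * N n"
      unfolding G'_def using Ladd[OF G H(1)] H(3) by simp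
    ultimately show ?thesis using s by metis
  qed
  define T where "T n G = (SOME G'. G' \<in> Lp M q \<and> Lp_norm M q (\<lambda>x. G' x - G x) \<le> (1/3)^n \<and> \<bar>L n G'\<bar> \<ge> (1/3)^n * N n)" for n G
  have T: "T n G \<in> Lp M q \<and> Lp_norm M q (\<lambda>x. T n G x - G x) \<le> (1/3)^n \<and> \<bar>L n (T n G)\<bar> \<ge> (1/3)^n * N n"
    if "G \<in> Lp M q" for n G
    using someI_ex[OF step[OF that, of n]] unfolding T_def .
  define G where "G = rec_nat (\<lambda>_. 0) T"
  have G_Suc: "G (Suc n) = T n (G n)" for n by (simp add: G_def)
  have GL: "G n \<in> Lp M q" for n
  proof (induction n)
    case 0 show ?case by (simp add: G_def Lp_zero)
  next
    case (Suc n) then show ?case using T by (simp add: G_Suc)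
  qed
  have Gstep: "Lp_norm M q (\<lambda>x. G (Suc n) x - G n x) \<le> (1/3)^n" "\<bar>L n (G (Suc n))\<bar> \<ge> (1/3)^n * N n" for n
    using T[OF GL] by (auto simp: G_Suc)
  \<comment> \<open>The steps from \<open>n\<close> on form a geometric series of ratio 1/3, with
    full sum \<open>3/2 * (1/3)^n\<close>.\<close>
  have tail: "Lp_norm M q (\<lambda>x. G (n + j) x - G n x) \<le> 3/2 * (1/3)^n * (1 - (1/3)^j)" for n j
  proof (induction j)
    case 0 show ?case by (simp add: Lp_norm_def)
  next
    case (Suc j)
    have "Lp_norm M q (\<lambda>x. G (n + Suc j) x - G n x) \<le>
      Lp_norm M q (\<lambda>x. G (n + Suc j) x - G (n + j) x) + Lp_norm M q (\<lambda>x. G (n + j) x - G n x)"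
      using GL pq by (intro Lp_norm_diff_triangle) auto
    also have "\<dots> \<le> (1/3)^(n + j) + 3/2 * (1/3)^n * (1 - (1/3)^j)"
      using Gstep(1)[of "n + j"] Suc by simp
    also have "\<dots> = 3/2 * (1/3)^n * (1 - (1/3)^Suc j)"
    proof -
      have "v * u + 3/2 * v * (1 - u) = 3/2 * v * (1 - 1/3 * u)" for u v :: real by (simp add: field_simps)
      then show ?thesis by (simp only: power_add power_Suc)
    qed
    finally show ?case .
  qed
  have tail': "Lp_norm M q (\<lambda>x. G m x - G n x) \<le> 3/2 * (1/3)^n" if "m \<ge> n" for m n
  proof -
    have "3/2 * (1/3::real)^n * (1 - (1/3)^(m-n)) \<le> 3/2 * (1/3)^n * 1" by (intro mult_left_mono) auto
    moreover have "Lp_norm M q (\<lambda>x. G m x - G n x) \<le> 3/2 * (1/3)^n * (1 - (1/3)^(m-n))"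
      using tail[of n "m - n"] that by simp
    ultimately show ?thesis by linarith
  qed
  have le: "Lp_norm M q (\<lambda>x. G m x - G n x) \<le> 3/2 * (1/3)^m + 3/2 * (1/3)^n" for m n
    using tail'[of n m] tail'[of m n] Lp_norm_diff_commute[of M q "G m" "G n"] by (cases "n \<le> m") (simp_all add: add_increasing add_increasing2)
  have "(\<lambda>n. 3/2 * (1/3)^n) \<longlonglongrightarrow> (0::real)" by (intro tendsto_mult_right_zero LIMSEQ_realpow_zero) auto
  then obtain Gs where Gs: "Gs \<in> Lp M q" "Lp_lim M q G Gs"
    using pq by (elim Lp_complete[OF GL _ le, rotated]) auto
  have close: "Lp_norm M q (\<lambda>x. Gs x - G n x) \<le> 3/2 * (1/3)^n" for n
  proof (rule LIMSEQ_le_const)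
    show "(\<lambda>m. Lp_norm M q (\<lambda>x. G m x - Gs x) + 3/2 * (1/3)^n) \<longlonglongrightarrow> 3/2 * (1/3)^n"
      using tendsto_add[OF Gs(2) tendsto_const] by simp
    have "Lp_norm M q (\<lambda>x. Gs x - G n x) \<le> Lp_norm M q (\<lambda>x. G m x - Gs x) + 3/2 * (1/3)^n" if "m \<ge> n" for m
    proof -
      have "Lp_norm M q (\<lambda>x. Gs x - G n x) \<le> Lp_norm M q (\<lambda>x. Gs x - G m x) + Lp_norm M q (\<lambda>x. G m x - G n x)"
        using GL Gs pq by (intro Lp_norm_diff_triangle) auto
      also have "Lp_norm M q (\<lambda>x. Gs x - G m x) = Lp_norm M q (\<lambda>x. G m x - Gs x)" by (rule Lp_norm_diff_commute)
      finally show ?thesis using tail'[OF that] by simp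
    qed
    then show "\<exists>N. \<forall>m\<ge>N. Lp_norm M q (\<lambda>x. Gs x - G n x) \<le> Lp_norm M q (\<lambda>x. G m x - Gs x) + 3/2 * (1/3)^n"
      by blast
  qed
  have large: "\<bar>L n Gs\<bar> \<ge> (4/3)^n / 2" for n
  proof -
    have "L n Gs = L n (\<lambda>x. G (Suc n) x + 1 *\<^sub>R (Gs x - G (Suc n) x))" by simp
    also have "\<dots> = L n (G (Suc n)) + 1 * L n (\<lambda>x. Gs x - G (Suc n) x)"
      using GL Gs pq by (intro Ladd Lp_diff) auto
    finally have 1: "\<bar>L n Gs\<bar> \<ge> \<bar>L n (G (Suc n))\<bar> - \<bar>L n (\<lambda>x. Gs x - G (Suc n) x)\<bar>" by simp
    have "\<bar>L n (\<lambda>x. Gs x - G (Suc n) x)\<bar> \<le> N n * Lp_norm M q (\<lambda>x. Gs x - G (Suc n) x)"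
      using GL Gs pq by (intro Lbound Lp_diff) auto
    \<comment> \<open>Counted from \<open>Suc n\<close>, the remaining steps have total length at
      most \<open>(1/3)^n / 2\<close>, so they undo at most half of what step \<open>n\<close>
      gained.\<close>
    also have "\<dots> \<le> N n * (3/2 * (1/3)^Suc n)" by (intro mult_left_mono close) (auto simp: N_def)
    also have "\<dots> = (1/3)^n * N n / 2" by simp
    finally have "\<bar>L n (\<lambda>x. Gs x - G (Suc n) x)\<bar> \<le> (1/3)^n * N n / 2" .
    moreover have "(1/3)^n * N n \<ge> (1/3)^n * 4^n" using k[of n] unfolding N_def by (intro mult_left_mono) auto
    moreover have "(1/3::real)^n * 4^n = (4/3)^n" by (simp add: power_divide)
    ultimately show ?thesis using 1 Gstep(2)[of n] by linarith
  qed
  obtain c where c: "\<And>n. \<bar>LINT x|M. F n x \<bullet> Gs x\<bar> \<le> c" using bdd[OF Gs(1)] by blast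
  obtain n where "(4/3::real)^n > 2 * c" using real_arch_pow[of "4/3" "2 * c"] by auto
  then show False using large[of n] c[of "k n"] unfolding L_def by linarith
qed

lemma duality_map_scaleR: "s > 0 \<Longrightarrow> duality_map p (s *\<^sub>R x) = s powr (p - 1) *\<^sub>R duality_map p x"
  by (simp add: duality_map_def powr_mult powr_diff powr_numeral power2_eq_square)

text \<open>The duality map is homogeneous of degree \<open>p - 1\<close>, so uniform continuity on
  one ball scales to all of space. Division by the larger of the two norms puts \<open>a\<close> and
  \<open>h\<close> into the unit ball and \<open>a - t *\<^sub>R h\<close> into the ball of radius
  2; multiplying back costs the factor \<open>s powr p\<close>.\<close>

lemma duality_map_uniformly_continuous:
  fixes p \<delta> :: real
  assumes p: "p > 1" and \<delta>: "\<delta> > 0"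
  obtains r where "r > 0" "\<And>a (h::'b::euclidean_space) t. 0 \<le> t \<Longrightarrow> t \<le> r \<Longrightarrow>
    \<bar>h \<bullet> (duality_map p a - duality_map p (a - t *\<^sub>R h))\<bar> \<le> \<delta> * (norm a powr p + norm h powr p)"
proof -
  have "continuous_on (cball 0 2) (duality_map p :: 'b \<Rightarrow> 'b)"
    using tendsto_duality_map[OF tendsto_ident_at p] by (auto simp: continuous_on_def)
  then have "uniformly_continuous_on (cball 0 2) (duality_map p :: 'b \<Rightarrow> 'b)"
    by (intro compact_uniformly_continuous) auto
  then obtain \<eta> where \<eta>: "\<eta> > 0" "\<And>x y :: 'b. norm x \<le> 2 \<Longrightarrow> norm y \<le> 2 \<Longrightarrow> dist x y < \<eta> \<Longrightarrow> dist (duality_map p x) (duality_map p y) < \<delta>"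
    unfolding uniformly_continuous_on_def using \<delta> by (metis mem_cball_0)
  show thesis
  proof (rule that[of "min 1 (\<eta> / 2)"])
    fix a h :: 'b and t :: real assume t: "0 \<le> t" "t \<le> min 1 (\<eta> / 2)"
    define s where "s = max (norm a) (norm h)"
    show "\<bar>h \<bullet> (duality_map p a - duality_map p (a - t *\<^sub>R h))\<bar> \<le> \<delta> * (norm a powr p + norm h powr p)"
    proof (cases "s = 0")
      case True
      then have "h = 0" by (simp add: s_def max_def split: if_splits)
      then show ?thesis using \<delta> by simp
    next
      case False
      then have s: "s > 0" using norm_ge_zero[of a] by (auto simp: s_def max_def split: if_splits)
      define a' where "a' = (1/s) *\<^sub>R a"
      define h' where "h' = (1/s) *\<^sub>R h"
      have n: "norm a' \<le> 1" "norm h' \<le> 1" using s by (auto simp: a'_def h'_def s_def)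
      have th: "norm (t *\<^sub>R h') \<le> t" using t n(2) by (simp add: mult_left_le)
      have eq: "a = s *\<^sub>R a'" "h = s *\<^sub>R h'" "a - t *\<^sub>R h = s *\<^sub>R (a' - t *\<^sub>R h')"
        using s by (auto simp: a'_def h'_def algebra_simps)
      have "dist (duality_map p a') (duality_map p (a' - t *\<^sub>R h')) < \<delta>"
        using n th t norm_triangle_ineq4[of a' "t *\<^sub>R h'"] \<eta>(1) by (intro \<eta>(2)) (auto simp: dist_norm)
      then have "norm h' * norm (duality_map p a' - duality_map p (a' - t *\<^sub>R h')) \<le> 1 * \<delta>"
        using n by (intro mult_mono) (auto simp: dist_norm)
      then have b: "\<bar>h' \<bullet> (duality_map p a' - duality_map p (a' - t *\<^sub>R h'))\<bar> \<le> \<delta>"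
        using Cauchy_Schwarz_ineq2[of h' "duality_map p a' - duality_map p (a' - t *\<^sub>R h')"] by simp
      have "h \<bullet> (duality_map p a - duality_map p (a - t *\<^sub>R h)) = s powr p * (h' \<bullet> (duality_map p a' - duality_map p (a' - t *\<^sub>R h')))"
        unfolding eq(3) unfolding eq(1,2) duality_map_scaleR[OF s] using s by (simp add: powr_diff inner_diff_right field_simps)
      then have "\<bar>h \<bullet> (duality_map p a - duality_map p (a - t *\<^sub>R h))\<bar> \<le> s powr p * \<delta>"
        using b by (simp add: abs_mult mult_left_mono)
      also have "\<dots> \<le> (norm a powr p + norm h powr p) * \<delta>"
        using \<delta> by (intro mult_right_mono) (auto simp: s_def max_def)
      finally show ?thesis by (simp add: mult.commute)
    qed
  qed (use \<eta>(1) in simp)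
qed

text \<open>Mazur's theorem without Hahn--Banach: the functional separating \<open>K\<close> from \<open>F\<close> is the duality map
  at the difference to an almost nearest point.\<close>

theorem Lp_convex_closed_imp_weakly_closed:
  fixes K :: "('a \<Rightarrow> 'b::euclidean_space) set"
  assumes K: "K \<subseteq> Lp M p" and F: "F \<in> Lp M p" and pq: "p > 1" "q > 1" "1/p + 1/q = 1"
    and convex: "\<And>f g t. f \<in> K \<Longrightarrow> g \<in> K \<Longrightarrow> 0 < t \<Longrightarrow> t \<le> 1 \<Longrightarrow> (\<lambda>x. f x + t *\<^sub>R (g x - f x)) \<in> K"
    and closed: "\<And>f g. (\<And>n. f n \<in> K) \<Longrightarrow> g \<in> Lp M p \<Longrightarrow> Lp_lim M p f g \<Longrightarrow> g \<in> K"
    and Fn: "\<And>n. Fn n \<in> K" 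
    and weak: "\<And>G. G \<in> Lp M q \<Longrightarrow> (\<lambda>n. LINT x|M. Fn n x \<bullet> G x) \<longlonglongrightarrow> (LINT x|M. F x \<bullet> G x)"
  shows "F \<in> K"
proof (rule ccontr)
  assume "F \<notin> K"
  have p: "p \<ge> 1" "p > 0" using pq by auto
  have FnL: "Fn n \<in> Lp M p" for n using Fn K by auto
  define I where "I f = (LINT x|M. norm (F x - f x) powr p)" for f
  define d where "d = Inf (I ` K)"
  have I0: "I f \<ge> 0" for f unfolding I_def by simp
  then have bdd: "bdd_below (I ` K)" by (intro bdd_belowI2[where m = 0])
  then have dle: "d \<le> I f" if "f \<in> K" for f unfolding d_def using that by (intro cINF_lower)
  have approx: "\<exists>f\<in>K. I f < d + e" if "e > 0" for e
  proof -
    have "Inf (I ` K) < d + e" using that by (simp add: d_def)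
    then show ?thesis using Fn by (subst (asm) cINF_less_iff[OF _ bdd]) auto
  qed
  \<comment> \<open>If \<open>d\<close> were 0, a minimising sequence in \<open>K\<close> would
    converge to \<open>F\<close> in norm, so closedness is what makes the distance positive.\<close>
  have d: "d > 0"
  proof (rule ccontr)
    assume "\<not> d > 0"
    then have "\<exists>f\<in>K. I f < 1 / real (Suc n)" for n using approx[of "1 / real (Suc n)"] by force
    then obtain f where f: "\<And>n. f n \<in> K" "\<And>n. I (f n) < 1 / real (Suc n)" by metis
    have "(\<lambda>n. I (f n)) \<longlonglongrightarrow> 0"
      using f(2) by (intro tendsto_sandwich[OF _ _ tendsto_const LIMSEQ_Suc[OF lim_1_over_n]]) (auto simp: I0 less_imp_le)
    then have "Lp_lim M p f F"
      using Lp_norm_tendsto_iff[OF p(2), of M "\<lambda>n x. F x - f n x"] by (simp add: I_def Lp_norm_diff_commute[of M p F])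
    then show False using closed[OF f(1) F] \<open>F \<notin> K\<close> by simp
  qed
  have "\<exists>c. \<forall>n. \<bar>LINT x|M. Fn n x \<bullet> G x\<bar> \<le> c" if "G \<in> Lp M q" for G
    using convergent_imp_Bseq[OF convergentI[OF weak[OF that]]] by (auto simp: Bseq_def)
  then obtain C where C: "\<And>n. Lp_norm M p (Fn n) \<le> C" using Lp_weakly_bounded_imp_bounded[of Fn, OF FnL pq] by blast
  define B where "B = C + Lp_norm M p F + (d + 1) powr (1/p)"
  have "C \<ge> 0" using C[of 0] Lp_norm_nonneg order_trans by blast
  then have B: "B \<ge> 0" by (simp add: B_def)
  \<comment> \<open>\<open>Y\<close> bounds the integrals of \<open>norm (a x) powr p\<close> and
    \<open>norm (h x) powr p\<close> together, for every \<open>n\<close>. Hence the error governed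
    by \<open>\<delta>\<close> costs at most \<open>d / 2\<close> and the choice of \<open>e\<close>
    at most \<open>d / 4\<close>, which leads to the factor \<open>3/4\<close>.\<close>
  define Y where "Y = d + 1 + B powr p"
  define \<delta> where "\<delta> = d / (2 * Y)"
  have "Y > 0" using d by (simp add: Y_def add_pos_nonneg)
  then have \<delta>: "\<delta> > 0" "\<delta> * Y = d / 2" using d by (auto simp: \<delta>_def)
  obtain r where r: "r > 0" "\<And>a (h::'b) t. 0 \<le> t \<Longrightarrow> t \<le> r \<Longrightarrow>
    \<bar>h \<bullet> (duality_map p a - duality_map p (a - t *\<^sub>R h))\<bar> \<le> \<delta> * (norm a powr p + norm h powr p)"
    using duality_map_uniformly_continuous[OF pq(1) \<delta>(1)] by metis
  define t where "t = min 1 r"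
  have t: "0 < t" "t \<le> 1" "t \<le> r" using r(1) by (auto simp: t_def)
  define e where "e = min 1 (p * t * d / 4)"
  have e: "e > 0" "e \<le> 1" "e \<le> p * t * d / 4" using p t d by (auto simp: e_def)
  obtain f where f: "f \<in> K" "I f < d + e" using approx[OF e(1)] by blast
  have fL: "f \<in> Lp M p" using f K by auto
  define a where "a x = F x - f x" for x
  have aL: "a \<in> Lp M p" unfolding a_def by (rule Lp_diff[OF F fL p(1)])
  have Ia: "(LINT x|M. norm (a x) powr p) = I f" by (simp add: I_def a_def)
  define G where "G x = duality_map p (a x)" for x
  have G: "G \<in> Lp M q" unfolding G_def by (rule duality_map_Lp[OF aL pq])
  have split: "(LINT x|M. (H x - f x) \<bullet> G x) = (LINT x|M. H x \<bullet> G x) - (LINT x|M. f x \<bullet> G x)" if "H \<in> Lp M p" for H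
    using Hoelder_inner(1)[OF that G pq] Hoelder_inner(1)[OF fL G pq] by (simp add: inner_diff_left)
  have le: "(LINT x|M. (Fn n x - f x) \<bullet> G x) \<le> 3/4 * d" for n
  proof -
    define h where "h x = Fn n x - f x" for x
    have hL: "h \<in> Lp M p" unfolding h_def by (rule Lp_diff[OF FnL fL p(1)])
    have "Lp_norm M p h \<le> Lp_norm M p (\<lambda>x. Fn n x - F x) + Lp_norm M p a"
      unfolding h_def a_def by (rule Lp_norm_diff_triangle[OF FnL F fL p(1)])
    also have "Lp_norm M p (\<lambda>x. Fn n x - F x) \<le> Lp_norm M p (Fn n) + Lp_norm M p F"
      using Lp_norm_diff_triangle[OF FnL Lp_zero F p(1), of n] Lp_norm_diff_commute[of M p "\<lambda>x. 0" F] by simp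
    also have "Lp_norm M p a \<le> (d + 1) powr (1/p)"
      unfolding Lp_norm_def Ia using f(2) e(2) p I0 by (intro powr_mono2) auto
    finally have "Lp_norm M p h \<le> B" using C[of n] by (simp add: B_def)
    then have Ih: "(LINT x|M. norm (h x) powr p) \<le> B powr p" using p B by (simp add: Lp_norm_le_iff)
    have pt: "norm (a x - t *\<^sub>R h x) powr p
      \<le> norm (a x) powr p - p * t * (h x \<bullet> G x) + p * t * (\<delta> * (norm (a x) powr p + norm (h x) powr p))" for x
    proof -
      have "h x \<bullet> G x - \<delta> * (norm (a x) powr p + norm (h x) powr p) \<le> h x \<bullet> duality_map p (a x - t *\<^sub>R h x)"
        using r(2)[of t "h x" "a x"] t by (simp add: G_def inner_diff_right)
      then have "p * t * (h x \<bullet> G x - \<delta> * (norm (a x) powr p + norm (h x) powr p)) \<le> p * t * (h x \<bullet> duality_map p (a x - t *\<^sub>R h x))"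
        using p t by (intro mult_left_mono) auto
      moreover have "norm (a x - t *\<^sub>R h x) powr p + p * t * (h x \<bullet> duality_map p (a x - t *\<^sub>R h x)) \<le> norm (a x) powr p"
        using norm_powr_tangent[OF p(1), of "a x - t *\<^sub>R h x" "a x"] by (simp add: duality_map_def inner_commute mult_ac)
      ultimately show ?thesis by (simp add: right_diff_distrib)
    qed
    have int: "integrable M (\<lambda>x. h x \<bullet> G x)" by (rule Hoelder_inner(1)[OF hL G pq])
    \<comment> \<open>A short move from the almost nearest point \<open>f\<close> towards
      \<open>Fn n\<close> stays in \<open>K\<close>, hence cannot come closer to \<open>F\<close>
      than \<open>d\<close>. This limits the first order gain of the move, which is its pairing with
      \<open>G\<close>.\<close>
    have "d \<le> I (\<lambda>x. f x + t *\<^sub>R (Fn n x - f x))" by (rule dle[OF convex[OF f(1) Fn t(1,2)]])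
    also have "\<dots> = (LINT x|M. norm (a x - t *\<^sub>R h x) powr p)" by (simp add: I_def a_def h_def diff_diff_eq)
    also have "\<dots> \<le> (LINT x|M. norm (a x) powr p - p * t * (h x \<bullet> G x) + p * t * (\<delta> * (norm (a x) powr p + norm (h x) powr p)))"
      using Lp_integrable[OF aL] Lp_integrable[OF hL] int Lp_integrable[OF Lp_diff[OF aL Lp_scaleR[OF hL p(2)] p(1)]]
      by (intro integral_mono pt) auto
    also have "\<dots> = I f - p * t * (LINT x|M. h x \<bullet> G x) + p * t * (\<delta> * (I f + (LINT x|M. norm (h x) powr p)))"
      using Lp_integrable[OF aL] Lp_integrable[OF hL] int by (simp add: Ia)
    also have "\<dots> \<le> d + p * t * d / 4 - p * t * (LINT x|M. h x \<bullet> G x) + p * t * (\<delta> * Y)"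
      unfolding Y_def using f(2) e Ih p t \<delta>(1) by (intro add_mono diff_mono mult_left_mono) auto
    finally have "p * t * (LINT x|M. h x \<bullet> G x) \<le> p * t * (3/4 * d)" unfolding \<delta>(2) by (simp add: algebra_simps)
    then show ?thesis using p t by (simp add: h_def)
  qed
  \<comment> \<open>The bound is linear in \<open>Fn n\<close> and survives the weak limit. With
    \<open>F\<close> in place of \<open>Fn n\<close> the pairing equals \<open>I f\<close>, which is
    at least \<open>d\<close>.\<close>
  have "(LINT x|M. Fn n x \<bullet> G x) \<le> 3/4 * d + (LINT x|M. f x \<bullet> G x)" for n using le[of n] split[OF FnL, of n] by linarith
  then have "(LINT x|M. F x \<bullet> G x) \<le> 3/4 * d + (LINT x|M. f x \<bullet> G x)" by (intro LIMSEQ_le_const2[OF weak[OF G]]) auto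
  then have "(LINT x|M. a x \<bullet> G x) \<le> 3/4 * d" using split[OF F] by (simp add: a_def)
  then have "I f \<le> 3/4 * d" by (simp add: G_def inner_duality_map Ia)
  then show False using dle[OF f(1)] d by simp
qed

section \<open>Smooth functions and mollification\<close>

definition smooth :: "(real ^ 'n \<Rightarrow> real) \<Rightarrow> bool" where
  "smooth \<phi> \<longleftrightarrow> (\<forall>k. Ck k \<phi>)"

lemma Ck_continuous: "Ck k \<phi> \<Longrightarrow> continuous_on UNIV \<phi>"
  by (cases k) (auto intro: differentiable_imp_continuous_on)

lemma Ck_SucD: "Ck (Suc k) \<phi> \<Longrightarrow> Ck k \<phi>"
proof (induction k arbitrary: \<phi>)
  case 0 then show ?case by (auto intro: differentiable_imp_continuous_on)
next
  case (Suc k) then show ?case by (metis Ck.simps(2))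
qed

lemma smooth_continuous: "smooth \<phi> \<Longrightarrow> continuous_on S \<phi>"
  unfolding smooth_def using Ck_continuous continuous_on_subset by blast

lemma smooth_differentiable: "smooth \<phi> \<Longrightarrow> \<phi> differentiable at x"
proof -
  assume "smooth \<phi>"
  then have "Ck (Suc 0) \<phi>" unfolding smooth_def by blast
  then show ?thesis by (simp add: differentiable_on_def)
qed

lemma smooth_partial: "smooth \<phi> \<Longrightarrow> smooth (partial j \<phi>)"
  unfolding smooth_def by (metis Ck.simps(2))

lemma partial_has_derivative: "(\<phi> has_derivative D) (at x) \<Longrightarrow> partial j \<phi> x = D (axis j 1)"
  unfolding partial_def using frechet_derivative_at by metis

lemma linear_axis_expansion:
  fixes D :: "real ^ 'n \<Rightarrow> real"
  assumes "linear D"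
  shows "D h = (\<Sum>j\<in>UNIV. D (axis j 1) * h $ j)"
proof -
  have "h = (\<Sum>j\<in>UNIV. h $ j *\<^sub>R axis j 1)"
    by (simp add: vec_eq_iff axis_def if_distrib cong: if_cong)
  then have "D h = D (\<Sum>j\<in>UNIV. h $ j *\<^sub>R axis j 1)" by simp
  also have "\<dots> = (\<Sum>j\<in>UNIV. h $ j *\<^sub>R D (axis j 1))"
    using assms by (simp add: linear_sum linear_scale)
  finally show ?thesis by (simp add: mult.commute)
qed

lemma has_derivative_partial:
  fixes \<phi> :: "real ^ 'n \<Rightarrow> real"
  assumes "\<phi> differentiable at x"
  shows "(\<phi> has_derivative (\<lambda>h. \<Sum>j\<in>UNIV. partial j \<phi> x * h $ j)) (at x)"
proof -
  have D: "(\<phi> has_derivative frechet_derivative \<phi> (at x)) (at x)"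
    using assms frechet_derivative_works by blast
  have "frechet_derivative \<phi> (at x) = (\<lambda>h. \<Sum>j\<in>UNIV. partial j \<phi> x * h $ j)"
    unfolding partial_def by (rule ext) (rule linear_axis_expansion[OF has_derivative_linear[OF D]])
  then show ?thesis using D by simp
qed

lemma partial_const [simp]: "partial j (\<lambda>x. c) x = 0"
  using partial_has_derivative[of "\<lambda>x. c" "\<lambda>x. 0"] by simp

lemma partial_add:
  assumes "f differentiable at x" "g differentiable at x"
  shows "partial j (\<lambda>x. f x + g x) x = partial j f x + partial j g x"
proof -
  have "((\<lambda>x. f x + g x) has_derivative (\<lambda>h. frechet_derivative f (at x) h + frechet_derivative g (at x) h)) (at x)"
    using assms by (intro has_derivative_add) (simp_all flip: frechet_derivative_works)
  from partial_has_derivative[OF this] show ?thesis by (simp add: partial_def)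
qed

lemma partial_mult:
  assumes "f differentiable at x" "g differentiable at x"
  shows "partial j (\<lambda>x. f x * g x) x = f x * partial j g x + partial j f x * g x"
proof -
  have "((\<lambda>x. f x * g x) has_derivative (\<lambda>h. f x * frechet_derivative g (at x) h + frechet_derivative f (at x) h * g x)) (at x)"
    using assms by (intro has_derivative_mult) (simp_all flip: frechet_derivative_works)
  from partial_has_derivative[OF this] show ?thesis by (simp add: partial_def)
qed

lemma partial_component: "partial j (\<lambda>x. x $ i) x = (if i = j then 1 else 0)"
  using partial_has_derivative[OF bounded_linear_imp_has_derivative[OF bounded_linear_vec_nth[of i]], of j x]
  by (auto simp: axis_def)

lemma partial_affine:
  assumes "f differentiable at (a + c *\<^sub>R x)"
  shows "partial j (\<lambda>x. f (a + c *\<^sub>R x)) x = c * partial j f (a + c *\<^sub>R x)"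
proof -
  have D: "(f has_derivative frechet_derivative f (at (a + c *\<^sub>R x))) (at (a + c *\<^sub>R x))"
    using assms by (simp flip: frechet_derivative_works)
  have "((\<lambda>x. a + c *\<^sub>R x) has_derivative (\<lambda>h. c *\<^sub>R h)) (at x)"
    by (auto intro!: derivative_eq_intros)
  from has_derivative_compose[OF this D]
  have "((\<lambda>x. f (a + c *\<^sub>R x)) has_derivative (\<lambda>h. frechet_derivative f (at (a + c *\<^sub>R x)) (c *\<^sub>R h))) (at x)" .
  from partial_has_derivative[OF this] have "partial j (\<lambda>x. f (a + c *\<^sub>R x)) x = frechet_derivative f (at (a + c *\<^sub>R x)) (c *\<^sub>R axis j 1)" .
  also have "\<dots> = c * partial j f (a + c *\<^sub>R x)"
    using linear_scale[OF has_derivative_linear[OF D]] by (simp add: partial_def)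
  finally show ?thesis .
qed

lemma Ck_const: "Ck k (\<lambda>x::real^'n. c)"
proof (induction k arbitrary: c)
  case (Suc k)
  have "partial j (\<lambda>x. c) = (\<lambda>x. 0)" for j :: 'n by (rule ext) simp
  then show ?case using Suc by simp
qed auto

lemma Ck_add: "Ck k f \<Longrightarrow> Ck k g \<Longrightarrow> Ck k (\<lambda>x. f x + g x)"
proof (induction k arbitrary: f g)
  case (Suc k)
  then have d: "f differentiable at x" "g differentiable at x" for x by (auto simp: differentiable_on_def)
  have "partial j (\<lambda>x. f x + g x) = (\<lambda>x. partial j f x + partial j g x)" for j
    by (rule ext) (rule partial_add[OF d])
  then show ?case using Suc by (auto intro: differentiable_on_add)
qed (auto intro: continuous_intros)

lemma Ck_mult: "Ck k f \<Longrightarrow> Ck k g \<Longrightarrow> Ck k (\<lambda>x. f x * g x)"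
proof (induction k arbitrary: f g)
  case (Suc k)
  then have d: "f differentiable at x" "g differentiable at x" for x by (auto simp: differentiable_on_def)
  have "partial j (\<lambda>x. f x * g x) = (\<lambda>x. f x * partial j g x + partial j f x * g x)" for j
    by (rule ext) (rule partial_mult[OF d])
  then show ?case using Suc Ck_SucD[OF Suc.prems(1)] Ck_SucD[OF Suc.prems(2)] 
    by (auto intro!: differentiable_on_mult Ck_add)
qed (auto intro: continuous_intros)

lemma Ck_affine: "Ck k f \<Longrightarrow> Ck k (\<lambda>x. f (a + c *\<^sub>R x))"
proof (induction k arbitrary: f)
  case 0 then show ?case by (auto intro!: continuous_intros continuous_on_compose2[of UNIV f])
next
  case (Suc k)
  then have d: "f differentiable at x" for x by (auto simp: differentiable_on_def)
  have "partial j (\<lambda>x. f (a + c *\<^sub>R x)) = (\<lambda>x. c * partial j f (a + c *\<^sub>R x))" for j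
    by (rule ext) (rule partial_affine[OF d])
  moreover have "(\<lambda>x. f (a + c *\<^sub>R x)) differentiable at x" for x
    using differentiable_chain_at[of "\<lambda>x. a + c *\<^sub>R x" x f, OF _ d] by (simp add: o_def)
  moreover have "Ck k (\<lambda>x. c * partial j f (a + c *\<^sub>R x))" for j
    using Suc by (intro Ck_mult Ck_const) simp
  ultimately show ?case by (simp add: differentiable_on_def)
qed

lemma Ck_component: "Ck k (\<lambda>x::real^'a. x $ i)"
proof (cases k)
  case 0 then show ?thesis by (auto intro: continuous_intros)
next
  case (Suc k)
  have "partial j (\<lambda>x. x $ i) = (\<lambda>x. if i = j then 1 else 0)" for j 
    by (rule ext) (rule partial_component)
  moreover have "Ck k (\<lambda>x::real^'a. if i = j then 1 else 0)" for j by (rule Ck_const)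
  ultimately show ?thesis using Suc
    by (simp add: bounded_linear_imp_differentiable_on bounded_linear_vec_nth del: if_split)
qed

lemma smooth_const: "smooth (\<lambda>x. c)"
  and smooth_add: "smooth f \<Longrightarrow> smooth g \<Longrightarrow> smooth (\<lambda>x. f x + g x)"
  and smooth_mult: "smooth f \<Longrightarrow> smooth g \<Longrightarrow> smooth (\<lambda>x. f x * g x)"
  and smooth_affine: "smooth f \<Longrightarrow> smooth (\<lambda>x. f (a + c *\<^sub>R x))"
  and smooth_component: "smooth (\<lambda>x. x $ i)"
  by (simp_all add: smooth_def Ck_const Ck_add Ck_mult Ck_affine Ck_component)

lemma smooth_minus: "smooth f \<Longrightarrow> smooth (\<lambda>x. - f x)"
  using smooth_mult[OF smooth_const[of "-1"]] by simp

lemma smooth_diff: "smooth f \<Longrightarrow> smooth g \<Longrightarrow> smooth (\<lambda>x. f x - g x)"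
  using smooth_add[OF _ smooth_minus] by fastforce

lemma smooth_sum: "(\<And>i. i \<in> I \<Longrightarrow> smooth (f i)) \<Longrightarrow> smooth (\<lambda>x. \<Sum>i\<in>I. f i x)"
  by (induction I rule: infinite_finite_induct) (auto intro: smooth_const smooth_add)

lemma smooth_prod: "(\<And>i. i \<in> I \<Longrightarrow> smooth (f i)) \<Longrightarrow> smooth (\<lambda>x. \<Prod>i\<in>I. f i x)"
  by (induction I rule: infinite_finite_induct) (auto intro: smooth_const smooth_mult)

text \<open>The powers of \<open>s\<close> in the denominator are carried along because they make
  the family closed under differentiation, up to linear combinations.\<close>

definition flat_exp :: "nat \<Rightarrow> real \<Rightarrow> real" where
  "flat_exp m s = (if s > 0 then exp (- 1 / s) / s ^ m else 0)"

text \<open>The inequality \<open>1 + x \<le> exp x\<close> at \<open>x = 1 / (s * k)\<close>,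
  raised to the power \<open>k = m + 2\<close>, beats the pole of order \<open>m\<close> by two
  powers of \<open>s\<close>. Quadratic decay is what gives the derivative at the origin.\<close>

lemma flat_exp_bound: "\<exists>C. \<forall>s. \<bar>flat_exp m s\<bar> \<le> C * s\<^sup>2"
proof (intro exI allI)
  fix s
  define k where "k = m + 2"
  have k: "k > 0" by (simp add: k_def)
  show "\<bar>flat_exp m s\<bar> \<le> (real k ^ k) * s\<^sup>2"
  proof (cases "s > 0")
    case True
    have "1 / s / real k \<le> exp (1 / s / real k)" using exp_ge_add_one_self[of "1 / s / real k"] by linarith
    then have "(1 / s / real k) ^ k \<le> exp (1 / s / real k) ^ k" using True by (intro power_mono) auto
    also have "\<dots> = exp (1 / s)" using k by (simp flip: exp_of_nat_mult)
    finally have "1 \<le> exp (1/s) * (s * real k) ^ k" using True k by (simp add: power_divide field_simps power_mult_distrib)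
    then have "exp (-1/s) * 1 \<le> exp (-1/s) * (exp (1/s) * (s * real k) ^ k)" by (intro mult_left_mono) auto
    also have "\<dots> = (s * real k) ^ k" by (simp add: exp_minus)
    finally have "exp (-1/s) / s ^ m \<le> (s * real k) ^ k / s ^ m" using True by (intro divide_right_mono) auto
    also have "\<dots> = (real k ^ k) * s\<^sup>2" using True by (simp add: k_def power_mult_distrib power_add power2_eq_square)
    finally show ?thesis using True by (simp add: flat_exp_def)
  qed (auto simp: flat_exp_def)
qed

lemma flat_exp_derivative:
  "(flat_exp m has_real_derivative (flat_exp (m + 2) s - real m * flat_exp (m + 1) s)) (at s)"
proof -
  consider "s > 0" | "s < 0" | "s = 0" by linarith
  then show ?thesis
  proof cases
    case 1
    have "((\<lambda>s. exp (- 1 / s) / s ^ m) has_real_derivative (flat_exp (m + 2) s - real m * flat_exp (m + 1) s)) (at s)"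
    proof -
      have D1: "((\<lambda>s. s ^ m) has_real_derivative real m * s ^ m / s) (at s)"
        using DERIV_pow[of m s UNIV] 1 by (cases m) auto
      have D2: "((\<lambda>s. exp (- 1 / s)) has_real_derivative exp (- 1 / s) / s\<^sup>2) (at s)"
        using 1 by (auto intro!: derivative_eq_intros simp: power2_eq_square)
      have "s ^ m \<noteq> 0" using 1 by simp
      have eq: "(exp (- 1 / s) / s\<^sup>2 * s ^ m - exp (- 1 / s) * (real m * s ^ m / s)) / (s ^ m * s ^ m)
          = flat_exp (m + 2) s - real m * flat_exp (m + 1) s"
        using 1 by (simp add: flat_exp_def power_add power2_eq_square diff_divide_distrib)
      show ?thesis using DERIV_divide[OF D2 D1 \<open>s ^ m \<noteq> 0\<close>] unfolding eq .
    qed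
    moreover have "eventually (\<lambda>s. flat_exp m s = exp (- 1 / s) / s ^ m) (nhds s)"
      using eventually_nhds_in_open[of "{0<..}" s] 1 by (auto elim!: eventually_mono simp: flat_exp_def)
    ultimately show ?thesis by (subst DERIV_cong_ev[OF refl _ refl])
  next
    case 2
    have "((\<lambda>s. 0) has_real_derivative (flat_exp (m + 2) s - real m * flat_exp (m + 1) s)) (at s)"
      using 2 by (auto simp: flat_exp_def)
    moreover have "eventually (\<lambda>s. flat_exp m s = 0) (nhds s)"
      using eventually_nhds_in_open[of "{..<0}" s] 2 by (auto elim!: eventually_mono simp: flat_exp_def)
    ultimately show ?thesis by (subst DERIV_cong_ev[OF refl _ refl])
  next
    case 3
    obtain C where C: "\<And>s. \<bar>flat_exp m s\<bar> \<le> C * s\<^sup>2" using flat_exp_bound by blast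
    have "((\<lambda>h. flat_exp m h / h) \<longlongrightarrow> 0) (at 0)"
    proof (rule Lim_null_comparison)
      have "\<bar>flat_exp m h / h\<bar> \<le> C * \<bar>h\<bar>" for h
      proof (cases "h = 0")
        case False
        have "\<bar>flat_exp m h\<bar> \<le> C * \<bar>h\<bar> * \<bar>h\<bar>" using C[of h] by (simp add: power2_eq_square)
        then show ?thesis using False by (simp add: abs_divide pos_divide_le_eq)
      qed simp
      then show "\<forall>\<^sub>F x in at 0. norm (flat_exp m x / x) \<le> C * \<bar>x\<bar>" by simp
      show "((\<lambda>x. C * \<bar>x\<bar>) \<longlongrightarrow> 0) (at (0::real))" by (auto intro!: tendsto_eq_intros)
    qed
    then show ?thesis using 3 by (simp add: DERIV_def flat_exp_def)
  qed
qed

text \<open>The induction on \<open>k\<close> treats all \<open>m\<close> at once, since one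
  derivative raises the index.\<close>

lemma Ck_flat_exp_compose: 
  assumes "smooth g"
  shows "Ck k (\<lambda>x. flat_exp m (g x))"
proof (induction k arbitrary: m)
  have D: "((\<lambda>x. flat_exp m (g x)) has_derivative 
     (\<lambda>h. (flat_exp (m + 2) (g x) - real m * flat_exp (m + 1) (g x)) * frechet_derivative g (at x) h)) (at x)" for x m
    using has_derivative_compose[of g "frechet_derivative g (at x)" x UNIV "flat_exp m"]
      smooth_differentiable[OF assms] flat_exp_derivative[of m "g x"]
    by (simp add: has_field_derivative_def flip: frechet_derivative_works)
  case 0
  show ?case using has_derivative_continuous[OF D] by (simp add: continuous_at_imp_continuous_on)
  fix k m assume IH: "\<And>m. Ck k (\<lambda>x. flat_exp m (g x))"
  have "partial j (\<lambda>x. flat_exp m (g x)) = (\<lambda>x. (flat_exp (m + 2) (g x) + (- real m) * flat_exp (m + 1) (g x)) * partial j g x)" for j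
    by (rule ext) (simp only: partial_has_derivative[OF D], simp add: partial_def)
  moreover have "Ck k (partial j g)" for j using smooth_partial[OF assms] by (simp add: smooth_def)
  then have "Ck k (\<lambda>x. (flat_exp (m + 2) (g x) + (- real m) * flat_exp (m + 1) (g x)) * partial j g x)" for j
    by (intro Ck_mult Ck_add Ck_const IH)
  moreover have "(\<lambda>x. flat_exp m (g x)) differentiable_on UNIV"
    unfolding differentiable_on_def differentiable_def using D by blast
  ultimately show "Ck (Suc k) (\<lambda>x. flat_exp m (g x))" by simp
qed

lemma smooth_bump_exists:
  fixes a :: "real ^ 'n"
  assumes "r > 0"
  obtains \<rho> where "smooth \<rho>" "\<And>x. \<rho> x \<ge> 0" "\<And>x. \<rho> x \<noteq> 0 \<longleftrightarrow> x \<in> ball a r"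
proof
  \<comment> \<open>The square of \<open>r\<close> minus the squared distance from \<open>a\<close>,
    written in coordinates so that its smoothness is that of a polynomial.\<close>
  define g where "g = (\<lambda>x::real^'n. r\<^sup>2 - (\<Sum>i\<in>UNIV. (x $ i - a $ i) * (x $ i - a $ i)))"
  have g: "smooth g" unfolding g_def by (intro smooth_diff smooth_sum smooth_mult smooth_component smooth_const)
  show "smooth (\<lambda>x. flat_exp 0 (g x))" unfolding smooth_def using Ck_flat_exp_compose[OF g] by blast
  show "flat_exp 0 (g x) \<ge> 0" for x by (simp add: flat_exp_def)
  fix x
  have "g x = r\<^sup>2 - (norm (x - a))\<^sup>2"
    unfolding g_def by (simp add: dot_square_norm[symmetric] inner_vec_def)
  then have "g x > 0 \<longleftrightarrow> norm (x - a) < r"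
  proof -
    have "r\<^sup>2 \<le> (norm (x - a))\<^sup>2 \<longleftrightarrow> r \<le> norm (x - a)" using assms by (intro power_mono_iff) auto
    then show ?thesis using \<open>g x = _\<close> by linarith
  qed
  then show "flat_exp 0 (g x) \<noteq> 0 \<longleftrightarrow> x \<in> ball a r"
    by (auto simp: flat_exp_def dist_norm norm_minus_commute)
qed

lemma partial_cong_open:
  assumes "open S" "x \<in> S" "\<And>y. y \<in> S \<Longrightarrow> f y = g y"
  shows "partial j f x = partial j g x"
proof -
  have "(f has_derivative D) (at x) \<longleftrightarrow> (g has_derivative D) (at x)" for D
    using assms has_derivative_transform_within_open[of f D x UNIV S g] 
      has_derivative_transform_within_open[of g D x UNIV S f] by auto
  then show ?thesis unfolding partial_def frechet_derivative_def by simp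
qed

section \<open>Functions of bounded support\<close>

definition bounded_support :: "real \<Rightarrow> ('a::real_normed_vector \<Rightarrow> 'b::zero) \<Rightarrow> bool" where
  "bounded_support R f \<longleftrightarrow> (\<forall>x. f x \<noteq> 0 \<longrightarrow> norm x \<le> R)"

lemma bounded_supportD: "bounded_support R f \<Longrightarrow> norm x > R \<Longrightarrow> f x = 0"
  unfolding bounded_support_def by force

lemma bounded_support_partial:
  assumes "bounded_support R f"
  shows "bounded_support R (partial j f)"
  unfolding bounded_support_def
proof (intro allI impI, rule ccontr)
  fix z
  assume z: "partial j f z \<noteq> 0"
  assume "\<not> norm z \<le> R"
  then have "z \<in> - cball 0 R" by simp
  moreover have "f y = 0" if "y \<in> - cball 0 R" for y using that assms bounded_supportD by force
  ultimately have "partial j f z = partial j (\<lambda>_. 0) z"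
    by (intro partial_cong_open[of "- cball 0 R"]) auto
  then show False using z by simp
qed

lemma bounded_support_imp_bounded:
  fixes f :: "'a::euclidean_space \<Rightarrow> real"
  assumes "continuous_on UNIV f" "bounded_support R f"
  obtains B where "B \<ge> 0" "\<And>z. \<bar>f z\<bar> \<le> B"
proof -
  have "bounded (f ` cball 0 R)"
    using assms(1) by (intro compact_imp_bounded compact_continuous_image) (auto intro: continuous_on_subset)
  then obtain B where B: "\<And>z. norm z \<le> R \<Longrightarrow> \<bar>f z\<bar> \<le> B" by (force simp: bounded_iff)
  show thesis
  proof
    show "\<bar>f z\<bar> \<le> max 0 B" for z
      by (cases "f z = 0") (use B[of z] assms(2) in \<open>auto simp: bounded_support_def\<close>)
  qed auto
qed

text \<open>A margin of 1 around the support suffices: two points closer than 1 either both lie in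
  the larger ball, where compactness applies, or both have value 0.\<close>

lemma bounded_support_uniformly_continuous:
  fixes f :: "'a::euclidean_space \<Rightarrow> 'b::real_normed_vector"
  assumes "continuous_on UNIV f" "bounded_support R f" "e > 0"
  obtains d where "d > 0" "\<And>x y. dist x y < d \<Longrightarrow> dist (f x) (f y) < e"
proof -
  have "uniformly_continuous_on (cball 0 (R + 1)) f"
    using assms(1) by (intro compact_uniformly_continuous) (auto intro: continuous_on_subset)
  then obtain d where d: "d > 0" "\<And>x y. x \<in> cball 0 (R+1) \<Longrightarrow> y \<in> cball 0 (R+1) \<Longrightarrow> dist x y < d \<Longrightarrow> dist (f x) (f y) < e"
    using assms(3) unfolding uniformly_continuous_on_def by meson
  show thesis
  proof
    show "min d 1 > 0" using d by simp
    fix x y :: 'a assume xy: "dist x y < min d 1"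
    have "dist x 0 \<le> dist x y + dist y 0" "dist y 0 \<le> dist x y + dist x 0"
      using dist_triangle[of x 0 y] dist_triangle2[of y 0 x] by (auto simp: dist_commute)
    then have nn: "norm x \<le> norm y + 1" "norm y \<le> norm x + 1" using xy by auto
    show "dist (f x) (f y) < e"
    proof (cases "f x = 0 \<and> f y = 0")
      case True then show ?thesis using assms(3) by simp
    next
      case False
      then have "norm x \<le> R + 1" "norm y \<le> R + 1" using assms(2) nn unfolding bounded_support_def by fastforce+
      then show ?thesis using d(2)[of x y] xy by auto
    qed
  qed
qed

lemma smooth_segment_MVT:
  fixes K :: "real ^ 'n \<Rightarrow> real"
  assumes "smooth K"
  obtains s where "0 < s" "s < 1" "K (u + v) - K u = (\<Sum>j\<in>UNIV. partial j K (u + s *\<^sub>R v) * v $ j)"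
proof -
  define g where "g s = K (u + s *\<^sub>R v)" for s :: real
  have der: "(g has_derivative (\<lambda>t. (\<Sum>j\<in>UNIV. partial j K (u + s *\<^sub>R v) * v $ j) * t)) (at s)" for s
  proof -
    have "((\<lambda>s. u + s *\<^sub>R v) has_derivative (\<lambda>t. t *\<^sub>R v)) (at s)"
      by (auto intro!: derivative_eq_intros)
    from has_derivative_compose[OF this has_derivative_partial[OF smooth_differentiable[OF assms]]]
    have "(g has_derivative (\<lambda>t. \<Sum>j\<in>UNIV. partial j K (u + s *\<^sub>R v) * (t *\<^sub>R v) $ j)) (at s)"
      by (simp add: g_def[abs_def])
    then show ?thesis by (simp add: sum_distrib_left sum_distrib_right ac_simps)
  qed
  then have "(g has_real_derivative (\<Sum>j\<in>UNIV. partial j K (u + s *\<^sub>R v) * v $ j)) (at s)" for s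
    unfolding has_field_derivative_def .
  then obtain s where "0 < s" "s < 1" "g 1 - g 0 = (1 - 0) * (\<Sum>j\<in>UNIV. partial j K (u + s *\<^sub>R v) * v $ j)"
    using MVT2[of 0 1 g "\<lambda>s. \<Sum>j\<in>UNIV. partial j K (u + s *\<^sub>R v) * v $ j"] by auto
  then show thesis using that by (simp add: g_def)
qed

text \<open>Uniformity in \<open>u\<close> is the point: it permits differentiation under the
  integral against any integrable function. The mean value theorem on the segment reduces the
  remainder to the modulus of continuity of the partial derivatives.\<close>

lemma smooth_uniform_derivative:
  fixes K :: "real ^ 'n \<Rightarrow> real"
  assumes K: "smooth K" "bounded_support R K" and e: "e > 0"
  obtains d where "d > 0" "\<And>u v. norm v < d \<Longrightarrow> \<bar>K (u + v) - K u - (\<Sum>j\<in>UNIV. partial j K u * v $ j)\<bar> \<le> e * norm v"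
proof -
  define n where "n = real CARD('n)"
  have n: "n > 0" by (simp add: n_def)
  have "\<exists>d>0. \<forall>x y. dist x y < d \<longrightarrow> dist (partial j K x) (partial j K y) < e / n" for j
    using bounded_support_uniformly_continuous[of "partial j K" R "e / n"] bounded_support_partial[OF K(2)]
      smooth_continuous[OF smooth_partial[OF K(1)]] e n by (metis divide_pos_pos)
  then obtain d where d: "\<And>j. d j > 0" "\<And>j x y. dist x y < d j \<Longrightarrow> dist (partial j K x) (partial j K y) < e / n"
    by metis
  define \<delta> where "\<delta> = Min (range d)"
  have \<delta>: "\<delta> > 0" "\<And>j. \<delta> \<le> d j" using d(1) by (auto simp: \<delta>_def)
  show thesis
  proof (rule that[OF \<delta>(1)])
    fix u v :: "real^'n" assume v: "norm v < \<delta>"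
    obtain s where s: "0 < s" "s < 1" "K (u + v) - K u = (\<Sum>j\<in>UNIV. partial j K (u + s *\<^sub>R v) * v $ j)"
      using smooth_segment_MVT[OF K(1)] by metis
    have "\<bar>K (u + v) - K u - (\<Sum>j\<in>UNIV. partial j K u * v $ j)\<bar> = \<bar>\<Sum>j\<in>UNIV. (partial j K (u + s *\<^sub>R v) - partial j K u) * v $ j\<bar>"
      by (simp add: s(3) sum_subtractf left_diff_distrib)
    also have "\<dots> \<le> (\<Sum>j\<in>(UNIV::'n set). e / n * norm v)"
    proof (rule order_trans[OF sum_abs sum_mono])
      fix j :: 'n
      have "dist (u + s *\<^sub>R v) u = s * norm v" using s by (simp add: dist_norm)
      also have "\<dots> \<le> norm v" using s by (simp add: mult_left_le_one_le)
      finally have "dist (u + s *\<^sub>R v) u < d j" using v \<delta>(2)[of j] by linarith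
      from d(2)[OF this] have "\<bar>partial j K (u + s *\<^sub>R v) - partial j K u\<bar> \<le> e / n" by (simp add: dist_real_def)
      moreover have "\<bar>v $ j\<bar> \<le> norm v" by (rule component_le_norm_cart)
      ultimately show "\<bar>(partial j K (u + s *\<^sub>R v) - partial j K u) * v $ j\<bar> \<le> e / n * norm v"
        unfolding abs_mult using e n by (intro mult_mono) auto
    qed
    also have "\<dots> = e * norm v" using n by (simp add: n_def)
    finally show "\<bar>K (u + v) - K u - (\<Sum>j\<in>UNIV. partial j K u * v $ j)\<bar> \<le> e * norm v" .
  qed
qed

text \<open>The kernel is taken at \<open>y - x\<close>, so the value at \<open>x\<close> is the
  integral of \<open>g (z + x)\<close> with weight \<open>K z\<close>, and a derivative in
  \<open>x\<close> falls on \<open>K\<close> with a minus sign. A kernel supported off the origin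
  thus samples \<open>g\<close> in a prescribed direction.\<close>

definition mollify :: "(real ^ 'n \<Rightarrow> real) \<Rightarrow> (real ^ 'n \<Rightarrow> 'b::euclidean_space) \<Rightarrow> real ^ 'n \<Rightarrow> 'b" where
  "mollify K g x = (LINT y|lborel. K (y - x) *\<^sub>R g y)"

lemma mollify_integrable:
  fixes g :: "real ^ 'n \<Rightarrow> 'b::euclidean_space"
  assumes K: "continuous_on UNIV K" "bounded_support R K" and g: "integrable lborel g"
  shows "integrable lborel (\<lambda>y. K (y - x) *\<^sub>R g y)"
proof -
  obtain B where B: "B \<ge> 0" "\<And>z. \<bar>K z\<bar> \<le> B" using bounded_support_imp_bounded[OF K] by metis
  have [measurable]: "K \<in> borel_measurable borel" using K by (simp add: borel_measurable_continuous_onI)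
  have [measurable]: "g \<in> borel_measurable lborel" using g by auto
  show ?thesis
  proof (rule Bochner_Integration.integrable_bound)
    show "integrable lborel (\<lambda>y. B *\<^sub>R g y)" using g by simp
    show "AE y in lborel. norm (K (y - x) *\<^sub>R g y) \<le> norm (B *\<^sub>R g y)"
      using B by (auto intro!: mult_right_mono)
  qed auto
qed

lemma mollify_has_derivative:
  fixes g :: "real ^ 'n \<Rightarrow> real"
  assumes K: "smooth K" "bounded_support R K" and g: "integrable lborel g"
  shows "(mollify K g has_derivative (\<lambda>h. \<Sum>j\<in>UNIV. - mollify (partial j K) g x * h $ j)) (at x)"
proof -
  note intK = mollify_integrable[OF smooth_continuous[OF K(1)] K(2) g]
  note intP = mollify_integrable[OF smooth_continuous[OF smooth_partial[OF K(1)]] bounded_support_partial[OF K(2)] g]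
  define I where "I = (LINT y|lborel. \<bar>g y\<bar>)"
  have I0: "I \<ge> 0" by (simp add: I_def)
  have "bounded_linear (\<lambda>h. \<Sum>j\<in>UNIV. - mollify (partial j K) g x * h $ j)"
    by (intro bounded_linear_sum bounded_linear_const_mult bounded_linear_vec_nth)
  moreover have "\<exists>d>0. \<forall>x'. norm (x' - x) < d \<longrightarrow> norm (mollify K g x' - mollify K g x - (\<Sum>j\<in>UNIV. - mollify (partial j K) g x * (x' - x) $ j)) \<le> e * norm (x' - x)"
    if e: "e > 0" for e
  proof -
    \<comment> \<open>Adding 1 covers the case that \<open>g\<close> vanishes almost
      everywhere.\<close>
    have "e / (I + 1) > 0" using e I0 by simp
    then obtain d where d: "d > 0" "\<And>u v. norm v < d \<Longrightarrow> \<bar>K (u + v) - K u - (\<Sum>j\<in>UNIV. partial j K u * v $ j)\<bar> \<le> e / (I + 1) * norm v"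
      using smooth_uniform_derivative[OF K] by metis
    have "norm (mollify K g x' - mollify K g x - (\<Sum>j\<in>UNIV. - mollify (partial j K) g x * (x' - x) $ j)) \<le> e * norm (x' - x)"
      if x': "norm (x' - x) < d" for x'
    proof -
      have 1: "mollify K g x' - mollify K g x - (\<Sum>j\<in>UNIV. - mollify (partial j K) g x * (x' - x) $ j)
         = (LINT y|lborel. K (y - x') *\<^sub>R g y - K (y - x) *\<^sub>R g y - (\<Sum>j\<in>UNIV. (partial j K (y - x) *\<^sub>R g y) * (x - x') $ j))"
        unfolding mollify_def using intK intP
        by (simp add: sum_negf[symmetric] right_diff_distrib del: sum_negf)
      have pt: "\<bar>K (y - x') *\<^sub>R g y - K (y - x) *\<^sub>R g y - (\<Sum>j\<in>UNIV. (partial j K (y - x) *\<^sub>R g y) * (x - x') $ j)\<bar>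
           \<le> (e / (I + 1) * norm (x' - x)) * \<bar>g y\<bar>" for y
      proof -
        have "K (y - x') *\<^sub>R g y - K (y - x) *\<^sub>R g y - (\<Sum>j\<in>UNIV. (partial j K (y - x) *\<^sub>R g y) * (x - x') $ j)
           = (K ((y - x) + (x - x')) - K (y - x) - (\<Sum>j\<in>UNIV. partial j K (y - x) * (x - x') $ j)) * g y"
          by (simp add: algebra_simps sum_distrib_left sum_distrib_right sum_subtractf)
        moreover have "\<bar>K ((y - x) + (x - x')) - K (y - x) - (\<Sum>j\<in>UNIV. partial j K (y - x) * (x - x') $ j)\<bar> \<le> e / (I + 1) * norm (x - x')"
          using x' by (intro d) (simp add: norm_minus_commute)
        ultimately show ?thesis unfolding norm_minus_commute[of x' x] by (simp only: abs_mult mult_right_mono abs_ge_zero)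
      qed
      have "norm (LINT y|lborel. K (y - x') *\<^sub>R g y - K (y - x) *\<^sub>R g y - (\<Sum>j\<in>UNIV. (partial j K (y - x) *\<^sub>R g y) * (x - x') $ j))
        \<le> (LINT y|lborel. norm (K (y - x') *\<^sub>R g y - K (y - x) *\<^sub>R g y - (\<Sum>j\<in>UNIV. (partial j K (y - x) *\<^sub>R g y) * (x - x') $ j)))"
        by (rule integral_norm_bound)
      also have "\<dots> \<le> (LINT y|lborel. (e / (I + 1) * norm (x' - x)) * \<bar>g y\<bar>)"
        using intK intP g pt by (intro integral_mono integrable_norm) (auto intro!: Bochner_Integration.integrable_diff Bochner_Integration.integrable_sum)
      also have "\<dots> = (e / (I + 1) * norm (x' - x)) * I" by (simp add: I_def)
      also have "\<dots> \<le> e * norm (x' - x)"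
      proof -
        have "e / (I + 1) * I \<le> e" using e I0 by (simp add: field_simps)
        then have "e / (I + 1) * I * norm (x' - x) \<le> e * norm (x' - x)" by (intro mult_right_mono) auto
        then show ?thesis by (simp add: ac_simps)
      qed
      finally show ?thesis unfolding 1 .
    qed
    then show ?thesis using d(1) by blast
  qed
  ultimately show ?thesis unfolding has_derivative_at_alt by blast
qed

lemma partial_mollify:
  fixes g :: "real ^ 'n \<Rightarrow> real"
  assumes "smooth K" "bounded_support R K" "integrable lborel g"
  shows "partial j (mollify K g) x = - mollify (partial j K) g x"
  using partial_has_derivative[OF mollify_has_derivative[OF assms], of j x]
  by (simp add: axis_def if_distrib cong: if_cong)

lemma smooth_mollify:
  fixes g :: "real ^ 'n \<Rightarrow> real"
  assumes "smooth K" "bounded_support R K" "integrable lborel g"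
  shows "smooth (mollify K g)"
proof -
  have "Ck k (mollify K g)" for k
    using assms(1,2)
  proof (induction k arbitrary: K)
    case 0
    then show ?case using mollify_has_derivative[OF 0 assms(3)] 
      by (auto intro!: continuous_at_imp_continuous_on has_derivative_continuous)
  next
    case (Suc k)
    have "partial j (mollify K g) = (\<lambda>x. (-1) * mollify (partial j K) g x)" for j
      by (rule ext) (simp add: partial_mollify[OF Suc.prems assms(3)])
    moreover have "Ck k (\<lambda>x. (-1) * mollify (partial j K) g x)" for j
      using Suc.prems by (intro Ck_mult Ck_const Suc.IH smooth_partial) (auto intro: bounded_support_partial)
    moreover have "mollify K g differentiable_on UNIV"
      unfolding differentiable_on_def differentiable_def using mollify_has_derivative[OF Suc.prems assms(3)] by blast
    ultimately show ?case by simp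
  qed
  then show ?thesis by (simp add: smooth_def)
qed

lemma lborel_integral_shift:
  fixes f :: "'a::euclidean_space \<Rightarrow> 'b::euclidean_space"
  assumes "f \<in> borel_measurable borel"
  shows "(LINT x|lborel. f (x + c)) = (LINT x|lborel. f x)"
    and "integrable lborel (\<lambda>x. f (x + c)) \<longleftrightarrow> integrable lborel f"
proof -
  have 1: "integral\<^sup>L (distr lborel borel ((+) c)) f = (LINT x|lborel. f (c + x))"
    using assms by (intro integral_distr) auto
  then show "(LINT x|lborel. f (x + c)) = (LINT x|lborel. f x)"
    by (simp add: lborel_distr_plus add.commute)
  have "integrable (distr lborel borel ((+) c)) f \<longleftrightarrow> integrable lborel (\<lambda>x. f (c + x))"
    using assms by (intro integrable_distr_eq) auto
  then show "integrable lborel (\<lambda>x. f (x + c)) \<longleftrightarrow> integrable lborel f"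
    by (simp add: lborel_distr_plus add.commute)
qed

lemma bounded_support_integrable:
  fixes f :: "'a::euclidean_space \<Rightarrow> real"
  assumes "continuous_on UNIV f" "bounded_support R f"
  shows "integrable lborel f"
proof -
  obtain B where B: "B \<ge> 0" "\<And>z. \<bar>f z\<bar> \<le> B" using bounded_support_imp_bounded[OF assms] by metis
  show ?thesis
  proof (rule Bochner_Integration.integrable_bound)
    show "integrable lborel (\<lambda>x. B * indicator (cball (0::'a) R) x)"
      by (intro integrable_mult_right integrable_real_indicator) (use emeasure_lborel_cball_finite in \<open>auto simp: less_top\<close>)
    show "f \<in> borel_measurable lborel" using assms by (simp add: borel_measurable_continuous_onI)
    show "AE x in lborel. norm (f x) \<le> norm (B * indicator (cball 0 R) x)"
    proof (rule AE_I2)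
      fix x show "norm (f x) \<le> norm (B * indicator (cball 0 R) x)"
        using B(2)[of x] B(1) assms(2) by (cases "f x = 0") (auto simp: indicator_def bounded_support_def)
    qed
  qed
qed

text \<open>The convolution of \<open>\<phi>\<close> with the indicator of a large ball is constant near the origin.\<close>

lemma integral_partial_eq_0:
  fixes \<phi> :: "real ^ 'n \<Rightarrow> real"
  assumes \<phi>: "smooth \<phi>" "bounded_support R \<phi>"
  shows "(LINT x|lborel. partial j \<phi> x) = 0"
proof -
  define g :: "real ^ 'n \<Rightarrow> real" where "g = indicator (cball 0 (R + 1))"
  have g: "integrable lborel g" unfolding g_def
    by (intro integrable_real_indicator) (use emeasure_lborel_cball_finite in \<open>auto simp: less_top\<close>)
  have on: "K (y - x) * g y = K (y - x)" if "bounded_support R K" "norm x < 1" for K :: "real ^ 'n \<Rightarrow> real" and x y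
    using that norm_triangle_ineq[of "y - x" x] by (cases "K (y - x) = 0") (auto simp: g_def bounded_support_def indicator_def)
  have m: "\<phi> \<in> borel_measurable borel" by (rule borel_measurable_continuous_onI[OF smooth_continuous[OF \<phi>(1)]])
  have c: "mollify \<phi> g x = (LINT y|lborel. \<phi> y)" if "x \<in> ball 0 1" for x
    using lborel_integral_shift(1)[OF m, of "- x"] that by (simp add: mollify_def on[OF \<phi>(2)])
  have on0: "partial j \<phi> y * g y = partial j \<phi> y" for y
    using on[OF bounded_support_partial[OF \<phi>(2)], where x = 0 and y = y] by simp
  have "(LINT y|lborel. partial j \<phi> y) = mollify (partial j \<phi>) g 0" by (simp add: mollify_def on0)
  also have "\<dots> = - partial j (mollify \<phi> g) 0" by (simp add: partial_mollify[OF \<phi> g])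
  also have "partial j (mollify \<phi> g) 0 = partial j (\<lambda>_. LINT y|lborel. \<phi> y) 0"
    by (rule partial_cong_open[OF open_ball, of _ 0 1]) (auto intro: c)
  finally show ?thesis by simp
qed

lemma integration_by_parts_smooth:
  fixes f g :: "real ^ 'n \<Rightarrow> real"
  assumes f: "smooth f" and g: "smooth g" "bounded_support R g"
  shows "(LINT x|lborel. f x * partial j g x) = - (LINT x|lborel. partial j f x * g x)"
proof -
  have i1: "integrable lborel (\<lambda>x. f x * partial j g x)"
    using bounded_support_partial[OF g(2), of j]
    by (intro bounded_support_integrable[of _ R] continuous_on_mult smooth_continuous[OF f] smooth_continuous[OF smooth_partial[OF g(1)]])
      (auto simp: bounded_support_def)
  have i2: "integrable lborel (\<lambda>x. partial j f x * g x)"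
    using g(2) by (intro bounded_support_integrable[of _ R] continuous_on_mult smooth_continuous[OF g(1)] smooth_continuous[OF smooth_partial[OF f]]) (auto simp: bounded_support_def)
  have "(LINT x|lborel. partial j (\<lambda>x. f x * g x) x) = 0"
    using g(2) by (intro integral_partial_eq_0[of _ R] smooth_mult f g) (auto simp: bounded_support_def)
  then show ?thesis using i1 i2
    by (simp add: partial_mult smooth_differentiable f g)
qed

text \<open>After truncation in value and in space, \<open>g\<close> is almost everywhere a limit of
  continuous functions. Projecting these onto a ball with \<open>P\<close> and multiplying by
  \<open>cut\<close> keeps the limit and supplies an integrable bound, so dominated convergence
  applies.\<close>

lemma Lp_lborel_dense_continuous:
  fixes g :: "'a::euclidean_space \<Rightarrow> 'b::euclidean_space"
  assumes g: "g \<in> Lp lborel p" and p: "p \<ge> 1" and e: "e > 0"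
  obtains c R where "continuous_on UNIV c" "bounded_support R c" "c \<in> Lp lborel p" "Lp_norm lborel p (\<lambda>x. g x - c x) < e"
proof -
  have gm [measurable]: "g \<in> borel_measurable borel" using Lp_measurable[OF g] by simp
  define h where "h N x = (if norm (g x) \<le> real N \<and> norm x \<le> real N then g x else 0)" for N x
  have hm [measurable]: "h N \<in> borel_measurable borel" for N unfolding h_def by measurable
  have "(\<lambda>N. LINT x|lborel. norm (g x - h N x) powr p) \<longlonglongrightarrow> integral\<^sup>L lborel (\<lambda>x::'a. 0)"
  proof (rule integral_dominated_convergence)
    show "integrable lborel (\<lambda>x. norm (g x) powr p)" by (rule Lp_integrable[OF g])
    show "AE x in lborel. norm (norm (g x - h N x) powr p) \<le> norm (g x) powr p" for N
      by (rule AE_I2) (auto simp: h_def)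
    show "AE x in lborel. (\<lambda>N. norm (g x - h N x) powr p) \<longlonglongrightarrow> 0"
    proof (rule AE_I2)
      fix x
      obtain N where N: "max (norm (g x)) (norm x) \<le> real N" using real_arch_simple by blast
      have "norm (g x - h n x) powr p = 0" if "n \<ge> N" for n
        using N that by (auto simp: h_def)
      then show "(\<lambda>N. norm (g x - h N x) powr p) \<longlonglongrightarrow> 0"
        by (intro tendsto_eventually) (auto simp: eventually_sequentially)
    qed
  qed measurable
  then have "(\<lambda>N. Lp_norm lborel p (\<lambda>x. g x - h N x)) \<longlonglongrightarrow> 0"
    using p by (subst Lp_norm_tendsto_iff) auto
  then have "eventually (\<lambda>N. Lp_norm lborel p (\<lambda>x. g x - h N x) < e/2) sequentially"
    using e by (intro order_tendstoD) auto
  then obtain N where N: "Lp_norm lborel p (\<lambda>x. g x - h N x) < e/2"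
    by (auto simp: eventually_sequentially)
  have hLp: "h N \<in> Lp lborel p"
    using p by (intro Lp_bounded_mult(1)[OF g, of 1]) (auto simp: h_def)
  have "h N \<in> borel_measurable lebesgue" by (rule measurable_completion) auto
  then have "h N measurable_on UNIV" by (intro lebesgue_measurable_imp_measurable_on) auto
  then obtain S c where S: "negligible S" and c: "\<And>n. continuous_on UNIV (c n)" "\<And>x. x \<notin> S \<Longrightarrow> (\<lambda>n. c n x) \<longlonglongrightarrow> h N x"
    unfolding measurable_on_def by auto
  define cut :: "'a \<Rightarrow> real" where "cut x = max 0 (min 1 (real N + 1 - norm x))" for x
  define P :: "'b \<Rightarrow> 'b" where "P = closest_point (cball 0 (real N))"
  have Pcont: "continuous_on UNIV P" unfolding P_def by (intro continuous_on_closest_point) auto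
  have Pn: "norm (P v) \<le> real N" for v
    using closest_point_in_set[of "cball (0::'b) (real N)" v] by (simp add: P_def)
  define d where "d n x = cut x *\<^sub>R P (c n x)" for n x
  have dcont: "continuous_on UNIV (d n)" for n
    unfolding d_def cut_def by (intro continuous_intros continuous_on_compose2[OF Pcont] c) auto
  have dsupp: "bounded_support (real N + 1) (d n)" for n
    unfolding bounded_support_def d_def cut_def by (auto simp: max_def min_def split: if_splits)
  have [measurable]: "d n \<in> borel_measurable borel" for n using dcont by (rule borel_measurable_continuous_onI)
  have hN: "norm (h N x) \<le> real N" for x by (auto simp: h_def)
  have cut01: "0 \<le> cut x" "cut x \<le> 1" for x by (auto simp: cut_def)
  have dN: "norm (d n x) \<le> real N" for n x
    using mult_mono[OF cut01(2)[of x] Pn[of "c n x"]] cut01[of x] by (simp add: d_def)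
  have bnd: "norm (h N x - d n x) powr p \<le> (2 * real N) powr p * indicator (cball 0 (real N + 1)) x" for n x
  proof (cases "norm x \<le> real N + 1")
    case True
    have "norm (h N x - d n x) \<le> 2 * real N" using norm_triangle_ineq4[of "h N x" "d n x"] hN[of x] dN[of n x] by simp
    then show ?thesis using True p by (auto intro!: powr_mono2)
  next
    case False
    then have "d n x = 0" using bounded_supportD[OF dsupp] by auto
    moreover have "h N x = 0" using False by (auto simp: h_def)
    ultimately show ?thesis by simp
  qed
  have bint: "integrable lborel (\<lambda>x. (2 * real N) powr p * indicator (cball (0::'a) (real N + 1)) x)"
    by (intro integrable_mult_right integrable_real_indicator) (use emeasure_lborel_cball_finite in \<open>auto simp: less_top\<close>)
  have "(\<lambda>n. LINT x|lborel. norm (h N x - d n x) powr p) \<longlonglongrightarrow> integral\<^sup>L lborel (\<lambda>x::'a. 0)"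
  proof (rule integral_dominated_convergence[OF _ _ bint])
    show "AE x in lborel. norm (norm (h N x - d n x) powr p) \<le> (2 * real N) powr p * indicator (cball 0 (real N + 1)) x" for n
      using bnd by (intro AE_I2) simp
    have "AE x in lebesgue. x \<notin> S" using S by (simp add: negligible_iff_null_sets AE_not_in)
    then have "AE x in lborel. x \<notin> S" by (simp add: AE_completion_iff)
    then show "AE x in lborel. (\<lambda>n. norm (h N x - d n x) powr p) \<longlonglongrightarrow> 0"
    proof eventually_elim
      fix x assume "x \<notin> S"
      then have "(\<lambda>n. c n x) \<longlonglongrightarrow> h N x" by (rule c)
      then have "(\<lambda>n. P (c n x)) \<longlonglongrightarrow> P (h N x)"
        using Pcont by (intro isCont_tendsto_compose[of _ P]) (auto simp: continuous_on_eq_continuous_at)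
      moreover have "P (h N x) = h N x" unfolding P_def using hN by (intro closest_point_self) auto
      ultimately have "(\<lambda>n. d n x) \<longlonglongrightarrow> cut x *\<^sub>R h N x" unfolding d_def by (intro tendsto_intros) simp
      also have "cut x *\<^sub>R h N x = h N x" by (auto simp: cut_def h_def)
      finally have "(\<lambda>n. norm (h N x - d n x) powr p) \<longlonglongrightarrow> norm (h N x - h N x) powr p"
        using p by (intro tendsto_powr' tendsto_intros) auto
      then show "(\<lambda>n. norm (h N x - d n x) powr p) \<longlonglongrightarrow> 0" by simp
    qed
  qed measurable
  then have "(\<lambda>n. Lp_norm lborel p (\<lambda>x. h N x - d n x)) \<longlonglongrightarrow> 0"
    using p by (subst Lp_norm_tendsto_iff) auto
  then have "eventually (\<lambda>n. Lp_norm lborel p (\<lambda>x. h N x - d n x) < e/2) sequentially"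
    using e by (intro order_tendstoD) auto
  then obtain n where n: "Lp_norm lborel p (\<lambda>x. h N x - d n x) < e/2"
    by (auto simp: eventually_sequentially)
  have "(\<lambda>x. h N x - d n x) \<in> Lp lborel p"
    using bnd by (intro Lp_bound[OF _ bint]) auto
  from Lp_diff[OF hLp this p] have dLp: "d n \<in> Lp lborel p" by simp
  have "Lp_norm lborel p (\<lambda>x. g x - d n x) < e"
    using Lp_norm_diff_triangle[OF g hLp dLp p] N n by linarith
  then show thesis using that dcont dsupp dLp by blast
qed

lemma Lp_shift:
  fixes g :: "'a::euclidean_space \<Rightarrow> 'b::euclidean_space"
  assumes "g \<in> Lp lborel p"
  shows "(\<lambda>x. g (x + h)) \<in> Lp lborel p" "Lp_norm lborel p (\<lambda>x. g (x + h)) = Lp_norm lborel p g"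
proof -
  have [measurable]: "g \<in> borel_measurable borel" using Lp_measurable[OF assms] by simp
  have m: "(\<lambda>x. norm (g x) powr p) \<in> borel_measurable borel" by measurable
  show "(\<lambda>x. g (x + h)) \<in> Lp lborel p"
    using lborel_integral_shift(2)[OF m, of h] Lp_integrable[OF assms] by (intro LpI) auto
  show "Lp_norm lborel p (\<lambda>x. g (x + h)) = Lp_norm lborel p g"
    using lborel_integral_shift(1)[OF m, of h] by (simp add: Lp_norm_def)
qed

lemma Lp_translation_continuous:
  fixes g :: "'a::euclidean_space \<Rightarrow> 'b::euclidean_space"
  assumes g: "g \<in> Lp lborel p" and p: "p \<ge> 1" and e: "e > 0"
  obtains d where "d > 0" "\<And>h. norm h < d \<Longrightarrow> Lp_norm lborel p (\<lambda>x. g (x + h) - g x) < e"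
proof -
  obtain c R where c: "continuous_on UNIV c" "bounded_support R c" "c \<in> Lp lborel p" 
    "Lp_norm lborel p (\<lambda>x. g x - c x) < e / 4"
    using Lp_lborel_dense_continuous[OF g p, of "e/4"] e by (metis divide_pos_pos zero_less_numeral)
  define V where "V = measure lborel (cball (0::'a) (R + 1))"
  \<comment> \<open>A function bounded by \<open>\<epsilon>\<close> and supported in the ball of
    radius \<open>R + 1\<close> has norm at most \<open>\<epsilon> * V powr (1/p)\<close>, hence at
    most \<open>e / 4\<close>. Three such quarters stay below \<open>e\<close>.\<close>
  define \<epsilon> where "\<epsilon> = e / 4 / (V powr (1/p) + 1)"
  have \<epsilon>: "\<epsilon> > 0" using e by (simp add: \<epsilon>_def add_nonneg_pos)
  obtain d where d: "d > 0" "\<And>x y. dist x y < d \<Longrightarrow> dist (c x) (c y) < \<epsilon>"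
    using bounded_support_uniformly_continuous[OF c(1,2) \<epsilon>] by metis
  show thesis
  proof
    show "min d 1 > 0" using d by simp
    fix h :: 'a assume h: "norm h < min d 1"
    have sL: "(\<lambda>x. c (x + h)) \<in> Lp lborel p" "(\<lambda>x. g (x + h)) \<in> Lp lborel p" using Lp_shift c g by blast+
    have pt: "norm (c (x + h) - c x) powr p \<le> \<epsilon> powr p * indicator (cball 0 (R + 1)) x" for x
    proof (cases "norm x \<le> R + 1")
      case True
      have "norm (c (x + h) - c x) < \<epsilon>" using d(2)[of "x + h" x] h by (simp add: dist_norm)
      then show ?thesis using True p by (auto intro!: powr_mono2)
    next
      case False
      have "norm (x + h) \<ge> norm x - norm h" by norm
      then have "norm (x + h) > R" using False h by simp
      then have "c (x + h) = 0" by (rule bounded_supportD[OF c(2)])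
      moreover have "c x = 0" using False by (intro bounded_supportD[OF c(2)]) auto
      ultimately show ?thesis by simp
    qed
    have "(LINT x|lborel. norm (c (x + h) - c x) powr p) \<le> (LINT x|lborel. \<epsilon> powr p * indicator (cball 0 (R + 1)) (x::'a))"
      using Lp_integrable[OF Lp_diff[OF sL(1) c(3) p]] pt
      by (intro integral_mono integrable_mult_right integrable_real_indicator) 
        (use emeasure_lborel_cball_finite in \<open>auto simp: less_top\<close>)
    also have "\<dots> = (\<epsilon> * V powr (1/p)) powr p"
      using p \<epsilon> by (simp add: V_def powr_mult powr_powr)
    finally have "Lp_norm lborel p (\<lambda>x. c (x + h) - c x) \<le> \<epsilon> * V powr (1/p)"
      using p \<epsilon> by (subst Lp_norm_le_iff) auto
    also have "\<dots> \<le> \<epsilon> * (V powr (1/p) + 1)" using \<epsilon> by (intro mult_left_mono) auto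
    also have "\<dots> = e / 4"
    proof -
      have "V powr (1/p) + 1 > 0" by (simp add: add_nonneg_pos)
      then show ?thesis unfolding \<epsilon>_def by (metis less_irrefl nonzero_eq_divide_eq)
    qed
    finally have 1: "Lp_norm lborel p (\<lambda>x. c (x + h) - c x) \<le> e / 4" .
    have 2: "Lp_norm lborel p (\<lambda>x. g (x + h) - c (x + h)) < e / 4"
      using Lp_shift(2)[OF Lp_diff[OF g c(3) p], of h] c(4) by simp
    have "Lp_norm lborel p (\<lambda>x. g (x + h) - g x) \<le> Lp_norm lborel p (\<lambda>x. g (x + h) - c (x + h)) 
       + Lp_norm lborel p (\<lambda>x. c (x + h) - g x)"
      using sL c g p by (intro Lp_norm_diff_triangle) auto
    moreover have "Lp_norm lborel p (\<lambda>x. c (x + h) - g x) \<le> Lp_norm lborel p (\<lambda>x. c (x + h) - c x) 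
       + Lp_norm lborel p (\<lambda>x. c x - g x)"
      using sL c g p by (intro Lp_norm_diff_triangle) auto
    moreover have "Lp_norm lborel p (\<lambda>x. c x - g x) = Lp_norm lborel p (\<lambda>x. g x - c x)"
      by (rule Lp_norm_diff_commute)
    ultimately show "Lp_norm lborel p (\<lambda>x. g (x + h) - g x) < e" using 1 2 c(4) e by linarith
  qed
qed

definition mollifier :: "real \<Rightarrow> (real ^ 'n \<Rightarrow> real) \<Rightarrow> bool" where
  "mollifier r K \<longleftrightarrow> smooth K \<and> (\<forall>x. K x \<ge> 0) \<and> bounded_support r K \<and> (LINT x|lborel. K x) = 1"

lemma mollifierD:
  assumes "mollifier r K"
  shows "smooth K" "K x \<ge> 0" "bounded_support r K" "(LINT x|lborel. K x) = 1" 
    "integrable lborel K" "continuous_on UNIV K" "K \<in> borel_measurable borel"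
proof -
  show *: "smooth K" "K x \<ge> 0" "bounded_support r K" "(LINT x|lborel. K x) = 1"
    using assms by (auto simp: mollifier_def)
  show **: "continuous_on UNIV K" by (rule smooth_continuous[OF *(1)])
  show "integrable lborel K" by (rule bounded_support_integrable[OF ** *(3)])
  show "K \<in> borel_measurable borel" by (rule borel_measurable_continuous_onI[OF **])
qed

text \<open>The centre \<open>a\<close> may differ from the origin because approximation up to the
  boundary uses kernels that look inwards. The radius in \<open>mollifier\<close> is measured from
  the origin, hence \<open>norm a + r\<close>.\<close>

lemma mollifier_exists:
  fixes a :: "real ^ 'n"
  assumes "r > 0"
  obtains K where "mollifier (norm a + r) K" "\<And>x. K x \<noteq> 0 \<longleftrightarrow> x \<in> ball a r"
proof -
  obtain \<rho> where \<rho>: "smooth \<rho>" "\<And>x. \<rho> x \<ge> 0" "\<And>x. \<rho> x \<noteq> 0 \<longleftrightarrow> x \<in> ball a r"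
    using smooth_bump_exists[OF assms, of a] by metis
  have supp: "bounded_support (norm a + r) \<rho>"
    unfolding bounded_support_def
  proof (intro allI impI)
    fix x assume "\<rho> x \<noteq> 0"
    then have "norm (x - a) < r" using \<rho>(3)[of x] by (simp add: dist_norm norm_minus_commute)
    then show "norm x \<le> norm a + r" using norm_triangle_sub[of x a] by simp
  qed
  have int: "integrable lborel \<rho>" by (rule bounded_support_integrable[OF smooth_continuous[OF \<rho>(1)] supp])
  define c where "c = (LINT x|lborel. \<rho> x)"
  have "c \<noteq> 0"
  proof
    assume "c = 0"
    then have "AE x in lborel. \<rho> x = 0"
      unfolding c_def using int \<rho>(2) by (subst (asm) integral_nonneg_eq_0_iff_AE) auto
    then have "AE x in lborel. x \<notin> ball a r" using \<rho>(3) by (auto elim: eventually_mono)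
    then have "ball a r \<in> null_sets lborel"
      by (subst (asm) AE_iff_null_sets[symmetric]) auto
    then have "emeasure lborel (ball a r) = 0" by auto
    then show False using content_ball_pos[OF assms, of a] by (simp add: measure_def)
  qed
  moreover have "c \<ge> 0" unfolding c_def using \<rho>(2) by simp
  ultimately have c: "c > 0" by simp
  show thesis
  proof
    have "(LINT x|lborel. (1/c) * \<rho> x) = (1/c) * c" unfolding c_def by (rule integral_mult_right_zero)
    also have "\<dots> = 1" using c by simp
    finally have int1: "(LINT x|lborel. (1/c) * \<rho> x) = 1" .
    have "smooth (\<lambda>x. (1/c) * \<rho> x)" by (rule smooth_mult[OF smooth_const \<rho>(1)])
    moreover have "bounded_support (norm a + r) (\<lambda>x. (1/c) * \<rho> x)"
      using supp by (auto simp: bounded_support_def)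
    ultimately show "mollifier (norm a + r) (\<lambda>x. (1/c) * \<rho> x)"
      unfolding mollifier_def using int1 \<rho>(2) c by auto
    show "(1/c) * \<rho> x \<noteq> 0 \<longleftrightarrow> x \<in> ball a r" for x using c \<rho>(3) by auto
  qed
qed

lemma mollify_eq_shift:
  fixes g :: "real ^ 'n \<Rightarrow> 'b::euclidean_space"
  assumes "K \<in> borel_measurable borel" "g \<in> borel_measurable borel"
  shows "mollify K g x = (LINT z|lborel. K z *\<^sub>R g (z + x))"
  using lborel_integral_shift(1)[of "\<lambda>y. K (y - x) *\<^sub>R g y" x] assms by (simp add: mollify_def)

lemma mollify_measurable [measurable]:
  fixes g :: "real ^ 'n \<Rightarrow> 'b::euclidean_space"
  assumes [measurable]: "K \<in> borel_measurable borel" "g \<in> borel_measurable borel"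
  shows "mollify K g \<in> borel_measurable borel"
  unfolding mollify_def by measurable

text \<open>Jensen's inequality for the probability density \<open>K\<close>, from the tangent
  inequality at the mean \<open>m\<close>. The extended integral on the right may be infinite, which
  suits Tonelli's theorem; \<open>v\<close> will be \<open>g x\<close>.\<close>

lemma mollify_Jensen:
  fixes g :: "real ^ 'n \<Rightarrow> 'b::euclidean_space"
  assumes K: "mollifier r K" and g: "integrable lborel g" and p: "p \<ge> 1"
  shows "ennreal (norm (mollify K g x - v) powr p) \<le> (\<integral>\<^sup>+z. ennreal (K z * norm (g (z + x) - v) powr p) \<partial>lborel)"
proof -
  note Kd = mollifierD[OF K]
  have [measurable]: "K \<in> borel_measurable borel" by (rule Kd)
  have [measurable]: "g \<in> borel_measurable borel" using g by auto
  have iKg: "integrable lborel (\<lambda>z. K z *\<^sub>R g (z + x))"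
    using lborel_integral_shift(2)[of "\<lambda>y. K (y - x) *\<^sub>R g y" x] mollify_integrable[OF Kd(6,3) g, of x] by simp
  have i1: "integrable lborel (\<lambda>z. K z *\<^sub>R (g (z + x) - v))"
    using iKg Kd(5) by (simp add: scaleR_diff_right)
  have eq: "mollify K g x - v = (LINT z|lborel. K z *\<^sub>R (g (z + x) - v))"
    using iKg Kd(4,5) by (simp add: mollify_eq_shift scaleR_diff_right)
  have i2: "integrable lborel (\<lambda>z. K z * norm (g (z + x) - v))"
    using integrable_norm[OF i1] Kd(2) by simp
  define m where "m = (LINT z|lborel. K z * norm (g (z + x) - v))"
  have "norm (mollify K g x - v) \<le> (LINT z|lborel. norm (K z *\<^sub>R (g (z + x) - v)))"
    unfolding eq by (rule integral_norm_bound)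
  also have "\<dots> = m" using Kd(2) by (simp add: m_def)
  finally have le: "norm (mollify K g x - v) \<le> m" .
  show ?thesis
  proof (cases "(\<integral>\<^sup>+z. ennreal (K z * norm (g (z + x) - v) powr p) \<partial>lborel) = \<infinity>")
    case False
    then have i3: "integrable lborel (\<lambda>z. K z * norm (g (z + x) - v) powr p)"
      using Kd(2) by (intro integrableI_nonneg) (auto simp: less_top)
    have "m powr p \<le> (LINT z|lborel. K z * norm (g (z + x) - v) powr p)"
    proof (cases "m = 0")
      case True
      then show ?thesis using Kd(2) by simp
    next
      case False
      then have m: "m > 0" using le norm_ge_zero[of "mollify K g x - v"] by linarith
      have "(LINT z|lborel. K z * m powr p + (p * m powr (p - 1)) * (K z * norm (g (z + x) - v) - K z * m))
         \<le> (LINT z|lborel. K z * norm (g (z + x) - v) powr p)"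
      proof (rule integral_mono)
        show "integrable lborel (\<lambda>z. K z * m powr p + (p * m powr (p - 1)) * (K z * norm (g (z + x) - v) - K z * m))"
          using Kd(5) i2 by auto
        fix z
        have "K z * (m powr p + p * m powr (p - 1) * (norm (g (z + x) - v) - m)) \<le> K z * norm (g (z + x) - v) powr p"
          using powr_bernoulli[of "norm (g (z + x) - v)" m p] m p Kd(2) by (intro mult_left_mono) auto
        then show "K z * m powr p + (p * m powr (p - 1)) * (K z * norm (g (z + x) - v) - K z * m) \<le> K z * norm (g (z + x) - v) powr p"
          by (simp add: algebra_simps)
      qed (rule i3)
      also have "(LINT z|lborel. K z * m powr p + (p * m powr (p - 1)) * (K z * norm (g (z + x) - v) - K z * m))
         = m powr p + (p * m powr (p - 1)) * (m - m)"
        using Kd(4,5) i2 by (simp add: m_def)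
      finally show ?thesis by simp
    qed
    moreover have "norm (mollify K g x - v) powr p \<le> m powr p" using le p by (intro powr_mono2) auto
    ultimately have "ennreal (norm (mollify K g x - v) powr p) \<le> ennreal (LINT z|lborel. K z * norm (g (z + x) - v) powr p)"
      by (intro ennreal_leI) linarith
    also have "\<dots> = (\<integral>\<^sup>+z. ennreal (K z * norm (g (z + x) - v) powr p) \<partial>lborel)"
      using i3 Kd(2) by (intro nn_integral_eq_integral[symmetric]) auto
    finally show ?thesis .
  qed simp
qed

text \<open>Jensen and Tonelli bound the error by an average over \<open>z\<close> of the
  translation errors. The restriction to \<open>S\<close> serves the compactness argument, where
  only points of a compact subset are known to stay in the domain when translated.\<close>

lemma mollify_Lp_error_on:
  fixes g :: "real ^ 'n \<Rightarrow> 'b::euclidean_space"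
  assumes K: "mollifier r K" and g: "g \<in> Lp lborel p" "integrable lborel g" and p: "p \<ge> 1" and c: "c \<ge> 0"
    and S: "S \<in> sets borel" and shift: "\<And>z. K z \<noteq> 0 \<Longrightarrow> Lp_norm lborel p (\<lambda>x. indicator S x *\<^sub>R (g (x + z) - g x)) \<le> c"
  shows "(\<lambda>x. indicator S x *\<^sub>R (mollify K g x - g x)) \<in> Lp lborel p" "Lp_norm lborel p (\<lambda>x. indicator S x *\<^sub>R (mollify K g x - g x)) \<le> c"
proof -
  note Kd = mollifierD[OF K]
  have [measurable]: "K \<in> borel_measurable borel" "S \<in> sets borel" by (rule Kd S)+
  have [measurable]: "g \<in> borel_measurable borel" using g by auto
  have "(\<integral>\<^sup>+x. ennreal (norm (indicator S x *\<^sub>R (mollify K g x - g x)) powr p) \<partial>lborel)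
     \<le> (\<integral>\<^sup>+x. (\<integral>\<^sup>+z. ennreal (K z * norm (indicator S x *\<^sub>R (g (z + x) - g x)) powr p) \<partial>lborel) \<partial>lborel)"
  proof (rule nn_integral_mono)
    fix x
    show "ennreal (norm (indicator S x *\<^sub>R (mollify K g x - g x)) powr p) \<le> (\<integral>\<^sup>+z. ennreal (K z * norm (indicator S x *\<^sub>R (g (z + x) - g x)) powr p) \<partial>lborel)"
      using mollify_Jensen[OF K g(2) p, of x "g x"] p by (cases "x \<in> S") auto
  qed
  also have "\<dots> = (\<integral>\<^sup>+z. (\<integral>\<^sup>+x. ennreal (K z * norm (indicator S x *\<^sub>R (g (z + x) - g x)) powr p) \<partial>lborel) \<partial>lborel)"
    by (rule lborel_pair.Fubini'[symmetric]) measurable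
  also have "\<dots> \<le> (\<integral>\<^sup>+z. ennreal (K z) * ennreal (c powr p) \<partial>lborel)"
  proof (rule nn_integral_mono)
    fix z
    show "(\<integral>\<^sup>+x. ennreal (K z * norm (indicator S x *\<^sub>R (g (z + x) - g x)) powr p) \<partial>lborel) \<le> ennreal (K z) * ennreal (c powr p)"
    proof (cases "K z = 0")
      case False
      have "(\<lambda>x. g (x + z) - g x) \<in> Lp lborel p" by (intro Lp_diff Lp_shift g p)
      then have L: "(\<lambda>x. indicator S x *\<^sub>R (g (x + z) - g x)) \<in> Lp lborel p"
        by (rule Lp_bounded_mult(1)[where c = 1]) (use p in \<open>auto intro!: AE_I2 simp: indicator_def\<close>)
      have "(\<integral>\<^sup>+x. ennreal (K z * norm (indicator S x *\<^sub>R (g (z + x) - g x)) powr p) \<partial>lborel) 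
         = ennreal (K z) * (\<integral>\<^sup>+x. ennreal (norm (indicator S x *\<^sub>R (g (x + z) - g x)) powr p) \<partial>lborel)"
        using Kd(2) by (subst nn_integral_cmult[symmetric]) (auto simp: ennreal_mult add.commute)
      also have "(\<integral>\<^sup>+x. ennreal (norm (indicator S x *\<^sub>R (g (x + z) - g x)) powr p) \<partial>lborel) = ennreal (LINT x|lborel. norm (indicator S x *\<^sub>R (g (x + z) - g x)) powr p)"
        using Lp_integrable[OF L] by (intro nn_integral_eq_integral) auto
      also have "\<dots> \<le> ennreal (c powr p)"
        using shift[OF False] p c by (intro ennreal_leI) (simp add: Lp_norm_le_iff)
      finally show ?thesis by (simp add: mult_left_mono)
    qed simp
  qed
  also have "\<dots> = ennreal (c powr p)"
    using Kd by (simp add: nn_integral_multc nn_integral_eq_integral)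
  finally have *: "(\<integral>\<^sup>+x. ennreal (norm (indicator S x *\<^sub>R (mollify K g x - g x)) powr p) \<partial>lborel) \<le> ennreal (c powr p)" .
  have int: "integrable lborel (\<lambda>x. norm (indicator S x *\<^sub>R (mollify K g x - g x)) powr p)"
    by (intro integrableI_bounded) (use * in \<open>auto simp: order_le_less_trans\<close>)
  then show "(\<lambda>x. indicator S x *\<^sub>R (mollify K g x - g x)) \<in> Lp lborel p" by (intro LpI) auto
  have "ennreal (LINT x|lborel. norm (indicator S x *\<^sub>R (mollify K g x - g x)) powr p) \<le> ennreal (c powr p)"
    using * int by (subst (asm) nn_integral_eq_integral) auto
  then show "Lp_norm lborel p (\<lambda>x. indicator S x *\<^sub>R (mollify K g x - g x)) \<le> c" using p c by (simp add: Lp_norm_le_iff)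
qed

lemma mollify_Lp_error:
  fixes g :: "real ^ 'n \<Rightarrow> 'b::euclidean_space"
  assumes "mollifier r K" "g \<in> Lp lborel p" "integrable lborel g" "p \<ge> 1" "c \<ge> 0"
    and "\<And>z. K z \<noteq> 0 \<Longrightarrow> Lp_norm lborel p (\<lambda>x. g (x + z) - g x) \<le> c"
  shows "(\<lambda>x. mollify K g x - g x) \<in> Lp lborel p" "Lp_norm lborel p (\<lambda>x. mollify K g x - g x) \<le> c"
  using mollify_Lp_error_on[of r K g p c UNIV] assms by auto

lemma mollify_Lp_tendsto:
  fixes g :: "real ^ 'n \<Rightarrow> 'b::euclidean_space"
  assumes K: "\<And>n. mollifier (r n) (K n)" and r: "r \<longlonglongrightarrow> 0"
    and g: "g \<in> Lp lborel p" "integrable lborel g" and p: "p \<ge> 1"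
  shows "Lp_lim lborel p (\<lambda>n. mollify (K n) g) g"
proof (rule LIMSEQ_I)
  fix e :: real assume e: "e > 0"
  obtain d where d: "d > 0" "\<And>h. norm h < d \<Longrightarrow> Lp_norm lborel p (\<lambda>x. g (x + h) - g x) < e / 2"
    using Lp_translation_continuous[OF g(1) p, of "e/2"] e by (metis half_gt_zero)
  obtain N where N: "\<And>n. n \<ge> N \<Longrightarrow> r n < d" using order_tendstoD(2)[OF r d(1)] by (auto simp: eventually_sequentially)
  have "Lp_norm lborel p (\<lambda>x. mollify (K n) g x - g x) \<le> e / 2" if "n \<ge> N" for n
  proof (rule mollify_Lp_error(2)[OF K g p])
    fix z assume "K n z \<noteq> 0"
    then have "norm z \<le> r n" using mollifierD(3)[OF K] by (auto simp: bounded_support_def)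
    then show "Lp_norm lborel p (\<lambda>x. g (x + z) - g x) \<le> e / 2"
      using N[OF that] by (intro less_imp_le d) auto
  qed (use e in auto)
  then show "\<exists>no. \<forall>n\<ge>no. norm (Lp_norm lborel p (\<lambda>x. mollify (K n) g x - g x) - 0) < e"
    using e by (intro exI[of _ N]) (force intro: order_le_less_trans)
qed

section \<open>Passing between a domain and the whole space\<close>

lemma open_lebesgue_space: "open U \<Longrightarrow> U \<inter> space lebesgue \<in> sets lebesgue"
  by (simp add: borel_open sets_completionI_sets)

lemma AE_lebesgue_on_iff:
  assumes "open U"
  shows "(AE x in lebesgue_on U. Q x) \<longleftrightarrow> (AE x in lebesgue. x \<in> U \<longrightarrow> Q x)"
  using AE_restrict_space_iff[OF open_lebesgue_space[OF assms]] by simp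

lemma borel_imp_lebesgue_on_measurable:
  fixes f :: "'a::euclidean_space \<Rightarrow> 'b::euclidean_space"
  shows "f \<in> borel_measurable borel \<Longrightarrow> f \<in> borel_measurable (lebesgue_on S)"
  by (intro measurable_restrict_space1 measurable_completion) simp

lemma completion_ex_borel_measurable_euclidean:
  fixes g :: "'a \<Rightarrow> 'b::euclidean_space"
  assumes "g \<in> borel_measurable (completion M)"
  obtains g' where "g' \<in> borel_measurable M" "AE x in M. g x = g' x"
proof -
  have "\<exists>h. h \<in> borel_measurable M \<and> (AE x in M. g x \<bullet> b = h x)" for b
  proof -
    have "(\<lambda>x. g x \<bullet> b) \<in> borel_measurable (completion M)" using assms by measurable
    from completion_ex_borel_measurable_real[OF this] show ?thesis by blast
  qed
  then obtain h where h: "\<And>b. h b \<in> borel_measurable M" "\<And>b. AE x in M. g x \<bullet> b = h b x" by metis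
  show thesis
  proof
    show "(\<lambda>x. \<Sum>b\<in>Basis. h b x *\<^sub>R b) \<in> borel_measurable M" using h(1) by measurable
    have "AE x in M. \<forall>b\<in>Basis. g x \<bullet> b = h b x" by (intro AE_finite_allI h) simp
    then show "AE x in M. g x = (\<Sum>b\<in>Basis. h b x *\<^sub>R b)"
    proof eventually_elim
      fix x assume "\<forall>b\<in>Basis. g x \<bullet> b = h b x"
      then have "(\<Sum>b\<in>Basis. h b x *\<^sub>R b) = (\<Sum>b\<in>Basis. (g x \<bullet> b) *\<^sub>R b)" by (intro sum.cong) auto
      then show "g x = (\<Sum>b\<in>Basis. h b x *\<^sub>R b)" by (simp add: euclidean_representation)
    qed
  qed
qed

text \<open>Elements of the function spaces are Lebesgue measurable on \<open>U\<close> only,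
  whereas mollification, Fubini and translation act on Borel functions on the whole space. Extension
  by zero off \<open>U\<close> bridges the gap.\<close>

lemma borel_representative:
  fixes u :: "'a::euclidean_space \<Rightarrow> 'b::euclidean_space"
  assumes "open U" "u \<in> borel_measurable (lebesgue_on U)"
  obtains v where "v \<in> borel_measurable borel" "\<And>x. x \<notin> U \<Longrightarrow> v x = 0" "AE x in lebesgue_on U. u x = v x"
proof -
  have "(\<lambda>x. indicator U x *\<^sub>R u x) \<in> borel_measurable lebesgue"
    using assms(2) borel_measurable_restrict_space_iff[OF open_lebesgue_space[OF assms(1)], of u] by simp
  then obtain g where g: "g \<in> borel_measurable lborel" "AE x in lborel. indicator U x *\<^sub>R u x = g x"
    by (rule completion_ex_borel_measurable_euclidean)
  show thesis
  proof
    show "(\<lambda>x. indicator U x *\<^sub>R g x) \<in> borel_measurable borel"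
      using assms(1) g(1) by (intro borel_measurable_scaleR borel_measurable_indicator) auto
    show "indicator U x *\<^sub>R g x = 0" if "x \<notin> U" for x using that by simp
    have "AE x in lebesgue. indicator U x *\<^sub>R u x = g x" by (rule AE_completion[OF g(2)])
    then show "AE x in lebesgue_on U. u x = indicator U x *\<^sub>R g x"
      unfolding AE_lebesgue_on_iff[OF assms(1)] by eventually_elim (auto simp: indicator_def)
  qed
qed

lemma lebesgue_on_integral_borel:
  fixes f :: "'a::euclidean_space \<Rightarrow> 'b::euclidean_space"
  assumes "open U" "f \<in> borel_measurable borel" "\<And>x. x \<notin> U \<Longrightarrow> f x = 0"
  shows "(LINT x|lebesgue_on U. f x) = (LINT x|lborel. f x)"
    and "integrable (lebesgue_on U) f \<longleftrightarrow> integrable lborel f"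
proof -
  have eq: "(\<lambda>x. indicator U x *\<^sub>R f x) = f" using assms(3) by (auto simp: indicator_def fun_eq_iff)
  show "(LINT x|lebesgue_on U. f x) = (LINT x|lborel. f x)"
    unfolding integral_restrict_space[OF open_lebesgue_space[OF assms(1)]] eq
    using assms(2) by (intro integral_completion) simp
  show "integrable (lebesgue_on U) f \<longleftrightarrow> integrable lborel f"
    unfolding integrable_restrict_space[OF open_lebesgue_space[OF assms(1)]] eq
    using assms(2) by (intro integrable_completion) simp
qed

lemma lebesgue_on_Lp_borel:
  fixes f :: "'a::euclidean_space \<Rightarrow> 'b::euclidean_space"
  assumes "open U" "f \<in> borel_measurable borel" "\<And>x. x \<notin> U \<Longrightarrow> f x = 0"
  shows "f \<in> Lp (lebesgue_on U) p \<longleftrightarrow> f \<in> Lp lborel p"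
    and "Lp_norm (lebesgue_on U) p f = Lp_norm lborel p f"
proof -
  have m: "(\<lambda>x. norm (f x) powr p) \<in> borel_measurable borel" using assms(2) by measurable
  have z: "norm (f x) powr p = 0" if "x \<notin> U" for x using assms(3)[OF that] by simp
  note T = lebesgue_on_integral_borel[OF assms(1) m]
  show "f \<in> Lp (lebesgue_on U) p \<longleftrightarrow> f \<in> Lp lborel p"
    unfolding Lp_def using T(2) z assms(2) borel_imp_lebesgue_on_measurable[OF assms(2)] by auto
  show "Lp_norm (lebesgue_on U) p f = Lp_norm lborel p f"
    unfolding Lp_norm_def using T(1) z by simp
qed

lemma Lp_norm_restrict_le:
  fixes f :: "'a::euclidean_space \<Rightarrow> 'b::euclidean_space"
  assumes "open U" "f \<in> Lp lborel p" "p > 0"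
  shows "f \<in> Lp (lebesgue_on U) p" "Lp_norm (lebesgue_on U) p f \<le> Lp_norm lborel p f"
proof -
  have [measurable]: "f \<in> borel_measurable borel" using Lp_measurable[OF assms(2)] by simp
  define g where "g x = indicator U x *\<^sub>R f x" for x
  have [measurable]: "U \<in> sets borel" using assms by simp
  have gm [measurable]: "g \<in> borel_measurable borel" unfolding g_def by measurable
  have g: "g \<in> Lp lborel p" "Lp_norm lborel p g \<le> 1 * Lp_norm lborel p f"
    using assms(3) by (auto intro!: Lp_bounded_mult[OF assms(2), of 1, simplified] simp: g_def indicator_def)
  have g': "g \<in> Lp (lebesgue_on U) p" "Lp_norm (lebesgue_on U) p g = Lp_norm lborel p g"
    using lebesgue_on_Lp_borel[OF assms(1) gm] g by (auto simp: g_def)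
  have fm: "f \<in> borel_measurable (lebesgue_on U)" by (intro borel_imp_lebesgue_on_measurable) auto
  have ae: "AE x in lebesgue_on U. g x = f x" unfolding AE_lebesgue_on_iff[OF assms(1)] by (auto simp: g_def)
  show "f \<in> Lp (lebesgue_on U) p" by (rule Lp_cong_AE[OF g'(1) fm ae])
  show "Lp_norm (lebesgue_on U) p f \<le> Lp_norm lborel p f"
    using Lp_norm_cong_AE[OF Lp_measurable[OF g'(1)] fm ae, of p] g' g by simp
qed

lemma finite_measure_lebesgue_on_bounded:
  assumes "open U" "bounded U"
  shows "finite_measure (lebesgue_on U)"
proof (rule finite_measureI)
  have "emeasure (lebesgue_on U) (space (lebesgue_on U)) = emeasure lborel U"
    using open_lebesgue_space[OF assms(1)] assms(1) by (simp add: emeasure_restrict_space space_restrict_space)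
  then show "emeasure (lebesgue_on U) (space (lebesgue_on U)) \<noteq> \<infinity>"
    using emeasure_bounded_finite[OF assms(2)] by auto
qed

lemma Lp_finite_measure_integrable:
  fixes f :: "'a \<Rightarrow> 'b::euclidean_space"
  assumes "finite_measure M" "f \<in> Lp M p" "p \<ge> 1"
  shows "integrable M f"
proof -
  interpret finite_measure M by fact
  show ?thesis
  proof (rule Bochner_Integration.integrable_bound)
    show "integrable M (\<lambda>x. 1 + norm (f x) powr p)" using Lp_integrable[OF assms(2)] by auto
    show "AE x in M. norm (f x) \<le> norm (1 + norm (f x) powr p)"
    proof (rule AE_I2)
      fix x
      show "norm (f x) \<le> norm (1 + norm (f x) powr p)"
      proof (cases "norm (f x) \<le> 1")
        case False
        then have "norm (f x) powr 1 \<le> norm (f x) powr p" using assms(3) by (intro powr_mono) auto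
        then show ?thesis using False by auto
      qed (simp add: add_increasing2)
    qed
  qed (rule Lp_measurable[OF assms(2)])
qed

lemma Lp_bounded_function:
  fixes f :: "'a \<Rightarrow> 'b::euclidean_space"
  assumes "finite_measure M" "f \<in> borel_measurable M" "AE x in M. norm (f x) \<le> B" "p > 0"
  shows "f \<in> Lp M p"
proof -
  interpret finite_measure M by fact
  show ?thesis
    by (rule Lp_bound[of _ _ "\<lambda>_. B powr p"]) (use assms in \<open>auto elim!: eventually_mono intro!: powr_mono2\<close>)
qed

section \<open>Weak derivatives\<close>

lemma test_functionsD:
  assumes "\<phi> \<in> test_functions U"
  shows "smooth \<phi>" "\<exists>R. bounded_support R \<phi>" "compact (closure {x. \<phi> x \<noteq> 0})" "closure {x. \<phi> x \<noteq> 0} \<subseteq> U"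
    "\<phi> x \<noteq> 0 \<Longrightarrow> x \<in> closure {x. \<phi> x \<noteq> 0}"
    "partial j \<phi> x \<noteq> 0 \<Longrightarrow> x \<in> closure {x. \<phi> x \<noteq> 0}"
proof -
  show *: "smooth \<phi>" "compact (closure {x. \<phi> x \<noteq> 0})" "closure {x. \<phi> x \<noteq> 0} \<subseteq> U"
    using assms by (auto simp: test_functions_def smooth_def)
  obtain R where R: "\<And>x. x \<in> closure {x. \<phi> x \<noteq> 0} \<Longrightarrow> norm x \<le> R"
    using compact_imp_bounded[OF *(2)] by (auto simp: bounded_iff)
  show in_cl: "\<phi> x \<noteq> 0 \<Longrightarrow> x \<in> closure {x. \<phi> x \<noteq> 0}" for x
    using subsetD[OF closure_subset, of x "{x. \<phi> x \<noteq> 0}"] by simp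
  show "\<exists>R. bounded_support R \<phi>"
    unfolding bounded_support_def using R in_cl by blast
  show "x \<in> closure {x. \<phi> x \<noteq> 0}" if "partial j \<phi> x \<noteq> 0"
  proof (rule ccontr)
    assume "x \<notin> closure {x. \<phi> x \<noteq> 0}"
    then have x: "x \<in> - closure {x. \<phi> x \<noteq> 0}" unfolding Compl_iff .
    have "\<phi> y = 0" if "y \<in> - closure {x. \<phi> x \<noteq> 0}" for y using in_cl[of y] that by blast
    from partial_cong_open[OF open_Compl[OF closed_closure] x this, where j = j] have "partial j \<phi> x = partial j (\<lambda>_. 0) x" .
    then show False using that by simp
  qed
qed

lemma test_functionsI:
  assumes "smooth \<phi>" "compact S" "S \<subseteq> U" "\<And>x. \<phi> x \<noteq> 0 \<Longrightarrow> x \<in> S"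
  shows "\<phi> \<in> test_functions U"
proof -
  have "closure {x. \<phi> x \<noteq> 0} \<subseteq> S"
    using assms by (intro closure_minimal compact_imp_closed) auto
  moreover have "compact (closure {x. \<phi> x \<noteq> 0})"
    using calculation assms(2) by (metis bounded_subset closed_closure compact_eq_bounded_closed)
  ultimately show ?thesis using assms by (auto simp: test_functions_def smooth_def)
qed

lemma test_functions_mult_smooth:
  assumes "\<phi> \<in> test_functions U" "smooth f"
  shows "(\<lambda>x. \<phi> x * f x) \<in> test_functions U"
  by (rule test_functionsI[OF smooth_mult[OF test_functionsD(1)[OF assms(1)] assms(2)] test_functionsD(3,4)[OF assms(1)]])
     (rule test_functionsD(5)[OF assms(1)], simp)

lemma loc_integrable_mult_integrable:
  fixes g :: "real ^ 'n \<Rightarrow> real"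
  assumes U: "open U" and g: "loc_integrable U g" and \<phi>: "continuous_on UNIV \<phi>" 
    and S: "compact S" "S \<subseteq> U" "\<And>x. \<phi> x \<noteq> 0 \<Longrightarrow> x \<in> S"
  shows "integrable (lebesgue_on U) (\<lambda>x. g x * \<phi> x)"
proof -
  have "S \<in> sets lebesgue" by (rule sets_completionI_sets) (simp add: borel_compact[OF S(1)])
  then have Sm: "S \<inter> space lebesgue \<in> sets lebesgue" by simp
  have "integrable (lebesgue_on S) g" using g S by (simp add: loc_integrable_def)
  then have int: "integrable lebesgue (\<lambda>x. indicator S x *\<^sub>R g x)"
    using integrable_restrict_space[OF Sm] by blast
  have "bounded (\<phi> ` S)" using \<phi> S(1) by (intro compact_imp_bounded compact_continuous_image) (auto intro: continuous_on_subset)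
  then obtain B where B: "\<And>x. x \<in> S \<Longrightarrow> \<bar>\<phi> x\<bar> \<le> B" by (auto simp: bounded_iff)
  have \<phi>m: "\<phi> \<in> borel_measurable lebesgue" using \<phi> by (intro measurable_completion) (simp add: borel_measurable_continuous_onI)
  have eq: "(\<lambda>x. indicator U x *\<^sub>R (g x * \<phi> x)) = (\<lambda>x. (indicator S x *\<^sub>R g x) * \<phi> x)"
    using S by (auto simp: indicator_def fun_eq_iff)
  have "integrable lebesgue (\<lambda>x. (indicator S x *\<^sub>R g x) * \<phi> x)"
  proof (rule Bochner_Integration.integrable_bound)
    show "integrable lebesgue (\<lambda>x. B * (indicator S x *\<^sub>R g x))" using int by (rule integrable_mult_right)
    show "(\<lambda>x. (indicator S x *\<^sub>R g x) * \<phi> x) \<in> borel_measurable lebesgue"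
      using borel_measurable_integrable[OF int] \<phi>m by (intro borel_measurable_times)
    show "AE x in lebesgue. norm (indicator S x *\<^sub>R g x * \<phi> x) \<le> norm (B * (indicator S x *\<^sub>R g x))"
    proof (rule AE_I2)
      fix x
      show "norm (indicator S x *\<^sub>R g x * \<phi> x) \<le> norm (B * (indicator S x *\<^sub>R g x))"
      proof (cases "x \<in> S")
        case True
        then have "\<bar>\<phi> x\<bar> \<le> \<bar>B\<bar>" using B[of x] by linarith
        then show ?thesis using True by (simp add: abs_mult mult.commute[of "\<bar>B\<bar>"] mult_left_mono)
      qed simp
    qed
  qed
  then show ?thesis
    unfolding integrable_restrict_space[OF open_lebesgue_space[OF U]] eq .
qed

lemma mollifier_at_0_exists:
  assumes "r > 0"
  shows "\<exists>K :: real ^ 'n \<Rightarrow> real. mollifier r K"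
proof -
  obtain K :: "real ^ 'n \<Rightarrow> real" where "mollifier (norm (0 :: real ^ 'n) + r) K"
    by (rule mollifier_exists[OF assms, where a = 0])
  then show ?thesis by auto
qed

text \<open>Multiplying by a bump function \<open>\<beta>\<close> makes \<open>g\<close> globally integrable while keeping the hypothesis, so
  every mollification of \<open>g \<beta>\<close> vanishes identically.\<close>

lemma fundamental_lemma:
  fixes g :: "real ^ 'n \<Rightarrow> real"
  assumes U: "open U" and g: "loc_integrable U g" 
    and zero: "\<And>\<phi>. \<phi> \<in> test_functions U \<Longrightarrow> (LINT x|lebesgue_on U. g x * \<phi> x) = 0"
  shows "AE x in lebesgue_on U. g x = 0"
proof -
  have local: "\<exists>r>0. ball x0 r \<subseteq> U \<and> (AE x in lebesgue. x \<in> ball x0 r \<longrightarrow> g x = 0)" if x0: "x0 \<in> U" for x0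
  proof -
    obtain r where r: "r > 0" "cball x0 r \<subseteq> U" using U x0 open_contains_cball by meson
    obtain \<beta> where \<beta>s: "smooth \<beta>" and \<beta>: "\<And>x. \<beta> x \<noteq> 0 \<longleftrightarrow> x \<in> ball x0 r"
      using smooth_bump_exists[OF r(1), of x0] by metis
    have \<beta>t: "\<beta> \<in> test_functions U" by (rule test_functionsI[OF \<beta>s compact_cball r(2)]) (simp add: \<beta>)
    have int: "integrable (lebesgue_on U) (\<lambda>x. g x * \<beta> x)"
      by (rule loc_integrable_mult_integrable[OF U g smooth_continuous[OF \<beta>s] compact_cball r(2)]) (simp add: \<beta>)
    obtain h where h: "h \<in> borel_measurable borel" "\<And>x. x \<notin> U \<Longrightarrow> h x = 0" "AE x in lebesgue_on U. g x * \<beta> x = h x"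
      by (rule borel_representative[OF U borel_measurable_integrable[OF int]]) (rule that; assumption)
    have "integrable (lebesgue_on U) h"
      using int h(3) borel_imp_lebesgue_on_measurable[OF h(1)] by (subst integrable_cong_AE[symmetric]) auto
    then have hint: "integrable lborel h" using lebesgue_on_integral_borel(2)[OF U h(1,2)] by simp
    then have hL: "h \<in> Lp lborel 1" by (auto simp: Lp_def)
    have mz: "mollify K h y = 0" if K: "mollifier s K" for K s y
    proof -
      have "smooth (\<lambda>z. K (- y + 1 *\<^sub>R z))" by (rule smooth_affine[OF mollifierD(1)[OF K]])
      then have sm: "smooth (\<lambda>z. K (z - y))" by simp
      have Km: "(\<lambda>z. K (z - y)) \<in> borel_measurable borel" by (rule borel_measurable_continuous_onI[OF smooth_continuous[OF sm]])
      have "mollify K h y = (LINT z|lebesgue_on U. K (z - y) *\<^sub>R h z)" unfolding mollify_def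
        using Km h(1) by (intro lebesgue_on_integral_borel(1)[OF U, symmetric] borel_measurable_scaleR) (auto simp: h(2))
      also have "\<dots> = (LINT z|lebesgue_on U. g z * (\<beta> z * K (z - y)))"
      proof (rule integral_cong_AE)
        show "(\<lambda>z. K (z - y) *\<^sub>R h z) \<in> borel_measurable (lebesgue_on U)"
          using Km h(1) by (intro borel_imp_lebesgue_on_measurable borel_measurable_scaleR)
        show "(\<lambda>z. g z * (\<beta> z * K (z - y))) \<in> borel_measurable (lebesgue_on U)"
          using borel_measurable_times[OF borel_measurable_integrable[OF int] borel_imp_lebesgue_on_measurable[OF Km]] by (simp add: mult.assoc)
        show "AE z in lebesgue_on U. K (z - y) *\<^sub>R h z = g z * (\<beta> z * K (z - y))"
          using h(3) by eventually_elim (simp add: ac_simps)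
      qed
      also have "\<dots> = 0" by (rule zero[OF test_functions_mult_smooth[OF \<beta>t sm]])
      finally show ?thesis .
    qed
    have "\<exists>K :: real ^ 'n \<Rightarrow> real. mollifier (1 / Suc n) K" for n by (rule mollifier_at_0_exists) simp
    then obtain K :: "nat \<Rightarrow> real ^ 'n \<Rightarrow> real" where K: "\<And>n. mollifier (1 / Suc n) (K n)" by metis
    have "Lp_lim lborel 1 (\<lambda>n. mollify (K n) h) h"
      by (rule mollify_Lp_tendsto[OF K LIMSEQ_Suc[OF lim_1_over_n] hL hint]) simp
    then have "Lp_norm lborel 1 h = 0" unfolding mz[OF K] by (simp add: Lp_norm_def LIMSEQ_const_iff)
    then have "AE x in lborel. h x = 0" using Lp_norm_eq_0_iff[OF hL] by simp
    then have "AE x in lebesgue. h x = 0" by (rule AE_completion)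
    moreover have "AE x in lebesgue. x \<in> U \<longrightarrow> g x * \<beta> x = h x" using h(3) AE_lebesgue_on_iff[OF U] by simp
    ultimately have "AE x in lebesgue. x \<in> ball x0 r \<longrightarrow> g x = 0"
      by eventually_elim (use \<beta> r(2) ball_subset_cball in fastforce)
    moreover have "ball x0 r \<subseteq> U" using r(2) ball_subset_cball by blast
    ultimately show ?thesis using r(1) by blast
  qed
  then have "\<forall>x\<in>U. \<exists>r. r > 0 \<and> ball x r \<subseteq> U \<and> (AE y in lebesgue. y \<in> ball x r \<longrightarrow> g y = 0)" by blast
  from bchoice[OF this] obtain r where r: "\<forall>x\<in>U. r x > 0 \<and> ball x (r x) \<subseteq> U \<and> 
    (AE y in lebesgue. y \<in> ball x (r x) \<longrightarrow> g y = 0)" ..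
  \<comment> \<open>Countably many of the balls cover, so the exceptional null sets can be
    united.\<close>
  obtain F where F: "F \<subseteq> (\<lambda>x. ball x (r x)) ` U" "countable F" "\<Union>F = \<Union>((\<lambda>x. ball x (r x)) ` U)"
    using Lindelof[of "(\<lambda>x. ball x (r x)) ` U"] by blast
  have cover: "U \<subseteq> \<Union>F"
  proof
    fix x assume "x \<in> U"
    then have "x \<in> ball x (r x)" using r by simp
    then show "x \<in> \<Union>F" unfolding F(3) using \<open>x \<in> U\<close> by blast
  qed
  have "AE y in lebesgue. \<forall>B\<in>F. y \<in> B \<longrightarrow> g y = 0"
  proof (rule AE_ball_countable'[OF _ F(2)])
    fix B assume "B \<in> F"
    then obtain x where "x \<in> U" "B = ball x (r x)" using F(1) by blast
    then show "AE y in lebesgue. y \<in> B \<longrightarrow> g y = 0" using r by simp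
  qed
  then have "AE y in lebesgue. y \<in> U \<longrightarrow> g y = 0"
    by eventually_elim (use cover in blast)
  then show ?thesis using AE_lebesgue_on_iff[OF U] by simp
qed

lemma loc_integrable_component:
  "loc_integrable U G \<Longrightarrow> loc_integrable U (\<lambda>x. G x $ i)"
  unfolding loc_integrable_def by (auto intro!: integrable_bounded_linear[OF bounded_linear_vec_nth])

lemma loc_integrable_add: "loc_integrable U u \<Longrightarrow> loc_integrable U v \<Longrightarrow> loc_integrable U (\<lambda>x. u x + v x)"
  and loc_integrable_scaleR: "loc_integrable U u \<Longrightarrow> loc_integrable U (\<lambda>x. c *\<^sub>R u x)"
  and loc_integrable_diff: "loc_integrable U u \<Longrightarrow> loc_integrable U v \<Longrightarrow> loc_integrable U (\<lambda>x. u x - v x)"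
  unfolding loc_integrable_def by auto

lemma integrable_imp_loc_integrable:
  fixes u :: "real ^ 'n \<Rightarrow> 'b::euclidean_space"
  assumes "open U" "integrable (lebesgue_on U) u"
  shows "loc_integrable U u"
  unfolding loc_integrable_def
proof (intro allI impI)
  fix K assume K: "compact K \<and> K \<subseteq> U"
  then have Km: "K \<in> sets lebesgue" by (intro sets_completionI_sets) (simp add: borel_compact)
  have "integrable lebesgue (\<lambda>x. indicator U x *\<^sub>R u x)"
    using assms(2) unfolding integrable_restrict_space[OF open_lebesgue_space[OF assms(1)]] .
  then have "integrable lebesgue (\<lambda>x. indicator K x *\<^sub>R indicator U x *\<^sub>R u x)"
    by (rule integrable_mult_indicator[rotated]) (use Km in simp)
  also have "(\<lambda>x. indicator K x *\<^sub>R indicator U x *\<^sub>R u x) = (\<lambda>x. indicator K x *\<^sub>R u x)"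
    using K by (auto simp: indicator_def fun_eq_iff)
  finally show "integrable (lebesgue_on K) u" using integrable_restrict_space[of K lebesgue u] Km by simp
qed

lemma test_function_integrable:
  fixes g :: "real ^ 'n \<Rightarrow> real"
  assumes "open U" "loc_integrable U g" "\<phi> \<in> test_functions U"
  shows "integrable (lebesgue_on U) (\<lambda>x. g x * \<phi> x)" "integrable (lebesgue_on U) (\<lambda>x. g x * partial j \<phi> x)"
  using loc_integrable_mult_integrable[OF assms(1,2) _ test_functionsD(3,4)[OF assms(3)]]
    test_functionsD(5,6)[OF assms(3)] smooth_continuous[OF test_functionsD(1)[OF assms(3)]]
    smooth_continuous[OF smooth_partial[OF test_functionsD(1)[OF assms(3)]]] by blast+

lemma loc_integrable_weakly_equal:
  fixes G H :: "real ^ 'n \<Rightarrow> real"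
  assumes "open U" "loc_integrable U G" "loc_integrable U H"
    "\<And>\<phi>. \<phi> \<in> test_functions U \<Longrightarrow> (LINT x|lebesgue_on U. G x * \<phi> x) = (LINT x|lebesgue_on U. H x * \<phi> x)"
  shows "AE x in lebesgue_on U. G x = H x"
proof -
  have "AE x in lebesgue_on U. G x - H x = 0"
  proof (rule fundamental_lemma[OF assms(1) loc_integrable_diff[OF assms(2,3)]])
    fix \<phi> assume \<phi>: "\<phi> \<in> test_functions U"
    show "(LINT x|lebesgue_on U. (G x - H x) * \<phi> x) = 0"
      using assms(4)[OF \<phi>] test_function_integrable(1)[OF assms(1,2) \<phi>] test_function_integrable(1)[OF assms(1,3) \<phi>]
      by (simp add: left_diff_distrib)
  qed
  then show ?thesis by simp
qed

lemma is_weak_gradient_unique: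
  fixes G H :: "('n::finite) mfield"
  assumes "open U" "is_weak_gradient U u G" "is_weak_gradient U u H"
  shows "AE x in lebesgue_on U. G x = H x"
proof -
  have "AE x in lebesgue_on U. G x $ i $ j = H x $ i $ j" for i j
    using assms unfolding is_weak_gradient_def
    by (intro loc_integrable_weakly_equal loc_integrable_component) auto
  then have "AE x in lebesgue_on U. \<forall>i j. G x $ i $ j = H x $ i $ j"
    by (simp add: AE_all_countable)
  then show ?thesis by eventually_elim (simp add: vec_eq_iff)
qed

lemma is_weak_divergence_unique:
  fixes g h :: "('n::finite) vfield"
  assumes "open U" "is_weak_divergence U v g" "is_weak_divergence U v h"
  shows "AE x in lebesgue_on U. g x = h x"
proof -
  have "AE x in lebesgue_on U. g x $ i = h x $ i" for i
    using assms unfolding is_weak_divergence_def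
    by (intro loc_integrable_weakly_equal loc_integrable_component) auto
  then have "AE x in lebesgue_on U. \<forall>i. g x $ i = h x $ i"
    by (simp add: AE_all_countable)
  then show ?thesis by eventually_elim (simp add: vec_eq_iff)
qed

text \<open>Completeness of Lebesgue measure. It makes the fields picked by choice in
  \<open>weak_gradient\<close> and \<open>weak_divergence\<close> measurable on
  \<open>U\<close>.\<close>

lemma borel_measurable_lebesgue_on_AE:
  fixes f g :: "'a::euclidean_space \<Rightarrow> 'b::euclidean_space"
  assumes "open U" "f \<in> borel_measurable (lebesgue_on U)" "AE x in lebesgue_on U. f x = g x"
  shows "g \<in> borel_measurable (lebesgue_on U)"
proof -
  note iff = borel_measurable_restrict_space_iff[OF open_lebesgue_space[OF assms(1)]]
  have "(\<lambda>x. indicator U x *\<^sub>R f x) \<in> borel_measurable lebesgue" by (rule iffD1[OF iff assms(2)])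
  moreover have "AE x in lebesgue. indicator U x *\<^sub>R f x = indicator U x *\<^sub>R g x"
    using assms(3) unfolding AE_lebesgue_on_iff[OF assms(1)] by eventually_elim (auto simp: indicator_def)
  ultimately have "(\<lambda>x. indicator U x *\<^sub>R g x) \<in> borel_measurable lebesgue" by (rule borel_measurable_AE)
  then show ?thesis by (rule iffD2[OF iff])
qed

lemma weak_gradient_AE_eq:
  assumes "open U" "is_weak_gradient U u G"
  shows "AE x in lebesgue_on U. weak_gradient U u x = G x"
    and "G \<in> borel_measurable (lebesgue_on U) \<Longrightarrow> weak_gradient U u \<in> borel_measurable (lebesgue_on U)"
proof -
  have "is_weak_gradient U u (weak_gradient U u)"
    unfolding weak_gradient_def using assms(2) by (rule someI[of "is_weak_gradient U u"])
  then show *: "AE x in lebesgue_on U. weak_gradient U u x = G x" 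
    using is_weak_gradient_unique assms by blast
  assume "G \<in> borel_measurable (lebesgue_on U)"
  then show "weak_gradient U u \<in> borel_measurable (lebesgue_on U)"
    by (rule borel_measurable_lebesgue_on_AE[OF assms(1) _ eventually_mono[OF *]]) simp
qed

lemma weak_divergence_AE_eq:
  assumes "open U" "is_weak_divergence U v g"
  shows "AE x in lebesgue_on U. weak_divergence U v x = g x"
proof -
  have "is_weak_divergence U v (weak_divergence U v)"
    unfolding weak_divergence_def using assms(2) by (rule someI[of "is_weak_divergence U v"])
  then show *: "AE x in lebesgue_on U. weak_divergence U v x = g x" 
    using is_weak_divergence_unique assms by blast
qed

lemma is_weak_gradient_add_scaleR:
  assumes U: "open U" and u: "is_weak_gradient U u G" and w: "is_weak_gradient U w H"
  shows "is_weak_gradient U (\<lambda>x. u x + c *\<^sub>R w x) (\<lambda>x. G x + c *\<^sub>R H x)"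
  unfolding is_weak_gradient_def
proof (intro conjI ballI allI)
  have loc: "loc_integrable U u" "loc_integrable U G" "loc_integrable U w" "loc_integrable U H"
    using u w by (auto simp: is_weak_gradient_def)
  then show "loc_integrable U (\<lambda>x. u x + c *\<^sub>R w x)" "loc_integrable U (\<lambda>x. G x + c *\<^sub>R H x)"
    by (intro loc_integrable_add loc_integrable_scaleR; simp)+
  fix \<phi> i j assume \<phi>: "\<phi> \<in> test_functions U"
  note T = test_function_integrable[OF U _ \<phi>]
  have "(LINT x|lebesgue_on U. (u x + c *\<^sub>R w x) $ i * partial j \<phi> x) 
     = (LINT x|lebesgue_on U. u x $ i * partial j \<phi> x) + c * (LINT x|lebesgue_on U. w x $ i * partial j \<phi> x)"
    using T(2)[OF loc_integrable_component[OF loc(1)]] T(2)[OF loc_integrable_component[OF loc(3)]]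
    by (simp add: distrib_right mult.assoc)
  moreover have "(LINT x|lebesgue_on U. (G x + c *\<^sub>R H x) $ i $ j * \<phi> x) 
     = (LINT x|lebesgue_on U. G x $ i $ j * \<phi> x) + c * (LINT x|lebesgue_on U. H x $ i $ j * \<phi> x)"
    using T(1)[OF loc_integrable_component[OF loc_integrable_component[OF loc(2)]]] 
      T(1)[OF loc_integrable_component[OF loc_integrable_component[OF loc(4)]]]
    by (simp add: distrib_right mult.assoc)
  ultimately show "(LINT x|lebesgue_on U. (u x + c *\<^sub>R w x) $ i * partial j \<phi> x) 
      = - (LINT x|lebesgue_on U. (G x + c *\<^sub>R H x) $ i $ j * \<phi> x)"
    using u w \<phi> unfolding is_weak_gradient_def by simp
qed

lemma lborel_integral_scale:
  fixes f :: "'a::euclidean_space \<Rightarrow> real"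
  assumes [measurable]: "f \<in> borel_measurable borel" and t: "t > 0"
  shows "(LINT x|lborel. f ((1/t) *\<^sub>R x)) = t ^ DIM('a) * (LINT x|lborel. f x)"
proof -
  have "(LINT x|lborel. f ((1/t) *\<^sub>R x)) = (LINT x|density (distr lborel borel (\<lambda>x::'a. 0 + t *\<^sub>R x)) (\<lambda>_. \<bar>t\<bar> ^ DIM('a)). f ((1/t) *\<^sub>R x))"
    using lborel_affine[of t "0::'a"] t by simp
  also have "\<dots> = t ^ DIM('a) * (LINT x|lborel. f x)"
    using t by (simp add: integral_density integral_distr)
  finally show ?thesis .
qed

text \<open>The cutoff is the indicator of \<open>S\<close> mollified at scale \<open>t\<close>. Its
  derivatives are bounded by the integrals of the absolute derivatives of the kernel; scaling a
  fixed kernel yields the factor \<open>1 / t\<close>, with a constant independent of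
  \<open>S\<close> and \<open>t\<close>.\<close>

lemma smooth_cutoffs_exist:
  "\<exists>C>0. \<forall>S t. S \<in> sets borel \<longrightarrow> bounded S \<longrightarrow> t > 0 \<longrightarrow> 
    (\<exists>\<eta> :: real ^ 'n \<Rightarrow> real. smooth \<eta> \<and> (\<forall>x. 0 \<le> \<eta> x \<and> \<eta> x \<le> 1) \<and> (\<forall>x. ball x t \<subseteq> S \<longrightarrow> \<eta> x = 1) \<and>
      (\<forall>x. ball x t \<inter> S = {} \<longrightarrow> \<eta> x = 0) \<and> (\<forall>j x. \<bar>partial j \<eta> x\<bar> \<le> C / t))"
proof -
  \<comment> \<open>The support radius 1/2 becomes \<open>t / 2\<close> after scaling, so the points
    seen from \<open>x\<close> lie inside the open ball of radius \<open>t\<close>.\<close>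
  obtain K1 :: "real ^ 'n \<Rightarrow> real" where K1: "mollifier (1/2) K1" using mollifier_at_0_exists[of "1/2"] by auto
  note K1d = mollifierD[OF K1]
  define I where "I j = (LINT x|lborel. \<bar>partial j K1 x\<bar>)" for j
  define C where "C = (\<Sum>j\<in>UNIV. I j) + 1"
  have I0: "I j \<ge> 0" for j by (simp add: I_def)
  have C: "C > 0" "I j \<le> C" for j
    using I0 member_le_sum[of j UNIV I] sum_nonneg[of UNIV I] by (auto simp: C_def intro: add_nonneg_pos)
  have P1m: "partial j K1 \<in> borel_measurable borel" for j
    by (intro borel_measurable_continuous_onI smooth_continuous smooth_partial K1d)
  show ?thesis
  proof (intro exI[of _ C] conjI allI impI C(1))
    fix S :: "(real^'n) set" and t :: real
    assume S: "S \<in> sets borel" "bounded S" and t: "t > 0"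
    define n where "n = DIM(real^'n)"
    define K where "K z = (1 / t ^ n) * K1 (0 + (1/t) *\<^sub>R z)" for z
    have Ksm: "smooth K" unfolding K_def by (intro smooth_mult smooth_const smooth_affine K1d)
    have Ksupp: "bounded_support (t/2) K"
      unfolding bounded_support_def K_def
    proof (intro allI impI)
      fix z assume "(1 / t ^ n) * K1 (0 + (1/t) *\<^sub>R z) \<noteq> 0"
      then have "norm ((1/t) *\<^sub>R z) \<le> 1/2" using K1d(3) by (auto simp: bounded_support_def)
      then show "norm z \<le> t/2" using t by (simp add: field_simps)
    qed
    have Kint: "(LINT x|lborel. K x) = 1"
      using lborel_integral_scale[OF K1d(7) t] K1d(4) t by (simp add: K_def n_def)
    have "K z \<ge> 0" for z unfolding K_def using K1d(2) t by simp
    with Ksm Ksupp Kint have K: "mollifier (t/2) K" unfolding mollifier_def by blast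
    note Kd = mollifierD[OF K]
    have dK: "partial j K z = (1 / t ^ n) * ((1/t) * partial j K1 ((1/t) *\<^sub>R z))" for j z
      unfolding K_def using partial_affine[OF smooth_differentiable[OF K1d(1)], of j 0 "1/t" z]
        partial_mult[of "\<lambda>_. 1 / t^n" z "\<lambda>z. K1 (0 + (1/t) *\<^sub>R z)" j] smooth_differentiable[OF smooth_affine[OF K1d(1), of 0 "1/t"], of z]
      by simp
    have dKint: "(LINT z|lborel. \<bar>partial j K z\<bar>) = I j / t" for j
    proof -
      have m: "(\<lambda>x. \<bar>partial j K1 x\<bar>) \<in> borel_measurable borel" using P1m[of j] by measurable
      have "(LINT z|lborel. \<bar>partial j K z\<bar>) = (LINT z|lborel. (1 / t ^ n) * (1/t) * \<bar>partial j K1 ((1/t) *\<^sub>R z)\<bar>)"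
        using t by (simp add: dK abs_mult)
      also have "\<dots> = I j / t" using lborel_integral_scale[OF m t] t by (simp add: I_def n_def)
      finally show ?thesis .
    qed
    define g :: "real^'n \<Rightarrow> real" where "g = indicator S"
    have gm [measurable]: "g \<in> borel_measurable borel" using S by (simp add: g_def)
    have gint: "integrable lborel g" unfolding g_def
      using S emeasure_bounded_finite[OF S(2)] by (intro integrable_real_indicator) auto
    have iK: "integrable lborel (\<lambda>z. K z * g (z + x))" for x
      using lborel_integral_shift(2)[of "\<lambda>y. K (y - x) *\<^sub>R g y" x] mollify_integrable[OF Kd(6,3) gint, of x] Kd(7) by simp
    define \<eta> where "\<eta> = mollify K g"
    have \<eta>: "\<eta> x = (LINT z|lborel. K z * g (z + x))" for x
      unfolding \<eta>_def by (subst mollify_eq_shift[OF Kd(7) gm]) simp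
    have near: "z + x \<in> ball x t" if "K z \<noteq> 0" for z x
      using Ksupp that t by (force simp: bounded_support_def dist_norm)
    have "smooth \<eta>" unfolding \<eta>_def by (rule smooth_mollify[OF Kd(1,3) gint])
    moreover have "0 \<le> \<eta> x \<and> \<eta> x \<le> 1" for x
    proof
      show "0 \<le> \<eta> x" unfolding \<eta> using Kd(2) by (intro integral_nonneg_AE) (auto simp: g_def)
      have "(LINT z|lborel. K z * g (z + x)) \<le> (LINT z|lborel. K z)"
        using Kd(2) by (intro integral_mono iK Kd(5)) (auto simp: g_def indicator_def)
      then show "\<eta> x \<le> 1" unfolding \<eta> Kd(4) .
    qed
    moreover have "\<eta> x = 1" if "ball x t \<subseteq> S" for x
    proof -
      have "K z * g (z + x) = K z" for z
        using near[of z x] that by (cases "K z = 0") (auto simp: g_def indicator_def)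
      then have "(\<lambda>z. K z * g (z + x)) = K" by (rule ext)
      then show ?thesis unfolding \<eta> using Kd(4) by simp
    qed
    moreover have "\<eta> x = 0" if "ball x t \<inter> S = {}" for x
    proof -
      have "K z * g (z + x) = 0" for z
        using near[of z x] that by (cases "K z = 0") (auto simp: g_def indicator_def)
      then show ?thesis unfolding \<eta> by (simp only: integral_zero)
    qed
    moreover have "\<bar>partial j \<eta> x\<bar> \<le> C / t" for j x
    proof -
      have dKm: "partial j K \<in> borel_measurable borel"
        by (intro borel_measurable_continuous_onI smooth_continuous smooth_partial Kd)
      have dKi: "integrable lborel (partial j K)"
        by (rule bounded_support_integrable[OF smooth_continuous[OF smooth_partial[OF Kd(1)]] bounded_support_partial[OF Kd(3)]])
      have "partial j \<eta> x = - (LINT z|lborel. partial j K z * g (z + x))"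
        unfolding \<eta>_def partial_mollify[OF Kd(1,3) gint] mollify_eq_shift[OF dKm gm] by simp
      then have "\<bar>partial j \<eta> x\<bar> = \<bar>LINT z|lborel. partial j K z * g (z + x)\<bar>" by simp
      also have "\<dots> \<le> (LINT z|lborel. \<bar>partial j K z * g (z + x)\<bar>)" by (rule integral_abs_bound)
      also have "\<dots> \<le> (LINT z|lborel. \<bar>partial j K z\<bar>)"
      proof (rule integral_mono)
        show "integrable lborel (\<lambda>z. \<bar>partial j K z\<bar>)" using dKi by simp
        show "integrable lborel (\<lambda>z. \<bar>partial j K z * g (z + x)\<bar>)"
        proof (rule Bochner_Integration.integrable_bound[OF dKi])
          show "(\<lambda>z. \<bar>partial j K z * g (z + x)\<bar>) \<in> borel_measurable lborel" using dKm gm by measurable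
        qed (auto simp: g_def indicator_def)
      qed (auto simp: g_def indicator_def)
      also have "\<dots> \<le> C / t" unfolding dKint using C t by (intro divide_right_mono) auto
      finally show ?thesis .
    qed
    ultimately show "\<exists>\<eta>. smooth \<eta> \<and> (\<forall>x. 0 \<le> \<eta> x \<and> \<eta> x \<le> 1) \<and> (\<forall>x. ball x t \<subseteq> S \<longrightarrow> \<eta> x = 1) \<and>
      (\<forall>x. ball x t \<inter> S = {} \<longrightarrow> \<eta> x = 0) \<and> (\<forall>j x. \<bar>partial j \<eta> x\<bar> \<le> C / t)"
      by blast
  qed
qed

section \<open>Density of smooth fields\<close>

definition outer :: "real ^ 'n \<Rightarrow> real ^ 'm \<Rightarrow> real ^ 'm ^ 'n" where
  "outer a b = (\<chi> i j. a $ i * b $ j)"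

definition sgrad :: "(real ^ 'n \<Rightarrow> real) \<Rightarrow> real ^ 'n \<Rightarrow> real ^ 'n" where
  "sgrad f x = (\<chi> j. partial j f x)"

definition smooth_field :: "('n::finite) vfield \<Rightarrow> bool" where
  "smooth_field v \<longleftrightarrow> (\<forall>i. smooth (\<lambda>x. v x $ i))"

definition grad :: "('n::finite) vfield \<Rightarrow> 'n mfield" where
  "grad v x = (\<chi> i j. partial j (\<lambda>x. v x $ i) x)"

lemma norm_outer: "norm (outer a b) = norm a * norm b"
proof -
  have "norm (outer a b $ i) = \<bar>a $ i\<bar> * norm b" for i
  proof -
    have "outer a b $ i = a $ i *\<^sub>R b" by (simp add: outer_def vec_eq_iff)
    then show ?thesis by simp
  qed
  then show ?thesis by (simp add: norm_vec_def[of "outer a b"] norm_vec_def[of a] L2_set_left_distrib)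
qed

lemma inner_outer: "A \<bullet> outer a b = a \<bullet> (A *v b)"
  by (simp add: inner_vec_def outer_def matrix_vector_mult_def sum_distrib_left algebra_simps)

text \<open>Cauchy-Schwarz for the Frobenius product of \<open>A\<close> with the rank-one matrix
  \<open>outer (A *v x) x\<close>.\<close>

lemma norm_matrix_vector_mult_le: "norm ((A :: real ^ 'n ^ 'm) *v x) \<le> norm A * norm x"
proof -
  have "norm (A *v x) * norm (A *v x) = A \<bullet> outer (A *v x) x"
    by (simp add: inner_outer norm_eq_sqrt_inner)
  also have "\<dots> \<le> norm A * (norm (A *v x) * norm x)" 
    using norm_cauchy_schwarz[of A "outer (A *v x) x"] by (simp add: norm_outer)
  finally have "norm (A *v x) * norm (A *v x) \<le> norm (A *v x) * (norm A * norm x)" by (simp add: ac_simps)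
  then show ?thesis by (cases "A *v x = 0") (auto simp: mult_le_cancel_left)
qed

lemma continuous_on_outer: "continuous_on S f \<Longrightarrow> continuous_on S g \<Longrightarrow> continuous_on S (\<lambda>x. outer (f x) (g x))"
  unfolding outer_def by (intro continuous_on_vec_lambda continuous_on_mult continuous_on_component)

lemma borel_measurable_outer [measurable]:
  fixes f :: "'c \<Rightarrow> real ^ 'n" and g :: "'c \<Rightarrow> real ^ 'm"
  assumes [measurable]: "f \<in> borel_measurable M" "g \<in> borel_measurable M"
  shows "(\<lambda>x. outer (f x) (g x)) \<in> borel_measurable M"
proof -
  have "continuous_on UNIV (\<lambda>z :: (real ^ 'n) \<times> (real ^ 'm). outer (fst z) (snd z))"
    by (intro continuous_on_outer continuous_intros)
  then show ?thesis by (rule borel_measurable_continuous_Pair[OF assms])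
qed

lemma smooth_sgrad_continuous: "smooth f \<Longrightarrow> continuous_on S (sgrad f)"
  unfolding sgrad_def[abs_def] by (intro continuous_on_vec_lambda smooth_continuous smooth_partial)

lemma smooth_field_continuous: "smooth_field v \<Longrightarrow> continuous_on S v"
proof -
  assume "smooth_field v"
  then have "continuous_on S (\<lambda>x. \<chi> i. v x $ i)"
    unfolding smooth_field_def by (intro continuous_on_vec_lambda smooth_continuous) auto
  then show ?thesis by simp
qed

lemma smooth_field_grad_continuous: "smooth_field v \<Longrightarrow> continuous_on S (grad v)"
  unfolding grad_def[abs_def] smooth_field_def by (intro continuous_on_vec_lambda smooth_continuous smooth_partial) auto

lemma smooth_field_add: "smooth_field v \<Longrightarrow> smooth_field w \<Longrightarrow> smooth_field (\<lambda>x. v x + w x)"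
  unfolding smooth_field_def by (auto intro: smooth_add)

lemma grad_add: "smooth_field v \<Longrightarrow> smooth_field w \<Longrightarrow> grad (\<lambda>x. v x + w x) x = grad v x + grad w x"
  unfolding smooth_field_def grad_def by (simp add: vec_eq_iff partial_add smooth_differentiable)

lemma smooth_field_has_derivative:
  assumes "smooth_field v"
  shows "(v has_derivative (\<lambda>h. grad v x *v h)) (at x)"
proof -
  have "((\<lambda>y. v y $ i) has_derivative (\<lambda>h. (grad v x *v h) $ i)) (at x)" for i
    using has_derivative_partial[OF smooth_differentiable, of "\<lambda>y. v y $ i" x] assms
    by (simp add: smooth_field_def grad_def matrix_vector_mult_def)
  then have "((\<lambda>y. v y \<bullet> b) has_derivative (\<lambda>h. (grad v x *v h) \<bullet> b)) (at x)" if "b \<in> Basis" for b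
    using that by (auto simp: Basis_vec_def inner_axis)
  then show ?thesis by (subst has_derivative_componentwise_within) auto
qed

lemma continuous_Lp_bounded_domain:
  fixes f :: "'a::euclidean_space \<Rightarrow> 'b::euclidean_space"
  assumes "open U" "bounded U" "continuous_on UNIV f" "p > 0"
  shows "f \<in> Lp (lebesgue_on U) p"
proof -
  have "bounded (f ` closure U)"
    using assms by (intro compact_imp_bounded compact_continuous_image) (auto intro: continuous_on_subset simp: compact_closure)
  then obtain B where "\<And>x. x \<in> U \<Longrightarrow> norm (f x) \<le> B" using closure_subset by (fastforce simp: bounded_iff)
  then show ?thesis
    using assms finite_measure_lebesgue_on_bounded[OF assms(1,2)]
    by (intro Lp_bounded_function[of _ _ B] borel_imp_lebesgue_on_measurable borel_measurable_continuous_onI)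
       (auto simp: AE_lebesgue_on_iff)
qed

lemma Lp_norm_cong: "(\<And>x. x \<in> space M \<Longrightarrow> f x = g x) \<Longrightarrow> Lp_norm M p f = Lp_norm M p g"
  unfolding Lp_norm_def by (auto cong: Bochner_Integration.integral_cong)

lemma mollify_diff_Lp:
  fixes g :: "real ^ 'n \<Rightarrow> 'b::euclidean_space"
  assumes K: "mollifier r K" and g: "g \<in> Lp lborel p" "integrable lborel g" and p: "p \<ge> 1"
  shows "(\<lambda>x. mollify K g x - g x) \<in> Lp lborel p"
proof (rule mollify_Lp_error(1)[OF K g p])
  show "Lp_norm lborel p (\<lambda>x. g (x + z) - g x) \<le> Lp_norm lborel p g + Lp_norm lborel p g" for z
    using Lp_norm_triangle[OF Lp_shift(1)[OF g(1), of z] Lp_scaleR[OF g(1), of "-1"]] Lp_norm_scaleR[of p lborel "-1" g]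
      Lp_shift(2)[OF g(1), of z] p by simp
qed simp

lemma mollify_component:
  fixes g :: "real ^ 'n \<Rightarrow> real ^ 'm"
  assumes "smooth K" "bounded_support R K" "integrable lborel g"
  shows "mollify K g x $ i = mollify K (\<lambda>y. g y $ i) x"
  using integral_bounded_linear[OF bounded_linear_vec_nth mollify_integrable[OF smooth_continuous[OF assms(1)] assms(2,3), of x], of i]
  by (simp add: mollify_def)

lemma mollify_component2:
  fixes g :: "real ^ 'n \<Rightarrow> real ^ 'm ^ 'k"
  assumes "smooth K" "bounded_support R K" "integrable lborel g"
  shows "mollify K g x $ i $ j = mollify K (\<lambda>y. g y $ i $ j) x"
  using integral_bounded_linear[OF bounded_linear_compose[OF bounded_linear_vec_nth[of j] bounded_linear_vec_nth[of i]]
      mollify_integrable[OF smooth_continuous[OF assms(1)] assms(2,3), of x]]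
  by (simp add: mollify_def)

lemma bounded_mult_Lp:
  fixes \<phi> :: "real ^ 'n \<Rightarrow> real" and f :: "real ^ 'n \<Rightarrow> 'b::euclidean_space"
  assumes \<phi>: "continuous_on UNIV \<phi>" "\<forall>x\<in>U. \<bar>\<phi> x\<bar> \<le> M" and M: "M \<ge> 0" and p: "p > 0" and f: "f \<in> Lp (lebesgue_on U) p"
  shows "(\<lambda>x. \<phi> x *\<^sub>R f x) \<in> Lp (lebesgue_on U) p"
    "Lp_norm (lebesgue_on U) p (\<lambda>x. \<phi> x *\<^sub>R f x) \<le> M * Lp_norm (lebesgue_on U) p f"
proof -
  have m: "(\<lambda>x. \<phi> x *\<^sub>R f x) \<in> borel_measurable (lebesgue_on U)"
    by (intro borel_measurable_scaleR Lp_measurable[OF f] borel_imp_lebesgue_on_measurable borel_measurable_continuous_onI \<phi>(1))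
  have "AE x in lebesgue_on U. norm (\<phi> x *\<^sub>R f x) \<le> M * norm (f x)"
    using \<phi>(2) by (intro AE_I2) (auto simp: space_restrict_space intro: mult_right_mono)
  from Lp_bounded_mult[OF f M p m this]
  show "(\<lambda>x. \<phi> x *\<^sub>R f x) \<in> Lp (lebesgue_on U) p"
    "Lp_norm (lebesgue_on U) p (\<lambda>x. \<phi> x *\<^sub>R f x) \<le> M * Lp_norm (lebesgue_on U) p f" by auto
qed

lemma bounded_outer_Lp:
  fixes b :: "real ^ 'n \<Rightarrow> real ^ 'm" and f :: "real ^ 'n \<Rightarrow> real ^ 'k"
  assumes b: "continuous_on UNIV b" "\<forall>x\<in>U. norm (b x) \<le> M" and M: "M \<ge> 0" and p: "p > 0" and f: "f \<in> Lp (lebesgue_on U) p"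
  shows "(\<lambda>x. outer (f x) (b x)) \<in> Lp (lebesgue_on U) p"
    "Lp_norm (lebesgue_on U) p (\<lambda>x. outer (f x) (b x)) \<le> M * Lp_norm (lebesgue_on U) p f"
proof -
  have m: "(\<lambda>x. outer (f x) (b x)) \<in> borel_measurable (lebesgue_on U)"
    by (intro borel_measurable_outer Lp_measurable[OF f] borel_imp_lebesgue_on_measurable borel_measurable_continuous_onI b(1))
  have "AE x in lebesgue_on U. norm (outer (f x) (b x)) \<le> M * norm (f x)"
    using b(2) by (intro AE_I2) (auto simp: space_restrict_space norm_outer mult.commute[of M] intro: mult_left_mono)
  from Lp_bounded_mult[OF f M p m this]
  show "(\<lambda>x. outer (f x) (b x)) \<in> Lp (lebesgue_on U) p"
    "Lp_norm (lebesgue_on U) p (\<lambda>x. outer (f x) (b x)) \<le> M * Lp_norm (lebesgue_on U) p f" by auto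
qed

lemma continuous_bounded_on_domain:
  fixes f :: "'a::euclidean_space \<Rightarrow> 'b::euclidean_space"
  assumes "bounded U" "continuous_on UNIV f"
  shows "\<exists>M\<ge>0. \<forall>x\<in>U. norm (f x) \<le> M"
proof -
  have "bounded (f ` closure U)"
    using assms by (intro compact_imp_bounded compact_continuous_image) (auto intro: continuous_on_subset)
  then obtain M where "M > 0" "\<forall>x\<in>closure U. norm (f x) \<le> M" unfolding bounded_pos by auto
  then show ?thesis using closure_subset[of U] by (intro exI[of _ M]) auto
qed

lemma Lp_null_add:
  fixes a b :: "nat \<Rightarrow> 'a \<Rightarrow> 'b::euclidean_space"
  assumes "\<And>n. a n \<in> Lp M p" "\<And>n. b n \<in> Lp M p" and p: "p \<ge> 1"
    and "(\<lambda>n. Lp_norm M p (a n)) \<longlonglongrightarrow> 0" "(\<lambda>n. Lp_norm M p (b n)) \<longlonglongrightarrow> 0"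
  shows "(\<lambda>n. Lp_norm M p (\<lambda>x. a n x + b n x)) \<longlonglongrightarrow> 0"
proof (rule Lim_null_comparison)
  show "(\<lambda>n. Lp_norm M p (a n) + Lp_norm M p (b n)) \<longlonglongrightarrow> 0" using tendsto_add[OF assms(4,5)] by simp
  show "\<forall>\<^sub>F n in sequentially. norm (Lp_norm M p (\<lambda>x. a n x + b n x)) \<le> Lp_norm M p (a n) + Lp_norm M p (b n)"
    using Lp_norm_triangle[OF assms(1,2) p] by simp
qed

text \<open>A uniform interior cone condition near \<open>x\<close>: small moves in directions close
  to \<open>e\<close> do not leave \<open>U\<close> as long as they end in the ball. At a point of
  \<open>U\<close> itself the ball can be chosen inside \<open>U\<close>; at a boundary point
  \<open>e\<close> points inwards.\<close>

definition interior_ball :: "(real ^ 'n) set \<Rightarrow> real ^ 'n \<Rightarrow> real \<Rightarrow> bool" where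
  "interior_ball U x r \<longleftrightarrow> r > 0 \<and> (\<exists>e \<delta> t0. 0 < \<delta> \<and> 0 < t0 \<and>
     (\<forall>y\<in>U. \<forall>t z. 0 < t \<and> t < t0 \<and> z \<in> cball e \<delta> \<and> y + t *\<^sub>R z \<in> ball x r \<longrightarrow> y + t *\<^sub>R z \<in> U))"

definition smooth_limit :: "(real ^ 'n) set \<Rightarrow> real \<Rightarrow> 'n vfield \<Rightarrow> 'n mfield \<Rightarrow> bool" where
  "smooth_limit U p f F \<longleftrightarrow> (\<exists>v. (\<forall>n. smooth_field (v n)) \<and>
     Lp_lim (lebesgue_on U) p v f \<and> Lp_lim (lebesgue_on U) p (\<lambda>n. grad (v n)) F)"

lemma smooth_limit_cong:
  assumes "\<And>x. x \<in> U \<Longrightarrow> f x = g x" "\<And>x. x \<in> U \<Longrightarrow> F x = G x"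
  shows "smooth_limit U p f F \<longleftrightarrow> smooth_limit U p g G"
proof -
  have "Lp_norm (lebesgue_on U) p (\<lambda>x. v x - f x) = Lp_norm (lebesgue_on U) p (\<lambda>x. v x - g x)"
    "Lp_norm (lebesgue_on U) p (\<lambda>x. V x - F x) = Lp_norm (lebesgue_on U) p (\<lambda>x. V x - G x)" for v V
    by (rule Lp_norm_cong, simp add: assms)+
  then show ?thesis unfolding smooth_limit_def by simp
qed

lemma smooth_limit_add:
  fixes U :: "(real ^ 'n) set"
  assumes U: "open U" "bounded U" and p: "p \<ge> 1"
    and f: "f \<in> Lp (lebesgue_on U) p" "F \<in> Lp (lebesgue_on U) p" "smooth_limit U p f F"
    and g: "g \<in> Lp (lebesgue_on U) p" "G \<in> Lp (lebesgue_on U) p" "smooth_limit U p g G"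
  shows "smooth_limit U p (\<lambda>x. f x + g x) (\<lambda>x. F x + G x)"
proof -
  obtain v where v: "\<And>n. smooth_field (v n)" "Lp_lim (lebesgue_on U) p v f"
     "Lp_lim (lebesgue_on U) p (\<lambda>n. grad (v n)) F" using f(3) unfolding smooth_limit_def by blast
  obtain w where w: "\<And>n. smooth_field (w n)" "Lp_lim (lebesgue_on U) p w g"
     "Lp_lim (lebesgue_on U) p (\<lambda>n. grad (w n)) G" using g(3) unfolding smooth_limit_def by blast
  have L: "h \<in> Lp (lebesgue_on U) p" if "continuous_on UNIV h" for h :: "real ^ 'n \<Rightarrow> 'z::euclidean_space"
    using continuous_Lp_bounded_domain[OF U that] p by simp
  note vL = L[OF smooth_field_continuous[OF v(1)]] L[OF smooth_field_grad_continuous[OF v(1)]]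
    and wL = L[OF smooth_field_continuous[OF w(1)]] L[OF smooth_field_grad_continuous[OF w(1)]]
  show ?thesis
    unfolding smooth_limit_def
  proof (intro exI[of _ "\<lambda>n x. v n x + w n x"] conjI allI)
    show "smooth_field (\<lambda>x. v n x + w n x)" for n by (rule smooth_field_add[OF v(1) w(1)])
    show "(\<lambda>n. Lp_norm (lebesgue_on U) p (\<lambda>x. v n x + w n x - (f x + g x))) \<longlonglongrightarrow> 0"
      using Lp_null_add[OF Lp_diff[OF vL(1) f(1) p] Lp_diff[OF wL(1) g(1) p] p v(2) w(2)] by (simp add: add_diff_add)
    show "(\<lambda>n. Lp_norm (lebesgue_on U) p (\<lambda>x. grad (\<lambda>x. v n x + w n x) x - (F x + G x))) \<longlonglongrightarrow> 0"
      using Lp_null_add[OF Lp_diff[OF vL(2) f(2) p] Lp_diff[OF wL(2) g(2) p] p v(3) w(3)]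
      by (simp add: add_diff_add grad_add[OF v(1) w(1)])
  qed
qed

text \<open>The fields are extended by zero, but the weak identity is tested only with functions
  supported in \<open>U\<close>: the extension need not be weakly differentiable across the
  boundary.\<close>

locale lborel_weak_gradient =
  fixes U :: "(real ^ 'n) set" and p :: real and u :: "'n vfield" and G :: "'n mfield"
  assumes U: "open U" "bounded U" and p: "p \<ge> 1"
    and u: "u \<in> Lp lborel p" "\<And>x. x \<notin> U \<Longrightarrow> u x = 0"
    and G: "G \<in> Lp lborel p" "\<And>x. x \<notin> U \<Longrightarrow> G x = 0"
    and weak: "\<And>\<phi> i j. \<phi> \<in> test_functions U \<Longrightarrow> 
      (LINT x|lborel. u x $ i * partial j \<phi> x) = - (LINT x|lborel. G x $ i $ j * \<phi> x)"
begin

lemma measurable_u [measurable]: "u \<in> borel_measurable borel" using Lp_measurable[OF u(1)] by simp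
lemma measurable_G [measurable]: "G \<in> borel_measurable borel" using Lp_measurable[OF G(1)] by simp

lemma Lp_integrable_off:
  fixes f :: "real ^ 'n \<Rightarrow> 'b::euclidean_space"
  assumes "f \<in> Lp lborel p" "\<And>x. x \<notin> U \<Longrightarrow> f x = 0"
  shows "integrable lborel f"
proof -
  have m: "f \<in> borel_measurable borel" using Lp_measurable[OF assms(1)] by simp
  have "f \<in> Lp (lebesgue_on U) p" using lebesgue_on_Lp_borel(1)[OF U(1) m] assms by simp
  then have "integrable (lebesgue_on U) f"
    using Lp_finite_measure_integrable[OF finite_measure_lebesgue_on_bounded[OF U] _ p] by blast
  then show ?thesis using lebesgue_on_integral_borel(2)[OF U(1) m] assms(2) by simp
qed

lemma product_Lp:
  assumes \<zeta>: "smooth \<zeta>"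
  shows "(\<lambda>x. \<zeta> x *\<^sub>R u x) \<in> Lp lborel p" "(\<lambda>x. \<zeta> x *\<^sub>R G x) \<in> Lp lborel p" "(\<lambda>x. outer (u x) (sgrad \<zeta> x)) \<in> Lp lborel p"
proof -
  have c: "continuous_on UNIV \<zeta>" "continuous_on UNIV (sgrad \<zeta>)"
    by (rule smooth_continuous[OF \<zeta>], rule smooth_sgrad_continuous[OF \<zeta>])
  have [measurable]: "\<zeta> \<in> borel_measurable borel" "sgrad \<zeta> \<in> borel_measurable borel"
    using c by (auto intro: borel_measurable_continuous_onI)
  have p0: "p > 0" using p by simp
  obtain A where A: "A \<ge> 0" "\<forall>x\<in>U. \<bar>\<zeta> x\<bar> \<le> A" using continuous_bounded_on_domain[OF U(2) c(1)] by auto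
  obtain C where C: "C \<ge> 0" "\<forall>x\<in>U. norm (sgrad \<zeta> x) \<le> C" using continuous_bounded_on_domain[OF U(2) c(2)] by auto
  have L: "u \<in> Lp (lebesgue_on U) p" "G \<in> Lp (lebesgue_on U) p"
    using lebesgue_on_Lp_borel(1)[OF U(1) measurable_u u(2)] lebesgue_on_Lp_borel(1)[OF U(1) measurable_G G(2)] u(1) G(1) by auto
  have to: "f \<in> Lp lborel p" if "f \<in> Lp (lebesgue_on U) p" "f \<in> borel_measurable borel" "\<And>x. x \<notin> U \<Longrightarrow> f x = 0"
    for f :: "real ^ 'n \<Rightarrow> 'z::euclidean_space"
    using lebesgue_on_Lp_borel(1)[OF U(1) that(2,3)] that(1) by blast
  show "(\<lambda>x. \<zeta> x *\<^sub>R u x) \<in> Lp lborel p"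
    by (rule to[OF bounded_mult_Lp(1)[OF c(1) A(2,1) p0 L(1)]]) (measurable, simp add: u)
  show "(\<lambda>x. \<zeta> x *\<^sub>R G x) \<in> Lp lborel p"
    by (rule to[OF bounded_mult_Lp(1)[OF c(1) A(2,1) p0 L(2)]]) (measurable, simp add: G)
  show "(\<lambda>x. outer (u x) (sgrad \<zeta> x)) \<in> Lp lborel p"
    by (rule to[OF bounded_outer_Lp(1)[OF c(2) C(2,1) p0 L(1)]]) (measurable, simp add: u outer_def vec_eq_iff)
qed

lemma product_integrable:
  assumes "smooth \<zeta>"
  shows "integrable lborel (\<lambda>x. \<zeta> x *\<^sub>R u x)" "integrable lborel (\<lambda>x. \<zeta> x *\<^sub>R G x)" "integrable lborel (\<lambda>x. outer (u x) (sgrad \<zeta> x))"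
  using product_Lp[OF assms] by (auto intro!: Lp_integrable_off simp: u G outer_def vec_eq_iff)

text \<open>The weak gradient identity is tested with the kernel centred at \<open>x\<close> times
  \<open>\<zeta>\<close>. So mollification commutes with differentiation at exactly those
  \<open>x\<close> where this product is known to be supported in \<open>U\<close>.\<close>

lemma grad_mollify_product:
  assumes \<zeta>: "smooth \<zeta>" and K: "smooth K" "bounded_support R K"
    and test: "(\<lambda>y. K (y - x) * \<zeta> y) \<in> test_functions U"
  shows "grad (mollify K (\<lambda>y. \<zeta> y *\<^sub>R u y)) x = mollify K (\<lambda>y. \<zeta> y *\<^sub>R G y + outer (u y) (sgrad \<zeta> y)) x"
proof -
  note i = product_integrable[OF \<zeta>] and nth = integrable_bounded_linear[OF bounded_linear_vec_nth]
  have "grad (mollify K (\<lambda>y. \<zeta> y *\<^sub>R u y)) x $ i $ j = mollify K (\<lambda>y. \<zeta> y *\<^sub>R G y + outer (u y) (sgrad \<zeta> y)) x $ i $ j" for i j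
  proof -
    have iu: "integrable lborel (\<lambda>y. \<zeta> y * u y $ i)" using nth[OF i(1), of i] by simp
    have iG: "integrable lborel (\<lambda>y. \<zeta> y * G y $ i $ j)" using nth[OF nth[OF i(2), of i], of j] by simp
    have io: "integrable lborel (\<lambda>y. u y $ i * partial j \<zeta> y)" using nth[OF nth[OF i(3), of i], of j] by (simp add: outer_def sgrad_def)
    note A = mollify_integrable[OF smooth_continuous[OF smooth_partial[OF K(1)]] bounded_support_partial[OF K(2)] iu, of j x]
    note C = mollify_integrable[OF smooth_continuous[OF K(1)] K(2) iG, of x]
    note D = mollify_integrable[OF smooth_continuous[OF K(1)] K(2) io, of x]
    have sh: "(\<lambda>y. K (- x + 1 *\<^sub>R y)) = (\<lambda>y. K (y - x))" by (auto simp: fun_eq_iff)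
    have d: "partial j (\<lambda>y. K (y - x) * \<zeta> y) y = K (y - x) * partial j \<zeta> y + partial j K (y - x) * \<zeta> y" for y
      using partial_mult[of "\<lambda>y. K (y - x)" y \<zeta> j] partial_affine[OF smooth_differentiable[OF K(1)], of j "-x" 1 y]
        smooth_differentiable[OF smooth_affine[OF K(1), of "-x" 1], of y] smooth_differentiable[OF \<zeta>, of y]
      unfolding sh by simp
    have "(LINT y|lborel. u y $ i * partial j (\<lambda>y. K (y - x) * \<zeta> y) y)
      = (LINT y|lborel. K (y - x) *\<^sub>R (u y $ i * partial j \<zeta> y) + partial j K (y - x) *\<^sub>R (\<zeta> y * u y $ i))"
      unfolding d by (simp add: algebra_simps)
    also have "\<dots> = (LINT y|lborel. K (y - x) *\<^sub>R (u y $ i * partial j \<zeta> y)) + mollify (partial j K) (\<lambda>y. \<zeta> y * u y $ i) x"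
      unfolding mollify_def by (rule Bochner_Integration.integral_add[OF D A])
    finally have "- mollify (partial j K) (\<lambda>y. \<zeta> y * u y $ i) x
      = (LINT y|lborel. K (y - x) *\<^sub>R (\<zeta> y * G y $ i $ j)) + (LINT y|lborel. K (y - x) *\<^sub>R (u y $ i * partial j \<zeta> y))"
      using weak[OF test, of i j] by (simp add: ac_simps)
    also have "\<dots> = mollify K (\<lambda>y. \<zeta> y * G y $ i $ j + u y $ i * partial j \<zeta> y) x"
      unfolding mollify_def scaleR_add_right by (rule Bochner_Integration.integral_add[OF C D, symmetric])
    also have "\<dots> = mollify K (\<lambda>y. \<zeta> y *\<^sub>R G y + outer (u y) (sgrad \<zeta> y)) x $ i $ j"
      unfolding mollify_component2[OF K Bochner_Integration.integrable_add[OF i(2,3)]] by (simp add: outer_def sgrad_def)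
    also have "- mollify (partial j K) (\<lambda>y. \<zeta> y * u y $ i) x = grad (mollify K (\<lambda>y. \<zeta> y *\<^sub>R u y)) x $ i $ j"
      using partial_mollify[OF K iu] mollify_component[OF K i(1), of _ i] by (simp add: grad_def)
    finally show ?thesis .
  qed
  then show ?thesis by (simp add: vec_eq_iff)
qed

text \<open>The second field is the gradient of the product \<open>\<zeta> u\<close> by the Leibniz
  rule.\<close>

abbreviation approximable :: "(real ^ 'n \<Rightarrow> real) \<Rightarrow> bool" where
  "approximable \<zeta> \<equiv> smooth_limit U p (\<lambda>x. \<zeta> x *\<^sub>R u x) (\<lambda>x. \<zeta> x *\<^sub>R G x + outer (u x) (sgrad \<zeta> x))"

lemma approximable_add:
  assumes \<zeta>: "smooth \<zeta>" "approximable \<zeta>" and \<xi>: "smooth \<xi>" "approximable \<xi>"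
  shows "approximable (\<lambda>x. \<zeta> x + \<xi> x)"
proof -
  have L: "(\<lambda>x. \<zeta> x *\<^sub>R u x) \<in> Lp (lebesgue_on U) p" "(\<lambda>x. \<zeta> x *\<^sub>R G x + outer (u x) (sgrad \<zeta> x)) \<in> Lp (lebesgue_on U) p"
    if "smooth \<zeta>" for \<zeta>
    using product_Lp[OF that] p by (auto intro!: Lp_norm_restrict_le(1)[OF U(1)] Lp_add)
  have eq: "(\<zeta> x + \<xi> x) *\<^sub>R G x + outer (u x) (sgrad (\<lambda>x. \<zeta> x + \<xi> x) x)
    = (\<zeta> x *\<^sub>R G x + outer (u x) (sgrad \<zeta> x)) + (\<xi> x *\<^sub>R G x + outer (u x) (sgrad \<xi> x))" for x
    by (simp add: sgrad_def outer_def vec_eq_iff partial_add smooth_differentiable \<zeta> \<xi> algebra_simps)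
  show ?thesis
    unfolding eq scaleR_add_left[of _ _ "u _"] by (rule smooth_limit_add[OF U p L[OF \<zeta>(1)] \<zeta>(2) L[OF \<xi>(1)] \<xi>(2)])
qed

text \<open>The kernel is supported in a small ball around \<open>t n *\<^sub>R e\<close>, so the
  mollification at \<open>x\<close> samples points \<open>x + t n *\<^sub>R z\<close> with
  \<open>z\<close> close to \<open>e\<close>. By the cone condition these lie in \<open>U\<close>
  wherever \<open>\<zeta>\<close> is nonzero, for every \<open>x\<close> in \<open>U\<close>. Thus
  the gradient identity holds up to the boundary without extending \<open>u\<close> across
  it.\<close>

lemma approximable_local:
  assumes good: "interior_ball U x0 r" and \<zeta>: "smooth \<zeta>" "\<And>y. \<zeta> y \<noteq> 0 \<Longrightarrow> y \<in> cball x0 s" and s: "s < r"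
  shows "approximable \<zeta>"
proof -
  obtain e \<delta> t0 where g: "0 < \<delta>" "0 < t0" 
    "\<And>y t z. y \<in> U \<Longrightarrow> 0 < t \<Longrightarrow> t < t0 \<Longrightarrow> z \<in> cball e \<delta> \<Longrightarrow> y + t *\<^sub>R z \<in> ball x0 r \<Longrightarrow> y + t *\<^sub>R z \<in> U"
    using good unfolding interior_ball_def by blast
  \<comment> \<open>The shift by 2 keeps \<open>t n\<close> strictly below \<open>t0\<close> already
    for \<open>n = 0\<close>.\<close>
  define t where "t n = t0 / real (n + 2)" for n
  have t: "0 < t n" "t n < t0" for n using g(2) by (auto simp: t_def field_simps add_pos_nonneg)
  have tlim: "t \<longlonglongrightarrow> 0" unfolding t_def
    using LIMSEQ_ignore_initial_segment[OF lim_const_over_n[of t0], of 2] by simp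
  define R where "R n = norm (t n *\<^sub>R e) + t n * \<delta>" for n
  have "\<exists>K. mollifier (R n) K \<and> (\<forall>z. K z \<noteq> 0 \<longleftrightarrow> z \<in> ball (t n *\<^sub>R e) (t n * \<delta>))" for n
  proof -
    have "t n * \<delta> > 0" using t g by simp
    then obtain K where "mollifier (norm (t n *\<^sub>R e) + t n * \<delta>) K" "\<And>z. K z \<noteq> 0 \<longleftrightarrow> z \<in> ball (t n *\<^sub>R e) (t n * \<delta>)"
      by (rule mollifier_exists[where a = "t n *\<^sub>R e"]) (rule that; assumption)
    then show ?thesis unfolding R_def by blast
  qed
  then obtain K where K: "\<And>n. mollifier (R n) (K n)" "\<And>n z. K n z \<noteq> 0 \<longleftrightarrow> z \<in> ball (t n *\<^sub>R e) (t n * \<delta>)" by metis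
  have "(\<lambda>n. norm (t n *\<^sub>R e) + t n * \<delta>) \<longlonglongrightarrow> norm (0 *\<^sub>R e) + 0 * \<delta>" by (intro tendsto_intros tlim)
  then have Rlim: "R \<longlonglongrightarrow> 0" unfolding R_def by simp
  define f where "f x = \<zeta> x *\<^sub>R u x" for x
  define F where "F x = \<zeta> x *\<^sub>R G x + outer (u x) (sgrad \<zeta> x)" for x
  have fL: "f \<in> Lp lborel p" "integrable lborel f" unfolding f_def
    by (rule product_Lp product_integrable, rule \<zeta>)+
  have FL: "F \<in> Lp lborel p" "integrable lborel F" unfolding F_def
    by (intro Lp_add Bochner_Integration.integrable_add product_Lp product_integrable \<zeta> p)+
  have grad: "grad (mollify (K n) f) x = mollify (K n) F x" if x: "x \<in> U" for n x
    unfolding f_def F_def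
  proof (rule grad_mollify_product[OF \<zeta>(1) mollifierD(1,3)[OF K(1)]])
    have "smooth (\<lambda>y. K n (- x + 1 *\<^sub>R y))" by (rule smooth_affine[OF mollifierD(1)[OF K(1)]])
    then have sm: "smooth (\<lambda>y. K n (y - x))" by simp
    define S where "S = cball x0 s \<inter> cball (x + t n *\<^sub>R e) (t n * \<delta>)"
    show "(\<lambda>y. K n (y - x) * \<zeta> y) \<in> test_functions U"
    proof (rule test_functionsI[OF smooth_mult[OF sm \<zeta>(1)], of S])
      show "compact S" unfolding S_def by (intro compact_Int compact_cball)
      show "S \<subseteq> U"
      proof
        fix y assume y: "y \<in> S"
        define z where "z = (1 / t n) *\<^sub>R (y - x)"
        have yz: "y = x + t n *\<^sub>R z" using t[of n] by (simp add: z_def)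
        have "norm (x + t n *\<^sub>R e - y) \<le> t n * \<delta>" using y by (simp add: S_def dist_norm)
        also have "x + t n *\<^sub>R e - y = t n *\<^sub>R (e - z)" by (simp add: yz algebra_simps)
        finally have "z \<in> cball e \<delta>" using t[of n] by (simp add: dist_norm)
        moreover have "y \<in> ball x0 r" using y s by (simp add: S_def)
        ultimately show "y \<in> U" using g(3)[OF x t(1) t(2), of z n] by (simp add: yz[symmetric])
      qed
      fix y assume "K n (y - x) * \<zeta> y \<noteq> 0"
      then have "y - x \<in> ball (t n *\<^sub>R e) (t n * \<delta>)" "y \<in> cball x0 s" using K(2) \<zeta>(2) by auto
      moreover have "dist (t n *\<^sub>R e) (y - x) = dist (x + t n *\<^sub>R e) y" by (simp add: dist_norm algebra_simps)
      ultimately show "y \<in> S" by (simp add: S_def)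
    qed
  qed
  show ?thesis
    unfolding smooth_limit_def
  proof (intro exI[of _ "\<lambda>n. mollify (K n) f"] conjI allI)
    show "smooth_field (mollify (K n) f)" for n
      unfolding smooth_field_def
    proof
      fix i
      have "(\<lambda>x. mollify (K n) f x $ i) = mollify (K n) (\<lambda>y. f y $ i)"
        using mollify_component[OF mollifierD(1,3)[OF K(1)] fL(2)] by blast
      then show "smooth (\<lambda>x. mollify (K n) f x $ i)"
        using smooth_mollify[OF mollifierD(1,3)[OF K(1)] integrable_bounded_linear[OF bounded_linear_vec_nth fL(2)]] by simp
    qed
    show "(\<lambda>n. Lp_norm (lebesgue_on U) p (\<lambda>x. mollify (K n) f x - \<zeta> x *\<^sub>R u x)) \<longlonglongrightarrow> 0"
    proof (rule Lim_null_comparison[OF _ mollify_Lp_tendsto[OF K(1) Rlim fL p]])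
      show "\<forall>\<^sub>F n in sequentially. norm (Lp_norm (lebesgue_on U) p (\<lambda>x. mollify (K n) f x - \<zeta> x *\<^sub>R u x))
         \<le> Lp_norm lborel p (\<lambda>x. mollify (K n) f x - f x)"
        using Lp_norm_restrict_le(2)[OF U(1) mollify_diff_Lp[OF K(1) fL p]] p by (simp add: f_def)
    qed
    show "(\<lambda>n. Lp_norm (lebesgue_on U) p (\<lambda>x. grad (mollify (K n) f) x - (\<zeta> x *\<^sub>R G x + outer (u x) (sgrad \<zeta> x)))) \<longlonglongrightarrow> 0"
    proof (rule Lim_null_comparison[OF _ mollify_Lp_tendsto[OF K(1) Rlim FL p]])
      have "Lp_norm (lebesgue_on U) p (\<lambda>x. grad (mollify (K n) f) x - (\<zeta> x *\<^sub>R G x + outer (u x) (sgrad \<zeta> x)))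
        = Lp_norm (lebesgue_on U) p (\<lambda>x. mollify (K n) F x - F x)" for n
        using grad by (intro Lp_norm_cong) (simp add: F_def)
      then show "\<forall>\<^sub>F n in sequentially. norm (Lp_norm (lebesgue_on U) p (\<lambda>x. grad (mollify (K n) f) x - (\<zeta> x *\<^sub>R G x + outer (u x) (sgrad \<zeta> x))))
         \<le> Lp_norm lborel p (\<lambda>x. mollify (K n) F x - F x)"
        using Lp_norm_restrict_le(2)[OF U(1) mollify_diff_Lp[OF K(1) FL p]] p by simp
    qed
  qed
qed

lemma approximable_zero: "approximable (\<lambda>x. 0)"
  unfolding smooth_limit_def
proof (intro exI[of _ "\<lambda>n x. 0"] conjI allI)
  show "smooth_field (\<lambda>x::real^'n. 0)" by (simp add: smooth_field_def smooth_const)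
  have "grad (\<lambda>x::real^'n. 0) x - (0 *\<^sub>R G x + outer (u x) (sgrad (\<lambda>x. 0) x)) = 0" for x
    by (simp add: grad_def outer_def sgrad_def vec_eq_iff)
  then show "(\<lambda>n. Lp_norm (lebesgue_on U) p (\<lambda>x. grad (\<lambda>x. 0) x - (0 *\<^sub>R G x + outer (u x) (sgrad (\<lambda>x. 0) x)))) \<longlonglongrightarrow> 0"
    by (simp add: Lp_norm_def)
qed (simp add: Lp_norm_def)

text \<open>In place of a partition of unity the complementary product
  \<open>1 - (\<Prod>a\<in>F. 1 - \<eta> a y)\<close> is used. It equals 1 as soon as one factor has
  \<open>\<eta> a y = 1\<close>, and each new index adds a term supported near a single centre, so
  no division by a sum occurs.\<close>

theorem smooth_approximation:
  assumes good: "\<And>x. x \<in> closure U \<Longrightarrow> \<exists>r. interior_ball U x r"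
  shows "smooth_limit U p u G"
proof -
  obtain r where r: "\<And>x. x \<in> closure U \<Longrightarrow> interior_ball U x (r x)" using good by metis
  have r0: "r x > 0" if "x \<in> closure U" for x using r[OF that] by (simp add: interior_ball_def)
  have "\<exists>\<eta>. smooth \<eta> \<and> (\<forall>y. dist x y < r x / 4 \<longrightarrow> \<eta> y = 1) \<and> (\<forall>y. \<eta> y \<noteq> 0 \<longrightarrow> y \<in> cball x (r x / 2))"
    if x: "x \<in> closure U" for x
  proof -
    have pos: "r x / 8 > 0" using r0[OF x] by simp
    \<comment> \<open>A ball of radius \<open>3 * r x / 8\<close>, smoothed at scale
      \<open>r x / 8\<close>: the cutoff is 1 up to distance \<open>r x / 4\<close> and 0 beyond
      \<open>r x / 2\<close>.\<close>
    obtain \<eta> where \<eta>: "smooth \<eta>" "\<And>y. ball y (r x / 8) \<subseteq> ball x (3 * r x / 8) \<Longrightarrow> \<eta> y = 1"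
      "\<And>y. ball y (r x / 8) \<inter> ball x (3 * r x / 8) = {} \<Longrightarrow> \<eta> y = 0"
      using smooth_cutoffs_exist pos bounded_ball[of x "3 * r x / 8"] borel_open[OF open_ball, of x "3 * r x / 8"] by metis
    have "\<eta> y = 1" if "dist x y < r x / 4" for y
    proof (rule \<eta>(2), rule subsetI)
      fix z assume "z \<in> ball y (r x / 8)"
      then show "z \<in> ball x (3 * r x / 8)" using that dist_triangle[of x z y] by simp
    qed
    moreover have "y \<in> cball x (r x / 2)" if "\<eta> y \<noteq> 0" for y
    proof -
      have "ball y (r x / 8) \<inter> ball x (3 * r x / 8) \<noteq> {}" using \<eta>(3)[of y] \<open>\<eta> y \<noteq> 0\<close> by blast
      then obtain z where "z \<in> ball y (r x / 8)" "z \<in> ball x (3 * r x / 8)" by blast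
      then show ?thesis using dist_triangle2[of x y z] by simp
    qed
    ultimately show ?thesis using \<eta>(1) by blast
  qed
  then obtain \<eta> where \<eta>: "\<And>x. x \<in> closure U \<Longrightarrow> smooth (\<eta> x)" 
    "\<And>x y. x \<in> closure U \<Longrightarrow> dist x y < r x / 4 \<Longrightarrow> \<eta> x y = 1" 
    "\<And>x y. x \<in> closure U \<Longrightarrow> \<eta> x y \<noteq> 0 \<Longrightarrow> y \<in> cball x (r x / 2)" by metis
  have "compact (closure U)" using U by (simp add: compact_closure)
  moreover have "closure U \<subseteq> (\<Union>x\<in>closure U. ball x (r x / 4))" using r0 by force
  ultimately obtain F where F: "F \<subseteq> closure U" "finite F" "closure U \<subseteq> (\<Union>x\<in>F. ball x (r x / 4))"
    by (elim compactE_image[of "closure U" "closure U" "\<lambda>x. ball x (r x / 4)"]) auto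
  have sp: "smooth (\<lambda>y. \<Prod>x\<in>A. (1 - \<eta> x y))" if "A \<subseteq> closure U" for A
    using that by (intro smooth_prod smooth_diff smooth_const \<eta>) auto
  have "approximable (\<lambda>y. 1 - (\<Prod>x\<in>F. (1 - \<eta> x y)))"
    using F(2,1)
  proof (induction F)
    case empty show ?case using approximable_zero by simp
  next
    case (insert a A)
    have a: "a \<in> closure U" and A: "A \<subseteq> closure U" using insert.prems by auto
    have "approximable (\<lambda>y. \<eta> a y * (\<Prod>x\<in>A. (1 - \<eta> x y)))"
      by (rule approximable_local[OF r[OF a] smooth_mult[OF \<eta>(1)[OF a] sp[OF A]], of "r a / 2"])
         (use \<eta>(3)[OF a] r0[OF a] in auto)
    \<comment> \<open>Passing from \<open>A\<close> to \<open>insert a A\<close> adds the function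
      \<open>\<eta> a\<close> times the old product, which inherits the small support of
      \<open>\<eta> a\<close>.\<close>
    then have "approximable (\<lambda>y. (1 - (\<Prod>x\<in>A. (1 - \<eta> x y))) + \<eta> a y * (\<Prod>x\<in>A. (1 - \<eta> x y)))"
      using insert.IH[OF A] by (intro approximable_add smooth_diff smooth_const smooth_mult \<eta>(1)[OF a] sp[OF A])
    also have "(\<lambda>y. (1 - (\<Prod>x\<in>A. (1 - \<eta> x y))) + \<eta> a y * (\<Prod>x\<in>A. (1 - \<eta> x y))) = (\<lambda>y. 1 - (\<Prod>x\<in>insert a A. (1 - \<eta> x y)))"
      using insert.hyps by (simp add: fun_eq_iff algebra_simps)
    finally show ?case .
  qed
  note lim = this
  have one: "1 - (\<Prod>a\<in>F. (1 - \<eta> a x)) = 1" if "x \<in> U" for x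
  proof -
    have "x \<in> (\<Union>x\<in>F. ball x (r x / 4))" using F(3) subsetD[OF closure_subset \<open>x \<in> U\<close>] by blast
    then obtain a where a: "a \<in> F" "dist a x < r a / 4" by auto
    then have "\<eta> a x = 1" using F(1) by (intro \<eta>(2)) auto
    then have "(\<Prod>a\<in>F. (1 - \<eta> a x)) = 0" using a(1) F(2) by (intro prod_zero) auto
    then show ?thesis by simp
  qed
  have sg: "outer (u x) (sgrad (\<lambda>y. 1 - (\<Prod>a\<in>F. (1 - \<eta> a y))) x) = 0" if x: "x \<in> U" for x
  proof -
    have "partial j (\<lambda>y. 1 - (\<Prod>a\<in>F. (1 - \<eta> a y))) x = partial j (\<lambda>y. 1) x" for j
      by (rule partial_cong_open[OF U(1) x]) (rule one)
    then show ?thesis by (simp add: outer_def sgrad_def vec_eq_iff)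
  qed
  show ?thesis by (rule iffD1[OF smooth_limit_cong lim]) (simp_all only: one sg scaleR_one add_0_right)
qed

end

section \<open>Lipschitz domains satisfy the interior cone condition\<close>

lemma lipschitz_boundary_chart:
  assumes "lipschitz_boundary U" "x0 \<in> frontier U"
  obtains e \<gamma> L r where "norm e = 1" "0 < r" "L \<ge> 0" "L-lipschitz_on {y. y \<bullet> e = 0} \<gamma>"
    "\<And>x. x \<in> ball x0 r \<Longrightarrow> x \<in> U \<longleftrightarrow> \<gamma> (x - (x \<bullet> e) *\<^sub>R e) < x \<bullet> e"
proof -
  obtain e \<gamma> L r where *: "norm e = 1" "0 < r" "L-lipschitz_on {y. y \<bullet> e = 0} \<gamma>"
    "U \<inter> ball x0 r = {x \<in> ball x0 r. \<gamma> (x - (x \<bullet> e) *\<^sub>R e) < x \<bullet> e}"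
    using assms unfolding lipschitz_boundary_def by blast
  show thesis
    by (rule that[OF *(1,2) lipschitz_on_nonneg[OF *(3)] *(3)]) (use *(4) in blast)
qed

lemma projection_norm_le:
  fixes e x :: "'a::real_inner"
  assumes "norm e = 1"
  shows "norm (x - (x \<bullet> e) *\<^sub>R e) \<le> norm x" "(x - (x \<bullet> e) *\<^sub>R e) \<bullet> e = 0"
proof -
  have ee: "e \<bullet> e = 1" using assms by (simp add: dot_square_norm)
  show "(x - (x \<bullet> e) *\<^sub>R e) \<bullet> e = 0" by (simp add: inner_diff_left ee)
  have "(norm (x - (x \<bullet> e) *\<^sub>R e))\<^sup>2 = (norm x)\<^sup>2 - (x \<bullet> e)\<^sup>2"
    unfolding power2_norm_eq_inner by (simp add: inner_diff_left inner_diff_right ee inner_commute power2_eq_square)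
  then have "(norm (x - (x \<bullet> e) *\<^sub>R e))\<^sup>2 \<le> (norm x)\<^sup>2" by simp
  then show "norm (x - (x \<bullet> e) *\<^sub>R e) \<le> norm x" by (rule power2_le_imp_le) simp
qed

lemma lipschitz_graph_cone:
  fixes e :: "real ^ 'n"
  assumes e: "norm e = 1" and L: "L-lipschitz_on {y. y \<bullet> e = 0} \<gamma>"
  shows "\<bar>\<gamma> ((x + v) - ((x + v) \<bullet> e) *\<^sub>R e) - \<gamma> (x - (x \<bullet> e) *\<^sub>R e)\<bar> \<le> L * norm (v - (v \<bullet> e) *\<^sub>R e)"
proof -
  have "dist (\<gamma> ((x + v) - ((x + v) \<bullet> e) *\<^sub>R e)) (\<gamma> (x - (x \<bullet> e) *\<^sub>R e)) 
     \<le> L * dist ((x + v) - ((x + v) \<bullet> e) *\<^sub>R e) (x - (x \<bullet> e) *\<^sub>R e)"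
    using projection_norm_le(2)[OF e] by (intro lipschitz_onD[OF L]) auto
  also have "dist ((x + v) - ((x + v) \<bullet> e) *\<^sub>R e) (x - (x \<bullet> e) *\<^sub>R e) = norm (v - (v \<bullet> e) *\<^sub>R e)"
    by (simp add: dist_norm inner_add_left algebra_simps)
  finally show ?thesis by (simp add: dist_real_def)
qed

lemma interior_ball_exists:
  fixes U :: "(real ^ 'n) set"
  assumes U: "open U" "lipschitz_boundary U" and x0: "x0 \<in> closure U"
  shows "\<exists>r. interior_ball U x0 r"
proof (cases "x0 \<in> U")
  case True
  then obtain r where "r > 0" "ball x0 r \<subseteq> U" using U(1) open_contains_ball by metis
  then show ?thesis unfolding interior_ball_def 
    by (intro exI[of _ r] conjI exI[of _ "0::real^'n"] exI[of _ "1::real"]) auto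
next
  case False
  then have "x0 \<in> frontier U" using x0 U(1) by (simp add: frontier_def interior_open)
  then obtain e \<gamma> L r where c: "norm e = 1" "0 < r" "L \<ge> 0" "L-lipschitz_on {y. y \<bullet> e = 0} \<gamma>"
    "\<And>x. x \<in> ball x0 r \<Longrightarrow> x \<in> U \<longleftrightarrow> \<gamma> (x - (x \<bullet> e) *\<^sub>R e) < x \<bullet> e"
    by (rule lipschitz_boundary_chart[OF U(2)]) (rule that; assumption)
  \<comment> \<open>With this \<open>\<delta>\<close> the climb \<open>1 - \<delta>\<close> along
    \<open>e\<close> exceeds \<open>L * \<delta>\<close>, the most that the graph can rise under the
    horizontal part of the move.\<close>
  define \<delta> where "\<delta> = 1 / (2 * (1 + L))"
  have \<delta>: "0 < \<delta>" "\<delta> \<le> 1" "\<delta> + L * \<delta> = 1 / 2" using c(3) by (auto simp: \<delta>_def field_simps)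
  have ee: "e \<bullet> e = 1" using c(1) by (simp add: dot_square_norm)
  \<comment> \<open>Directions have norm at most 2, so moves with \<open>t < r / 4\<close> are
    shorter than \<open>r / 2\<close>; an end point in the half ball therefore forces the starting
    point into the chart.\<close>
  have "y + t *\<^sub>R z \<in> U" if y: "y \<in> U" and t: "0 < t" "t < r / 4" and z: "z \<in> cball e \<delta>" and b: "y + t *\<^sub>R z \<in> ball x0 (r / 2)" for y t z
  proof -
    have ze: "norm (z - e) \<le> \<delta>" using z by (simp add: dist_norm norm_minus_commute)
    have "norm z \<le> norm e + norm (z - e)" using norm_triangle_sub[of z e] by simp
    then have nz: "norm z \<le> 2" using ze \<delta> c(1) by linarith
    have "norm (t *\<^sub>R z) \<le> t * 2" using t nz by simp
    moreover have "dist (y + t *\<^sub>R z) y = norm (t *\<^sub>R z)" by (simp add: dist_norm)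
    ultimately have "dist (y + t *\<^sub>R z) y < r / 2" using t by linarith
    then have yb: "y \<in> ball x0 r" using b dist_triangle[of x0 y "y + t *\<^sub>R z"] by simp
    have yb': "y + t *\<^sub>R z \<in> ball x0 r" using b c(2) by simp
    have "z - (z \<bullet> e) *\<^sub>R e = (z - e) - ((z - e) \<bullet> e) *\<^sub>R e" by (simp add: inner_diff_left ee algebra_simps)
    then have "norm (z - (z \<bullet> e) *\<^sub>R e) \<le> norm (z - e)" using projection_norm_le(1)[OF c(1), of "z - e"] by metis
    then have pz: "norm (z - (z \<bullet> e) *\<^sub>R e) \<le> \<delta>" using ze by linarith
    have "\<bar>(z - e) \<bullet> e\<bar> \<le> \<delta>" using Cauchy_Schwarz_ineq2[of "z - e" e] ze c(1) by simp
    then have ze1: "z \<bullet> e \<ge> 1 - \<delta>" by (simp add: inner_diff_left ee)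
    have "t *\<^sub>R z - ((t *\<^sub>R z) \<bullet> e) *\<^sub>R e = t *\<^sub>R (z - (z \<bullet> e) *\<^sub>R e)" by (simp add: scaleR_diff_right)
    then have "norm (t *\<^sub>R z - ((t *\<^sub>R z) \<bullet> e) *\<^sub>R e) \<le> t * \<delta>" using t pz by simp
    then have "L * norm (t *\<^sub>R z - ((t *\<^sub>R z) \<bullet> e) *\<^sub>R e) \<le> L * (t * \<delta>)" using c(3) by (rule mult_left_mono)
    then have "\<gamma> ((y + t *\<^sub>R z) - ((y + t *\<^sub>R z) \<bullet> e) *\<^sub>R e) \<le> \<gamma> (y - (y \<bullet> e) *\<^sub>R e) + L * (t * \<delta>)"
      using lipschitz_graph_cone[OF c(1,4), of y "t *\<^sub>R z"] by linarith
    also have "\<dots> < y \<bullet> e + L * (t * \<delta>)" using c(5)[OF yb] y by simp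
    also have "\<dots> \<le> y \<bullet> e + t * (z \<bullet> e)"
    proof -
      have "t * (L * \<delta>) \<le> t * (z \<bullet> e)" using ze1 \<delta>(3) t by (intro mult_left_mono) auto
      then show ?thesis by (simp add: ac_simps)
    qed
    finally show ?thesis using c(5)[OF yb'] by (simp add: inner_add_left)
  qed
  then show ?thesis unfolding interior_ball_def using c(2) \<delta>(1)
    by (intro exI[of _ "r/2"] conjI exI[of _ e] exI[of _ \<delta>] exI[of _ "r/4"]) auto
qed

text \<open>The gradient is carried along explicitly, so that sums and limits need no choice. The
  chosen \<open>weak_gradient\<close> matters only inside \<open>W1p_norm\<close> and
  \<open>normal_trace\<close>.\<close>

definition W1p_pair :: "(real ^ 'n) set \<Rightarrow> real \<Rightarrow> 'n vfield \<Rightarrow> 'n mfield \<Rightarrow> bool" where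
  "W1p_pair U p u G \<longleftrightarrow> u \<in> Lp (lebesgue_on U) p \<and> G \<in> Lp (lebesgue_on U) p \<and> is_weak_gradient U u G"

text \<open>Smoothness on the whole space, and not merely in \<open>U\<close>, is what makes the
  trace of the approximating fields known: they are continuous up to the boundary.\<close>

theorem W1p_smooth_dense:
  fixes U :: "(real ^ 'n) set"
  assumes dom: "open U" "bounded U" "lipschitz_boundary U" and p: "p \<ge> 1" and uG: "W1p_pair U p u G"
  obtains v where "\<And>n. smooth_field (v n)" "Lp_lim (lebesgue_on U) p v u"
     "Lp_lim (lebesgue_on U) p (\<lambda>n. grad (v n)) G"
proof -
  have uL: "u \<in> Lp (lebesgue_on U) p" and GL: "G \<in> Lp (lebesgue_on U) p" and w: "is_weak_gradient U u G"
    using uG by (auto simp: W1p_pair_def)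
  obtain u' where u': "u' \<in> borel_measurable borel" "\<And>x. x \<notin> U \<Longrightarrow> u' x = 0" "AE x in lebesgue_on U. u x = u' x"
    by (rule borel_representative[OF dom(1) Lp_measurable[OF uL]]) (rule that; assumption)
  obtain G' where G': "G' \<in> borel_measurable borel" "\<And>x. x \<notin> U \<Longrightarrow> G' x = 0" "AE x in lebesgue_on U. G x = G' x"
    by (rule borel_representative[OF dom(1) Lp_measurable[OF GL]]) (rule that; assumption)
  have u'L: "u' \<in> Lp (lebesgue_on U) p" by (rule Lp_cong_AE[OF uL borel_imp_lebesgue_on_measurable[OF u'(1)] u'(3)])
  have G'L: "G' \<in> Lp (lebesgue_on U) p" by (rule Lp_cong_AE[OF GL borel_imp_lebesgue_on_measurable[OF G'(1)] G'(3)])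
  interpret lborel_weak_gradient U p u' G'
  proof
    show "u' \<in> Lp lborel p" using lebesgue_on_Lp_borel(1)[OF dom(1) u'(1,2)] u'L by simp
    show "G' \<in> Lp lborel p" using lebesgue_on_Lp_borel(1)[OF dom(1) G'(1,2)] G'L by simp
    fix \<phi> i j assume \<phi>: "\<phi> \<in> test_functions U"
    have m: "\<phi> \<in> borel_measurable borel" "partial j \<phi> \<in> borel_measurable borel"
      by (intro borel_measurable_continuous_onI smooth_continuous smooth_partial test_functionsD(1)[OF \<phi>])+
    have mu: "(\<lambda>x. u' x $ i * partial j \<phi> x) \<in> borel_measurable borel"
      using u'(1) m by (intro borel_measurable_times) (auto intro: measurable_compose[OF _ borel_measurable_nth])
    have mG: "(\<lambda>x. G' x $ i $ j * \<phi> x) \<in> borel_measurable borel"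
      using m(1) by (intro borel_measurable_times borel_measurable_continuous_on[OF _ G'(1), of "\<lambda>A. A $ i $ j"]
          continuous_on_component continuous_on_id)
    have Lu: "(\<lambda>x. u x $ i * partial j \<phi> x) \<in> borel_measurable (lebesgue_on U)"
      using test_function_integrable(2)[OF dom(1) loc_integrable_component \<phi>] w by (auto simp: is_weak_gradient_def)
    have LG: "(\<lambda>x. G x $ i $ j * \<phi> x) \<in> borel_measurable (lebesgue_on U)"
      using test_function_integrable(1)[OF dom(1) loc_integrable_component[OF loc_integrable_component] \<phi>] w by (auto simp: is_weak_gradient_def)
    have "(LINT x|lborel. u' x $ i * partial j \<phi> x) = (LINT x|lebesgue_on U. u' x $ i * partial j \<phi> x)"
      by (rule lebesgue_on_integral_borel(1)[OF dom(1) mu, symmetric]) (simp add: u'(2))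
    also have "\<dots> = (LINT x|lebesgue_on U. u x $ i * partial j \<phi> x)"
      by (rule integral_cong_AE[OF borel_imp_lebesgue_on_measurable[OF mu] Lu]) (use u'(3) in \<open>auto elim: eventually_mono\<close>)
    also have "\<dots> = - (LINT x|lebesgue_on U. G x $ i $ j * \<phi> x)" using w \<phi> by (simp add: is_weak_gradient_def)
    also have "(LINT x|lebesgue_on U. G x $ i $ j * \<phi> x) = (LINT x|lebesgue_on U. G' x $ i $ j * \<phi> x)"
      by (rule integral_cong_AE[OF LG borel_imp_lebesgue_on_measurable[OF mG]]) (use G'(3) in \<open>auto elim: eventually_mono\<close>)
    also have "\<dots> = (LINT x|lborel. G' x $ i $ j * \<phi> x)"
      by (rule lebesgue_on_integral_borel(1)[OF dom(1) mG]) (simp add: G'(2))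
    finally show "(LINT x|lborel. u' x $ i * partial j \<phi> x) = - (LINT x|lborel. G' x $ i $ j * \<phi> x)" .
  qed (use dom p u' G' in auto)
  have "smooth_limit U p u' G'" by (rule smooth_approximation) (rule interior_ball_exists[OF dom(1,3)])
  then obtain v where v: "\<forall>n. smooth_field (v n)" "(\<lambda>n. Lp_norm (lebesgue_on U) p (\<lambda>x. v n x - u' x)) \<longlonglongrightarrow> 0"
     "(\<lambda>n. Lp_norm (lebesgue_on U) p (\<lambda>x. grad (v n) x - G' x)) \<longlonglongrightarrow> 0"
    unfolding smooth_limit_def by (elim exE conjE)
  have p0: "p > 0" using p by simp
  have vm: "v n \<in> borel_measurable (lebesgue_on U)" "grad (v n) \<in> borel_measurable (lebesgue_on U)" for n
    by (intro Lp_measurable[where p = p] continuous_Lp_bounded_domain[OF dom(1,2) _ p0] smooth_field_continuous smooth_field_grad_continuous spec[OF v(1)])+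
  note um = Lp_measurable[OF uL] Lp_measurable[OF u'L] Lp_measurable[OF GL] Lp_measurable[OF G'L]
  have "Lp_norm (lebesgue_on U) p (\<lambda>x. v n x - u x) = Lp_norm (lebesgue_on U) p (\<lambda>x. v n x - u' x)"
       "Lp_norm (lebesgue_on U) p (\<lambda>x. grad (v n) x - G x) = Lp_norm (lebesgue_on U) p (\<lambda>x. grad (v n) x - G' x)" for n
    using u'(3) G'(3) by (intro Lp_norm_cong_AE borel_measurable_diff vm um; auto elim: eventually_mono)+
  then show thesis using that[of v] v by simp
qed

section \<open>Hausdorff measure\<close>

definition hausdorff_weight :: "nat \<Rightarrow> 'a::metric_space set \<Rightarrow> ennreal" where
  "hausdorff_weight m C = (if C = {} then 0 else ennreal (unit_ball_vol (real m) * (diameter C / 2) ^ m))"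

definition hausdorff_cover :: "real \<Rightarrow> 'a::metric_space set \<Rightarrow> (nat \<Rightarrow> 'a set) \<Rightarrow> bool" where
  "hausdorff_cover \<delta> A C \<longleftrightarrow> A \<subseteq> (\<Union>i. C i) \<and> (\<forall>i. bounded (C i) \<and> diameter (C i) \<le> \<delta>)"

lemma hausdorff_pre_alt: "hausdorff_pre m \<delta> A = (INF C \<in> {C. hausdorff_cover \<delta> A C}. \<Sum>i. hausdorff_weight m (C i))"
  unfolding hausdorff_pre_def hausdorff_weight_def hausdorff_cover_def ..

lemma hausdorff_pre_le: "hausdorff_cover \<delta> A C \<Longrightarrow> hausdorff_pre m \<delta> A \<le> (\<Sum>i. hausdorff_weight m (C i))"
  unfolding hausdorff_pre_alt by (rule INF_lower) simp

lemma hausdorff_pre_greatest: 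
  "(\<And>C. hausdorff_cover \<delta> A C \<Longrightarrow> x \<le> (\<Sum>i. hausdorff_weight m (C i))) \<Longrightarrow> x \<le> hausdorff_pre m \<delta> A"
  unfolding hausdorff_pre_alt by (rule INF_greatest) simp

lemma hausdorff_pre_mono: "A \<subseteq> B \<Longrightarrow> hausdorff_pre m \<delta> A \<le> hausdorff_pre m \<delta> B"
  by (rule hausdorff_pre_greatest, rule hausdorff_pre_le) (auto simp: hausdorff_cover_def)

lemma hausdorff_pre_antimono: "\<delta> \<le> \<delta>' \<Longrightarrow> hausdorff_pre m \<delta>' A \<le> hausdorff_pre m \<delta> A"
  by (rule hausdorff_pre_greatest, rule hausdorff_pre_le) (auto simp: hausdorff_cover_def intro: order_trans)

lemma hausdorff_pre_empty: "\<delta> > 0 \<Longrightarrow> hausdorff_pre m \<delta> {} = 0"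
  using hausdorff_pre_le[of \<delta> "{}" "\<lambda>_. {}" m] by (simp add: hausdorff_cover_def hausdorff_weight_def)

lemma hausdorff_pre_countably_subadditive:
  fixes A :: "nat \<Rightarrow> 'a::metric_space set"
  shows "hausdorff_pre m \<delta> (\<Union>n. A n) \<le> (\<Sum>n. hausdorff_pre m \<delta> (A n))"
proof (rule ennreal_le_epsilon)
  fix e :: real assume "0 < e" "(\<Sum>n. hausdorff_pre m \<delta> (A n)) < top"
  then have *: "\<And>n. hausdorff_pre m \<delta> (A n) < hausdorff_pre m \<delta> (A n) + e * (1/2)^Suc n"
    by (auto simp add: less_top dest!: ennreal_suminf_lessD)
  have "\<exists>C. hausdorff_cover \<delta> (A n) C \<and> (\<Sum>i. hausdorff_weight m (C i)) < hausdorff_pre m \<delta> (A n) + e * (1/2)^Suc n" for n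
    using *[of n] unfolding hausdorff_pre_alt[of m \<delta> "A n"] by (subst (asm) INF_less_iff) auto
  then obtain B where B: "\<And>n. hausdorff_cover \<delta> (A n) (B n)"
    "\<And>n. (\<Sum>i. hausdorff_weight m (B n i)) < hausdorff_pre m \<delta> (A n) + e * (1/2)^Suc n" by metis
  define C where "C = case_prod B o prod_decode"
  have "(\<Union>n. A n) \<subseteq> (\<Union>i. C i)"
  proof
    fix x assume "x \<in> (\<Union>n. A n)"
    then obtain n i where "x \<in> B n i" using B(1) unfolding hausdorff_cover_def by blast
    then have "x \<in> C (prod_encode (n, i))" by (simp add: C_def)
    then show "x \<in> (\<Union>i. C i)" by blast
  qed
  then have "hausdorff_cover \<delta> (\<Union>n. A n) C"
    using B(1) unfolding hausdorff_cover_def C_def by (auto simp: case_prod_beta)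
  then have "hausdorff_pre m \<delta> (\<Union>n. A n) \<le> (\<Sum>i. hausdorff_weight m (C i))" by (rule hausdorff_pre_le)
  also have "\<dots> = (\<Sum>i. (\<lambda>z. hausdorff_weight m (case_prod B z)) (prod_decode i))" by (simp add: C_def)
  also have "\<dots> = (\<Sum>n. \<Sum>i. hausdorff_weight m (B n i))"
    by (rule suminf_ennreal_2dimen) simp
  also have "\<dots> \<le> (\<Sum>n. hausdorff_pre m \<delta> (A n) + e * (1/2) ^ Suc n)"
    using B(2) by (intro suminf_le less_imp_le) auto
  also have "\<dots> = (\<Sum>n. hausdorff_pre m \<delta> (A n)) + (\<Sum>n. ennreal e * ennreal ((1/2) ^ Suc n))"
    using \<open>0 < e\<close> by (subst suminf_add[symmetric]) (auto simp del: ennreal_suminf_cmult simp add: ennreal_mult[symmetric])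
  also have "\<dots> = (\<Sum>n. hausdorff_pre m \<delta> (A n)) + e"
    unfolding ennreal_suminf_cmult by (subst suminf_ennreal_eq[OF zero_le_power power_half_series]) auto
  finally show "hausdorff_pre m \<delta> (\<Union>n. A n) \<le> (\<Sum>n. hausdorff_pre m \<delta> (A n)) + e" .
qed

lemma hausdorff_pre_le_outer: "\<delta> > 0 \<Longrightarrow> hausdorff_pre m \<delta> A \<le> hausdorff_outer m A"
  unfolding hausdorff_outer_def by (rule SUP_upper) simp

lemma hausdorff_outer_mono: "A \<subseteq> B \<Longrightarrow> hausdorff_outer m A \<le> hausdorff_outer m B"
  unfolding hausdorff_outer_def by (rule SUP_mono) (use hausdorff_pre_mono in blast)

lemma hausdorff_outer_empty: "hausdorff_outer m {} = 0"
  unfolding hausdorff_outer_def by (simp add: hausdorff_pre_empty)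

lemma hausdorff_outer_countably_subadditive:
  "hausdorff_outer m (\<Union>n. A n) \<le> (\<Sum>n. hausdorff_outer m (A n))"
proof -
  have "hausdorff_pre m \<delta> (\<Union>n. A n) \<le> (\<Sum>n. hausdorff_outer m (A n))" if "\<delta> > 0" for \<delta>
  proof -
    have "(\<Sum>n. hausdorff_pre m \<delta> (A n)) \<le> (\<Sum>n. hausdorff_outer m (A n))"
      by (intro suminf_le hausdorff_pre_le_outer that) auto
    then show ?thesis using hausdorff_pre_countably_subadditive order_trans by blast
  qed
  then show ?thesis unfolding hausdorff_outer_def[of m "\<Union>n. A n"] by (intro SUP_least) auto
qed

lemma hausdorff_outer_subadditive: "hausdorff_outer m (A \<union> B) \<le> hausdorff_outer m A + hausdorff_outer m B"
proof -
  define C where "C n = (if n = 0 then A else if n = 1 then B else {})" for n :: nat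
  have "A \<union> B = (\<Union>n. C n)" by (auto simp: C_def split: if_splits)
  then have "hausdorff_outer m (A \<union> B) \<le> (\<Sum>n. hausdorff_outer m (C n))"
    using hausdorff_outer_countably_subadditive[of m C] by simp
  also have "\<dots> = (\<Sum>n\<in>{0,1}. hausdorff_outer m (C n))"
    by (rule suminf_finite) (auto simp: C_def hausdorff_outer_empty)
  finally show ?thesis by (simp add: C_def)
qed

text \<open>At scales below the distance no covering set meets both \<open>A\<close> and
  \<open>B\<close>, so every cover of the union splits into two without loss.\<close>

lemma hausdorff_outer_metric:
  assumes d: "d > 0" "\<And>a b. a \<in> A \<Longrightarrow> b \<in> B \<Longrightarrow> dist a b \<ge> d"
  shows "hausdorff_outer m A + hausdorff_outer m B \<le> hausdorff_outer m (A \<union> B)"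
proof -
  have small: "hausdorff_pre m \<delta> A + hausdorff_pre m \<delta> B \<le> hausdorff_pre m \<delta> (A \<union> B)" if \<delta>: "\<delta> > 0" "\<delta> < d" for \<delta>
  proof (rule hausdorff_pre_greatest)
    fix C assume C: "hausdorff_cover \<delta> (A \<union> B) C"
    define CA where "CA i = (if C i \<inter> A = {} then {} else C i)" for i
    define CB where "CB i = (if C i \<inter> A = {} then C i else {})" for i
    have dis: "C i \<inter> B = {}" if ne: "C i \<inter> A \<noteq> {}" for i
    proof (rule ccontr)
      assume "C i \<inter> B \<noteq> {}"
      then obtain a b where ab: "a \<in> C i" "a \<in> A" "b \<in> C i" "b \<in> B" using ne by blast
      then have "dist a b \<le> diameter (C i)" using C by (intro diameter_bounded_bound) (auto simp: hausdorff_cover_def)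
      also have "\<dots> \<le> \<delta>" using C by (simp add: hausdorff_cover_def)
      finally show False using d(2)[OF ab(2,4)] \<delta> by simp
    qed
    have "hausdorff_cover \<delta> A CA"
      unfolding hausdorff_cover_def
    proof
      show "A \<subseteq> (\<Union>i. CA i)"
      proof
        fix x assume x: "x \<in> A"
        then obtain i where "x \<in> C i" using C by (auto simp: hausdorff_cover_def)
        then have "x \<in> CA i" using x by (auto simp: CA_def)
        then show "x \<in> (\<Union>i. CA i)" by blast
      qed
    qed (use C \<delta> in \<open>auto simp: CA_def hausdorff_cover_def\<close>)
    moreover have "hausdorff_cover \<delta> B CB"
      unfolding hausdorff_cover_def
    proof
      show "B \<subseteq> (\<Union>i. CB i)"
      proof
        fix x assume x: "x \<in> B"
        then obtain i where "x \<in> C i" using C by (auto simp: hausdorff_cover_def)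
        then have "x \<in> CB i" using x dis[of i] by (auto simp: CB_def)
        then show "x \<in> (\<Union>i. CB i)" by blast
      qed
    qed (use C \<delta> in \<open>auto simp: CB_def hausdorff_cover_def\<close>)
    ultimately have "hausdorff_pre m \<delta> A + hausdorff_pre m \<delta> B 
       \<le> (\<Sum>i. hausdorff_weight m (CA i)) + (\<Sum>i. hausdorff_weight m (CB i))"
      by (intro add_mono hausdorff_pre_le)
    also have "\<dots> = (\<Sum>i. hausdorff_weight m (CA i) + hausdorff_weight m (CB i))"
      by (rule suminf_add) auto
    also have "(\<lambda>i. hausdorff_weight m (CA i) + hausdorff_weight m (CB i)) = (\<lambda>i. hausdorff_weight m (C i))"
      by (auto simp: CA_def CB_def hausdorff_weight_def fun_eq_iff)
    finally show "hausdorff_pre m \<delta> A + hausdorff_pre m \<delta> B \<le> (\<Sum>i. hausdorff_weight m (C i))" .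
  qed
  have "hausdorff_pre m \<delta> A + hausdorff_pre m \<delta>' B \<le> hausdorff_outer m (A \<union> B)" if \<delta>: "\<delta> > 0" "\<delta>' > 0" for \<delta> \<delta>'
  proof -
    define \<eta> where "\<eta> = min (min \<delta> \<delta>') (d / 2)"
    have \<eta>: "\<eta> > 0" "\<eta> < d" "\<eta> \<le> \<delta>" "\<eta> \<le> \<delta>'" using \<delta> d(1) by (auto simp: \<eta>_def)
    have "hausdorff_pre m \<delta> A + hausdorff_pre m \<delta>' B \<le> hausdorff_pre m \<eta> A + hausdorff_pre m \<eta> B"
      by (intro add_mono hausdorff_pre_antimono \<eta>)
    also have "\<dots> \<le> hausdorff_pre m \<eta> (A \<union> B)" by (rule small[OF \<eta>(1,2)])
    also have "\<dots> \<le> hausdorff_outer m (A \<union> B)" by (rule hausdorff_pre_le_outer[OF \<eta>(1)])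
    finally show ?thesis .
  qed
  then show ?thesis
    unfolding hausdorff_outer_def[of m A] hausdorff_outer_def[of m B]
    by (subst ennreal_SUP_add_left[symmetric], simp, subst ennreal_SUP_add_right, simp) (intro SUP_least, simp)
qed

lemma infdist_diff_le_dist: "infdist x F - infdist y F \<le> dist x y"
  using infdist_triangle[of x F y] by simp

text \<open>The set \<open>T - F\<close> is exhausted by the sets \<open>A n\<close> at distance at least \<open>1 / (n + 1)\<close> from \<open>F\<close>; the
  layers \<open>D k\<close> between them have summable measure because every second layer is at positive distance
  from the previous ones.\<close>

lemma hausdorff_outer_closed_split:
  fixes F T :: "'a::metric_space set"
  assumes F: "closed F" "F \<noteq> {}"
  shows "hausdorff_outer m (T \<inter> F) + hausdorff_outer m (T - F) \<le> hausdorff_outer m T"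
proof (cases "hausdorff_outer m T = top")
  case False
  let ?\<mu> = "hausdorff_outer m"
  define A where "A n = {x \<in> T - F. infdist x F \<ge> 1 / real (Suc n)}" for n
  define D where "D k = A (Suc k) - A k" for k
  have DA: "x \<in> D k \<Longrightarrow> 1 / real (k + 2) \<le> infdist x F \<and> infdist x F < 1 / real (k + 1)" for x k
    by (auto simp: D_def A_def)
  have DT: "D k \<subseteq> T" for k by (auto simp: D_def A_def)
  have alt: "(\<Sum>k<N. ?\<mu> (D (2 * k + c))) \<le> ?\<mu> (\<Union>k<N. D (2 * k + c))" for N c
  proof (induction N)
    case (Suc N)
    have "(\<Sum>k<Suc N. ?\<mu> (D (2 * k + c))) \<le> ?\<mu> (\<Union>k<N. D (2 * k + c)) + ?\<mu> (D (2 * N + c))"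
      using Suc by (simp add: add_right_mono)
    also have "\<dots> \<le> ?\<mu> ((\<Union>k<N. D (2 * k + c)) \<union> D (2 * N + c))"
    proof (cases "N = 0")
      case True then show ?thesis by (simp add: hausdorff_outer_empty)
    next
      case N: False
      show ?thesis
      proof (rule hausdorff_outer_metric)
        have "1 / real (2 * N + c + 1) < 1 / real (2 * N + c)"
          using N by (intro divide_strict_left_mono) auto
        then show "1 / real (2 * N + c) - 1 / real (2 * N + c + 1) > 0" by simp
        fix x y assume x: "x \<in> (\<Union>k<N. D (2 * k + c))" and y: "y \<in> D (2 * N + c)"
        then obtain k where k: "k < N" "x \<in> D (2 * k + c)" by blast
        have "1 / real (2 * N + c) \<le> 1 / real (2 * k + c + 2)" using k(1) by (intro divide_left_mono) auto
        also have "\<dots> \<le> infdist x F" using DA[OF k(2)] by simp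
        finally have "1 / real (2 * N + c) \<le> infdist x F" .
        moreover have "infdist y F < 1 / real (2 * N + c + 1)" using DA[OF y] by simp
        ultimately show "1 / real (2 * N + c) - 1 / real (2 * N + c + 1) \<le> dist x y"
          using infdist_diff_le_dist[of x F y] by linarith
      qed
    qed
    also have "(\<Union>k<N. D (2 * k + c)) \<union> D (2 * N + c) = (\<Union>k<Suc N. D (2 * k + c))"
      by (auto simp: less_Suc_eq)
    finally show ?case .
  qed (simp add: hausdorff_outer_empty)
  have altT: "(\<Sum>k<N. ?\<mu> (D (2 * k + c))) \<le> ?\<mu> T" for N c
    by (rule order_trans[OF alt]) (intro hausdorff_outer_mono UN_least DT)
  have Dfin: "?\<mu> (D k) < top" for k
    using hausdorff_outer_mono[OF DT, of m k] False by (simp add: less_top order_le_less_trans)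
  define d where "d k = enn2real (?\<mu> (D k))" for k
  have d: "?\<mu> (D k) = ennreal (d k)" "d k \<ge> 0" for k using Dfin[of k] by (auto simp: d_def)
  define t where "t = enn2real (?\<mu> T)"
  have t: "?\<mu> T = ennreal t" "t \<ge> 0" using False by (auto simp: t_def less_top)
  have half: "(\<Sum>k<N. d (2 * k + c)) \<le> t" for N c
  proof -
    have "ennreal (\<Sum>k<N. d (2 * k + c)) = (\<Sum>k<N. ?\<mu> (D (2 * k + c)))" using d by (simp add: sum_ennreal)
    then show ?thesis using altT[of c N] altT[of N c] t d by (simp add: sum_nonneg)
  qed
  have "summable d"
  proof (rule summableI_nonneg_bounded[where x = "2 * t"])
    fix n
    have "(\<Sum>k<n. d k) \<le> (\<Sum>k<2*n. d k)" using d(2) by (intro sum_mono2) auto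
    also have "\<dots> = (\<Sum>k<n. d (2 * k + 0)) + (\<Sum>k<n. d (2 * k + 1))"
      by (induction n) auto
    also have "\<dots> \<le> 2 * t" using half[of 0 n] half[of 1 n] half[of n 0] half[of n 1] by linarith
    finally show "(\<Sum>k<n. d k) \<le> 2 * t" .
  qed (rule d)
  have main: "?\<mu> (T \<inter> F) + ?\<mu> (T - F) \<le> ?\<mu> T + ennreal (\<Sum>k. d (k + n))" for n
  proof -
    have cover: "T - F \<subseteq> A n \<union> (\<Union>k. D (k + n))"
    proof
      fix x assume x: "x \<in> T - F"
      then have "infdist x F > 0" using F in_closed_iff_infdist_zero[OF F, of x] infdist_nonneg[of x F] by (simp add: order_less_le)
      then obtain N where N: "1 / real (Suc N) < infdist x F" using nat_approx_posE by blast
      then have xN: "x \<in> A N" using x by (simp add: A_def)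
      define k where "k = (LEAST k. x \<in> A k)"
      have k: "x \<in> A k" unfolding k_def using xN by (rule LeastI)
      have lt: "x \<notin> A j" if "j < k" for j using that not_less_Least unfolding k_def by blast
      show "x \<in> A n \<union> (\<Union>k. D (k + n))"
      proof (cases "k \<le> n")
        case True
        have "1 / real (Suc n) \<le> 1 / real (Suc k)" using True by (intro divide_left_mono) auto
        then have "x \<in> A n" using k by (auto simp: A_def)
        then show ?thesis by blast
      next
        case False
        then have "x \<in> D (k - 1)" using k lt[of "k - 1"] by (simp add: D_def)
        moreover have "k - 1 = (k - 1 - n) + n" using False by simp
        ultimately show ?thesis by (metis UN_I UNIV_I UnI2)
      qed
    qed
    have "?\<mu> (T - F) \<le> ?\<mu> (A n) + ?\<mu> (\<Union>k. D (k + n))"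
      using hausdorff_outer_mono[OF cover] hausdorff_outer_subadditive order_trans by blast
    also have "?\<mu> (\<Union>k. D (k + n)) \<le> (\<Sum>k. ?\<mu> (D (k + n)))" by (rule hausdorff_outer_countably_subadditive)
    also have "(\<Sum>k. ?\<mu> (D (k + n))) = ennreal (\<Sum>k. d (k + n))"
      unfolding d(1) using d(2) summable_ignore_initial_segment[OF \<open>summable d\<close>, of n] by (intro suminf_ennreal2) auto
    finally have 1: "?\<mu> (T - F) \<le> ?\<mu> (A n) + ennreal (\<Sum>k. d (k + n))" by (simp add: add_left_mono)
    have "?\<mu> (T \<inter> F) + ?\<mu> (A n) \<le> ?\<mu> ((T \<inter> F) \<union> A n)"
    proof (rule hausdorff_outer_metric)
      show "1 / real (Suc n) > 0" by simp
      fix a b assume "a \<in> T \<inter> F" "b \<in> A n"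
      then show "1 / real (Suc n) \<le> dist a b"
        using infdist_le[of a F b] by (auto simp: A_def dist_commute)
    qed
    also have "\<dots> \<le> ?\<mu> T" by (rule hausdorff_outer_mono) (auto simp: A_def)
    finally have "?\<mu> (T \<inter> F) + ?\<mu> (A n) + ennreal (\<Sum>k. d (k + n)) \<le> ?\<mu> T + ennreal (\<Sum>k. d (k + n))"
      by (rule add_right_mono)
    moreover have "?\<mu> (T \<inter> F) + ?\<mu> (T - F) \<le> ?\<mu> (T \<inter> F) + (?\<mu> (A n) + ennreal (\<Sum>k. d (k + n)))"
      by (rule add_left_mono[OF 1])
    ultimately show ?thesis unfolding add.assoc[symmetric] by (rule order_trans[rotated])
  qed
  show ?thesis
  proof (rule ennreal_le_epsilon)
    fix e :: real assume e: "e > 0"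
    obtain N where N: "\<forall>n\<ge>N. norm (\<Sum>i. d (i + n)) < e" using suminf_exist_split[OF e \<open>summable d\<close>] by blast
    have "(\<Sum>i. d (i + N)) \<le> e" using N[rule_format, of N] by (simp add: abs_less_iff)
    then have "?\<mu> T + ennreal (\<Sum>k. d (k + N)) \<le> ?\<mu> T + ennreal e" by (intro add_left_mono ennreal_leI)
    then show "?\<mu> (T \<inter> F) + ?\<mu> (T - F) \<le> ?\<mu> T + ennreal e" using main[of N] by (rule order_trans[rotated])
  qed
qed simp

text \<open>\<open>measure_of\<close> returns the given set function only where that is known to be
  countably additive. By Caratheodory it is so on the sets that split every other set additively,
  and these contain the closed sets, hence all Borel sets.\<close>

theorem emeasure_hausdorff_measure:
  fixes A :: "'a::metric_space set"
  assumes "A \<in> sets borel"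
  shows "emeasure (hausdorff_measure m) A = hausdorff_outer m A"
proof -
  have "outer_measure_space UNIV (hausdorff_outer m :: 'a set \<Rightarrow> ennreal)"
    unfolding outer_measure_space_def positive_def increasing_def countably_subadditive_def
    using hausdorff_outer_empty hausdorff_outer_mono hausdorff_outer_countably_subadditive by blast
  then have oms: "outer_measure_space (Pow UNIV) (hausdorff_outer m :: 'a set \<Rightarrow> ennreal)" by simp
  interpret P: sigma_algebra UNIV "Pow UNIV :: 'a set set" by (rule sigma_algebra_Pow)
  let ?L = "lambda_system UNIV (Pow UNIV) (hausdorff_outer m :: 'a set \<Rightarrow> ennreal)"
  have L: "measure_space UNIV ?L (hausdorff_outer m)" by (rule P.caratheodory_lemma[OF oms])
  then have saL: "sigma_algebra UNIV ?L" by (simp add: measure_space_def)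
  have "F \<in> ?L" if F: "closed F" for F
  proof -
    have "hausdorff_outer m (T \<inter> F) + hausdorff_outer m (T - F) = hausdorff_outer m T" for T
    proof (cases "F = {}")
      case False
      have "T = (T \<inter> F) \<union> (T - F)" by blast
      then have "hausdorff_outer m T \<le> hausdorff_outer m (T \<inter> F) + hausdorff_outer m (T - F)"
        using hausdorff_outer_subadditive[of m "T \<inter> F" "T - F"] by simp
      then show ?thesis using hausdorff_outer_closed_split[OF F False] by (intro antisym) auto
    qed (simp add: hausdorff_outer_empty)
    then show ?thesis unfolding P.lambda_system_eq by simp
  qed
  then have "sigma_sets UNIV (Collect closed) \<subseteq> ?L"
    by (intro sigma_algebra.sigma_sets_subset[OF saL]) auto
  then have sub: "sets borel \<subseteq> ?L" by (simp add: borel_eq_closed)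
  have sab: "sigma_algebra UNIV (sets (borel :: 'a measure))" using sets.sigma_algebra_axioms[of borel] by simp
  have ms: "measure_space UNIV (sets borel) (hausdorff_outer m :: 'a set \<Rightarrow> ennreal)"
    by (rule measure_down[OF L sab sub])
  show ?thesis unfolding hausdorff_measure_def
    using ms assms by (intro emeasure_measure_of_sigma) (auto simp: measure_space_def)
qed

lemma sets_hausdorff_measure [simp, measurable_cong]: "sets (hausdorff_measure m) = sets borel"
  and space_hausdorff_measure [simp]: "space (hausdorff_measure m) = UNIV"
  unfolding hausdorff_measure_def using sets.sigma_sets_eq[of borel] by (auto simp: sets_measure_of_conv space_measure_of_conv)

section \<open>Layers above Lipschitz graphs\<close>

text \<open>The set is the \<open>d\<close>-neighbourhood of a segment, up to its ends. Balls of
  radius \<open>2 * d\<close> at spacing \<open>d\<close> along the segment cover it, and at most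
  \<open>\<epsilon> / d + 1\<close> of them are used.\<close>

lemma emeasure_thick_segment:
  fixes c e :: "'a::euclidean_space"
  assumes e: "norm e = 1" and d: "d > 0" and \<epsilon>: "\<epsilon> > 0"
  shows "emeasure lborel ((\<lambda>(y, s). y + s *\<^sub>R e) ` (cball c d \<times> {0..\<epsilon>}))
     \<le> ennreal (unit_ball_vol (real DIM('a)) * 2 ^ DIM('a) * (\<epsilon> + d) * d ^ (DIM('a) - 1))"
proof -
  define N where "N = nat \<lfloor>\<epsilon> / d\<rfloor>"
  have N: "real N \<le> \<epsilon> / d" using \<epsilon> d by (simp add: N_def)
  have sub: "(\<lambda>(y, s). y + s *\<^sub>R e) ` (cball c d \<times> {0..\<epsilon>}) \<subseteq> (\<Union>k\<le>N. cball (c + (real k * d) *\<^sub>R e) (2 * d))"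
  proof clarify
    fix y s assume y: "y \<in> cball c d" and s: "s \<in> {0..\<epsilon>}"
    define k where "k = nat \<lfloor>s / d\<rfloor>"
    have sd: "0 \<le> s / d" using s d by simp
    have k: "real k \<le> s / d" "s / d < real k + 1" using sd unfolding k_def by (auto, linarith?)
    have "k \<le> N" unfolding k_def N_def using s d by (intro nat_mono floor_mono divide_right_mono) auto
    moreover have "0 \<le> s - real k * d" "s - real k * d \<le> d" using k d by (auto simp: field_simps)
    then have "norm ((s - real k * d) *\<^sub>R e) \<le> d" using e by simp
    then have "dist (c + (real k * d) *\<^sub>R e) (y + s *\<^sub>R e) \<le> 2 * d"
    proof -
      have "(y + s *\<^sub>R e) - (c + (real k * d) *\<^sub>R e) = (y - c) + (s - real k * d) *\<^sub>R e" by (simp add: algebra_simps)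
      then have "norm ((y + s *\<^sub>R e) - (c + (real k * d) *\<^sub>R e)) \<le> norm (y - c) + norm ((s - real k * d) *\<^sub>R e)"
        by (simp only: norm_triangle_ineq)
      then show ?thesis using y \<open>norm ((s - real k * d) *\<^sub>R e) \<le> d\<close> by (simp add: dist_norm norm_minus_commute)
    qed
    ultimately show "y + s *\<^sub>R e \<in> (\<Union>k\<le>N. cball (c + (real k * d) *\<^sub>R e) (2 * d))" by auto
  qed
  have "emeasure lborel ((\<lambda>(y, s). y + s *\<^sub>R e) ` (cball c d \<times> {0..\<epsilon>})) \<le> emeasure lborel (\<Union>k\<le>N. cball (c + (real k * d) *\<^sub>R e) (2 * d))"
    by (intro emeasure_mono sub) auto
  also have "\<dots> \<le> (\<Sum>k\<le>N. emeasure lborel (cball (c + (real k * d) *\<^sub>R e) (2 * d)))"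
    by (intro emeasure_subadditive_finite) auto
  also have "\<dots> = ennreal (real (Suc N) * (unit_ball_vol (real DIM('a)) * (2 * d) ^ DIM('a)))"
    using d by (simp add: emeasure_cball ennreal_mult ennreal_of_nat_eq_real_of_nat flip: of_nat_Suc)
  also have "\<dots> \<le> ennreal (unit_ball_vol (real DIM('a)) * 2 ^ DIM('a) * (\<epsilon> + d) * d ^ (DIM('a) - 1))"
  proof (rule ennreal_leI)
    have "real (Suc N) * d \<le> \<epsilon> + d" using N d by (simp add: field_simps)
    then have "(real (Suc N) * d) * (unit_ball_vol (real DIM('a)) * 2 ^ DIM('a) * d ^ (DIM('a) - 1)) 
        \<le> (\<epsilon> + d) * (unit_ball_vol (real DIM('a)) * 2 ^ DIM('a) * d ^ (DIM('a) - 1))"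
      using d by (intro mult_right_mono) auto
    moreover have "d ^ DIM('a) = d * d ^ (DIM('a) - 1)" by (simp flip: power_Suc)
    ultimately show "real (Suc N) * (unit_ball_vol (real DIM('a)) * (2 * d) ^ DIM('a)) 
       \<le> unit_ball_vol (real DIM('a)) * 2 ^ DIM('a) * (\<epsilon> + d) * d ^ (DIM('a) - 1)"
      by (simp add: power_mult_distrib ac_simps)
  qed
  finally show ?thesis .
qed

text \<open>Covering sets consisting of one point have diameter 0. The bound follows by continuity
  from larger radii; in dimension one the last factor is \<open>0 ^ 0 = 1\<close>, and the bound
  stays of order \<open>\<epsilon>\<close>.\<close>

lemma emeasure_thick_segment0:
  fixes c e :: "'a::euclidean_space"
  assumes e: "norm e = 1" and d: "d \<ge> 0" and \<epsilon>: "\<epsilon> > 0"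
  shows "emeasure lborel ((\<lambda>(y, s). y + s *\<^sub>R e) ` (cball c d \<times> {0..\<epsilon>}))
     \<le> ennreal (unit_ball_vol (real DIM('a)) * 2 ^ DIM('a) * (\<epsilon> + d) * d ^ (DIM('a) - 1))"
proof -
  define f where "f t = unit_ball_vol (real DIM('a)) * 2 ^ DIM('a) * (\<epsilon> + t) * t ^ (DIM('a) - 1)" for t
  have "(\<lambda>n. f (d + 1 / real (Suc n))) \<longlonglongrightarrow> f (d + 0)"
    unfolding f_def by (intro tendsto_intros LIMSEQ_Suc[OF lim_1_over_n])
  then have lim: "(\<lambda>n. ennreal (f (d + 1 / real (Suc n)))) \<longlonglongrightarrow> ennreal (f d)" by (intro tendsto_ennrealI) simp
  have T: "compact ((\<lambda>(y, s). y + s *\<^sub>R e) ` (cball c d' \<times> {0..\<epsilon>}))" for d'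
    by (intro compact_continuous_image compact_Times) (auto simp: case_prod_beta intro!: continuous_intros)
  have "emeasure lborel ((\<lambda>(y, s). y + s *\<^sub>R e) ` (cball c d \<times> {0..\<epsilon>})) \<le> ennreal (f (d + 1 / real (Suc n)))" for n
  proof -
    have "emeasure lborel ((\<lambda>(y, s). y + s *\<^sub>R e) ` (cball c d \<times> {0..\<epsilon>})) 
      \<le> emeasure lborel ((\<lambda>(y, s). y + s *\<^sub>R e) ` (cball c (d + 1 / real (Suc n)) \<times> {0..\<epsilon>}))"
    proof (intro emeasure_mono image_mono Sigma_mono)
      show "cball c d \<subseteq> cball c (d + 1 / real (Suc n))" by (intro subset_cball) simp
    qed (use borel_compact[OF T] in auto)
    also have "\<dots> \<le> ennreal (f (d + 1 / real (Suc n)))"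
      unfolding f_def using d \<epsilon> by (intro emeasure_thick_segment e) (auto intro: add_nonneg_pos)
    finally show ?thesis .
  qed
  then show ?thesis unfolding f_def[symmetric] using LIMSEQ_le_const[OF lim] by blast
qed

text \<open>A layer of thickness \<open>\<epsilon>\<close> above a graph is compared with the graph itself. Covering the graph
  by small sets covers the layer by thick segments, whose volume is of order \<open>\<epsilon>\<close> times
  the \<open>(n - 1)\<close>-st power of the diameter. Here \<open>x\<close> lies at height \<open>\<tau> x\<close> above the graph.\<close>

definition layer_const :: "'a::euclidean_space itself \<Rightarrow> real" where
  "layer_const _ = unit_ball_vol (real DIM('a)) * 2 ^ DIM('a) * 2 ^ (DIM('a) - 1) / unit_ball_vol (real (DIM('a) - 1))"

lemma layer_const_pos: "layer_const TYPE('a::euclidean_space) > 0"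
  unfolding layer_const_def by (intro divide_pos_pos mult_pos_pos) auto

lemma emeasure_layer_le:
  fixes e :: "'a::euclidean_space" and \<tau> :: "'a \<Rightarrow> real"
  assumes e: "norm e = 1" and \<epsilon>: "\<epsilon> > 0" and \<tau>: "continuous_on UNIV \<tau>" and A: "A \<in> sets borel"
  shows "emeasure lborel {x. 0 < \<tau> x \<and> \<tau> x < \<epsilon> \<and> x - \<tau> x *\<^sub>R e \<in> A}
    \<le> ennreal (layer_const TYPE('a) * \<epsilon>) * emeasure (hausdorff_measure (DIM('a) - 1)) A"
proof -
  define n where "n = DIM('a)"
  define S where "S = {x. 0 < \<tau> x \<and> \<tau> x < \<epsilon> \<and> x - \<tau> x *\<^sub>R e \<in> A}"
  define H where "H = hausdorff_outer (n - 1) A"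
  define L where "L = layer_const TYPE('a)"
  have L: "L > 0" by (simp add: L_def layer_const_pos)
  \<comment> \<open>At scale \<open>\<delta>\<close> the covering bodies are longer than
    \<open>\<epsilon>\<close> by up to \<open>\<delta>\<close>. This excess disappears as
    \<open>\<delta>\<close> tends to 0, and the thickness enters linearly.\<close>
  have pre: "emeasure lborel S \<le> ennreal (L * (\<epsilon> + \<delta>)) * hausdorff_pre (n - 1) \<delta> A" if \<delta>: "\<delta> > 0" for \<delta>
  proof -
    have each: "emeasure lborel S \<le> ennreal (L * (\<epsilon> + \<delta>)) * (\<Sum>i. hausdorff_weight (n - 1) (C i))"
      if C: "hausdorff_cover \<delta> A C" for C
    proof -
      \<comment> \<open>Any point of the set will do as a centre, since the ball whose radius is the
        diameter contains the set.\<close>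
      define c where "c i = (SOME x. x \<in> C i)" for i
      define T where "T i = (if C i = {} then {} else (\<lambda>(y, s). y + s *\<^sub>R e) ` (cball (c i) (diameter (C i)) \<times> {0..\<epsilon>}))" for i
      have ci: "c i \<in> C i" if "C i \<noteq> {}" for i unfolding c_def using that by (simp add: some_in_eq)
      have Tm: "T i \<in> sets borel" for i
      proof -
        have "compact ((\<lambda>(y, s). y + s *\<^sub>R e) ` (cball (c i) (diameter (C i)) \<times> {0..\<epsilon>}))"
          by (intro compact_continuous_image compact_Times) (auto simp: case_prod_beta intro!: continuous_intros)
        then show ?thesis by (simp add: T_def borel_compact)
      qed
      have "S \<subseteq> (\<Union>i. T i)"
      proof
        fix x assume x: "x \<in> S"
        then obtain i where i: "x - \<tau> x *\<^sub>R e \<in> C i" using C by (auto simp: S_def hausdorff_cover_def)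
        then have ne: "C i \<noteq> {}" by auto
        have "dist (c i) (x - \<tau> x *\<^sub>R e) \<le> diameter (C i)"
          using C i ci[OF ne] by (intro diameter_bounded_bound) (auto simp: hausdorff_cover_def)
        then have "(x - \<tau> x *\<^sub>R e, \<tau> x) \<in> cball (c i) (diameter (C i)) \<times> {0..\<epsilon>}" using x by (auto simp: S_def)
        then have "(\<lambda>(y, s). y + s *\<^sub>R e) (x - \<tau> x *\<^sub>R e, \<tau> x) \<in> T i" using ne unfolding T_def by (simp only: if_False) (rule imageI)
        then show "x \<in> (\<Union>i. T i)" by auto
      qed
      then have "emeasure lborel S \<le> emeasure lborel (\<Union>i. T i)" using Tm by (intro emeasure_mono) auto
      also have "\<dots> \<le> (\<Sum>i. emeasure lborel (T i))" using Tm by (intro emeasure_subadditive_countably) auto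
      also have "\<dots> \<le> (\<Sum>i. ennreal (L * (\<epsilon> + \<delta>)) * hausdorff_weight (n - 1) (C i))"
      proof (intro suminf_le summableI)
        fix i
        show "emeasure lborel (T i) \<le> ennreal (L * (\<epsilon> + \<delta>)) * hausdorff_weight (n - 1) (C i)"
        proof (cases "C i = {}")
          case False
          define d where "d = diameter (C i)"
          have d: "0 \<le> d" "d \<le> \<delta>" using C diameter_ge_0[of "C i"] by (auto simp: d_def hausdorff_cover_def)
          have W: "unit_ball_vol (real (n - 1)) \<noteq> 0" by (metis less_irrefl of_nat_0_le_iff unit_ball_vol_pos)
          have "emeasure lborel (T i) \<le> ennreal (unit_ball_vol (real n) * 2 ^ n * (\<epsilon> + d) * d ^ (n - 1))"
            unfolding n_def using False emeasure_thick_segment0[OF e d(1) \<epsilon>, of "c i"] by (simp add: T_def d_def)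
          also have "\<dots> \<le> ennreal ((L * (\<epsilon> + \<delta>)) * (unit_ball_vol (real (n - 1)) * (d / 2) ^ (n - 1)))"
          proof (rule ennreal_leI)
            \<comment> \<open>The quotient in \<open>layer_const\<close> converts the power of the
              diameter into the Hausdorff weight, which is normalised by half the diameter and the
              volume of the unit ball of dimension \<open>n - 1\<close>.\<close>
            have "L * (unit_ball_vol (real (n - 1)) * (d / 2) ^ (n - 1)) = unit_ball_vol (real n) * 2 ^ n * d ^ (n - 1)"
              using W unfolding L_def layer_const_def n_def[symmetric] by (simp add: power_divide)
            then have "(L * (\<epsilon> + \<delta>)) * (unit_ball_vol (real (n - 1)) * (d / 2) ^ (n - 1)) = (unit_ball_vol (real n) * 2 ^ n * d ^ (n - 1)) * (\<epsilon> + \<delta>)"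
              by (simp add: ac_simps)
            moreover have "(unit_ball_vol (real n) * 2 ^ n * d ^ (n - 1)) * (\<epsilon> + d) \<le> (unit_ball_vol (real n) * 2 ^ n * d ^ (n - 1)) * (\<epsilon> + \<delta>)"
              using d by (intro mult_left_mono) auto
            ultimately show "unit_ball_vol (real n) * 2 ^ n * (\<epsilon> + d) * d ^ (n - 1) \<le> (L * (\<epsilon> + \<delta>)) * (unit_ball_vol (real (n - 1)) * (d / 2) ^ (n - 1))"
              by (simp only: ac_simps)
          qed
          also have "\<dots> = ennreal (L * (\<epsilon> + \<delta>)) * hausdorff_weight (n - 1) (C i)"
            using False L \<epsilon> \<delta> d by (simp add: hausdorff_weight_def d_def ennreal_mult)
          finally show ?thesis .
        qed (simp add: T_def)
      qed
      finally show ?thesis by simp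
    qed
    \<comment> \<open>The factor is divided off so that the estimate for each cover becomes a lower
      bound for the infimum over covers.\<close>
    define k where "k = ennreal (L * (\<epsilon> + \<delta>))"
    have k: "0 < k" "k \<noteq> top" using L \<epsilon> \<delta> by (auto simp: k_def)
    have "emeasure lborel S / k \<le> hausdorff_pre (n - 1) \<delta> A"
      using each k unfolding k_def[symmetric] by (intro hausdorff_pre_greatest divide_le_posI_ennreal) auto
    then have "k * (emeasure lborel S / k) \<le> k * hausdorff_pre (n - 1) \<delta> A" by (rule mult_left_mono) simp
    moreover have "k * (emeasure lborel S / k) = emeasure lborel S"
      using k by (simp add: ennreal_times_divide mult.commute[of k] ennreal_mult_divide_eq)
    ultimately show ?thesis by (simp add: k_def)
  qed
  have "emeasure lborel S \<le> ennreal (L * \<epsilon>) * H"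
  proof (cases "H = top")
    case True then show ?thesis using L \<epsilon> by (simp add: ennreal_mult_top)
  next
    case False
    then obtain h where h: "H = ennreal h" "h \<ge> 0" by (cases H) auto
    have "(\<lambda>k. L * (\<epsilon> + 1 / real (Suc k)) * h) \<longlonglongrightarrow> L * (\<epsilon> + 0) * h"
      by (intro tendsto_intros LIMSEQ_Suc[OF lim_1_over_n])
    then have lim: "(\<lambda>k. ennreal (L * (\<epsilon> + 1 / real (Suc k)) * h)) \<longlonglongrightarrow> ennreal (L * \<epsilon> * h)"
      by (intro tendsto_ennrealI) simp
    have "emeasure lborel S \<le> ennreal (L * (\<epsilon> + 1 / real (Suc k)) * h)" for k
    proof -
      have "emeasure lborel S \<le> ennreal (L * (\<epsilon> + 1 / real (Suc k))) * hausdorff_pre (n - 1) (1 / real (Suc k)) A"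
        by (rule pre) simp
      also have "\<dots> \<le> ennreal (L * (\<epsilon> + 1 / real (Suc k))) * H"
        unfolding H_def by (intro mult_left_mono hausdorff_pre_le_outer) auto
      finally show ?thesis using h L \<epsilon> by (simp add: ennreal_mult)
    qed
    then have "emeasure lborel S \<le> ennreal (L * \<epsilon> * h)" using LIMSEQ_le_const[OF lim] by blast
    then show ?thesis using h L \<epsilon> by (simp add: ennreal_mult)
  qed
  then show ?thesis unfolding S_def H_def L_def n_def using emeasure_hausdorff_measure[OF A] by simp
qed

text \<open>The estimate for sets says that Lebesgue measure on the layer, pushed forward by
  \<open>x \<mapsto> x - \<tau> x *\<^sub>R e\<close>, is dominated by a multiple of Hausdorff
  measure. The inequality of measures then passes to integrals.\<close>

lemma nn_integral_layer_le:
  fixes e :: "'a::euclidean_space" and \<tau> :: "'a \<Rightarrow> real"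
  assumes e: "norm e = 1" and \<epsilon>: "\<epsilon> > 0" and \<tau>: "continuous_on UNIV \<tau>" and h [measurable]: "h \<in> borel_measurable borel"
  shows "(\<integral>\<^sup>+x. indicator {x. 0 < \<tau> x \<and> \<tau> x < \<epsilon>} x * h (x - \<tau> x *\<^sub>R e) \<partial>lborel)
    \<le> ennreal (layer_const TYPE('a) * \<epsilon>) * (\<integral>\<^sup>+x. h x \<partial>hausdorff_measure (DIM('a) - 1))"
proof -
  have [measurable]: "\<tau> \<in> borel_measurable borel" using \<tau> by (rule borel_measurable_continuous_onI)
  define S where "S = {x. 0 < \<tau> x \<and> \<tau> x < \<epsilon>}"
  have [measurable]: "S \<in> sets borel" unfolding S_def by measurable
  define H :: "'a measure" where "H = hausdorff_measure (DIM('a) - 1)"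
  define M where "M = distr (density lborel (indicator S)) borel (\<lambda>x. x - \<tau> x *\<^sub>R e)"
  define N where "N = scale_measure (ennreal (layer_const TYPE('a) * \<epsilon>)) H"
  have sets: "sets M = sets N" by (simp add: M_def N_def H_def)
  have "emeasure M A \<le> emeasure N A" if "A \<in> sets M" for A
  proof -
    have A [measurable]: "A \<in> sets borel" using that by (simp add: M_def)
    have "emeasure M A = emeasure (density lborel (indicator S)) ((\<lambda>x. x - \<tau> x *\<^sub>R e) -` A)"
      unfolding M_def by (subst emeasure_distr) auto
    also have "\<dots> = (\<integral>\<^sup>+x. indicator S x * indicator ((\<lambda>x. x - \<tau> x *\<^sub>R e) -` A) x \<partial>lborel)"
      by (intro emeasure_density) (auto intro!: measurable_sets_borel[OF _ A])
    also have "\<dots> = (\<integral>\<^sup>+x. indicator {x. 0 < \<tau> x \<and> \<tau> x < \<epsilon> \<and> x - \<tau> x *\<^sub>R e \<in> A} x \<partial>lborel)"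
      by (intro nn_integral_cong) (auto simp: S_def indicator_def)
    also have "\<dots> = emeasure lborel {x. 0 < \<tau> x \<and> \<tau> x < \<epsilon> \<and> x - \<tau> x *\<^sub>R e \<in> A}"
      by (intro nn_integral_indicator) measurable
    also have "\<dots> \<le> ennreal (layer_const TYPE('a) * \<epsilon>) * emeasure H A"
      unfolding H_def by (rule emeasure_layer_le[OF e \<epsilon> \<tau> A])
    finally show ?thesis by (simp add: N_def)
  qed
  then have "M \<le> N" by (simp add: le_measure[OF sets] le_fun_def)
  have "(\<integral>\<^sup>+x. indicator S x * h (x - \<tau> x *\<^sub>R e) \<partial>lborel) = (\<integral>\<^sup>+x. h x \<partial>M)"
    unfolding M_def by (subst nn_integral_distr) (auto simp: nn_integral_density)
  also have "\<dots> \<le> (\<integral>\<^sup>+x. h x \<partial>N)" by (rule nn_integral_mono_measure[OF sets \<open>M \<le> N\<close>])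
  also have "\<dots> = ennreal (layer_const TYPE('a) * \<epsilon>) * (\<integral>\<^sup>+x. h x \<partial>H)"
    unfolding N_def by (rule nn_integral_scale_measure) (simp add: H_def)
  finally show ?thesis by (simp add: S_def H_def)
qed

section \<open>Translation and trace estimates\<close>

text \<open>The tangent inequality is integrated at the mean \<open>m\<close> of \<open>f\<close>,
  where its linear term integrates to zero.\<close>

lemma integral_powr_Jensen:
  fixes f :: "real \<Rightarrow> real"
  assumes f: "continuous_on {0..\<theta>} f" "\<And>s. f s \<ge> 0" and \<theta>: "\<theta> > 0" and p: "p \<ge> 1"
  shows "(integral {0..\<theta>} f) powr p \<le> \<theta> powr (p - 1) * integral {0..\<theta>} (\<lambda>s. f s powr p)"
proof -
  define J where "J = integral {0..\<theta>} f"
  define m where "m = J / \<theta>"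
  have fi: "f integrable_on {0..\<theta>}" using f(1) by (rule integrable_continuous_real)
  have "continuous_on {0..\<theta>} (\<lambda>s. f s powr p)" using f p by (intro continuous_on_powr' continuous_intros) auto
  then have pi: "(\<lambda>s. f s powr p) integrable_on {0..\<theta>}" by (rule integrable_continuous_real)
  have J0: "J \<ge> 0" unfolding J_def using fi f(2) by (intro integral_nonneg) auto
  have I0: "integral {0..\<theta>} (\<lambda>s. f s powr p) \<ge> 0" using pi by (intro integral_nonneg) auto
  show ?thesis
  proof (cases "J = 0")
    case True then show ?thesis using I0 unfolding J_def[symmetric] by simp
  next
    case False
    then have m: "m > 0" using J0 \<theta> by (simp add: m_def)
    have gi: "(\<lambda>s. p * m powr (p - 1) * f s) integrable_on {0..\<theta>}"
      using integrable_cmul[OF fi, of "p * m powr (p - 1)"] by simp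
    have "integral {0..\<theta>} (\<lambda>s. (m powr p - p * m powr (p - 1) * m) + p * m powr (p - 1) * f s) \<le> integral {0..\<theta>} (\<lambda>s. f s powr p)"
    proof (rule integral_le)
      show "(\<lambda>s. (m powr p - p * m powr (p - 1) * m) + p * m powr (p - 1) * f s) integrable_on {0..\<theta>}"
        by (intro integrable_add integrable_const_ivl gi)
      show "(m powr p - p * m powr (p - 1) * m) + p * m powr (p - 1) * f s \<le> f s powr p" for s
        using powr_bernoulli[OF f(2)[of s] m p] by (simp add: algebra_simps)
    qed (rule pi)
    also have "integral {0..\<theta>} (\<lambda>s. (m powr p - p * m powr (p - 1) * m) + p * m powr (p - 1) * f s)
       = \<theta> * (m powr p - p * m powr (p - 1) * m) + p * m powr (p - 1) * J"
      using gi \<theta> by (subst Henstock_Kurzweil_Integration.integral_add) (auto simp: J_def)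
    also have "\<dots> = \<theta> * m powr p" using \<theta> by (simp add: m_def algebra_simps)
    finally have "\<theta> powr (p - 1) * (\<theta> * m powr p) \<le> \<theta> powr (p - 1) * integral {0..\<theta>} (\<lambda>s. f s powr p)"
      by (intro mult_left_mono) auto
    moreover have "\<theta> powr (p - 1) * (\<theta> * m powr p) = J powr p"
    proof -
      have "\<theta> powr (p - 1) * \<theta> = \<theta> powr p" using \<theta> by (simp add: powr_diff)
      moreover have "J = \<theta> * m" using \<theta> by (simp add: m_def)
      then have "J powr p = \<theta> powr p * m powr p" using \<theta> m by (simp add: powr_mult)
      ultimately show ?thesis by (simp add: mult.assoc[symmetric])
    qed
    ultimately show ?thesis by (simp add: J_def)
  qed
qed

lemma smooth_line_estimate:
  fixes v :: "('n::finite) vfield"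
  assumes v: "smooth_field v" and e: "norm e = 1" and \<theta>: "\<theta> \<ge> 0" and p: "p \<ge> 1"
  shows "ennreal (norm (v x - v (x - \<theta> *\<^sub>R e)) powr p) \<le>
    ennreal (\<theta> powr (p - 1)) * (\<integral>\<^sup>+s. indicator {0<..<\<theta>} s * ennreal (norm (grad v (x - s *\<^sub>R e)) powr p) \<partial>lborel)"
proof (cases "\<theta> = 0")
  case False
  with \<theta> have \<theta>: "\<theta> > 0" by simp
  define f where "f s = norm (grad v (x - s *\<^sub>R e))" for s
  have fc: "continuous_on T f" for T unfolding f_def
    by (intro continuous_on_norm continuous_on_compose2[OF smooth_field_grad_continuous[OF v, of UNIV]] continuous_intros) auto
  have der: "((\<lambda>s. v (x - s *\<^sub>R e)) has_vector_derivative - (grad v (x - s *\<^sub>R e) *v e)) (at s within {0..\<theta>})" for s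
  proof -
    have "((\<lambda>s. x - s *\<^sub>R e) has_derivative (\<lambda>t. - (t *\<^sub>R e))) (at s within {0..\<theta>})"
      by (auto intro!: derivative_eq_intros)
    from has_derivative_compose[OF this smooth_field_has_derivative[OF v]]
    have "((\<lambda>s. v (x - s *\<^sub>R e)) has_derivative (\<lambda>t. grad v (x - s *\<^sub>R e) *v (- (t *\<^sub>R e)))) (at s within {0..\<theta>})" .
    moreover have "(\<lambda>t. grad v (x - s *\<^sub>R e) *v (- (t *\<^sub>R e))) = (\<lambda>t. t *\<^sub>R - (grad v (x - s *\<^sub>R e) *v e))"
    proof
      fix t
      have "grad v (x - s *\<^sub>R e) *v (- (t *\<^sub>R e)) = - (grad v (x - s *\<^sub>R e) *v (t *\<^sub>R e))"
        by (rule linear_neg[OF matrix_vector_mul_linear])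
      then show "grad v (x - s *\<^sub>R e) *v (- (t *\<^sub>R e)) = t *\<^sub>R - (grad v (x - s *\<^sub>R e) *v e)"
        by (simp add: matrix_vector_mult_scaleR)
    qed
    ultimately show ?thesis by (simp add: has_vector_derivative_def)
  qed
  have hi: "((\<lambda>s. - (grad v (x - s *\<^sub>R e) *v e)) has_integral v (x - \<theta> *\<^sub>R e) - v (x - 0 *\<^sub>R e)) {0..\<theta>}"
    using \<theta> der by (intro fundamental_theorem_of_calculus) auto
  have "norm (v (x - \<theta> *\<^sub>R e) - v (x - 0 *\<^sub>R e)) \<le> integral {0..\<theta>} f"
    unfolding integral_unique[OF hi, symmetric]
  proof (rule integral_norm_bound_integral)
    show "f integrable_on {0..\<theta>}" by (rule integrable_continuous_real[OF fc])
    show "norm (- (grad v (x - s *\<^sub>R e) *v e)) \<le> f s" for s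
      using norm_matrix_vector_mult_le[of "grad v (x - s *\<^sub>R e)" e] e by (simp add: f_def)
  qed (use hi in auto)
  then have "norm (v x - v (x - \<theta> *\<^sub>R e)) powr p \<le> (integral {0..\<theta>} f) powr p"
    using p by (intro powr_mono2) (auto simp: norm_minus_commute)
  also have "\<dots> \<le> \<theta> powr (p - 1) * integral {0..\<theta>} (\<lambda>s. f s powr p)"
    by (rule integral_powr_Jensen[OF fc _ \<theta> p]) (simp add: f_def)
  finally have "ennreal (norm (v x - v (x - \<theta> *\<^sub>R e)) powr p) \<le> ennreal (\<theta> powr (p - 1) * integral {0..\<theta>} (\<lambda>s. f s powr p))"
    by (rule ennreal_leI)
  also have "\<dots> = ennreal (\<theta> powr (p - 1)) * ennreal (integral {0..\<theta>} (\<lambda>s. f s powr p))"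
    by (rule ennreal_mult') simp
  also have "ennreal (integral {0..\<theta>} (\<lambda>s. f s powr p)) = (\<integral>\<^sup>+s. ennreal (f s powr p) * indicator {0..\<theta>} s \<partial>lborel)"
  proof (rule nn_integral_has_integral_lebesgue'[symmetric])
    have "continuous_on {0..\<theta>} (\<lambda>s. f s powr p)" using p by (intro continuous_on_powr' fc continuous_intros) (auto simp: f_def)
    then show "((\<lambda>s. f s powr p) has_integral integral {0..\<theta>} (\<lambda>s. f s powr p)) {0..\<theta>}"
      by (intro integrable_integral integrable_continuous_real)
  qed simp
  also have "\<dots> = (\<integral>\<^sup>+s. indicator {0<..<\<theta>} s * ennreal (f s powr p) \<partial>lborel)"
  \<comment> \<open>The end points are dropped because later only the open segment is known to lie
    in the domain.\<close>
  proof (rule nn_integral_cong_AE)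
    have "AE s in lborel. s \<noteq> 0" "AE s in lborel. s \<noteq> \<theta>" by (rule AE_lborel_singleton)+
    then show "AE s in lborel. ennreal (f s powr p) * indicator {0..\<theta>} s = indicator {0<..<\<theta>} s * ennreal (f s powr p)"
      by eventually_elim (auto simp: indicator_def)
  qed
  finally show ?thesis by (simp add: f_def)
qed simp

lemma nn_integral_lborel_shift:
  fixes c :: "'a::euclidean_space"
  assumes "f \<in> borel_measurable borel"
  shows "(\<integral>\<^sup>+x. f (x + c) \<partial>lborel) = (\<integral>\<^sup>+x. f x \<partial>lborel)"
proof -
  have "(\<integral>\<^sup>+x. f x \<partial>lborel) = (\<integral>\<^sup>+x. f x \<partial>distr lborel borel ((+) c))" by (simp add: lborel_distr_plus)
  also have "\<dots> = (\<integral>\<^sup>+x. f (c + x) \<partial>lborel)" using assms by (intro nn_integral_distr) auto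
  finally show ?thesis by (simp add: add.commute)
qed

text \<open>With constant \<open>\<theta>\<close> this bounds differences along a translation; with \<open>\<theta>\<close> the height
  above the boundary it bounds the difference to the boundary values.\<close>

lemma smooth_translation_estimate:
  fixes v :: "('n::finite) vfield" and \<theta> :: "real ^ 'n \<Rightarrow> real"
  assumes v: "smooth_field v" and e: "norm e = 1" and p: "p \<ge> 1" 
    and S: "S \<in> sets borel" and U: "open U" and \<theta>: "\<theta> \<in> borel_measurable borel"
    and le: "\<And>x. x \<in> S \<Longrightarrow> 0 \<le> \<theta> x \<and> \<theta> x \<le> \<epsilon>" and sub: "\<And>x s. x \<in> S \<Longrightarrow> 0 < s \<Longrightarrow> s < \<theta> x \<Longrightarrow> x - s *\<^sub>R e \<in> U"
    and \<epsilon>: "\<epsilon> > 0"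
  shows "(\<integral>\<^sup>+x. indicator S x * ennreal (norm (v x - v (x - \<theta> x *\<^sub>R e)) powr p) \<partial>lborel)
    \<le> ennreal (\<epsilon> powr p) * (\<integral>\<^sup>+x. indicator U x * ennreal (norm (grad v x) powr p) \<partial>lborel)"
proof -
  define F where "F x = indicator U x * ennreal (norm (grad v x) powr p)" for x
  have [measurable]: "grad v \<in> borel_measurable borel"
    by (rule borel_measurable_continuous_onI[OF smooth_field_grad_continuous[OF v]])
  have [measurable]: "S \<in> sets borel" "U \<in> sets borel" "\<theta> \<in> borel_measurable borel" using S U \<theta> by auto
  have Fm [measurable]: "F \<in> borel_measurable borel" unfolding F_def by measurable
  have "(\<integral>\<^sup>+x. indicator S x * ennreal (norm (v x - v (x - \<theta> x *\<^sub>R e)) powr p) \<partial>lborel)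
     \<le> (\<integral>\<^sup>+x. (\<integral>\<^sup>+s. ennreal (\<epsilon> powr (p - 1)) * (indicator {0<..<\<epsilon>} s * F (x - s *\<^sub>R e)) \<partial>lborel) \<partial>lborel)"
  proof (rule nn_integral_mono)
    fix x
    show "indicator S x * ennreal (norm (v x - v (x - \<theta> x *\<^sub>R e)) powr p)
      \<le> (\<integral>\<^sup>+s. ennreal (\<epsilon> powr (p - 1)) * (indicator {0<..<\<epsilon>} s * F (x - s *\<^sub>R e)) \<partial>lborel)"
    proof (cases "x \<in> S")
      case True
      have "ennreal (norm (v x - v (x - \<theta> x *\<^sub>R e)) powr p) \<le> ennreal (\<theta> x powr (p - 1)) * 
        (\<integral>\<^sup>+s. indicator {0<..<\<theta> x} s * ennreal (norm (grad v (x - s *\<^sub>R e)) powr p) \<partial>lborel)"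
        using le[OF True] by (intro smooth_line_estimate v e p) auto
      also have "\<dots> \<le> ennreal (\<epsilon> powr (p - 1)) * (\<integral>\<^sup>+s. indicator {0<..<\<epsilon>} s * F (x - s *\<^sub>R e) \<partial>lborel)"
      proof (rule mult_mono)
        show "ennreal (\<theta> x powr (p - 1)) \<le> ennreal (\<epsilon> powr (p - 1))"
          using le[OF True] p by (intro ennreal_leI powr_mono2) auto
        have "indicator {0<..<\<theta> x} s * ennreal (norm (grad v (x - s *\<^sub>R e)) powr p) \<le> indicator {0<..<\<epsilon>} s * F (x - s *\<^sub>R e)" for s
          using le[OF True] sub[OF True, of s] by (auto simp: F_def indicator_def)
        then show "(\<integral>\<^sup>+s. indicator {0<..<\<theta> x} s * ennreal (norm (grad v (x - s *\<^sub>R e)) powr p) \<partial>lborel)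
          \<le> (\<integral>\<^sup>+s. indicator {0<..<\<epsilon>} s * F (x - s *\<^sub>R e) \<partial>lborel)" by (rule nn_integral_mono)
      qed auto
      also have "\<dots> = (\<integral>\<^sup>+s. ennreal (\<epsilon> powr (p - 1)) * (indicator {0<..<\<epsilon>} s * F (x - s *\<^sub>R e)) \<partial>lborel)"
        by (rule nn_integral_cmult[symmetric]) measurable
      finally show ?thesis using True by simp
    qed simp
  qed
  also have "\<dots> = (\<integral>\<^sup>+s. (\<integral>\<^sup>+x. ennreal (\<epsilon> powr (p - 1)) * (indicator {0<..<\<epsilon>} s * F (x - s *\<^sub>R e)) \<partial>lborel) \<partial>lborel)"
    by (rule lborel_pair.Fubini') measurable
  also have "\<dots> = (\<integral>\<^sup>+s. ennreal (\<epsilon> powr (p - 1)) * (indicator {0<..<\<epsilon>} s * (\<integral>\<^sup>+x. F x \<partial>lborel)) \<partial>lborel)"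
  \<comment> \<open>For fixed \<open>s\<close> the translate of \<open>F\<close> has the same
    integral as \<open>F\<close>; the integration over \<open>s\<close> then contributes only the
    length \<open>\<epsilon>\<close>.\<close>
  proof (rule nn_integral_cong)
    fix s
    have "(\<integral>\<^sup>+x. F (x - s *\<^sub>R e) \<partial>lborel) = (\<integral>\<^sup>+x. F x \<partial>lborel)"
      using nn_integral_lborel_shift[OF Fm, of "- (s *\<^sub>R e)"] by simp
    then show "(\<integral>\<^sup>+x. ennreal (\<epsilon> powr (p - 1)) * (indicator {0<..<\<epsilon>} s * F (x - s *\<^sub>R e)) \<partial>lborel) =
      ennreal (\<epsilon> powr (p - 1)) * (indicator {0<..<\<epsilon>} s * (\<integral>\<^sup>+x. F x \<partial>lborel))"
      by (simp add: nn_integral_cmult)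
  qed
  also have "\<dots> = ennreal (\<epsilon> powr (p - 1)) * (ennreal \<epsilon> * (\<integral>\<^sup>+x. F x \<partial>lborel))"
    using \<epsilon> by (simp add: nn_integral_cmult nn_integral_multc)
  also have "\<dots> = ennreal (\<epsilon> powr p) * (\<integral>\<^sup>+x. F x \<partial>lborel)"
    using \<epsilon> by (simp add: mult.assoc[symmetric] ennreal_mult[symmetric] powr_diff)
  finally show ?thesis by (simp add: F_def)
qed

lemma smooth_field_W1p_pair:
  fixes U :: "(real ^ 'n) set"
  assumes U: "open U" "bounded U" and p: "p > 0" and v: "smooth_field v"
  shows "W1p_pair U p v (grad v)"
proof -
  have vi: "integrable (lebesgue_on U) v" "integrable (lebesgue_on U) (grad v)"
    by (rule Lp_finite_measure_integrable[OF finite_measure_lebesgue_on_bounded[OF U] continuous_Lp_bounded_domain[OF U, of _ 1]];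
        simp add: smooth_field_continuous[OF v] smooth_field_grad_continuous[OF v])+
  have ibp: "(LINT x|lebesgue_on U. v x $ i * partial j \<phi> x) = - (LINT x|lebesgue_on U. grad v x $ i $ j * \<phi> x)"
    if \<phi>: "\<phi> \<in> test_functions U" for \<phi> i j
  proof -
    obtain R where R: "bounded_support R \<phi>" using test_functionsD(2)[OF \<phi>] by blast
    have vs: "smooth (\<lambda>x. v x $ i)" using v by (simp add: smooth_field_def)
    have off: "\<phi> x = 0" "partial j \<phi> x = 0" if "x \<notin> U" for x
      using test_functionsD(4,5,6)[OF \<phi>] that by blast+
    have m: "(\<lambda>x. v x $ i * partial j \<phi> x) \<in> borel_measurable borel" "(\<lambda>x. partial j (\<lambda>x. v x $ i) x * \<phi> x) \<in> borel_measurable borel"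
      by (intro borel_measurable_continuous_onI continuous_on_mult smooth_continuous smooth_partial vs test_functionsD(1)[OF \<phi>])+
    have "(LINT x|lebesgue_on U. v x $ i * partial j \<phi> x) = (LINT x|lborel. v x $ i * partial j \<phi> x)"
      by (rule lebesgue_on_integral_borel(1)[OF U(1) m(1)]) (simp add: off)
    also have "\<dots> = - (LINT x|lborel. partial j (\<lambda>x. v x $ i) x * \<phi> x)"
      by (rule integration_by_parts_smooth[OF vs test_functionsD(1)[OF \<phi>] R])
    also have "(LINT x|lborel. partial j (\<lambda>x. v x $ i) x * \<phi> x) = (LINT x|lebesgue_on U. partial j (\<lambda>x. v x $ i) x * \<phi> x)"
      by (rule lebesgue_on_integral_borel(1)[OF U(1) m(2), symmetric]) (simp add: off)
    finally show ?thesis by (simp add: grad_def)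
  qed
  show ?thesis unfolding W1p_pair_def is_weak_gradient_def
    by (intro conjI ballI allI continuous_Lp_bounded_domain[OF U smooth_field_continuous[OF v] p]
      continuous_Lp_bounded_domain[OF U smooth_field_grad_continuous[OF v] p]
      integrable_imp_loc_integrable[OF U(1)] vi ibp)
qed

lemma W1p_pair_add_scaleR:
  assumes "open U" "p \<ge> 1" "W1p_pair U p u G" "W1p_pair U p w H"
  shows "W1p_pair U p (\<lambda>x. u x + c *\<^sub>R w x) (\<lambda>x. G x + c *\<^sub>R H x)"
  using assms unfolding W1p_pair_def by (auto intro!: is_weak_gradient_add_scaleR Lp_add Lp_scaleR)

lemma W1p_pair_diff:
  assumes "open U" "p \<ge> 1" "W1p_pair U p u G" "W1p_pair U p w H"
  shows "W1p_pair U p (\<lambda>x. u x - w x) (\<lambda>x. G x - H x)"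
  using W1p_pair_add_scaleR[OF assms, of "-1"] by simp

lemma W1p_iff_pair: "u \<in> W1p U p \<longleftrightarrow> (\<exists>G. W1p_pair U p u G)"
  by (auto simp: W1p_def W1p_pair_def)

lemma W1p_norm_pair:
  assumes "open U" "W1p_pair U p u G"
  shows "W1p_norm U p u = Lp_norm (lebesgue_on U) p u + Lp_norm (lebesgue_on U) p G"
proof -
  have w: "is_weak_gradient U u G" and G: "G \<in> borel_measurable (lebesgue_on U)"
    using assms(2) by (auto simp: W1p_pair_def Lp_def)
  show ?thesis unfolding W1p_norm_def
    using Lp_norm_cong_AE[OF weak_gradient_AE_eq(2)[OF assms(1) w G] G weak_gradient_AE_eq(1)[OF assms(1) w]] by simp
qed

section \<open>Norms over parts of the domain and their behaviour under translation\<close>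

definition locnorm :: "(real ^ 'n) set \<Rightarrow> real \<Rightarrow> (real ^ 'n) set \<Rightarrow> (real ^ 'n \<Rightarrow> 'b::euclidean_space) \<Rightarrow> real" where
  "locnorm U p S f = Lp_norm (lebesgue_on U) p (\<lambda>x. indicator S x *\<^sub>R f x)"

lemma Lp_indicator:
  fixes f :: "'a::euclidean_space \<Rightarrow> 'b::euclidean_space"
  assumes S: "S \<in> sets borel" and f: "f \<in> Lp (lebesgue_on U) p" and p: "p > 0"
  shows "(\<lambda>x. indicator S x *\<^sub>R f x) \<in> Lp (lebesgue_on U) p"
    "Lp_norm (lebesgue_on U) p (\<lambda>x. indicator S x *\<^sub>R f x) \<le> Lp_norm (lebesgue_on U) p f"
proof -
  have "(indicator S :: 'a \<Rightarrow> real) \<in> borel_measurable (lebesgue_on U)"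
    using S by (intro borel_imp_lebesgue_on_measurable) simp
  then have m: "(\<lambda>x. indicator S x *\<^sub>R f x) \<in> borel_measurable (lebesgue_on U)"
    using Lp_measurable[OF f] by (intro borel_measurable_scaleR) auto
  have ae: "AE x in lebesgue_on U. norm (indicator S x *\<^sub>R f x) \<le> 1 * norm (f x)"
    by (rule AE_I2) (auto simp: indicator_def)
  show "(\<lambda>x. indicator S x *\<^sub>R f x) \<in> Lp (lebesgue_on U) p"
    "Lp_norm (lebesgue_on U) p (\<lambda>x. indicator S x *\<^sub>R f x) \<le> Lp_norm (lebesgue_on U) p f"
    using Lp_bounded_mult[OF f _ p m ae] by simp_all
qed

lemma locnorm_mono:
  fixes f :: "real ^ 'n \<Rightarrow> 'b::euclidean_space"
  assumes S: "S \<in> sets borel" "T \<in> sets borel" "S \<inter> U \<subseteq> T" and f: "f \<in> Lp (lebesgue_on U) p" and p: "p > 0"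
  shows "locnorm U p S f \<le> locnorm U p T f"
proof -
  have "Lp_norm (lebesgue_on U) p (\<lambda>x. indicator S x *\<^sub>R f x) \<le> 1 * Lp_norm (lebesgue_on U) p (\<lambda>x. indicator T x *\<^sub>R f x)"
  proof (rule Lp_bounded_mult(2)[OF Lp_indicator(1)[OF S(2) f p]])
    show "(\<lambda>x. indicator S x *\<^sub>R f x) \<in> borel_measurable (lebesgue_on U)"
      by (rule Lp_measurable[OF Lp_indicator(1)[OF S(1) f p]])
    show "AE x in lebesgue_on U. norm (indicator S x *\<^sub>R f x) \<le> 1 * norm (indicator T x *\<^sub>R f x)"
      using S(3) by (intro AE_I2) (auto simp: indicator_def)
  qed (use p in auto)
  then show ?thesis by (simp add: locnorm_def)
qed

lemma locnorm_diff_le: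
  fixes f g :: "real ^ 'n \<Rightarrow> 'b::euclidean_space"
  assumes S: "S \<in> sets borel" and f: "f \<in> Lp (lebesgue_on U) p" and g: "g \<in> Lp (lebesgue_on U) p" and p: "p \<ge> 1"
  shows "locnorm U p S f \<le> locnorm U p S g + Lp_norm (lebesgue_on U) p (\<lambda>x. f x - g x)"
proof -
  have p0: "p > 0" using p by simp
  have d: "(\<lambda>x. f x - g x) \<in> Lp (lebesgue_on U) p" by (rule Lp_diff[OF f g p])
  have "(\<lambda>x. indicator S x *\<^sub>R f x) = (\<lambda>x. indicator S x *\<^sub>R g x + indicator S x *\<^sub>R (f x - g x))"
    by (simp add: fun_eq_iff algebra_simps)
  then have "locnorm U p S f \<le> locnorm U p S g + Lp_norm (lebesgue_on U) p (\<lambda>x. indicator S x *\<^sub>R (f x - g x))"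
    unfolding locnorm_def
    using Lp_norm_triangle[OF Lp_indicator(1)[OF S g p0] Lp_indicator(1)[OF S d p0] p] by simp
  then show ?thesis using Lp_indicator(2)[OF S d p0] by linarith
qed

lemma locnorm_tendsto:
  fixes u :: "real ^ 'n \<Rightarrow> 'b::euclidean_space"
  assumes S: "S \<in> sets borel" and v: "\<And>n. v n \<in> Lp (lebesgue_on U) p" and u: "u \<in> Lp (lebesgue_on U) p" and p: "p \<ge> 1"
    and lim: "Lp_lim (lebesgue_on U) p v u"
  shows "(\<lambda>n. locnorm U p S (v n)) \<longlonglongrightarrow> locnorm U p S u"
proof -
  have "\<bar>locnorm U p S (v n) - locnorm U p S u\<bar> \<le> Lp_norm (lebesgue_on U) p (\<lambda>x. v n x - u x)" for n
    using locnorm_diff_le[OF S v u p, of n] locnorm_diff_le[OF S u v p, of n] Lp_norm_diff_commute[of "lebesgue_on U" p "v n" u]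
    by linarith
  then have "(\<lambda>n. locnorm U p S (v n) - locnorm U p S u) \<longlonglongrightarrow> 0"
    by (intro Lim_null_comparison[OF _ lim]) simp
  then show ?thesis by (simp add: LIM_zero_iff)
qed

lemma locnorm_UNIV: "locnorm U p UNIV u = Lp_norm (lebesgue_on U) p u"
  by (simp add: locnorm_def)

lemma Lp_norm_tendsto:
  fixes u :: "real ^ 'n \<Rightarrow> 'b::euclidean_space"
  assumes "\<And>n. v n \<in> Lp (lebesgue_on U) p" "u \<in> Lp (lebesgue_on U) p" "p \<ge> 1"
    "Lp_lim (lebesgue_on U) p v u"
  shows "(\<lambda>n. Lp_norm (lebesgue_on U) p (v n)) \<longlonglongrightarrow> Lp_norm (lebesgue_on U) p u"
  using locnorm_tendsto[where S = UNIV, OF _ assms] by (simp add: locnorm_UNIV)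

lemma nn_integral_locnorm:
  fixes f :: "real ^ 'n \<Rightarrow> 'b::euclidean_space"
  assumes U: "open U" and S: "S \<in> sets borel" "S \<subseteq> U" and f: "f \<in> Lp (lebesgue_on U) p" "f \<in> borel_measurable borel" and p: "p > 0"
  shows "(\<integral>\<^sup>+x. indicator S x * ennreal (norm (f x) powr p) \<partial>lborel) = ennreal (locnorm U p S f powr p)"
    and "(\<lambda>x. indicator S x *\<^sub>R f x) \<in> Lp lborel p" "locnorm U p S f = Lp_norm lborel p (\<lambda>x. indicator S x *\<^sub>R f x)"
proof -
  define g where "g x = indicator S x *\<^sub>R f x" for x
  have gm: "g \<in> borel_measurable borel" unfolding g_def using f(2) S(1) by (intro borel_measurable_scaleR) auto
  have off: "g x = 0" if "x \<notin> U" for x using that S(2) by (auto simp: g_def indicator_def)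
  have "g \<in> Lp (lebesgue_on U) p" unfolding g_def by (rule Lp_indicator(1)[OF S(1) f(1) p])
  then have gL: "g \<in> Lp lborel p" using lebesgue_on_Lp_borel(1)[OF U gm off] by simp
  then show "(\<lambda>x. indicator S x *\<^sub>R f x) \<in> Lp lborel p" unfolding g_def .
  show ln: "locnorm U p S f = Lp_norm lborel p (\<lambda>x. indicator S x *\<^sub>R f x)"
    using lebesgue_on_Lp_borel(2)[OF U gm off, of p] by (simp add: locnorm_def g_def)
  have "(\<integral>\<^sup>+x. indicator S x * ennreal (norm (f x) powr p) \<partial>lborel) = (\<integral>\<^sup>+x. ennreal (norm (g x) powr p) \<partial>lborel)"
    using p by (intro nn_integral_cong) (auto simp: g_def indicator_def)
  also have "\<dots> = ennreal (LINT x|lborel. norm (g x) powr p)"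
    by (rule nn_integral_eq_integral[OF Lp_integrable[OF gL]]) simp
  also have "(LINT x|lborel. norm (g x) powr p) = locnorm U p S f powr p"
    unfolding ln using p by (simp add: Lp_norm_powr g_def)
  finally show "(\<integral>\<^sup>+x. indicator S x * ennreal (norm (f x) powr p) \<partial>lborel) = ennreal (locnorm U p S f powr p)" .
qed

lemma Lp_norm_le_nn_integral:
  fixes g :: "'a::euclidean_space \<Rightarrow> 'b::euclidean_space"
  assumes g: "g \<in> borel_measurable borel" and p: "p > 0" and c: "c \<ge> 0"
    and le: "(\<integral>\<^sup>+x. ennreal (norm (g x) powr p) \<partial>lborel) \<le> ennreal (c powr p)"
  shows "g \<in> Lp lborel p" "Lp_norm lborel p g \<le> c"
proof -
  have int: "integrable lborel (\<lambda>x. norm (g x) powr p)"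
    by (intro integrableI_bounded) (use le g in \<open>auto simp: order_le_less_trans\<close>)
  then show "g \<in> Lp lborel p" using g by (intro LpI) auto
  have "ennreal (LINT x|lborel. norm (g x) powr p) \<le> ennreal (c powr p)"
    using le int by (subst (asm) nn_integral_eq_integral) auto
  then show "Lp_norm lborel p g \<le> c" using p c by (simp add: Lp_norm_le_iff)
qed

text \<open>The segments from \<open>S\<close> in direction \<open>h\<close> stay in
  \<open>U\<close>, so the line integrals see the gradient on \<open>U\<close> only, although
  \<open>v\<close> is defined everywhere. This is what lets the bound pass to Sobolev
  fields.\<close>

lemma locnorm_shift_smooth:
  fixes U :: "(real ^ 'n) set"
  assumes U: "open U" "bounded U" and p: "p \<ge> 1" and v: "smooth_field v"
    and S: "S \<in> sets borel" "S \<subseteq> U" and T: "T \<in> sets borel" "T \<subseteq> U"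
    and ST: "\<And>x. x \<in> S \<Longrightarrow> x + h \<in> T" and seg: "\<And>x s. x \<in> S \<Longrightarrow> 0 < s \<Longrightarrow> s < 1 \<Longrightarrow> x + s *\<^sub>R h \<in> U"
  shows "Lp_norm lborel p (\<lambda>x. indicator S x *\<^sub>R (v x - v (x + h))) \<le> norm h * Lp_norm (lebesgue_on U) p (grad v)"
    "locnorm U p S v \<le> locnorm U p T v + norm h * Lp_norm (lebesgue_on U) p (grad v)"
proof -
  have p0: "p > 0" using p by simp
  have vm [measurable]: "v \<in> borel_measurable borel" by (rule borel_measurable_continuous_onI[OF smooth_field_continuous[OF v]])
  have gm: "grad v \<in> borel_measurable borel" by (rule borel_measurable_continuous_onI[OF smooth_field_grad_continuous[OF v]])
  have vL: "v \<in> Lp (lebesgue_on U) p" "grad v \<in> Lp (lebesgue_on U) p"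
    using smooth_field_W1p_pair[OF U p0 v] by (auto simp: W1p_pair_def)
  have [measurable]: "S \<in> sets borel" by fact
  define N where "N = Lp_norm (lebesgue_on U) p (grad v)"
  have dm: "(\<lambda>x. indicator S x *\<^sub>R (v x - v (x + h))) \<in> borel_measurable borel" by measurable
  have "(\<lambda>x. indicator S x *\<^sub>R (v x - v (x + h))) \<in> Lp lborel p \<and> Lp_norm lborel p (\<lambda>x. indicator S x *\<^sub>R (v x - v (x + h))) \<le> norm h * N"
  proof (cases "h = 0")
    case True
    then show ?thesis by (simp add: Lp_zero Lp_norm_def N_def)
  next
    case False
    \<comment> \<open>The sign turns \<open>x - s *\<^sub>R e\<close>, the form of the translation
      estimate, into a move along \<open>h\<close>.\<close>
    define e where "e = - (1 / norm h) *\<^sub>R h"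
    have e: "norm e = 1" using False by (simp add: e_def)
    have he: "x - norm h *\<^sub>R e = x + h" for x using False by (simp add: e_def)
    have "(\<integral>\<^sup>+x. indicator S x * ennreal (norm (v x - v (x - norm h *\<^sub>R e)) powr p) \<partial>lborel)
      \<le> ennreal (norm h powr p) * (\<integral>\<^sup>+x. indicator U x * ennreal (norm (grad v x) powr p) \<partial>lborel)"
    proof (rule smooth_translation_estimate[OF v e p S(1) U(1)])
      fix x s assume x: "x \<in> S" and s: "0 < s" "s < norm h"
      have "x - s *\<^sub>R e = x + (s / norm h) *\<^sub>R h" by (simp add: e_def)
      also have "\<dots> \<in> U" using s False by (intro seg[OF x]) (auto simp: field_simps)
      finally show "x - s *\<^sub>R e \<in> U" .
    qed (use False in auto)
    also have "(\<integral>\<^sup>+x. indicator U x * ennreal (norm (grad v x) powr p) \<partial>lborel) = ennreal (locnorm U p U (grad v) powr p)"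
      using U by (intro nn_integral_locnorm vL gm p0) auto
    also have "locnorm U p U (grad v) = N" unfolding N_def locnorm_def by (rule Lp_norm_cong) simp
    also have "ennreal (norm h powr p) * ennreal (N powr p) = ennreal ((norm h * N) powr p)"
      by (simp add: N_def ennreal_mult[symmetric] powr_mult)
    finally have "(\<integral>\<^sup>+x. indicator S x * ennreal (norm (v x - v (x + h)) powr p) \<partial>lborel) \<le> ennreal ((norm h * N) powr p)"
      unfolding he .
    also have "(\<integral>\<^sup>+x. indicator S x * ennreal (norm (v x - v (x + h)) powr p) \<partial>lborel)
      = (\<integral>\<^sup>+x. ennreal (norm (indicator S x *\<^sub>R (v x - v (x + h))) powr p) \<partial>lborel)"
      using p0 by (intro nn_integral_cong) (auto simp: indicator_def)
    finally show ?thesis using Lp_norm_le_nn_integral[OF dm p0, of "norm h * N"] by (auto simp: N_def)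
  qed
  then have d: "(\<lambda>x. indicator S x *\<^sub>R (v x - v (x + h))) \<in> Lp lborel p" 
    "Lp_norm lborel p (\<lambda>x. indicator S x *\<^sub>R (v x - v (x + h))) \<le> norm h * N" by auto
  show "Lp_norm lborel p (\<lambda>x. indicator S x *\<^sub>R (v x - v (x + h))) \<le> norm h * Lp_norm (lebesgue_on U) p (grad v)"
    using d(2) by (simp add: N_def)
  note TL = nn_integral_locnorm(2,3)[OF U(1) T vL(1) vm p0]
  have sh: "(\<lambda>x. indicator T (x + h) *\<^sub>R v (x + h)) \<in> Lp lborel p" 
     "Lp_norm lborel p (\<lambda>x. indicator T (x + h) *\<^sub>R v (x + h)) = locnorm U p T v"
    using Lp_shift[OF TL(1), of h] TL(2) by auto
  have s2: "(\<lambda>x. indicator S x *\<^sub>R v (x + h)) \<in> Lp lborel p" "Lp_norm lborel p (\<lambda>x. indicator S x *\<^sub>R v (x + h)) \<le> 1 * locnorm U p T v"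
  proof -
    have m: "(\<lambda>x. indicator S x *\<^sub>R v (x + h)) \<in> borel_measurable lborel" by measurable
    have ae: "AE x in lborel. norm (indicator S x *\<^sub>R v (x + h)) \<le> 1 * norm (indicator T (x + h) *\<^sub>R v (x + h))"
      using ST by (intro AE_I2) (auto simp: indicator_def)
    show "(\<lambda>x. indicator S x *\<^sub>R v (x + h)) \<in> Lp lborel p" by (rule Lp_bounded_mult(1)[OF sh(1) _ p0 m ae]) simp
    show "Lp_norm lborel p (\<lambda>x. indicator S x *\<^sub>R v (x + h)) \<le> 1 * locnorm U p T v"
      unfolding sh(2)[symmetric] by (rule Lp_bounded_mult(2)[OF sh(1) _ p0 m ae]) simp
  qed
  have "(\<lambda>x. indicator S x *\<^sub>R v x) = (\<lambda>x. indicator S x *\<^sub>R (v x - v (x + h)) + indicator S x *\<^sub>R v (x + h))"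
    by (simp add: fun_eq_iff algebra_simps)
  then have "locnorm U p S v \<le> Lp_norm lborel p (\<lambda>x. indicator S x *\<^sub>R (v x - v (x + h))) + Lp_norm lborel p (\<lambda>x. indicator S x *\<^sub>R v (x + h))"
    unfolding nn_integral_locnorm(3)[OF U(1) S vL(1) vm p0] using Lp_norm_triangle[OF d(1) s2(1) p] by simp
  then show "locnorm U p S v \<le> locnorm U p T v + norm h * Lp_norm (lebesgue_on U) p (grad v)"
    using d(2) s2(2) by (simp add: N_def)
qed

text \<open>By density of smooth fields. The norm on \<open>S\<close> is controlled by the norm on a
  set containing the translate of \<open>S\<close>, plus the gradient; in this way the Poincare
  inequality spreads from a piece of the boundary over the domain.\<close>

lemma locnorm_shift:
  fixes U :: "(real ^ 'n) set"
  assumes U: "open U" "bounded U" "lipschitz_boundary U" and p: "p \<ge> 1" and uG: "W1p_pair U p u G"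
    and S: "S \<in> sets borel" "S \<subseteq> U" and T: "T \<in> sets borel" "T \<subseteq> U"
    and ST: "\<And>x. x \<in> S \<Longrightarrow> x + h \<in> T" and seg: "\<And>x s. x \<in> S \<Longrightarrow> 0 < s \<Longrightarrow> s < 1 \<Longrightarrow> x + s *\<^sub>R h \<in> U"
  shows "locnorm U p S u \<le> locnorm U p T u + norm h * Lp_norm (lebesgue_on U) p G"
proof -
  obtain v where v: "\<And>n. smooth_field (v n)" "Lp_lim (lebesgue_on U) p v u"
     "Lp_lim (lebesgue_on U) p (\<lambda>n. grad (v n)) G"
    by (rule W1p_smooth_dense[OF U p uG]) (rule that; assumption)
  have p0: "p > 0" using p by simp
  have uL: "u \<in> Lp (lebesgue_on U) p" "G \<in> Lp (lebesgue_on U) p" using uG by (auto simp: W1p_pair_def)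
  have vL: "v n \<in> Lp (lebesgue_on U) p" "grad (v n) \<in> Lp (lebesgue_on U) p" for n
    using smooth_field_W1p_pair[OF U(1,2) p0 v(1)] by (auto simp: W1p_pair_def)
  have "(\<lambda>n. locnorm U p S (v n)) \<longlonglongrightarrow> locnorm U p S u" by (rule locnorm_tendsto[OF S(1) vL(1) uL(1) p v(2)])
  moreover have "(\<lambda>n. locnorm U p T (v n) + norm h * Lp_norm (lebesgue_on U) p (grad (v n))) 
     \<longlonglongrightarrow> locnorm U p T u + norm h * Lp_norm (lebesgue_on U) p G"
    by (intro tendsto_intros locnorm_tendsto[OF T(1) vL(1) uL(1) p v(2)] Lp_norm_tendsto[OF vL(2) uL(2) p v(3)])
  moreover have "locnorm U p S (v n) \<le> locnorm U p T (v n) + norm h * Lp_norm (lebesgue_on U) p (grad (v n))" for n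
    by (rule locnorm_shift_smooth(2)[OF U(1,2) p v(1) S T ST seg])
  ultimately show ?thesis by (intro LIMSEQ_le) auto
qed

section \<open>Heights and strips in a boundary chart\<close>

definition graph_height :: "'a::real_inner \<Rightarrow> ('a \<Rightarrow> real) \<Rightarrow> 'a \<Rightarrow> real" where
  "graph_height e \<gamma> x = x \<bullet> e - \<gamma> (x - (x \<bullet> e) *\<^sub>R e)"

lemma graph_height_shift:
  assumes "norm e = 1"
  shows "graph_height e \<gamma> (x + s *\<^sub>R e) = graph_height e \<gamma> x + s"
proof -
  have "e \<bullet> e = 1" using assms by (simp add: dot_square_norm)
  then show ?thesis by (simp add: graph_height_def inner_add_left algebra_simps)
qed

text \<open>The summand 1 comes from the coordinate along \<open>e\<close>, the summand
  \<open>L\<close> from the graph over the projection, which does not increase distances.\<close>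

lemma graph_height_lipschitz:
  fixes e :: "real ^ 'n"
  assumes e: "norm e = 1" and L: "L-lipschitz_on {y. y \<bullet> e = 0} \<gamma>"
  shows "\<bar>graph_height e \<gamma> x - graph_height e \<gamma> y\<bar> \<le> (1 + L) * dist x y"
proof -
  define v where "v = x - y"
  have "\<bar>\<gamma> ((y + v) - ((y + v) \<bullet> e) *\<^sub>R e) - \<gamma> (y - (y \<bullet> e) *\<^sub>R e)\<bar> \<le> L * norm (v - (v \<bullet> e) *\<^sub>R e)"
    by (rule lipschitz_graph_cone[OF e L])
  also have "\<dots> \<le> L * norm v" by (intro mult_left_mono projection_norm_le(1)[OF e] lipschitz_on_nonneg[OF L])
  finally have "\<bar>\<gamma> (x - (x \<bullet> e) *\<^sub>R e) - \<gamma> (y - (y \<bullet> e) *\<^sub>R e)\<bar> \<le> L * dist x y" by (simp add: v_def dist_norm)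
  moreover have "\<bar>x \<bullet> e - y \<bullet> e\<bar> \<le> dist x y"
    using Cauchy_Schwarz_ineq2[of "x - y" e] e by (simp add: inner_diff_left dist_norm)
  ultimately show ?thesis unfolding graph_height_def distrib_right by linarith
qed

lemma graph_height_continuous:
  fixes e :: "real ^ 'n"
  assumes "norm e = 1" "L-lipschitz_on {y. y \<bullet> e = 0} \<gamma>"
  shows "continuous_on UNIV (graph_height e \<gamma>)"
proof (rule lipschitz_on_continuous_on)
  show "(1 + L)-lipschitz_on UNIV (graph_height e \<gamma>)"
    using graph_height_lipschitz[OF assms] lipschitz_on_nonneg[OF assms(2)]
    by (intro lipschitz_onI) (auto simp: dist_real_def)
qed

locale boundary_chart =
  fixes U :: "(real ^ 'n) set" and x0 e :: "real ^ 'n" and \<gamma> :: "real ^ 'n \<Rightarrow> real" and L r :: real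
  assumes U: "open U" and x0: "x0 \<in> frontier U"
    and e: "norm e = 1" and r: "0 < r" and L0: "L \<ge> 0" and L: "L-lipschitz_on {y. y \<bullet> e = 0} \<gamma>"
    and chart: "\<And>x. x \<in> ball x0 r \<Longrightarrow> x \<in> U \<longleftrightarrow> \<gamma> (x - (x \<bullet> e) *\<^sub>R e) < x \<bullet> e"
begin

abbreviation "\<tau> \<equiv> graph_height e \<gamma>"

text \<open>Points in the ball of radius \<open>\<rho>\<close> have height at most
  \<open>(1 + L) * \<rho>\<close>. Descending from them to the graph ends within
  \<open>(2 + L) * \<rho> < r\<close> of the centre, so the foot point is still in the
  chart.\<close>

definition "\<rho> = r / (3 + L)"

lemma \<rho>: "0 < \<rho>" "\<rho> \<le> r" "(2 + L) * \<rho> < r"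
proof -
  show "0 < \<rho>" "\<rho> \<le> r" using r L0 by (auto simp: \<rho>_def field_simps)
  have "(3 + L) * \<rho> = r" using L0 by (simp add: \<rho>_def)
  then show "(2 + L) * \<rho> < r" using \<open>0 < \<rho>\<close> by (simp add: algebra_simps)
qed

lemma in_iff: "x \<in> ball x0 r \<Longrightarrow> x \<in> U \<longleftrightarrow> \<tau> x > 0"
  using chart by (simp add: graph_height_def)

lemma continuous_\<tau>: "continuous_on UNIV \<tau>" by (rule graph_height_continuous[OF e L])

text \<open>Negative height is an open condition that excludes \<open>U\<close>, so frontier points
  have height 0. Conversely a point of height 0 is approached from above by points of
  \<open>U\<close>.\<close>

lemma frontier_iff:
  assumes z: "z \<in> ball x0 r"
  shows "z \<in> frontier U \<longleftrightarrow> \<tau> z = 0"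
proof
  assume zf: "z \<in> frontier U"
  then have "z \<notin> U" using U by (simp add: frontier_def interior_open)
  then have "\<tau> z \<le> 0" using in_iff[OF z] by simp
  moreover have "\<not> \<tau> z < 0"
  proof
    assume neg: "\<tau> z < 0"
    define W where "W = ball x0 r \<inter> {x. \<tau> x < 0}"
    have "open W" unfolding W_def using continuous_\<tau> by (intro open_Int open_Collect_less continuous_on_const) auto
    moreover have "z \<in> W" using z neg by (simp add: W_def)
    moreover have "W \<inter> U = {}" using in_iff by (force simp: W_def)
    ultimately have "z \<notin> closure U" using open_Int_closure_eq_empty by blast
    then show False using zf by (simp add: frontier_def)
  qed
  ultimately show "\<tau> z = 0" by simp
next
  assume tz: "\<tau> z = 0"
  then have "z \<notin> U" using in_iff[OF z] by simp
  moreover have "z \<in> closure U"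
  proof (rule Lim_in_closed_set[of "closure U" "\<lambda>n. z + (1 / real (Suc n)) *\<^sub>R e" sequentially])
    have lim: "(\<lambda>n. z + (1 / real (Suc n)) *\<^sub>R e) \<longlonglongrightarrow> z + 0 *\<^sub>R e"
      by (intro tendsto_intros LIMSEQ_Suc[OF lim_1_over_n])
    then show lim': "(\<lambda>n. z + (1 / real (Suc n)) *\<^sub>R e) \<longlonglongrightarrow> z" by simp
    have "\<forall>\<^sub>F n in sequentially. z + (1 / real (Suc n)) *\<^sub>R e \<in> ball x0 r"
      using lim' z by (rule topological_tendstoD[OF _ open_ball])
    then show "\<forall>\<^sub>F n in sequentially. z + (1 / real (Suc n)) *\<^sub>R e \<in> closure U"
    proof eventually_elim
      fix n assume "z + (1 / real (Suc n)) *\<^sub>R e \<in> ball x0 r"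
      then have "z + (1 / real (Suc n)) *\<^sub>R e \<in> U" using in_iff graph_height_shift[OF e, of \<gamma> z "1 / real (Suc n)"] tz by simp
      then show "z + (1 / real (Suc n)) *\<^sub>R e \<in> closure U" using closure_subset by blast
    qed
  qed auto
  ultimately show "z \<in> frontier U" using U by (simp add: frontier_def interior_open)
qed

definition strip :: "real \<Rightarrow> (real ^ 'n) set" where
  "strip \<epsilon> = U \<inter> ball x0 \<rho> \<inter> {x. \<tau> x < \<epsilon>}"

lemma strip_borel: "strip \<epsilon> \<in> sets borel"
  unfolding strip_def using U continuous_\<tau> by (intro sets.Int borel_open open_Collect_less continuous_on_const) auto

lemma strip_down:
  assumes x: "x \<in> strip \<epsilon>"
  shows "0 < \<tau> x" "\<tau> x < \<epsilon>" "0 \<le> s \<Longrightarrow> s \<le> \<tau> x \<Longrightarrow> x - s *\<^sub>R e \<in> ball x0 r" "\<tau> (x - s *\<^sub>R e) = \<tau> x - s"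
proof -
  have xb: "dist x0 x < \<rho>" and xU: "x \<in> U" and "\<tau> x < \<epsilon>" using x by (auto simp: strip_def)
  then show "\<tau> x < \<epsilon>" by simp
  have xr: "x \<in> ball x0 r" using xb \<rho>(2) by simp
  then show "0 < \<tau> x" using in_iff xU by simp
  have "\<tau> x0 = 0" using frontier_iff[of x0] x0 r by simp
  then have "\<tau> x \<le> (1 + L) * dist x x0" using graph_height_lipschitz[OF e L, of x x0] by simp
  also have "\<dots> \<le> (1 + L) * \<rho>" using xb L0 by (intro mult_left_mono) (auto simp: dist_commute)
  finally have tx: "\<tau> x \<le> (1 + L) * \<rho>" .
  show "x - s *\<^sub>R e \<in> ball x0 r" if s: "0 \<le> s" "s \<le> \<tau> x"
  proof -
    have "dist x0 (x - s *\<^sub>R e) \<le> dist x0 x + dist x (x - s *\<^sub>R e)" by (rule dist_triangle)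
    also have "dist x (x - s *\<^sub>R e) = s" using s e by (simp add: dist_norm)
    also have "dist x0 x + s < \<rho> + (1 + L) * \<rho>" using xb s tx by linarith
    also have "\<dots> < r" using \<rho>(3) by (simp add: algebra_simps)
    finally show ?thesis by simp
  qed
  show "\<tau> (x - s *\<^sub>R e) = \<tau> x - s" using graph_height_shift[OF e, of \<gamma> x "-s"] by simp
qed

lemma near_boundary_in_strip:
  assumes x: "x \<in> U" "x \<in> ball x0 \<rho>" and z: "z \<in> frontier U" "z \<in> ball x0 r" and d: "(1 + L) * dist x z < \<epsilon>"
  shows "x \<in> strip \<epsilon>"
proof -
  have "\<tau> x \<le> (1 + L) * dist x z" using graph_height_lipschitz[OF e L, of x z] frontier_iff[OF z(2)] z(1) by simp
  then show ?thesis using x d by (simp add: strip_def)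
qed

end

section \<open>Linearity and continuity of traces\<close>

lemma surface_measure_borel:
  fixes f :: "real ^ 'n \<Rightarrow> 'b::topological_space"
  shows "f \<in> borel_measurable borel \<Longrightarrow> f \<in> borel_measurable (surface_measure U)"
  unfolding surface_measure_def by (intro measurable_restrict_space1) simp

lemma trace_add_scaleR:
  fixes U :: "(real ^ 'n) set"
  assumes U: "open U" and p: "p \<ge> 1" and B: "is_trace_operator U p B" and u: "W1p_pair U p u G" and w: "W1p_pair U p w H"
  shows "AE x in surface_measure U. B (\<lambda>x. u x + c *\<^sub>R w x) x = B u x + c *\<^sub>R B w x"
proof -
  define m where "m = (\<lambda>y. c *\<^sub>R w y)"
  \<comment> \<open>The multiple \<open>c w\<close> is written as \<open>w + (c - 1) w\<close>,
    which brings it under the closure rule for pairs.\<close>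
  have "W1p_pair U p (\<lambda>x. w x + (c - 1) *\<^sub>R w x) (\<lambda>x. H x + (c - 1) *\<^sub>R H x)"
    by (rule W1p_pair_add_scaleR[OF U p w w])
  moreover have "(\<lambda>x. w x + (c - 1) *\<^sub>R w x) = m" by (simp add: m_def fun_eq_iff scaleR_left_diff_distrib)
  ultimately have m: "m \<in> W1p U p" by (auto simp: W1p_iff_pair)
  have uW: "u \<in> W1p U p" "w \<in> W1p U p" using u w by (auto simp: W1p_iff_pair)
  have "AE x in surface_measure U. B (\<lambda>x. u x + m x) x = B u x + B m x"
    using B uW m unfolding is_trace_operator_def by blast
  moreover have "AE x in surface_measure U. B m x = c *\<^sub>R B w x"
    using B uW unfolding is_trace_operator_def m_def by blast
  ultimately show ?thesis by eventually_elim (simp add: m_def)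
qed

lemma trace_diff:
  fixes U :: "(real ^ 'n) set"
  assumes "open U" "p \<ge> 1" "is_trace_operator U p B" "W1p_pair U p u G" "W1p_pair U p w H"
  shows "AE x in surface_measure U. B (\<lambda>x. u x - w x) x = B u x - B w x"
  using trace_add_scaleR[OF assms, of "-1"] by simp

lemma trace_Lp: "is_trace_operator U p B \<Longrightarrow> W1p_pair U p u G \<Longrightarrow> B u \<in> Lp (surface_measure U) p"
  using W1p_iff_pair[of u U p] unfolding is_trace_operator_def Wtr_def by blast

text \<open>Only the integral part of the boundary norm is kept: this is what pointwise statements
  about traces are derived from.\<close>

lemma trace_diff_bound:
  fixes U :: "(real ^ 'n) set"
  assumes U: "open U" and p: "p \<ge> 1" and B: "is_trace_operator U p B"
  obtains C where "C \<ge> 0" "\<And>u G w H. W1p_pair U p u G \<Longrightarrow> W1p_pair U p w H \<Longrightarrow>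
    Lp_norm (surface_measure U) p (\<lambda>x. B u x - B w x) \<le> C * (Lp_norm (lebesgue_on U) p (\<lambda>x. u x - w x) + Lp_norm (lebesgue_on U) p (\<lambda>x. G x - H x))"
proof -
  obtain C where C: "\<And>u. u \<in> W1p U p \<Longrightarrow> Wtr_norm U p (B u) \<le> C * W1p_norm U p u"
    using B unfolding is_trace_operator_def by blast
  show thesis
  proof (rule that[of "max 0 C"])
    fix u G w H assume u: "W1p_pair U p u G" and w: "W1p_pair U p w H"
    define d where "d = (\<lambda>x. u x - w x)"
    note du = d_def
    have dp: "W1p_pair U p d (\<lambda>x. G x - H x)" unfolding du by (rule W1p_pair_diff[OF U p u w])
    then have dW: "d \<in> W1p U p" by (auto simp: W1p_iff_pair)
    have "AE x in surface_measure U. B u x - B w x = B d x"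
      using trace_diff[OF U p B u w] unfolding d_def by eventually_elim simp
    then have "Lp_norm (surface_measure U) p (\<lambda>x. B u x - B w x) = Lp_norm (surface_measure U) p (B d)"
      using Lp_measurable[OF trace_Lp[OF B u]] Lp_measurable[OF trace_Lp[OF B w]] Lp_measurable[OF trace_Lp[OF B dp]]
      by (intro Lp_norm_cong_AE) auto
    also have "\<dots> \<le> Wtr_norm U p (B d)" by (simp add: Wtr_norm_def Wtr_seminorm_def)
    also have "\<dots> \<le> C * W1p_norm U p d" by (rule C[OF dW])
    also have "\<dots> \<le> max 0 C * W1p_norm U p d" by (intro mult_right_mono) (auto simp: W1p_norm_def)
    finally show "Lp_norm (surface_measure U) p (\<lambda>x. B u x - B w x) \<le> max 0 C * (Lp_norm (lebesgue_on U) p (\<lambda>x. u x - w x) + Lp_norm (lebesgue_on U) p (\<lambda>x. G x - H x))"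
      using W1p_norm_pair[OF U dp] by (simp add: du)
  qed simp
qed

context boundary_chart
begin

text \<open>In the strip \<open>v\<close> is split into its difference from the value at the foot
  point, \<open>D\<close>, and that value, \<open>E\<close>. The first is a line integral of the
  gradient over a length below \<open>\<epsilon>\<close>; the second is turned into a boundary
  integral by the comparison of the layer with Hausdorff measure.\<close>

lemma strip_estimate_smooth:
  assumes bd: "bounded U" and p: "p \<ge> 1" and v: "smooth_field v" and \<epsilon>: "\<epsilon> > 0"
    and fin: "(\<lambda>x. indicator (ball x0 r) x *\<^sub>R v x) \<in> Lp (surface_measure U) p"
  shows "locnorm U p (strip \<epsilon>) v \<le> \<epsilon> * Lp_norm (lebesgue_on U) p (grad v) +
    (layer_const TYPE(real ^ 'n) * \<epsilon>) powr (1 / p) * Lp_norm (surface_measure U) p (\<lambda>x. indicator (ball x0 r) x *\<^sub>R v x)"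
proof -
  have p0: "p > 0" using p by simp
  define S where "S = strip \<epsilon>"
  have S [measurable]: "S \<in> sets borel" and SU: "S \<subseteq> U" using strip_borel by (auto simp: S_def strip_def)
  have vm [measurable]: "v \<in> borel_measurable borel" by (rule borel_measurable_continuous_onI[OF smooth_field_continuous[OF v]])
  have gm: "grad v \<in> borel_measurable borel" by (rule borel_measurable_continuous_onI[OF smooth_field_grad_continuous[OF v]])
  have tm [measurable]: "\<tau> \<in> borel_measurable borel" by (rule borel_measurable_continuous_onI[OF continuous_\<tau>])
  have vL: "v \<in> Lp (lebesgue_on U) p" "grad v \<in> Lp (lebesgue_on U) p"
    using smooth_field_W1p_pair[OF U bd p0 v] by (auto simp: W1p_pair_def)
  define N where "N = Lp_norm (lebesgue_on U) p (grad v)"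
  define D where "D x = indicator S x *\<^sub>R (v x - v (x - \<tau> x *\<^sub>R e))" for x
  define E where "E x = indicator S x *\<^sub>R v (x - \<tau> x *\<^sub>R e)" for x
  define M where "M = Lp_norm (surface_measure U) p (\<lambda>x. indicator (ball x0 r) x *\<^sub>R v x)"
  define c where "c = layer_const TYPE(real ^ 'n) * \<epsilon>"
  have c: "c > 0" using \<epsilon> layer_const_pos[where 'a = "real ^ 'n"] by (simp add: c_def)
  have Dm: "D \<in> borel_measurable borel" unfolding D_def by measurable
  have Em: "E \<in> borel_measurable borel" unfolding E_def by measurable
  have "(\<integral>\<^sup>+x. ennreal (norm (D x) powr p) \<partial>lborel) = (\<integral>\<^sup>+x. indicator S x * ennreal (norm (v x - v (x - \<tau> x *\<^sub>R e)) powr p) \<partial>lborel)"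
    using p0 by (intro nn_integral_cong) (auto simp: D_def indicator_def)
  also have "\<dots> \<le> ennreal (\<epsilon> powr p) * (\<integral>\<^sup>+x. indicator U x * ennreal (norm (grad v x) powr p) \<partial>lborel)"
  proof (rule smooth_translation_estimate[OF v e p S U tm])
    fix x s assume x: "x \<in> S" and s: "0 < s" "s < \<tau> x"
    then show "x - s *\<^sub>R e \<in> U" using strip_down(3,4)[of x \<epsilon> s] in_iff by (auto simp: S_def)
  qed (use strip_down(1,2) \<epsilon> in \<open>auto simp: S_def less_imp_le\<close>)
  also have "(\<integral>\<^sup>+x. indicator U x * ennreal (norm (grad v x) powr p) \<partial>lborel) = ennreal (locnorm U p U (grad v) powr p)"
    using U by (intro nn_integral_locnorm vL gm p0) auto
  also have "locnorm U p U (grad v) = N" unfolding N_def locnorm_def by (rule Lp_norm_cong) simp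
  also have "ennreal (\<epsilon> powr p) * ennreal (N powr p) = ennreal ((\<epsilon> * N) powr p)"
    using \<epsilon> by (simp add: N_def ennreal_mult[symmetric] powr_mult)
  finally have D: "D \<in> Lp lborel p" "Lp_norm lborel p D \<le> \<epsilon> * N"
    using Lp_norm_le_nn_integral[OF Dm p0, of "\<epsilon> * N"] \<epsilon> by (auto simp: N_def)
  \<comment> \<open>The layer estimate integrates over all of Hausdorff measure; the indicators
    confine the integrand to the part of the frontier inside the chart, where the foot points
    lie.\<close>
  define h where "h x = indicator (ball x0 r) x * (ennreal (norm (v x) powr p) * indicator (frontier U) x)" for x
  have [measurable]: "frontier U \<in> sets borel" "ball x0 r \<in> sets borel" by auto
  have hm: "h \<in> borel_measurable borel" unfolding h_def by measurable
  have "(\<integral>\<^sup>+x. ennreal (norm (E x) powr p) \<partial>lborel) \<le> (\<integral>\<^sup>+x. indicator {x. 0 < \<tau> x \<and> \<tau> x < \<epsilon>} x * h (x - \<tau> x *\<^sub>R e) \<partial>lborel)"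
  proof (rule nn_integral_mono)
    fix x
    show "ennreal (norm (E x) powr p) \<le> indicator {x. 0 < \<tau> x \<and> \<tau> x < \<epsilon>} x * h (x - \<tau> x *\<^sub>R e)"
    proof (cases "x \<in> S")
      case True
      then have x: "x \<in> strip \<epsilon>" by (simp add: S_def)
      have b: "x - \<tau> x *\<^sub>R e \<in> ball x0 r" using strip_down(1)[OF x] strip_down(3)[OF x, of "\<tau> x"] by simp
      then have "x - \<tau> x *\<^sub>R e \<in> frontier U" using frontier_iff strip_down(4)[OF x, of "\<tau> x"] by simp
      then show ?thesis using True b strip_down(1,2)[OF x] by (simp add: E_def h_def)
    qed (use p0 in \<open>simp add: E_def\<close>)
  qed
  also have "\<dots> \<le> ennreal c * (\<integral>\<^sup>+x. h x \<partial>hausdorff_measure (DIM(real ^ 'n) - 1))"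
    unfolding c_def by (rule nn_integral_layer_le[OF e \<epsilon> continuous_\<tau> hm])
  also have "(\<integral>\<^sup>+x. h x \<partial>hausdorff_measure (DIM(real ^ 'n) - 1)) = (\<integral>\<^sup>+x. ennreal (norm (indicator (ball x0 r) x *\<^sub>R v x) powr p) \<partial>surface_measure U)"
  proof -
    have "(\<integral>\<^sup>+x. ennreal (norm (indicator (ball x0 r) x *\<^sub>R v x) powr p) \<partial>surface_measure U) 
      = (\<integral>\<^sup>+x. ennreal (norm (indicator (ball x0 r) x *\<^sub>R v x) powr p) * indicator (frontier U) x \<partial>hausdorff_measure (CARD('n) - 1))"
      unfolding surface_measure_def by (rule nn_integral_restrict_space) (simp add: borel_closed)
    also have "\<dots> = (\<integral>\<^sup>+x. h x \<partial>hausdorff_measure (CARD('n) - 1))"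
      using p0 by (intro nn_integral_cong) (auto simp: h_def indicator_def)
    finally show ?thesis by simp
  qed
  also have "\<dots> = ennreal (LINT x|surface_measure U. norm (indicator (ball x0 r) x *\<^sub>R v x) powr p)"
    by (rule nn_integral_eq_integral[OF Lp_integrable[OF fin]]) simp
  also have "(LINT x|surface_measure U. norm (indicator (ball x0 r) x *\<^sub>R v x) powr p) = M powr p"
    unfolding M_def using p0 by (simp add: Lp_norm_powr)
  also have "ennreal c * ennreal (M powr p) = ennreal ((c powr (1/p) * M) powr p)"
    using c p0 by (simp add: M_def ennreal_mult[symmetric] powr_mult powr_powr)
  finally have E: "E \<in> Lp lborel p" "Lp_norm lborel p E \<le> c powr (1/p) * M"
    using Lp_norm_le_nn_integral[OF Em p0, of "c powr (1/p) * M"] by (auto simp: M_def)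
  have "(\<lambda>x. indicator S x *\<^sub>R v x) = (\<lambda>x. D x + E x)" by (simp add: fun_eq_iff D_def E_def algebra_simps)
  then have "locnorm U p S v \<le> Lp_norm lborel p D + Lp_norm lborel p E"
    unfolding nn_integral_locnorm(3)[OF U S SU vL(1) vm p0] using Lp_norm_triangle[OF D(1) E(1) p] by simp
  then show ?thesis using D(2) E(2) by (simp add: S_def N_def M_def c_def)
qed

text \<open>For approximating smooth fields the boundary term is controlled by the trace of
  \<open>v n - u\<close> in the chart, which tends to 0 by continuity of traces. In the limit only
  the gradient term survives, with constant \<open>\<epsilon>\<close>.\<close>

lemma strip_estimate:
  assumes bd: "bounded U" "lipschitz_boundary U" and p: "p \<ge> 1" and \<epsilon>: "\<epsilon> > 0"
    and B: "is_trace_operator U p B" and uG: "W1p_pair U p u G"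
    and zero: "AE x in surface_measure U. x \<in> ball x0 r \<longrightarrow> B u x = 0"
  shows "locnorm U p (strip \<epsilon>) u \<le> \<epsilon> * Lp_norm (lebesgue_on U) p G"
proof -
  have p0: "p > 0" using p by simp
  obtain v where v: "\<And>n. smooth_field (v n)" "Lp_lim (lebesgue_on U) p v u"
     "Lp_lim (lebesgue_on U) p (\<lambda>n. grad (v n)) G"
    by (rule W1p_smooth_dense[OF U bd p uG]) (rule that; assumption)
  obtain C where C: "C \<ge> 0" "\<And>u G w H. W1p_pair U p u G \<Longrightarrow> W1p_pair U p w H \<Longrightarrow>
    Lp_norm (surface_measure U) p (\<lambda>x. B u x - B w x) \<le> C * (Lp_norm (lebesgue_on U) p (\<lambda>x. u x - w x) + Lp_norm (lebesgue_on U) p (\<lambda>x. G x - H x))"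
    by (rule trace_diff_bound[OF U p B]) (rule that; assumption)
  have uL: "u \<in> Lp (lebesgue_on U) p" "G \<in> Lp (lebesgue_on U) p" and uW: "u \<in> W1p U p" using uG by (auto simp: W1p_pair_def W1p_iff_pair)
  have vp: "W1p_pair U p (v n) (grad (v n))" for n by (rule smooth_field_W1p_pair[OF U bd(1) p0 v(1)])
  then have vL: "v n \<in> Lp (lebesgue_on U) p" "grad (v n) \<in> Lp (lebesgue_on U) p" and vW: "v n \<in> W1p U p" for n
    by (auto simp: W1p_pair_def W1p_iff_pair)
  define g where "g n x = indicator (ball x0 r) x *\<^sub>R v n x" for n x
  have gm: "g n \<in> borel_measurable (surface_measure U)" for n
    unfolding g_def using smooth_field_continuous[OF v(1)]
    by (intro surface_measure_borel borel_measurable_scaleR borel_measurable_indicator borel_measurable_continuous_onI) auto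
  have ae: "AE x in surface_measure U. norm (g n x) \<le> 1 * norm (B (v n) x - B u x)" for n
  proof -
    have "AE x in surface_measure U. B (v n) x = v n x"
      using B vW[of n] smooth_field_continuous[OF v(1)] unfolding is_trace_operator_def by blast
    with zero show ?thesis by eventually_elim (auto simp: g_def indicator_def)
  qed
  have gL: "g n \<in> Lp (surface_measure U) p" "Lp_norm (surface_measure U) p (g n) \<le> 1 * Lp_norm (surface_measure U) p (\<lambda>x. B (v n) x - B u x)" for n
    by (rule Lp_bounded_mult[OF Lp_diff[OF trace_Lp[OF B vp] trace_Lp[OF B uG] p] _ p0 gm ae], simp)+
  define c where "c = (layer_const TYPE(real ^ 'n) * \<epsilon>) powr (1 / p)"
  have c: "c \<ge> 0" by (simp add: c_def)
  have "locnorm U p (strip \<epsilon>) (v n) \<le> \<epsilon> * Lp_norm (lebesgue_on U) p (grad (v n)) + 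
     c * (C * (Lp_norm (lebesgue_on U) p (\<lambda>x. v n x - u x) + Lp_norm (lebesgue_on U) p (\<lambda>x. grad (v n) x - G x)))" for n
  proof -
    have "locnorm U p (strip \<epsilon>) (v n) \<le> \<epsilon> * Lp_norm (lebesgue_on U) p (grad (v n)) + c * Lp_norm (surface_measure U) p (g n)"
      unfolding c_def g_def by (rule strip_estimate_smooth[OF bd(1) p v(1) \<epsilon> gL(1)[unfolded g_def]])
    also have "c * Lp_norm (surface_measure U) p (g n) \<le> c * (C * (Lp_norm (lebesgue_on U) p (\<lambda>x. v n x - u x) + Lp_norm (lebesgue_on U) p (\<lambda>x. grad (v n) x - G x)))"
      using gL(2)[of n] C(2)[OF vp uG, of n] c by (intro mult_left_mono) auto
    finally show ?thesis by simp
  qed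
  moreover have "(\<lambda>n. locnorm U p (strip \<epsilon>) (v n)) \<longlonglongrightarrow> locnorm U p (strip \<epsilon>) u"
    by (rule locnorm_tendsto[OF strip_borel vL(1) uL(1) p v(2)])
  moreover have "(\<lambda>n. \<epsilon> * Lp_norm (lebesgue_on U) p (grad (v n)) + 
     c * (C * (Lp_norm (lebesgue_on U) p (\<lambda>x. v n x - u x) + Lp_norm (lebesgue_on U) p (\<lambda>x. grad (v n) x - G x))))
     \<longlonglongrightarrow> \<epsilon> * Lp_norm (lebesgue_on U) p G + c * (C * (0 + 0))"
    by (intro tendsto_intros Lp_norm_tendsto[OF vL(2) uL(2) p v(3)] v(2,3))
  ultimately have "locnorm U p (strip \<epsilon>) u \<le> \<epsilon> * Lp_norm (lebesgue_on U) p G + c * (C * (0 + 0))"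
    by (intro LIMSEQ_le[of "\<lambda>n. locnorm U p (strip \<epsilon>) (v n)"]) auto
  then show ?thesis by simp
qed

end

lemma boundary_chart_exists:
  assumes "open U" "lipschitz_boundary U" "x0 \<in> frontier U"
  shows "\<exists>e \<gamma> L r. boundary_chart U x0 e \<gamma> L r"
proof -
  obtain e \<gamma> L r where "norm e = 1" "0 < r" "L \<ge> 0" "L-lipschitz_on {y. y \<bullet> e = 0} \<gamma>"
    "\<And>x. x \<in> ball x0 r \<Longrightarrow> x \<in> U \<longleftrightarrow> \<gamma> (x - (x \<bullet> e) *\<^sub>R e) < x \<bullet> e"
    by (rule lipschitz_boundary_chart[OF assms(2,3)]) (rule that; assumption)
  then have "boundary_chart U x0 e \<gamma> L r" using assms by unfold_locales auto
  then show ?thesis by blast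
qed

lemma boundary_chart_shrink:
  assumes "boundary_chart U x0 e \<gamma> L r" "0 < r'" "r' \<le> r"
  shows "boundary_chart U x0 e \<gamma> L r'"
  using assms unfolding boundary_chart_def by auto

section \<open>The Poincare inequality\<close>

lemma locnorm_Un:
  fixes u :: "real ^ 'n \<Rightarrow> 'b::euclidean_space"
  assumes "S \<in> sets borel" "T \<in> sets borel" and u: "u \<in> Lp (lebesgue_on U) p" and p: "p \<ge> 1"
  shows "locnorm U p (S \<union> T) u \<le> locnorm U p S u + locnorm U p T u"
proof -
  have "(\<lambda>x. indicator (S \<union> T) x *\<^sub>R u x) = (\<lambda>x. indicator S x *\<^sub>R u x + indicator (T - S) x *\<^sub>R u x)"
    by (auto simp: fun_eq_iff indicator_def)
  then have "locnorm U p (S \<union> T) u \<le> locnorm U p S u + locnorm U p (T - S) u"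
    unfolding locnorm_def using assms by (simp add: Lp_norm_triangle Lp_indicator(1))
  also have "locnorm U p (T - S) u \<le> locnorm U p T u" using assms by (intro locnorm_mono) auto
  finally show ?thesis by simp
qed

lemma locnorm_empty: "p > 0 \<Longrightarrow> locnorm U p {} u = 0"
  by (simp add: locnorm_def Lp_norm_def)

text \<open>A Poincare inequality on the piece \<open>S\<close>, with one constant for the whole
  family \<open>V\<close> and with the gradient measured on all of \<open>U\<close>. The goal is
  \<open>S = UNIV\<close>.\<close>

definition controlled :: "(real ^ 'n) set \<Rightarrow> real \<Rightarrow> ('n vfield \<Rightarrow> 'n mfield \<Rightarrow> bool) \<Rightarrow> (real ^ 'n) set \<Rightarrow> bool" where
  "controlled U p V S \<longleftrightarrow> (\<exists>C\<ge>0. \<forall>u G. V u G \<longrightarrow> locnorm U p S u \<le> C * Lp_norm (lebesgue_on U) p G)"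

locale controlled_family =
  fixes U :: "(real ^ 'n) set" and p :: real and V :: "'n vfield \<Rightarrow> 'n mfield \<Rightarrow> bool"
  assumes dom: "open U" "bounded U" "lipschitz_boundary U" and p: "p \<ge> 1"
    and V: "V u G \<Longrightarrow> W1p_pair U p u G"
begin

lemma V_Lp: "V u G \<Longrightarrow> u \<in> Lp (lebesgue_on U) p" using V by (auto simp: W1p_pair_def)

lemma controlled_mono:
  assumes "controlled U p V T" "S \<in> sets borel" "T \<in> sets borel" "S \<inter> U \<subseteq> T"
  shows "controlled U p V S"
proof -
  obtain C where C: "C \<ge> 0" "\<And>u G. V u G \<Longrightarrow> locnorm U p T u \<le> C * Lp_norm (lebesgue_on U) p G"
    using assms(1) unfolding controlled_def by blast
  have "locnorm U p S u \<le> C * Lp_norm (lebesgue_on U) p G" if "V u G" for u G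
    using locnorm_mono[OF assms(2,3,4) V_Lp[OF that]] C(2)[OF that] p by simp
  then show ?thesis unfolding controlled_def using C(1) by blast
qed

lemma controlled_Un:
  assumes S: "controlled U p V S" "S \<in> sets borel" and T: "controlled U p V T" "T \<in> sets borel"
  shows "controlled U p V (S \<union> T)"
proof -
  obtain D where D: "D \<ge> 0" "\<And>u G. V u G \<Longrightarrow> locnorm U p T u \<le> D * Lp_norm (lebesgue_on U) p G"
    using T(1) unfolding controlled_def by blast
  obtain C where C: "C \<ge> 0" "\<And>u G. V u G \<Longrightarrow> locnorm U p S u \<le> C * Lp_norm (lebesgue_on U) p G"
    using S(1) unfolding controlled_def by blast
  have "locnorm U p (S \<union> T) u \<le> (C + D) * Lp_norm (lebesgue_on U) p G" if uG: "V u G" for u G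
    using locnorm_Un[OF S(2) T(2) V_Lp[OF uG] p] C(2)[OF uG] D(2)[OF uG] by (simp add: algebra_simps)
  then show ?thesis unfolding controlled_def using C(1) D(1) by (intro exI[of _ "C + D"]) auto
qed

lemma controlled_shift:
  assumes T: "controlled U p V T" "T \<in> sets borel" and S: "S \<in> sets borel"
    and ST: "\<And>x. x \<in> S \<Longrightarrow> x \<in> U \<Longrightarrow> x + h \<in> T \<inter> U" and seg: "\<And>x s. x \<in> S \<Longrightarrow> x \<in> U \<Longrightarrow> 0 < s \<Longrightarrow> s < 1 \<Longrightarrow> x + s *\<^sub>R h \<in> U"
  shows "controlled U p V S"
proof -
  have b: "S \<inter> U \<in> sets borel" "T \<inter> U \<in> sets borel" using S T dom by auto
  obtain C where C: "C \<ge> 0" "\<And>u G. V u G \<Longrightarrow> locnorm U p T u \<le> C * Lp_norm (lebesgue_on U) p G"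
    using T(1) unfolding controlled_def by blast
  have "locnorm U p S u \<le> (C + norm h) * Lp_norm (lebesgue_on U) p G" if uG: "V u G" for u G
  proof -
    have "locnorm U p S u \<le> locnorm U p (S \<inter> U) u" using locnorm_mono[OF S b(1) _ V_Lp[OF uG]] p by auto
    also have "\<dots> \<le> locnorm U p (T \<inter> U) u + norm h * Lp_norm (lebesgue_on U) p G"
      by (rule locnorm_shift[OF dom p V[OF uG] b(1) _ b(2)]) (use ST seg in auto)
    also have "locnorm U p (T \<inter> U) u \<le> locnorm U p T u" using locnorm_mono[OF b(2) T(2) _ V_Lp[OF uG]] p by auto
    finally show ?thesis using C(2)[OF uG] by (simp add: algebra_simps)
  qed
  then show ?thesis unfolding controlled_def using C(1) by (intro exI[of _ "C + norm h"]) auto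
qed

definition "controlled_point x \<longleftrightarrow> (\<exists>r>0. controlled U p V (ball x r))"

lemma controlled_point_near:
  assumes "controlled_point y" "d > 0"
  obtains s where "0 < s" "s \<le> d" "controlled U p V (ball y s)"
proof -
  obtain r where "r > 0" and c: "controlled U p V (ball y r)" using assms(1) unfolding controlled_point_def by blast
  show thesis by (rule that[of "min r d"]) (use \<open>r > 0\<close> assms(2) in \<open>auto intro: controlled_mono[OF c]\<close>)
qed

text \<open>Control passes between points of a ball inside \<open>U\<close>, because translating a
  small ball from one to the other stays in \<open>U\<close>. So the controlled points form a set
  that is both open and relatively closed, and connectedness finishes.\<close>

lemma controlled_point_interior:
  assumes "connected U" and x: "x \<in> U" "controlled_point x" and y: "y \<in> U"
  shows "controlled_point y"
proof -
  define D where "D = {x \<in> U. controlled_point x}"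
  have "open D" unfolding open_contains_ball
  proof
    fix x assume "x \<in> D"
    then obtain r where r: "r > 0" "controlled U p V (ball x r)" and "x \<in> U" by (auto simp: D_def controlled_point_def)
    obtain d where d: "d > 0" "ball x d \<subseteq> U" using dom(1) \<open>x \<in> U\<close> open_contains_ball by blast
    have "y \<in> D" if y: "y \<in> ball x (min r d)" for y
    proof -
      have "ball y (r - dist x y) \<subseteq> ball x r"
      proof
        fix z assume "z \<in> ball y (r - dist x y)"
        then show "z \<in> ball x r" using dist_triangle[of x z y] by simp
      qed
      then have "controlled U p V (ball y (r - dist x y))" by (intro controlled_mono[OF r(2)]) auto
      then show ?thesis using y d unfolding D_def controlled_point_def by (auto intro!: exI[of _ "r - dist x y"])
    qed
    then show "\<exists>e>0. ball x e \<subseteq> D" using r(1) d(1) by (intro exI[of _ "min r d"]) auto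
  qed
  moreover have "open (U - D)" unfolding open_contains_ball
  proof
    fix x assume xD: "x \<in> U - D"
    then obtain r where r: "r > 0" "ball x r \<subseteq> U" using dom(1) open_contains_ball by blast
    have "y \<notin> D" if y: "y \<in> ball x (r / 2)" for y
    proof
      assume "y \<in> D"
      then have "controlled_point y" by (simp add: D_def)
      then obtain s where s: "0 < s" "s \<le> r / 2" "controlled U p V (ball y s)"
        using r(1) by (elim controlled_point_near[where d = "r / 2"]) auto
      have b: "z + t *\<^sub>R (y - x) \<in> ball x r" if z: "z \<in> ball x s" and t: "0 \<le> t" "t \<le> 1" for z t
      proof -
        have "dist x (z + t *\<^sub>R (y - x)) \<le> dist x z + norm (t *\<^sub>R (y - x))"
          using dist_triangle[of x "z + t *\<^sub>R (y - x)" z] by (simp add: dist_norm)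
        also have "norm (t *\<^sub>R (y - x)) \<le> 1 * norm (y - x)" unfolding norm_scaleR using t by (intro mult_right_mono) auto
        finally show ?thesis using z y s by (simp add: dist_norm norm_minus_commute)
      qed
      have "controlled U p V (ball x s)"
      proof (rule controlled_shift[OF s(3), where h = "y - x"])
        fix z assume z: "z \<in> ball x s" "z \<in> U"
        have "dist y (z + (y - x)) = dist x z" by (simp add: dist_norm algebra_simps)
        then show "z + (y - x) \<in> ball y s \<inter> U" using z b[of z 1] r by auto
        show "z + t *\<^sub>R (y - x) \<in> U" if "0 < t" "t < 1" for t using b[of z t] z that r by auto
      qed auto
      then show False using xD s(1) by (auto simp: D_def controlled_point_def)
    qed
    then show "\<exists>e>0. ball x e \<subseteq> U - D" using r by (intro exI[of _ "r / 2"]) auto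
  qed
  ultimately have "D \<inter> U = {} \<or> (U - D) \<inter> U = {}"
    by (intro connectedD[OF assms(1)]) (auto simp: D_def)
  then show ?thesis using x y by (auto simp: D_def)
qed

text \<open>A neighbourhood of \<open>x0\<close> in \<open>U\<close>, pushed up by
  \<open>r / 2\<close> along \<open>e\<close>, lands near the interior point \<open>y\<close>, and
  the moving points never cross the graph.\<close>

lemma controlled_point_frontier:
  assumes all: "\<And>y. y \<in> U \<Longrightarrow> controlled_point y" and x0: "x0 \<in> frontier U"
  shows "controlled_point x0"
proof -
  obtain e \<gamma> L r where "boundary_chart U x0 e \<gamma> L r" using boundary_chart_exists[OF dom(1,3) x0] by blast
  then interpret boundary_chart U x0 e \<gamma> L r .
  define y where "y = x0 + (r / 2) *\<^sub>R e"
  have up: "x + t *\<^sub>R e \<in> U" if "dist x0 x < r / 2" "0 \<le> t" "t \<le> r / 2" "\<tau> x + t > 0" for x t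
  proof -
    have "dist x0 (x + t *\<^sub>R e) \<le> dist x0 x + dist x (x + t *\<^sub>R e)" by (rule dist_triangle)
    then have "x + t *\<^sub>R e \<in> ball x0 r" using that e by (simp add: dist_norm)
    then show ?thesis using in_iff graph_height_shift[OF e, of \<gamma> x t] that by simp
  qed
  have "\<tau> x0 = 0" using frontier_iff[of x0] x0 r by simp
  then have "y \<in> U" using up[of x0 "r / 2"] r by (simp add: y_def)
  then obtain s where s: "0 < s" "s \<le> r / 2" "controlled U p V (ball y s)"
    using r by (elim controlled_point_near[OF all, where d = "r / 2"]) auto
  have "controlled U p V (ball x0 s)"
  proof (rule controlled_shift[OF s(3), where h = "(r / 2) *\<^sub>R e"])
    fix x assume x: "x \<in> ball x0 s" "x \<in> U"
    then have tx: "\<tau> x > 0" "dist x0 x < r / 2" using in_iff s r by auto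
    have "dist y (x + (r / 2) *\<^sub>R e) = dist x0 x" by (simp add: dist_norm y_def)
    then show "x + (r / 2) *\<^sub>R e \<in> ball y s \<inter> U" using x up[of x "r / 2"] tx r by simp
    show "x + t *\<^sub>R ((r / 2) *\<^sub>R e) \<in> U" if "0 < t" "t < 1" for t
      using up[of x "t * (r / 2)"] tx that r mult_left_le_one_le[of "r / 2" t]
      add_pos_nonneg[of "\<tau> x" "t * r / 2"] by simp
  qed auto
  then show ?thesis using s(1) by (auto simp: controlled_point_def)
qed

lemma controlled_UNIV:
  assumes "connected U" "x \<in> U" "controlled_point x"
  shows "controlled U p V UNIV"
proof -
  have all: "controlled_point y" if "y \<in> U" for y using controlled_point_interior[OF assms that] .
  have "\<forall>y\<in>closure U. controlled_point y"
    using all controlled_point_frontier[OF all] dom(1) by (auto simp: frontier_def interior_open)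
  then obtain r where r: "\<And>y. y \<in> closure U \<Longrightarrow> r y > 0" "\<And>y. y \<in> closure U \<Longrightarrow> controlled U p V (ball y (r y))"
    unfolding controlled_point_def by metis
  obtain I where I: "I \<subseteq> closure U" "finite I" "closure U \<subseteq> (\<Union>y\<in>I. ball y (r y))"
  proof (rule compactE_image[of "closure U" "closure U" "\<lambda>y. ball y (r y)"])
    show "compact (closure U)" using dom(2) by simp
    show "closure U \<subseteq> (\<Union>y\<in>closure U. ball y (r y))" using r(1) by auto
  qed (use that in auto)
  have "controlled U p V (\<Union>y\<in>I. ball y (r y))" using I(2,1)
  proof (induction rule: finite_induct)
    case empty
    show ?case unfolding controlled_def using p by (auto simp: locnorm_empty intro!: exI[of _ 0])
  next
    case (insert y J)
    then have "controlled U p V (ball y (r y) \<union> (\<Union>y\<in>J. ball y (r y)))"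
      by (intro controlled_Un r(2)) (auto intro!: borel_open)
    then show ?case by simp
  qed
  then show ?thesis using I(3) closure_subset[of U]
    by (elim controlled_mono) (auto intro!: borel_open)
qed

end

text \<open>The constant is built up directly and not by a compactness argument by contradiction:
  the strip estimate gives control near one point of \<open>\<Gamma>\<close>, and translations and
  finitely many balls give the rest.\<close>

theorem poincare_inequality:
  fixes U \<Gamma> :: "(real ^ 'n) set"
  assumes dom: "open U" "bounded U" "lipschitz_boundary U" and con: "connected U" and p: "p \<ge> 1"
    and B: "is_trace_operator U p B" and \<Gamma>: "openin (top_of_set (frontier U)) \<Gamma>" "\<Gamma> \<noteq> {}"
  shows "\<exists>C\<ge>0. \<forall>u G. W1p_pair U p u G \<longrightarrow> (AE x in surface_measure U. x \<in> \<Gamma> \<longrightarrow> B u x = 0) \<longrightarrow>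
    Lp_norm (lebesgue_on U) p u \<le> C * Lp_norm (lebesgue_on U) p G"
proof -
  define V where "V = (\<lambda>u G. W1p_pair U p u G \<and> (AE x in surface_measure U. x \<in> \<Gamma> \<longrightarrow> B u x = 0))"
  interpret controlled_family U p V by unfold_locales (use dom p in \<open>auto simp: V_def\<close>)
  obtain x0 where x0: "x0 \<in> \<Gamma>" using \<Gamma> by blast
  then have x0f: "x0 \<in> frontier U" using openin_imp_subset[OF \<Gamma>(1)] by blast
  obtain W where W: "open W" "\<Gamma> = frontier U \<inter> W" using \<Gamma>(1) by (auto simp: openin_open)
  then obtain r' where r': "r' > 0" "ball x0 r' \<subseteq> W" using x0 open_contains_ball by blast
  obtain e \<gamma> L r where ch: "boundary_chart U x0 e \<gamma> L r" using boundary_chart_exists[OF dom(1,3) x0f] by blast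
  then have "r > 0" by (simp add: boundary_chart_def)
  \<comment> \<open>The smaller chart meets the frontier inside \<open>\<Gamma>\<close> only, so the
    trace vanishes on all of its boundary part.\<close>
  then have "boundary_chart U x0 e \<gamma> L (min r r')" using r' by (intro boundary_chart_shrink[OF ch]) auto
  then interpret boundary_chart U x0 e \<gamma> L "min r r'" .
  \<comment> \<open>Here \<open>\<epsilon>\<close> exceeds every height in the ball, so the strip is
    all of the domain inside that ball.\<close>
  define \<epsilon> where "\<epsilon> = (1 + L) * \<rho> + 1"
  have \<epsilon>: "\<epsilon> > 0" using L0 \<rho>(1) by (simp add: \<epsilon>_def add_nonneg_pos)
  have strip: "U \<inter> ball x0 \<rho> \<subseteq> strip \<epsilon>"
  proof
    fix x assume x: "x \<in> U \<inter> ball x0 \<rho>"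
    then have "(1 + L) * dist x x0 \<le> (1 + L) * \<rho>" using L0 by (intro mult_left_mono) (auto simp: dist_commute)
    then show "x \<in> strip \<epsilon>" using x x0f local.r by (intro near_boundary_in_strip[of x x0]) (auto simp: \<epsilon>_def)
  qed
  have "controlled U p V (strip \<epsilon>)" unfolding controlled_def
  proof (intro exI[of _ \<epsilon>] conjI allI impI)
    fix u G assume uG: "V u G"
    then have "AE x in surface_measure U. x \<in> \<Gamma> \<longrightarrow> B u x = 0" by (simp add: V_def)
    moreover have "AE x in surface_measure U. x \<in> frontier U"
      by (intro AE_I2) (simp add: surface_measure_def space_restrict_space)
    ultimately have "AE x in surface_measure U. x \<in> ball x0 (min r r') \<longrightarrow> B u x = 0"
      by eventually_elim (use W r' in auto)
    then show "locnorm U p (strip \<epsilon>) u \<le> \<epsilon> * Lp_norm (lebesgue_on U) p G"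
      by (intro strip_estimate[OF dom(2,3) p \<epsilon> B V[OF uG]])
  qed (use \<epsilon> in simp)
  then have c: "controlled U p V (U \<inter> ball x0 \<rho>)" using dom(1) strip
    by (elim controlled_mono) (auto intro: strip_borel)
  have "x0 \<in> closure U" using x0f by (simp add: frontier_def)
  then obtain x where x: "x \<in> U" "dist x x0 < \<rho>" using \<rho>(1) closure_approachable by blast
  have "open (U \<inter> ball x0 \<rho>)" using dom(1) by auto
  moreover have "x \<in> U \<inter> ball x0 \<rho>" using x by (simp add: dist_commute)
  ultimately obtain s where s: "s > 0" "ball x s \<subseteq> U \<inter> ball x0 \<rho>" using open_contains_ball by blast
  have "controlled U p V (ball x s)" using s(2) dom(1) by (intro controlled_mono[OF c]) auto
  then have "controlled_point x" using s(1) by (auto simp: controlled_point_def)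
  from controlled_UNIV[OF con x(1) this] show ?thesis
    unfolding controlled_def V_def locnorm_UNIV by blast
qed

section \<open>Green's formula for vanishing traces\<close>

lemma Lp_inner_tendsto:
  fixes F :: "'a \<Rightarrow> 'b::euclidean_space"
  assumes f: "\<And>n. f n \<in> Lp M p" "F \<in> Lp M p" and g: "g \<in> Lp M q" and pq: "p > 1" "q > 1" "1/p + 1/q = 1"
    and lim: "Lp_lim M p f F"
  shows "(\<lambda>n. LINT x|M. f n x \<bullet> g x) \<longlonglongrightarrow> (LINT x|M. F x \<bullet> g x)"
proof (rule LIM_zero_cancel, rule tendsto_0_le[where K = "Lp_norm M q g"])
  have "(LINT x|M. f n x \<bullet> g x) - (LINT x|M. F x \<bullet> g x) = (LINT x|M. (f n x - F x) \<bullet> g x)" for n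
    using Hoelder_inner(1)[OF f(1) g pq] Hoelder_inner(1)[OF f(2) g pq] by (simp add: inner_diff_left)
  then show "\<forall>\<^sub>F n in sequentially. norm ((LINT x|M. f n x \<bullet> g x) - (LINT x|M. F x \<bullet> g x)) \<le> norm (Lp_norm M p (\<lambda>x. f n x - F x)) * Lp_norm M q g"
    using Hoelder_inner(2)[OF Lp_diff[OF f] g pq] pq by simp
qed (fact lim)

lemma Lp_norm_indicator_tendsto_0:
  fixes f :: "'a \<Rightarrow> 'b::euclidean_space"
  assumes f: "f \<in> Lp M p" and p: "p > 0" and m: "\<And>n. (\<lambda>x. indicator (S n) x *\<^sub>R f x) \<in> borel_measurable M"
    and ev: "\<And>x. x \<in> space M \<Longrightarrow> \<forall>\<^sub>F n in sequentially. x \<notin> S n"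
  shows "(\<lambda>n. Lp_norm M p (\<lambda>x. indicator (S n) x *\<^sub>R f x)) \<longlonglongrightarrow> 0"
  unfolding Lp_norm_tendsto_iff[OF p]
proof -
  note [measurable] = Lp_measurable[OF f] m
  have "(\<lambda>n. LINT x|M. norm (indicator (S n) x *\<^sub>R f x) powr p) \<longlonglongrightarrow> (LINT x|M. 0)"
  proof (rule integral_dominated_convergence[where w = "\<lambda>x. norm (f x) powr p"])
    show "AE x in M. (\<lambda>n. norm (indicator (S n) x *\<^sub>R f x) powr p) \<longlonglongrightarrow> 0"
    proof (rule AE_I2)
      fix x assume "x \<in> space M"
      from ev[OF this] have "\<forall>\<^sub>F n in sequentially. norm (indicator (S n) x *\<^sub>R f x) powr p = 0"
        by eventually_elim (use p in simp)
      then show "(\<lambda>n. norm (indicator (S n) x *\<^sub>R f x) powr p) \<longlonglongrightarrow> 0" by (rule tendsto_eventually)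
    qed
    show "AE x in M. norm (norm (indicator (S n) x *\<^sub>R f x) powr p) \<le> norm (f x) powr p" for n
      using p by (intro AE_I2) (auto simp: indicator_def)
    show "(\<lambda>x. norm (indicator (S n) x *\<^sub>R f x) powr p) \<in> borel_measurable M" for n by measurable
  qed (use Lp_integrable[OF f] in auto)
  then show "(\<lambda>n. LINT x|M. norm (indicator (S n) x *\<^sub>R f x) powr p) \<longlonglongrightarrow> 0" by simp
qed

lemma weak_divergence_vector_test:
  fixes P :: "('n::finite) mfield"
  assumes U: "open U" and P: "is_weak_divergence U P g" and \<phi>: "\<And>i. \<phi> i \<in> test_functions U"
  shows "(LINT x|lebesgue_on U. (\<Sum>i\<in>UNIV. \<Sum>j\<in>UNIV. P x $ i $ j * partial j (\<phi> i) x)) + (LINT x|lebesgue_on U. (\<Sum>i\<in>UNIV. g x $ i * \<phi> i x)) = 0"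
proof -
  have l: "loc_integrable U (\<lambda>x. P x $ i $ j)" "loc_integrable U (\<lambda>x. g x $ i)" for i j
    using P by (auto simp: is_weak_divergence_def intro!: loc_integrable_component)
  have "(LINT x|lebesgue_on U. (\<Sum>i\<in>UNIV. \<Sum>j\<in>UNIV. P x $ i $ j * partial j (\<phi> i) x))
      = (\<Sum>i\<in>UNIV. LINT x|lebesgue_on U. (\<Sum>j\<in>UNIV. P x $ i $ j * partial j (\<phi> i) x))"
    by (intro Bochner_Integration.integral_sum Bochner_Integration.integrable_sum test_function_integrable(2)[OF U l(1) \<phi>])
  also have "\<dots> = (\<Sum>i\<in>UNIV. - (LINT x|lebesgue_on U. g x $ i * \<phi> i x))"
    using P \<phi> by (intro sum.cong) (auto simp: is_weak_divergence_def)
  also have "\<dots> = - (LINT x|lebesgue_on U. (\<Sum>i\<in>UNIV. g x $ i * \<phi> i x))"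
    by (subst Bochner_Integration.integral_sum) (auto simp: sum_negf intro: test_function_integrable(1)[OF U l(2) \<phi>])
  finally show ?thesis by simp
qed

text \<open>For smooth \<open>v\<close> in place of \<open>w\<close> the components of
  \<open>\<phi> v\<close> are test functions, and the formula is the definition of the weak
  divergence with the product rule. Both integrals are continuous in the field and its gradient, so
  density concludes.\<close>

theorem green_formula_cutoff:
  fixes U :: "(real ^ 'n) set"
  assumes dom: "open U" "bounded U" "lipschitz_boundary U" and pq: "p > 1" "q > 1" "1/p + 1/q = 1"
    and wG: "W1p_pair U p w G" and P: "P \<in> Lp (lebesgue_on U) q" and g: "g \<in> Lp (lebesgue_on U) q"
    and div: "is_weak_divergence U P g" and \<phi>: "\<phi> \<in> test_functions U"
  shows "(LINT x|lebesgue_on U. (\<phi> x *\<^sub>R G x + outer (w x) (sgrad \<phi> x)) \<bullet> P x) + (LINT x|lebesgue_on U. (\<phi> x *\<^sub>R w x) \<bullet> g x) = 0"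
proof -
  have p: "p \<ge> 1" "p > 0" using pq by auto
  obtain v where v: "\<And>n. smooth_field (v n)" "Lp_lim (lebesgue_on U) p v w"
     "Lp_lim (lebesgue_on U) p (\<lambda>n. grad (v n)) G"
    by (rule W1p_smooth_dense[OF dom p(1) wG]) (rule that; assumption)
  have wL: "w \<in> Lp (lebesgue_on U) p" "G \<in> Lp (lebesgue_on U) p" using wG by (auto simp: W1p_pair_def)
  have vL: "v n \<in> Lp (lebesgue_on U) p" "grad (v n) \<in> Lp (lebesgue_on U) p" for n
    using smooth_field_W1p_pair[OF dom(1,2) p(2) v(1)] by (auto simp: W1p_pair_def)
  have \<phi>s: "smooth \<phi>" by (rule test_functionsD(1)[OF \<phi>])
  have c: "continuous_on UNIV \<phi>" "continuous_on UNIV (sgrad \<phi>)"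
    by (rule smooth_continuous[OF \<phi>s] smooth_sgrad_continuous[OF \<phi>s])+
  obtain M where M: "M \<ge> 0" "\<forall>x\<in>U. \<bar>\<phi> x\<bar> \<le> M" using continuous_bounded_on_domain[OF dom(2) c(1)] by auto
  obtain N where N: "N \<ge> 0" "\<forall>x\<in>U. norm (sgrad \<phi> x) \<le> N" using continuous_bounded_on_domain[OF dom(2) c(2)] by auto
  note m = bounded_mult_Lp[OF c(1) M(2,1) p(2)] and o = bounded_outer_Lp[OF c(2) N(2,1) p(2)]
  define F where "F v G x = \<phi> x *\<^sub>R G x + outer (v x) (sgrad \<phi> x)" for v :: "'n vfield" and G :: "'n mfield" and x
  have FL: "F v G \<in> Lp (lebesgue_on U) p" if "v \<in> Lp (lebesgue_on U) p" "G \<in> Lp (lebesgue_on U) p" for v G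
    unfolding F_def by (intro Lp_add m o that p(1))
  have Fd: "Lp_norm (lebesgue_on U) p (\<lambda>x. F (v n) (grad (v n)) x - F w G x) \<le> 
      M * Lp_norm (lebesgue_on U) p (\<lambda>x. grad (v n) x - G x) + N * Lp_norm (lebesgue_on U) p (\<lambda>x. v n x - w x)" for n
  proof -
    have "(\<lambda>x. F (v n) (grad (v n)) x - F w G x) = (\<lambda>x. \<phi> x *\<^sub>R (grad (v n) x - G x) + outer (v n x - w x) (sgrad \<phi> x))"
      by (simp add: F_def fun_eq_iff outer_def vec_eq_iff algebra_simps)
    then show ?thesis
      using Lp_norm_triangle[OF m(1)[OF Lp_diff[OF vL(2) wL(2) p(1)]] o(1)[OF Lp_diff[OF vL(1) wL(1) p(1)]] p(1)]
        m(2)[OF Lp_diff[OF vL(2) wL(2) p(1)]] o(2)[OF Lp_diff[OF vL(1) wL(1) p(1)]] 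
      by (fastforce intro: order_trans add_mono)
  qed
  have "(\<lambda>n. Lp_norm (lebesgue_on U) p (\<lambda>x. F (v n) (grad (v n)) x - F w G x)) \<longlonglongrightarrow> 0"
    by (rule tendsto_sandwich[OF _ _ tendsto_const[of 0] tendsto_eq_rhs[OF tendsto_add[OF tendsto_mult[OF tendsto_const[of M] v(3)] tendsto_mult[OF tendsto_const[of N] v(2)]]]])
      (use Fd in auto)
  then have 1: "(\<lambda>n. LINT x|lebesgue_on U. F (v n) (grad (v n)) x \<bullet> P x) \<longlonglongrightarrow> (LINT x|lebesgue_on U. F w G x \<bullet> P x)"
    by (intro Lp_inner_tendsto[OF FL[OF vL] FL[OF wL] P pq])
  have "Lp_norm (lebesgue_on U) p (\<lambda>x. \<phi> x *\<^sub>R v n x - \<phi> x *\<^sub>R w x) \<le> M * Lp_norm (lebesgue_on U) p (\<lambda>x. v n x - w x)" for n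
    using m(2)[OF Lp_diff[OF vL(1) wL(1) p(1)]] by (simp add: scaleR_diff_right)
  then have "(\<lambda>n. Lp_norm (lebesgue_on U) p (\<lambda>x. \<phi> x *\<^sub>R v n x - \<phi> x *\<^sub>R w x)) \<longlonglongrightarrow> 0"
    by (intro tendsto_sandwich[OF _ _ tendsto_const[of 0] tendsto_eq_rhs[OF tendsto_mult[OF tendsto_const[of M] v(2)]]]) auto
  then have 2: "(\<lambda>n. LINT x|lebesgue_on U. (\<phi> x *\<^sub>R v n x) \<bullet> g x) \<longlonglongrightarrow> (LINT x|lebesgue_on U. (\<phi> x *\<^sub>R w x) \<bullet> g x)"
    by (intro Lp_inner_tendsto[OF m(1)[OF vL(1)] m(1)[OF wL(1)] g pq])
  have "(LINT x|lebesgue_on U. F (v n) (grad (v n)) x \<bullet> P x) + (LINT x|lebesgue_on U. (\<phi> x *\<^sub>R v n x) \<bullet> g x) = 0" for n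
  proof -
    have vi: "smooth (\<lambda>x. v n x $ i)" for i using v(1) by (simp add: smooth_field_def)
    have "F (v n) (grad (v n)) x \<bullet> P x = (\<Sum>i\<in>UNIV. \<Sum>j\<in>UNIV. P x $ i $ j * partial j (\<lambda>x. \<phi> x * v n x $ i) x)" for x
      by (simp add: F_def inner_vec_def outer_def grad_def sgrad_def partial_mult smooth_differentiable[OF \<phi>s] smooth_differentiable[OF vi] algebra_simps)
    moreover have "(\<phi> x *\<^sub>R v n x) \<bullet> g x = (\<Sum>i\<in>UNIV. g x $ i * (\<phi> x * v n x $ i))" for x
      by (simp add: inner_vec_def algebra_simps)
    ultimately show ?thesis
      using weak_divergence_vector_test[OF dom(1) div, of "\<lambda>i x. \<phi> x * v n x $ i"] test_functions_mult_smooth[OF \<phi> vi] by simp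
  qed
  then have "(LINT x|lebesgue_on U. F w G x \<bullet> P x) + (LINT x|lebesgue_on U. (\<phi> x *\<^sub>R w x) \<bullet> g x) = 0"
    using LIMSEQ_unique[OF tendsto_add[OF 1 2]] by simp
  then show ?thesis by (simp add: F_def)
qed

section \<open>Boundary layers and interior cutoffs\<close>

definition layer :: "(real ^ 'n) set \<Rightarrow> (real ^ 'n) set \<Rightarrow> real \<Rightarrow> (real ^ 'n) set" where
  "layer U Z \<delta> = U \<inter> (\<Union>z\<in>Z. ball z \<delta>)"

lemma layer_borel: "open U \<Longrightarrow> layer U Z \<delta> \<in> sets borel"
  unfolding layer_def by (intro borel_open open_Int open_UN ballI open_ball)

text \<open>A point within \<open>\<delta>\<close> of the graph has height below
  \<open>(1 + L) * \<delta>\<close>, so near each frontier point the layer lies in a strip of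
  proportional thickness. Finitely many charts cover the compact frontier, and their constants
  add.\<close>

lemma layer_estimate:
  fixes U :: "(real ^ 'n) set"
  assumes dom: "open U" "bounded U" "lipschitz_boundary U" and p: "p \<ge> 1" and B: "is_trace_operator U p B" 
    and wG: "W1p_pair U p w G" and zero: "AE x in surface_measure U. B w x = 0"
  shows "\<exists>C \<delta>0. C \<ge> 0 \<and> \<delta>0 > 0 \<and> (\<forall>\<delta>. 0 < \<delta> \<longrightarrow> \<delta> \<le> \<delta>0 \<longrightarrow> locnorm U p (layer U (frontier U) \<delta>) w \<le> C * \<delta>)"
proof -
  have wL: "w \<in> Lp (lebesgue_on U) p" using wG by (simp add: W1p_pair_def)
  define thin where "thin Z \<longleftrightarrow> (\<exists>C \<delta>0. C \<ge> 0 \<and> \<delta>0 > 0 \<and> (\<forall>\<delta>. 0 < \<delta> \<longrightarrow> \<delta> \<le> \<delta>0 \<longrightarrow> locnorm U p (layer U Z \<delta>) w \<le> C * \<delta>))" for Z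
  have "\<exists>s>0. thin (frontier U \<inter> ball x0 s)" if x0: "x0 \<in> frontier U" for x0
  proof -
    obtain e \<gamma> L r where "boundary_chart U x0 e \<gamma> L r" using boundary_chart_exists[OF dom(1,3) x0] by blast
    then interpret boundary_chart U x0 e \<gamma> L r .
    \<comment> \<open>Frontier points within \<open>\<rho> / 2\<close> and layers of width at most
      \<open>\<rho> / 2\<close> keep the layer inside the ball of radius \<open>\<rho>\<close> that
      defines the strip.\<close>
    have "locnorm U p (layer U (frontier U \<inter> ball x0 (\<rho> / 2)) \<delta>) w \<le> ((1 + L) * Lp_norm (lebesgue_on U) p G) * \<delta>"
      if \<delta>: "0 < \<delta>" "\<delta> \<le> \<rho> / 2" for \<delta>
    proof -
      have "x \<in> strip ((1 + L) * \<delta>)" if x: "x \<in> layer U (frontier U \<inter> ball x0 (\<rho> / 2)) \<delta>" for x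
      proof -
        obtain z where z: "z \<in> frontier U" "dist x0 z < \<rho> / 2" "dist x z < \<delta>" and "x \<in> U"
          using x by (auto simp: layer_def dist_commute)
        moreover have "dist x0 x \<le> dist x0 z + dist x z" by (simp add: dist_triangle2)
        moreover have "(1 + L) * dist x z < (1 + L) * \<delta>" using z(3) L0 by (intro mult_strict_left_mono) auto
        ultimately show ?thesis using \<delta> \<rho> by (intro near_boundary_in_strip[of x z]) auto
      qed
      then have "locnorm U p (layer U (frontier U \<inter> ball x0 (\<rho> / 2)) \<delta>) w \<le> locnorm U p (strip ((1 + L) * \<delta>)) w"
        using p by (intro locnorm_mono[OF layer_borel[OF dom(1)] strip_borel _ wL]) auto
      also have "\<dots> \<le> (1 + L) * \<delta> * Lp_norm (lebesgue_on U) p G"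
        using zero L0 \<delta> by (intro strip_estimate[OF dom(2,3) p _ B wG]) auto
      finally show ?thesis by (simp add: ac_simps)
    qed
    then have "thin (frontier U \<inter> ball x0 (\<rho> / 2))" unfolding thin_def using L0 \<rho>
      by (intro exI[of _ "(1 + L) * Lp_norm (lebesgue_on U) p G"] exI[of _ "\<rho> / 2"]) auto
    then show ?thesis using \<rho> by (intro exI[of _ "\<rho> / 2"]) auto
  qed
  then obtain s where s: "\<And>x. x \<in> frontier U \<Longrightarrow> s x > 0" "\<And>x. x \<in> frontier U \<Longrightarrow> thin (frontier U \<inter> ball x (s x))" by metis
  have Un: "thin (Z \<union> Z')" if Z: "thin Z" "thin Z'" for Z Z'
  proof -
    obtain C \<delta>0 C' \<delta>0' where "C \<ge> 0" "\<delta>0 > 0" and le: "\<And>\<delta>. 0 < \<delta> \<Longrightarrow> \<delta> \<le> \<delta>0 \<Longrightarrow> locnorm U p (layer U Z \<delta>) w \<le> C * \<delta>"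
      and "C' \<ge> 0" "\<delta>0' > 0" and le': "\<And>\<delta>. 0 < \<delta> \<Longrightarrow> \<delta> \<le> \<delta>0' \<Longrightarrow> locnorm U p (layer U Z' \<delta>) w \<le> C' * \<delta>"
      using Z unfolding thin_def by metis
    have "layer U (Z \<union> Z') \<delta> = layer U Z \<delta> \<union> layer U Z' \<delta>" for \<delta> unfolding layer_def by blast
    then have "locnorm U p (layer U (Z \<union> Z') \<delta>) w \<le> (C + C') * \<delta>" if "0 < \<delta>" "\<delta> \<le> min \<delta>0 \<delta>0'" for \<delta>
      using locnorm_Un[OF layer_borel[OF dom(1)] layer_borel[OF dom(1)] wL p, of Z \<delta> Z' \<delta>] le[of \<delta>] le'[of \<delta>] that by (simp add: distrib_right)
    then show ?thesis unfolding thin_def using \<open>C \<ge> 0\<close> \<open>C' \<ge> 0\<close> \<open>\<delta>0 > 0\<close> \<open>\<delta>0' > 0\<close>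
      by (intro exI[of _ "C + C'"] exI[of _ "min \<delta>0 \<delta>0'"]) auto
  qed
  obtain I where I: "I \<subseteq> frontier U" "finite I" "frontier U \<subseteq> (\<Union>x\<in>I. ball x (s x))"
  proof (rule compactE_image[of "frontier U" "frontier U" "\<lambda>x. ball x (s x)"])
    show "compact (frontier U)" using dom(2) by (rule compact_frontier_bounded)
    show "frontier U \<subseteq> (\<Union>x\<in>frontier U. ball x (s x))" using s(1) by auto
  qed (use that in auto)
  have "thin (\<Union>x\<in>I. frontier U \<inter> ball x (s x))" using I(2,1)
  proof (induction rule: finite_induct)
    case empty
    show ?case unfolding thin_def using p by (auto simp: layer_def locnorm_empty intro!: exI[of _ 0] exI[of _ 1])
  next
    case (insert x J)
    then have "thin (frontier U \<inter> ball x (s x) \<union> (\<Union>x\<in>J. frontier U \<inter> ball x (s x)))" by (intro Un s) auto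
    then show ?case by simp
  qed
  also have "(\<Union>x\<in>I. frontier U \<inter> ball x (s x)) = frontier U" using I by auto
  finally show ?thesis unfolding thin_def .
qed

text \<open>A ball is connected: meeting \<open>U\<close> but not its frontier, it cannot leave
  \<open>U\<close>.\<close>

lemma ball_subset_if_far_from_frontier:
  fixes x :: "real ^ 'n"
  assumes "x \<in> U" "\<And>z. z \<in> frontier U \<Longrightarrow> t \<le> dist x z"
  shows "ball x t \<subseteq> U"
proof (cases "t > 0")
  case True
  then have "x \<in> ball x t \<inter> U" using assms(1) by simp
  moreover have "ball x t \<inter> frontier U = {}" using assms(2) by force
  ultimately show ?thesis using connected_Int_frontier[OF connected_ball, of x t U] by blast
qed (simp add: ball_empty)

lemma interior_cutoffs_exist:
  fixes U :: "(real ^ 'n) set"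
  assumes dom: "open U" "bounded U"
  shows "\<exists>C>0. \<forall>t>0. \<exists>\<eta>\<in>test_functions U. (\<forall>x. 0 \<le> \<eta> x \<and> \<eta> x \<le> 1 \<and> norm (sgrad \<eta> x) \<le> C / t) \<and>
    (\<forall>x\<in>U. x \<notin> layer U (frontier U) t \<longrightarrow> \<eta> x = 1 \<and> sgrad \<eta> x = 0)"
proof -
  obtain C where "C > 0" and C: "\<forall>S t. S \<in> sets borel \<longrightarrow> bounded S \<longrightarrow> t > 0 \<longrightarrow> 
    (\<exists>\<eta> :: real ^ 'n \<Rightarrow> real. smooth \<eta> \<and> (\<forall>x. 0 \<le> \<eta> x \<and> \<eta> x \<le> 1) \<and> (\<forall>x. ball x t \<subseteq> S \<longrightarrow> \<eta> x = 1) \<and>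
      (\<forall>x. ball x t \<inter> S = {} \<longrightarrow> \<eta> x = 0) \<and> (\<forall>j x. \<bar>partial j \<eta> x\<bar> \<le> C / t))"
    using smooth_cutoffs_exist by (elim exE conjE) (rule that)
  show ?thesis
  proof (intro exI[of _ "4 * (CARD('n) * C)"] conjI allI impI)
    show "4 * (CARD('n) * C) > 0" using \<open>C > 0\<close> by simp
    fix t :: real assume "t > 0"
    \<comment> \<open>Four distances share the width \<open>t\<close>: the cutoff is 1 from distance
      \<open>4 * r\<close> on, it mollifies at scale \<open>r\<close> the set of points at distance
      at least \<open>3 * r\<close>, and its support keeps distance \<open>2 * r\<close> from the
      frontier.\<close>
    define r where "r = t / 4"
    have r: "r > 0" "t = 4 * r" using \<open>t > 0\<close> by (auto simp: r_def)
    define S where "S = U - layer U (frontier U) (3 * r)"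
    have S: "S \<in> sets borel" "bounded S" using dom layer_borel[OF dom(1)] by (auto simp: S_def intro: bounded_subset)
    have SI: "x \<in> S \<longleftrightarrow> x \<in> U \<and> (\<forall>z\<in>frontier U. 3 * r \<le> dist x z)" for x by (auto simp: S_def layer_def not_less dist_commute)
    obtain \<eta> where \<eta>: "smooth \<eta>" "\<And>x. 0 \<le> \<eta> x" "\<And>x. \<eta> x \<le> 1" "\<And>x. ball x r \<subseteq> S \<Longrightarrow> \<eta> x = 1"
      "\<And>x. ball x r \<inter> S = {} \<Longrightarrow> \<eta> x = 0" "\<And>j x. \<bar>partial j \<eta> x\<bar> \<le> C / r"
      using C[rule_format, OF S r(1)] by blast
    define K where "K = closure U \<inter> {x. \<forall>z\<in>frontier U. 2 * r \<le> dist x z}"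
    have K: "closed {x. \<forall>z\<in>frontier U. 2 * r \<le> dist x z}"
      unfolding Ball_def by (intro closed_Collect_all closed_Collect_imp open_Collect_const closed_Collect_le continuous_intros)
    show "\<exists>\<eta>\<in>test_functions U. (\<forall>x. 0 \<le> \<eta> x \<and> \<eta> x \<le> 1 \<and> norm (sgrad \<eta> x) \<le> 4 * (CARD('n) * C) / t) \<and>
      (\<forall>x\<in>U. x \<notin> layer U (frontier U) t \<longrightarrow> \<eta> x = 1 \<and> sgrad \<eta> x = 0)"
    proof (rule bexI[of _ \<eta>], intro conjI allI ballI impI)
      show "\<eta> \<in> test_functions U"
      proof (rule test_functionsI[OF \<eta>(1), of K])
        show "compact K" unfolding K_def using dom K by (intro compact_Int_closed) auto
        show "K \<subseteq> U"
        proof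
          fix x assume x: "x \<in> K"
          then have "x \<notin> frontier U" using r by (auto simp: K_def)
          then show "x \<in> U" using x dom(1) by (auto simp: K_def frontier_def interior_open)
        qed
        fix x assume "\<eta> x \<noteq> 0"
        then obtain y where y: "dist x y < r" "y \<in> S" using \<eta>(5)[of x] by (auto simp: set_eq_iff)
        have "ball y (3 * r) \<subseteq> U" using y(2) SI by (intro ball_subset_if_far_from_frontier) auto
        then have "x \<in> U" using y r by (auto simp: dist_commute)
        moreover have "2 * r \<le> dist x z" if "z \<in> frontier U" for z
          using dist_triangle2[of y z x] y SI that dist_triangle[of y z x] by (force simp: dist_commute)
        ultimately show "x \<in> K" using closure_subset by (auto simp: K_def)
      qed
      fix x
      \<comment> \<open>The constant collects the number of coordinates from the sum norm and the
        factor 4 from \<open>r = t / 4\<close>.\<close>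
      have "norm (sgrad \<eta> x) \<le> (\<Sum>j\<in>UNIV. \<bar>sgrad \<eta> x $ j\<bar>)" by (rule norm_le_l1_cart)
      also have "\<dots> \<le> (\<Sum>j\<in>(UNIV::'n set). C / r)" using \<eta>(6) by (intro sum_mono) (simp add: sgrad_def)
      finally show "norm (sgrad \<eta> x) \<le> 4 * (CARD('n) * C) / t" using r by simp
      assume x: "x \<in> U" "x \<notin> layer U (frontier U) t"
      then have far: "4 * r \<le> dist x z" if "z \<in> frontier U" for z using that r by (force simp: layer_def not_less dist_commute)
      have "ball x r \<subseteq> S"
      proof
        fix y assume y: "y \<in> ball x r"
        have "ball x (4 * r) \<subseteq> U" by (rule ball_subset_if_far_from_frontier[OF x(1) far])
        then have "y \<in> U" using y r by auto
        moreover have "3 * r \<le> dist y z" if "z \<in> frontier U" for z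
          using dist_triangle[of x z y] y far[OF that] by simp
        ultimately show "y \<in> S" using SI by auto
      qed
      then show \<eta>x: "\<eta> x = 1" by (rule \<eta>(4))
      have "(\<eta> has_derivative frechet_derivative \<eta> (at x)) (at x)"
        using smooth_differentiable[OF \<eta>(1)] frechet_derivative_works by blast
      \<comment> \<open>The plateau may be closed, so local constancy is not at hand; but the value
        1 is a global maximum, and there the derivative vanishes.\<close>
      from differential_zero_maxmin[OF UNIV_I open_UNIV this] have "frechet_derivative \<eta> (at x) = (\<lambda>v. 0)"
        using \<eta>(3) \<eta>x by auto
      then show "sgrad \<eta> x = 0" by (simp add: sgrad_def partial_def vec_eq_iff)
    qed (use \<eta>(2,3) in auto)
  qed
qed

theorem green_formula_zero_trace:
  fixes U :: "(real ^ 'n) set"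
  assumes dom: "open U" "bounded U" "lipschitz_boundary U" and pq: "p > 1" "q > 1" "1/p + 1/q = 1"
    and B: "is_trace_operator U p B" and wG: "W1p_pair U p w G" and zero: "AE x in surface_measure U. B w x = 0"
    and P: "P \<in> Lp (lebesgue_on U) q" and g: "g \<in> Lp (lebesgue_on U) q" and div: "is_weak_divergence U P g"
  shows "(LINT x|lebesgue_on U. G x \<bullet> P x) + (LINT x|lebesgue_on U. w x \<bullet> g x) = 0"
proof -
  let ?M = "lebesgue_on U"
  have p: "p \<ge> 1" "p > 0" "q > 0" using pq by auto
  have wL: "w \<in> Lp ?M p" "G \<in> Lp ?M p" using wG by (auto simp: W1p_pair_def)
  note [measurable] = Lp_measurable[OF wL(1)] Lp_measurable[OF wL(2)] Lp_measurable[OF P] Lp_measurable[OF g]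
  obtain C \<delta>0 where C: "C \<ge> 0" "\<delta>0 > 0" "\<forall>\<delta>. 0 < \<delta> \<longrightarrow> \<delta> \<le> \<delta>0 \<longrightarrow> locnorm U p (layer U (frontier U) \<delta>) w \<le> C * \<delta>"
    using layer_estimate[where B = B and w = w, OF dom p(1) B wG zero] by (elim exE conjE) (rule that)
  obtain D where D: "D > 0" "\<forall>t>0. \<exists>\<eta>\<in>test_functions U. (\<forall>x. 0 \<le> \<eta> x \<and> \<eta> x \<le> 1 \<and> norm (sgrad \<eta> x) \<le> D / t) \<and>
    (\<forall>x\<in>U. x \<notin> layer U (frontier U) t \<longrightarrow> \<eta> x = 1 \<and> sgrad \<eta> x = 0)"
    using interior_cutoffs_exist[OF dom(1,2)] by (elim exE conjE) (rule that)
  define t where "t n = \<delta>0 / real (Suc n)" for n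
  have t: "t n > 0" "t n \<le> \<delta>0" for n using C(2) by (auto simp: t_def divide_le_eq mult_le_cancel_left1)
  have t0: "t \<longlonglongrightarrow> 0" unfolding t_def using LIMSEQ_Suc[OF lim_const_over_n[of \<delta>0]] by simp
  define N where "N n = layer U (frontier U) (t n)" for n
  have N: "N n \<in> sets borel" for n using layer_borel[OF dom(1)] by (simp add: N_def)
  have "\<forall>n. \<exists>\<eta>. \<eta> \<in> test_functions U \<and> (\<forall>x. 0 \<le> \<eta> x \<and> \<eta> x \<le> 1 \<and> norm (sgrad \<eta> x) \<le> D / t n) \<and>
    (\<forall>x\<in>U. x \<notin> N n \<longrightarrow> \<eta> x = 1 \<and> sgrad \<eta> x = 0)" using D(2) t(1) unfolding N_def by (auto simp: Bex_def)
  from choice[OF this] obtain \<eta> where \<eta>: "\<And>n. \<eta> n \<in> test_functions U" 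
    "\<And>n x. 0 \<le> \<eta> n x \<and> \<eta> n x \<le> 1 \<and> norm (sgrad (\<eta> n) x) \<le> D / t n" "\<And>n x. x \<in> U \<Longrightarrow> x \<notin> N n \<Longrightarrow> \<eta> n x = 1 \<and> sgrad (\<eta> n) x = 0"
    by blast
  have \<eta>s: "smooth (\<eta> n)" for n by (rule test_functionsD(1)[OF \<eta>(1)])
  have [measurable]: "\<eta> n \<in> borel_measurable ?M" "sgrad (\<eta> n) \<in> borel_measurable ?M" for n
    by (intro borel_imp_lebesgue_on_measurable borel_measurable_continuous_onI smooth_continuous smooth_sgrad_continuous \<eta>s)+
  have ev: "\<forall>\<^sub>F n in sequentially. x \<notin> N n" if x: "x \<in> U" for x
  proof -
    obtain d where d: "d > 0" "ball x d \<subseteq> U" using dom(1) x open_contains_ball by blast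
    have "\<forall>\<^sub>F n in sequentially. t n < d" using t0 d(1) by (rule order_tendstoD(2))
    then show ?thesis
    proof eventually_elim
      fix n assume tn: "t n < d"
      have "z \<in> U" if "dist z x < t n" for z using tn that d(2) by (auto simp: dist_commute)
      then show "x \<notin> N n" using dom(1) by (auto simp: N_def layer_def frontier_def interior_open)
    qed
  qed
  have sp: "space ?M = U" by (simp add: space_restrict_space)
  have lim: "(\<lambda>n. LINT x|?M. \<eta> n x * f x) \<longlonglongrightarrow> (LINT x|?M. f x)" if f: "integrable ?M f" for f :: "real ^ 'n \<Rightarrow> real"
  proof (rule integral_dominated_convergence[where w = "\<lambda>x. \<bar>f x\<bar>"])
    note [measurable] = borel_measurable_integrable[OF f]
    show "(\<lambda>x. \<eta> n x * f x) \<in> borel_measurable ?M" for n by measurable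
    show "AE x in ?M. norm (\<eta> n x * f x) \<le> \<bar>f x\<bar>" for n
      using \<eta>(2) by (intro AE_I2) (auto simp: abs_mult intro!: mult_left_le_one_le)
    show "AE x in ?M. (\<lambda>n. \<eta> n x * f x) \<longlonglongrightarrow> f x"
    proof (rule AE_I2)
      fix x assume "x \<in> space ?M"
      then have x: "x \<in> U" using sp by simp
      from ev[OF x] have "\<forall>\<^sub>F n in sequentially. \<eta> n x * f x = f x" by eventually_elim (simp add: \<eta>(3)[OF x])
      then show "(\<lambda>n. \<eta> n x * f x) \<longlonglongrightarrow> f x" by (rule tendsto_eventually)
    qed
  qed (use f in auto)
  define b where "b n = (LINT x|?M. outer (w x) (sgrad (\<eta> n) x) \<bullet> P x)" for n
  have PN: "(\<lambda>n. locnorm U q (N n) P) \<longlonglongrightarrow> 0" unfolding locnorm_def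
    by (rule Lp_norm_indicator_tendsto_0[OF P p(3) Lp_measurable[OF Lp_indicator(1)[OF N P p(3)]]]) (use ev sp in auto)
  have oL: "(\<lambda>x. outer (w x) (sgrad (\<eta> n) x)) \<in> Lp ?M p" for n
    using \<eta>(2) D(1) t(1)[of n] by (intro bounded_outer_Lp(1)[OF smooth_sgrad_continuous[OF \<eta>s] _ _ p(2) wL(1), of _ "D / t n"]) auto
  \<comment> \<open>The factor \<open>D / t n\<close> of the cutoff gradient meets the factor
    \<open>C * t n\<close> of the thin layer and cancels. What tends to zero is the norm of
    \<open>P\<close> on layers that shrink away.\<close>
  have bn: "\<bar>b n\<bar> \<le> D * C * locnorm U q (N n) P" for n
  proof -
    let ?w = "\<lambda>x. indicator (N n) x *\<^sub>R w x" and ?P = "\<lambda>x. indicator (N n) x *\<^sub>R P x"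
    note o = bounded_outer_Lp[OF smooth_sgrad_continuous[OF \<eta>s] _ _ p(2) Lp_indicator(1)[OF N wL(1) p(2)], of n "D / t n" n]
    have oL: "(\<lambda>x. outer (?w x) (sgrad (\<eta> n) x)) \<in> Lp ?M p" and
      oN: "Lp_norm ?M p (\<lambda>x. outer (?w x) (sgrad (\<eta> n) x)) \<le> (D / t n) * locnorm U p (N n) w"
      using o \<eta>(2) D(1) t(1)[of n] by (auto simp: locnorm_def)
    \<comment> \<open>The gradient of the cutoff vanishes off the layer, so both factors may be
      truncated to it.\<close>
    have "b n = (LINT x|?M. outer (?w x) (sgrad (\<eta> n) x) \<bullet> ?P x)" unfolding b_def
    proof (rule Bochner_Integration.integral_cong[OF refl])
      fix x assume "x \<in> space ?M"
      then show "outer (w x) (sgrad (\<eta> n) x) \<bullet> P x = outer (?w x) (sgrad (\<eta> n) x) \<bullet> ?P x"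
        using \<eta>(3)[of x n] sp by (cases "x \<in> N n") (auto simp: outer_def inner_vec_def)
    qed
    also have "\<bar>\<dots>\<bar> \<le> Lp_norm ?M p (\<lambda>x. outer (?w x) (sgrad (\<eta> n) x)) * locnorm U q (N n) P"
      unfolding locnorm_def by (rule Hoelder_inner(2)[OF oL Lp_indicator(1)[OF N P p(3)] pq])
    also have "\<dots> \<le> ((D / t n) * locnorm U p (N n) w) * locnorm U q (N n) P"
      by (intro mult_right_mono oN) (simp add: locnorm_def)
    also have "\<dots> \<le> ((D / t n) * (C * t n)) * locnorm U q (N n) P"
      using C(3) t D(1) less_imp_le[OF t(1)[of n]] by (intro mult_left_mono mult_right_mono) (auto simp: N_def locnorm_def intro!: divide_nonneg_nonneg)
    also have "\<dots> = D * C * locnorm U q (N n) P" using t(1)[of n] by simp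
    finally show ?thesis .
  qed
  have b0: "b \<longlonglongrightarrow> 0"
    by (rule tendsto_0_le[OF PN, of _ "D * C"]) (use bn in \<open>auto simp: locnorm_def mult.commute\<close>)
  have I: "integrable ?M (\<lambda>x. G x \<bullet> P x)" "integrable ?M (\<lambda>x. w x \<bullet> g x)"
    using Hoelder_inner(1)[OF wL(2) P pq] Hoelder_inner(1)[OF wL(1) g pq] .
  have eq: "(LINT x|?M. \<eta> n x * (G x \<bullet> P x)) + b n + (LINT x|?M. \<eta> n x * (w x \<bullet> g x)) = 0" for n
  proof -
    have "(\<lambda>x. \<eta> n x *\<^sub>R G x) \<in> Lp ?M p"
      using \<eta>(2) by (intro bounded_mult_Lp(1)[OF smooth_continuous[OF \<eta>s] _ _ p(2) wL(2), of _ 1]) auto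
    from Hoelder_inner(1)[OF this P pq] have "(LINT x|?M. (\<eta> n x *\<^sub>R G x + outer (w x) (sgrad (\<eta> n) x)) \<bullet> P x) = (LINT x|?M. \<eta> n x * (G x \<bullet> P x)) + b n"
      unfolding b_def inner_add_left using Hoelder_inner(1)[OF oL P pq] by (subst Bochner_Integration.integral_add) auto
    then show ?thesis using green_formula_cutoff[OF dom pq wG P g div \<eta>(1)[of n]] by simp
  qed
  have "(\<lambda>n. (LINT x|?M. \<eta> n x * (G x \<bullet> P x)) + b n + (LINT x|?M. \<eta> n x * (w x \<bullet> g x))) \<longlonglongrightarrow> (LINT x|?M. G x \<bullet> P x) + 0 + (LINT x|?M. w x \<bullet> g x)"
    by (intro tendsto_add lim I b0)
  then show ?thesis unfolding eq using LIMSEQ_unique[OF tendsto_const] by fastforce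
qed

section \<open>The constraint sets\<close>

lemma Lp_loc_integrable:
  fixes u :: "real ^ 'n \<Rightarrow> 'b::euclidean_space"
  assumes "open U" "bounded U" "u \<in> Lp (lebesgue_on U) p" "p \<ge> 1"
  shows "loc_integrable U u"
  using assms by (intro integrable_imp_loc_integrable Lp_finite_measure_integrable finite_measure_lebesgue_on_bounded)

lemma test_function_Lp:
  fixes a :: "'b::euclidean_space" and b :: "real ^ 'm"
  assumes "open U" "bounded U" "\<phi> \<in> test_functions U" "p > 0"
  shows "(\<lambda>x. \<phi> x *\<^sub>R a) \<in> Lp (lebesgue_on U) p" "(\<lambda>x. partial j \<phi> x *\<^sub>R a) \<in> Lp (lebesgue_on U) p" "(\<lambda>x. outer b (sgrad \<phi> x)) \<in> Lp (lebesgue_on U) p"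
  using test_functionsD(1)[OF assms(3)] assms
  by (intro continuous_Lp_bounded_domain continuous_on_scaleR continuous_on_const continuous_on_outer smooth_continuous smooth_partial smooth_sgrad_continuous; simp)+

lemma W1p_pair_limit:
  fixes U :: "(real ^ 'n) set"
  assumes U: "open U" "bounded U" and pq: "p > 1" "q > 1" "1/p + 1/q = 1" and uG: "\<And>n. W1p_pair U p (u n) (G n)"
    and L: "w \<in> Lp (lebesgue_on U) p" "H \<in> Lp (lebesgue_on U) p"
    and lim: "Lp_lim (lebesgue_on U) p u w" "Lp_lim (lebesgue_on U) p G H"
  shows "W1p_pair U p w H"
  unfolding W1p_pair_def is_weak_gradient_def
proof (intro conjI ballI allI L)
  show "loc_integrable U w" "loc_integrable U H" using U L pq by (auto intro: Lp_loc_integrable)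
  fix \<phi> i j assume \<phi>: "\<phi> \<in> test_functions U"
  have Ln: "u n \<in> Lp (lebesgue_on U) p" "G n \<in> Lp (lebesgue_on U) p" for n using uG by (auto simp: W1p_pair_def)
  have q: "q > 0" using pq by simp
  have e: "(LINT x|lebesgue_on U. u n x \<bullet> (partial j \<phi> x *\<^sub>R axis i 1)) = - (LINT x|lebesgue_on U. G n x \<bullet> (\<phi> x *\<^sub>R axis i (axis j 1)))" for n
    using uG[of n] \<phi> by (simp add: W1p_pair_def is_weak_gradient_def inner_axis mult.commute)
  have "(\<lambda>n. LINT x|lebesgue_on U. u n x \<bullet> (partial j \<phi> x *\<^sub>R axis i 1)) \<longlonglongrightarrow> (LINT x|lebesgue_on U. w x \<bullet> (partial j \<phi> x *\<^sub>R axis i 1))"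
    by (intro Lp_inner_tendsto[OF Ln(1) L(1) test_function_Lp(2)[OF U \<phi> q] pq lim(1)])
  moreover have "(\<lambda>n. - (LINT x|lebesgue_on U. G n x \<bullet> (\<phi> x *\<^sub>R axis i (axis j 1)))) \<longlonglongrightarrow> - (LINT x|lebesgue_on U. H x \<bullet> (\<phi> x *\<^sub>R axis i (axis j 1)))"
    by (intro tendsto_minus Lp_inner_tendsto[OF Ln(2) L(2) test_function_Lp(1)[OF U \<phi> q] pq lim(2)])
  ultimately have "(LINT x|lebesgue_on U. w x \<bullet> (partial j \<phi> x *\<^sub>R axis i 1)) = - (LINT x|lebesgue_on U. H x \<bullet> (\<phi> x *\<^sub>R axis i (axis j 1)))"
    unfolding e by (rule LIMSEQ_unique)
  then show "(LINT x|lebesgue_on U. w x $ i * partial j \<phi> x) = - (LINT x|lebesgue_on U. H x $ i $ j * \<phi> x)"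
    by (simp add: inner_axis mult.commute)
qed

text \<open>By Hoelder, integrating one component against a field of the conjugate space is a
  bounded functional on the product space, so it may be used as a test of weak convergence.\<close>

lemma weakly_converges_XpqD:
  assumes w: "weakly_converges_Xpq U p q Z z" and pq: "p > 1" "q > 1" "1/p + 1/q = 1"
  shows "H \<in> Lp (lebesgue_on U) q \<Longrightarrow> (\<lambda>k. LINT x|lebesgue_on U. fst (Z k) x \<bullet> H x) \<longlonglongrightarrow> (LINT x|lebesgue_on U. fst z x \<bullet> H x)"
    and "G \<in> Lp (lebesgue_on U) p \<Longrightarrow> (\<lambda>k. LINT x|lebesgue_on U. snd (Z k) x \<bullet> G x) \<longlonglongrightarrow> (LINT x|lebesgue_on U. snd z x \<bullet> G x)"
proof -
  have qp: "1/q + 1/p = 1" using pq by simp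
  show "(\<lambda>k. LINT x|lebesgue_on U. fst (Z k) x \<bullet> H x) \<longlonglongrightarrow> (LINT x|lebesgue_on U. fst z x \<bullet> H x)" if H: "H \<in> Lp (lebesgue_on U) q"
  proof -
    note h = Hoelder_inner[OF _ H pq]
    have "\<bar>LINT x|lebesgue_on U. F x \<bullet> H x\<bar> \<le> Lp_norm (lebesgue_on U) q H * Xpq_norm U p q (F, P)"
      if "F \<in> Lp (lebesgue_on U) p" for F P :: "'a mfield"
      using h(2)[OF that] by (simp add: Xpq_norm_def algebra_simps add_increasing2)
    then have "(\<lambda>(F, P). LINT x|lebesgue_on U. F x \<bullet> H x) \<in> Xpq_dual U p q"
      unfolding Xpq_dual_def Xpq_def by (force simp: inner_add_left h(1) intro!: exI[of _ "Lp_norm (lebesgue_on U) q H"])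
    then show ?thesis using w unfolding weakly_converges_Xpq_def by (fastforce simp: case_prod_beta)
  qed
  show "(\<lambda>k. LINT x|lebesgue_on U. snd (Z k) x \<bullet> G x) \<longlonglongrightarrow> (LINT x|lebesgue_on U. snd z x \<bullet> G x)" if G: "G \<in> Lp (lebesgue_on U) p"
  proof -
    note h = Hoelder_inner[OF _ G pq(2,1) qp]
    have "\<bar>LINT x|lebesgue_on U. P x \<bullet> G x\<bar> \<le> Lp_norm (lebesgue_on U) p G * Xpq_norm U p q (F, P)"
      if "P \<in> Lp (lebesgue_on U) q" for F P :: "'a mfield"
      using h(2)[OF that] by (simp add: Xpq_norm_def algebra_simps add_increasing)
    then have "(\<lambda>(F, P). LINT x|lebesgue_on U. P x \<bullet> G x) \<in> Xpq_dual U p q"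
      unfolding Xpq_dual_def Xpq_def by (force simp: inner_add_left h(1) intro!: exI[of _ "Lp_norm (lebesgue_on U) p G"])
    then show ?thesis using w unfolding weakly_converges_Xpq_def by (fastforce simp: case_prod_beta)
  qed
qed

section \<open>The mixed boundary conditions\<close>

locale mixed_boundary_problem =
  fixes U \<Gamma>D \<Gamma>N :: "(real ^ 'n) set" and p q :: real and B :: "'n vfield \<Rightarrow> 'n vfield" 
    and f gD :: "'n vfield" and hN :: "'n vfield \<Rightarrow> real"
  assumes dom: "open U" "bounded U" "lipschitz_boundary U" and con: "connected U"
    and \<Gamma>D: "openin (top_of_set (frontier U)) \<Gamma>D" "\<Gamma>D \<noteq> {}" and \<Gamma>N: "openin (top_of_set (frontier U)) \<Gamma>N"
    and cover: "closure \<Gamma>D \<union> closure \<Gamma>N = frontier U"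
    and null: "emeasure (hausdorff_measure (CARD('n) - 1)) (closure \<Gamma>N - \<Gamma>N) = 0"
      "emeasure (hausdorff_measure (CARD('n) - 1)) (closure \<Gamma>D - \<Gamma>D) = 0"
    and pq: "p > 1" "q > 1" "1 / p + 1 / q = 1"
    and B: "is_trace_operator U p B" and f: "f \<in> Lp (lebesgue_on U) q" and gD: "gD \<in> Wtr U p" and hN: "hN \<in> Wtr_dual U p"
begin

abbreviation "M \<equiv> lebesgue_on U"

lemma p: "p \<ge> 1" "p > 0" "q \<ge> 1" "q > 0" and qp: "1 / q + 1 / p = 1" using pq by auto

lemma mf: "(\<lambda>x. - f x) \<in> Lp M q" using Lp_scaleR[OF f p(4), of "-1"] by simp

lemma normal_trace_eq:
  assumes P: "P \<in> Lp M q" "is_weak_divergence U P (\<lambda>x. - f x)" and uG: "W1p_pair U p u G" 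
    and \<psi>: "AE x in surface_measure U. B u x = \<psi> x"
  shows "normal_trace U p B P \<psi> = (LINT x|M. P x \<bullet> G x) - (LINT x|M. f x \<bullet> u x)"
proof -
  \<comment> \<open>The gradient and divergence picked by choice are replaced under the integral by
    the given ones, to which they are equal almost everywhere.\<close>
  have val: "(LINT x|M. P x \<bullet> weak_gradient U w x) + (LINT x|M. w x \<bullet> weak_divergence U P x)
     = (LINT x|M. H x \<bullet> P x) + (LINT x|M. w x \<bullet> - f x)" if wH: "W1p_pair U p w H" for w H
  proof -
    have m [measurable]: "w \<in> borel_measurable M" "H \<in> borel_measurable M" "P \<in> borel_measurable M" "f \<in> borel_measurable M" 
      using wH P f by (auto simp: W1p_pair_def dest: Lp_measurable)
    have wg: "is_weak_gradient U w H" using wH by (simp add: W1p_pair_def)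
    have [measurable]: "weak_gradient U w \<in> borel_measurable M" by (rule weak_gradient_AE_eq(2)[OF dom(1) wg m(2)])
    have d: "AE x in M. weak_divergence U P x = - f x" by (rule weak_divergence_AE_eq[OF dom(1) P(2)])
    then have "AE x in M. - f x = weak_divergence U P x" by eventually_elim simp
    from borel_measurable_lebesgue_on_AE[OF dom(1) _ this] have [measurable]: "weak_divergence U P \<in> borel_measurable M" by simp
    have "(LINT x|M. P x \<bullet> weak_gradient U w x) = (LINT x|M. H x \<bullet> P x)"
      using weak_gradient_AE_eq(1)[OF dom(1) wg] by (intro integral_cong_AE) (auto simp: inner_commute elim!: eventually_mono)
    moreover have "(LINT x|M. w x \<bullet> weak_divergence U P x) = (LINT x|M. w x \<bullet> - f x)"
      using d by (intro integral_cong_AE) (auto elim!: eventually_mono)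
    ultimately show ?thesis by simp
  qed
  have eq: "(LINT x|M. H x \<bullet> P x) + (LINT x|M. w x \<bullet> - f x) = (LINT x|M. G x \<bullet> P x) + (LINT x|M. u x \<bullet> - f x)"
    if wH: "W1p_pair U p w H" and w: "AE x in surface_measure U. B w x = \<psi> x" for w H
  proof -
    have "AE x in surface_measure U. B (\<lambda>x. w x - u x) x = 0"
      using trace_diff[OF dom(1) p(1) B wH uG] w \<psi> by eventually_elim simp
    from green_formula_zero_trace[where B = B and w = "\<lambda>x. w x - u x", OF dom pq B W1p_pair_diff[OF dom(1) p(1) wH uG] this P(1) mf P(2)]
    have "(LINT x|M. (H x - G x) \<bullet> P x) + (LINT x|M. (w x - u x) \<bullet> - f x) = 0" .
    moreover have "integrable M (\<lambda>x. H x \<bullet> P x)" "integrable M (\<lambda>x. G x \<bullet> P x)" "integrable M (\<lambda>x. w x \<bullet> - f x)" "integrable M (\<lambda>x. u x \<bullet> - f x)"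
      using wH uG by (auto intro!: Hoelder_inner(1)[OF _ _ pq] P(1) mf simp: W1p_pair_def simp del: inner_minus_right)
    ultimately show ?thesis unfolding inner_diff_left by (simp del: inner_minus_right)
  qed
  have "normal_trace U p B P \<psi> = (LINT x|M. G x \<bullet> P x) + (LINT x|M. u x \<bullet> - f x)"
    unfolding normal_trace_def
  proof (rule the_equality)
    show "\<forall>w\<in>W1p U p. (AE x in surface_measure U. B w x = \<psi> x) \<longrightarrow> (LINT x|M. G x \<bullet> P x) + (LINT x|M. u x \<bullet> - f x)
       = (LINT x|M. P x \<bullet> weak_gradient U w x) + (LINT x|M. w x \<bullet> weak_divergence U P x)"
    proof (intro ballI impI)
      fix w assume "w \<in> W1p U p" and w: "AE x in surface_measure U. B w x = \<psi> x"
      then obtain H where wH: "W1p_pair U p w H" by (auto simp: W1p_iff_pair)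
      show "(LINT x|M. G x \<bullet> P x) + (LINT x|M. u x \<bullet> - f x)
        = (LINT x|M. P x \<bullet> weak_gradient U w x) + (LINT x|M. w x \<bullet> weak_divergence U P x)"
        unfolding val[OF wH] by (rule eq[OF wH w, symmetric])
    qed
    have uW: "u \<in> W1p U p" using uG by (auto simp: W1p_iff_pair)
    fix c assume "\<forall>u\<in>W1p U p. (AE x in surface_measure U. B u x = \<psi> x) \<longrightarrow> c = (LINT x|M. P x \<bullet> weak_gradient U u x) + (LINT x|M. u x \<bullet> weak_divergence U P x)"
    from this[rule_format, OF uW \<psi>] show "c = (LINT x|M. G x \<bullet> P x) + (LINT x|M. u x \<bullet> - f x)" unfolding val[OF uG] .
  qed
  then show ?thesis by (simp add: inner_commute)
qed

text \<open>If no Sobolev field has trace \<open>\<psi>\<close>, the condition in the definite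
  description is vacuous for every field. The resulting value is arbitrary but common to
  \<open>P\<close> and \<open>Q\<close>, so the Neumann condition at such \<open>\<psi>\<close>
  passes from a sequence to its limit.\<close>

lemma normal_trace_off_range:
  assumes "\<not> (\<exists>u G. W1p_pair U p u G \<and> (AE x in surface_measure U. B u x = \<psi> x))"
  shows "normal_trace U p B P \<psi> = normal_trace U p B Q \<psi>"
proof -
  have "\<not> (AE x in surface_measure U. B u x = \<psi> x)" if "u \<in> W1p U p" for u using assms that W1p_iff_pair by blast
  then show ?thesis unfolding normal_trace_def by simp
qed

definition "dirichlet u \<longleftrightarrow> (AE x in surface_measure U. x \<in> \<Gamma>D \<longrightarrow> B u x = gD x)"

text \<open>The divergence equation is included because the normal trace can be evaluated only with
  the divergence known.\<close>

definition "neumann P \<longleftrightarrow> is_weak_divergence U P (\<lambda>x. - f x) \<and>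
  (\<forall>\<psi>\<in>Wtr U p. (AE x in surface_measure U. x \<notin> \<Gamma>N \<longrightarrow> \<psi> x = 0) \<longrightarrow> normal_trace U p B P \<psi> = hN \<psi>)"

abbreviation "E0 \<equiv> E0_set U \<Gamma>D \<Gamma>N p q B f gD hN"

lemma E0_iff: "(F, P) \<in> E0 \<longleftrightarrow> (\<exists>u. W1p_pair U p u F \<and> dirichlet u) \<and> P \<in> Lp M q \<and> neumann P"
  unfolding E0_set_def Xpq_def W1p_pair_def dirichlet_def neumann_def W1p_def by auto

lemma poincare:
  obtains C where "C \<ge> 0" "\<And>u G w H. W1p_pair U p u G \<Longrightarrow> W1p_pair U p w H \<Longrightarrow> dirichlet u \<Longrightarrow> dirichlet w \<Longrightarrow>
    Lp_norm M p (\<lambda>x. u x - w x) \<le> C * Lp_norm M p (\<lambda>x. G x - H x)"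
proof -
  obtain C where C: "C \<ge> 0" "\<forall>u G. W1p_pair U p u G \<longrightarrow> (AE x in surface_measure U. x \<in> \<Gamma>D \<longrightarrow> B u x = 0) \<longrightarrow>
    Lp_norm M p u \<le> C * Lp_norm M p G"
    using poincare_inequality[OF dom con p(1) B \<Gamma>D] by (elim exE conjE) (rule that)
  show thesis
  proof (rule that[OF C(1)])
    fix u G w H assume u: "W1p_pair U p u G" "dirichlet u" and w: "W1p_pair U p w H" "dirichlet w"
    have "AE x in surface_measure U. x \<in> \<Gamma>D \<longrightarrow> B (\<lambda>x. u x - w x) x = 0"
      using trace_diff[OF dom(1) p(1) B u(1) w(1)] u(2) w(2) unfolding dirichlet_def by eventually_elim simp
    then show "Lp_norm M p (\<lambda>x. u x - w x) \<le> C * Lp_norm M p (\<lambda>x. G x - H x)"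
      using C(2) W1p_pair_diff[OF dom(1) p(1) u(1) w(1)] by blast
  qed
qed

lemma dirichlet_limit:
  assumes uG: "\<And>n. W1p_pair U p (u n) (G n)" "\<And>n. dirichlet (u n)" and wH: "W1p_pair U p w H"
    and lim: "Lp_lim M p u w" "Lp_lim M p G H"
  shows "dirichlet w"
proof -
  let ?S = "surface_measure U"
  obtain C where C: "C \<ge> 0" "\<And>u G w H. W1p_pair U p u G \<Longrightarrow> W1p_pair U p w H \<Longrightarrow>
    Lp_norm ?S p (\<lambda>x. B u x - B w x) \<le> C * (Lp_norm M p (\<lambda>x. u x - w x) + Lp_norm M p (\<lambda>x. G x - H x))"
    by (rule trace_diff_bound[OF dom(1) p(1) B]) (rule that; assumption)
  obtain W where W: "open W" "\<Gamma>D = frontier U \<inter> W" using \<Gamma>D(1) by (auto simp: openin_open)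
  have gDL: "gD \<in> Lp ?S p" using gD by (simp add: Wtr_def)
  \<comment> \<open>The open set \<open>W\<close> cuts \<open>\<Gamma>D\<close> out of the frontier;
    its indicator is measurable and agrees with that of \<open>\<Gamma>D\<close> for surface
    measure.\<close>
  define d where "d x = indicator W x *\<^sub>R (gD x - B w x)" for x
  have dm: "d \<in> borel_measurable ?S" unfolding d_def using W(1)
    by (intro borel_measurable_scaleR borel_measurable_diff Lp_measurable[OF gDL] Lp_measurable[OF trace_Lp[OF B wH]] surface_measure_borel) auto
  have fr: "AE x in ?S. x \<in> frontier U" by (intro AE_I2) (simp add: surface_measure_def space_restrict_space)
  have ae: "AE x in ?S. norm (d x) \<le> 1 * norm (B (u n) x - B w x)" for n
    using uG(2)[of n] fr unfolding dirichlet_def by eventually_elim (auto simp: d_def W indicator_def)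
  note d = Lp_bounded_mult[OF Lp_diff[OF trace_Lp[OF B uG(1)] trace_Lp[OF B wH] p(1)] _ p(2) dm ae]
  have "Lp_norm ?S p d \<le> C * (Lp_norm M p (\<lambda>x. u n x - w x) + Lp_norm M p (\<lambda>x. G n x - H x))" for n
    using d(2)[of n] C(2)[OF uG(1) wH, of n] by simp
  moreover have "(\<lambda>n. C * (Lp_norm M p (\<lambda>x. u n x - w x) + Lp_norm M p (\<lambda>x. G n x - H x))) \<longlonglongrightarrow> C * (0 + 0)"
    by (intro tendsto_intros lim)
  ultimately have "Lp_norm ?S p d \<le> C * (0 + 0)" by (intro LIMSEQ_le_const) auto
  then have "Lp_norm ?S p d = 0" by (simp add: antisym)
  then have "AE x in ?S. d x = 0" using d(1) p by (simp add: Lp_norm_eq_0_iff)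
  then show ?thesis unfolding dirichlet_def by eventually_elim (auto simp: d_def W)
qed

text \<open>The linear constraint \<open>c \<le> \<integral> u \<bullet> g\<close> is carried along in order to recover, by convexity alone, the
  weak convergence of the potentials from that of the gradients.\<close>

definition "Dirichlet_fields g c = {F. \<exists>u. W1p_pair U p u F \<and> dirichlet u \<and> c \<le> (LINT x|M. u x \<bullet> g x)}"

lemma Dirichlet_fields_convex:
  assumes g: "g \<in> Lp M q" and FG: "F \<in> Dirichlet_fields g c" "G \<in> Dirichlet_fields g c" and t: "0 < t" "t \<le> 1"
  shows "(\<lambda>x. F x + t *\<^sub>R (G x - F x)) \<in> Dirichlet_fields g c"
proof -
  obtain u w where u: "W1p_pair U p u F" "dirichlet u" "c \<le> (LINT x|M. u x \<bullet> g x)" and w: "W1p_pair U p w G" "dirichlet w" "c \<le> (LINT x|M. w x \<bullet> g x)"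
    using FG by (auto simp: Dirichlet_fields_def)
  note wu = W1p_pair_diff[OF dom(1) p(1) w(1) u(1)]
  have "AE x in surface_measure U. x \<in> \<Gamma>D \<longrightarrow> B (\<lambda>x. u x + t *\<^sub>R (w x - u x)) x = gD x"
    using trace_add_scaleR[OF dom(1) p(1) B u(1) wu, of t] trace_diff[OF dom(1) p(1) B w(1) u(1)] u(2) w(2)
    unfolding dirichlet_def by eventually_elim simp
  moreover have "c \<le> (LINT x|M. (u x + t *\<^sub>R (w x - u x)) \<bullet> g x)"
  proof -
    have i: "integrable M (\<lambda>x. u x \<bullet> g x)" "integrable M (\<lambda>x. w x \<bullet> g x)"
      using u(1) w(1) by (auto intro!: Hoelder_inner(1)[OF _ g pq] simp: W1p_pair_def)
    have "c = (1 - t) * c + t * c" by (simp add: algebra_simps)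
    also have "\<dots> \<le> (1 - t) * (LINT x|M. u x \<bullet> g x) + t * (LINT x|M. w x \<bullet> g x)"
      using u(3) w(3) t by (intro add_mono mult_left_mono) auto
    also have "\<dots> = (LINT x|M. (u x + t *\<^sub>R (w x - u x)) \<bullet> g x)"
      using i by (simp add: inner_add_left inner_diff_left) (simp add: algebra_simps)
    finally show ?thesis .
  qed
  ultimately show ?thesis using W1p_pair_add_scaleR[OF dom(1) p(1) u(1) wu, of t]
    unfolding Dirichlet_fields_def dirichlet_def by blast
qed

lemma Dirichlet_fields_closed:
  assumes g: "g \<in> Lp M q" and F: "\<And>n. F n \<in> Dirichlet_fields g c" and G: "G \<in> Lp M p" and lim: "Lp_lim M p F G"
  shows "G \<in> Dirichlet_fields g c"
proof -
  obtain C where C: "C \<ge> 0" "\<And>u G w H. W1p_pair U p u G \<Longrightarrow> W1p_pair U p w H \<Longrightarrow> dirichlet u \<Longrightarrow> dirichlet w \<Longrightarrow>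
    Lp_norm M p (\<lambda>x. u x - w x) \<le> C * Lp_norm M p (\<lambda>x. G x - H x)" by (rule poincare) (rule that; assumption)
  have "\<forall>n. \<exists>u. W1p_pair U p u (F n) \<and> dirichlet u \<and> c \<le> (LINT x|M. u x \<bullet> g x)" using F by (simp add: Dirichlet_fields_def)
  from choice[OF this] obtain u where u: "\<And>n. W1p_pair U p (u n) (F n)" "\<And>n. dirichlet (u n)" and ug: "\<And>n. c \<le> (LINT x|M. u n x \<bullet> g x)" by blast
  then have uL: "u n \<in> Lp M p" "F n \<in> Lp M p" for n by (auto simp: W1p_pair_def)
  \<comment> \<open>By the Poincare inequality norm convergence of the gradients makes the
    potentials a Cauchy sequence, which yields a potential of the limit.\<close>
  have le: "Lp_norm M p (\<lambda>x. u m x - u n x) \<le> C * Lp_norm M p (\<lambda>x. F m x - G x) + C * Lp_norm M p (\<lambda>x. F n x - G x)" for m n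
  proof -
    have "Lp_norm M p (\<lambda>x. u m x - u n x) \<le> C * Lp_norm M p (\<lambda>x. F m x - F n x)" by (rule C(2)[OF u(1) u(1) u(2) u(2)])
    also have "\<dots> \<le> C * (Lp_norm M p (\<lambda>x. F m x - G x) + Lp_norm M p (\<lambda>x. F n x - G x))"
      using Lp_norm_diff_triangle[OF uL(2) G uL(2) p(1), of m n] C(1)
      by (intro mult_left_mono) (simp_all add: Lp_norm_diff_commute[of M p G])
    finally show ?thesis by (simp add: distrib_left)
  qed
  obtain w where w: "w \<in> Lp M p" "Lp_lim M p u w"
    by (rule Lp_complete[OF uL(1) p(1) le tendsto_mult_right_zero[OF lim]]) (rule that; assumption)
  have wG: "W1p_pair U p w G" by (rule W1p_pair_limit[OF dom(1,2) pq u(1) w(1) G w(2) lim])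
  have "(\<lambda>n. LINT x|M. u n x \<bullet> g x) \<longlonglongrightarrow> (LINT x|M. w x \<bullet> g x)" by (rule Lp_inner_tendsto[OF uL(1) w(1) g pq w(2)])
  then have "c \<le> (LINT x|M. w x \<bullet> g x)" using ug by (intro LIMSEQ_le_const) auto
  then show ?thesis using wG dirichlet_limit[OF u wG w(2) lim] unfolding Dirichlet_fields_def by blast
qed

lemma Dirichlet_fields_weakly_closed:
  assumes g: "g \<in> Lp M q" and Fn: "\<And>n. Fn n \<in> Dirichlet_fields g c" and F: "F \<in> Lp M p" 
    and w: "\<And>G. G \<in> Lp M q \<Longrightarrow> (\<lambda>n. LINT x|M. Fn n x \<bullet> G x) \<longlonglongrightarrow> (LINT x|M. F x \<bullet> G x)"
  shows "F \<in> Dirichlet_fields g c"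
  using Dirichlet_fields_convex[OF g] Dirichlet_fields_closed[OF g]
  by (rule Lp_convex_closed_imp_weakly_closed[OF _ F pq _ _ Fn w, rotated 1]) 
    (auto simp: Dirichlet_fields_def W1p_pair_def)

theorem E0_weakly_closed:
  assumes Z: "\<And>k. Z k \<in> E0" and w: "weakly_converges_Xpq U p q Z z"
  shows "z \<in> E0"
proof -
  obtain F P where z: "z = (F, P)" by (cases z)
  have FP: "F \<in> Lp M p" "P \<in> Lp M q" using w by (auto simp: z weakly_converges_Xpq_def Xpq_def)
  \<comment> \<open>With \<open>g = 0\<close> and \<open>c = 0\<close> the linear constraint is
    empty, and the set consists of all admissible gradients.\<close>
  have Zk: "fst (Z k) \<in> Dirichlet_fields (\<lambda>x. 0) 0" "snd (Z k) \<in> Lp M q" "neumann (snd (Z k))" for k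
    using Z[of k] E0_iff[of "fst (Z k)" "snd (Z k)"] by (auto simp: Dirichlet_fields_def)
  note lim = weakly_converges_XpqD[OF w pq, unfolded z fst_conv snd_conv]
  have "F \<in> Dirichlet_fields (\<lambda>x. 0) 0" by (rule Dirichlet_fields_weakly_closed[OF Lp_zero Zk(1) FP(1) lim(1)])
  moreover have div: "is_weak_divergence U P (\<lambda>x. - f x)" unfolding is_weak_divergence_def
  proof (intro conjI ballI allI)
    show "loc_integrable U P" "loc_integrable U (\<lambda>x. - f x)" using FP mf p dom by (auto intro: Lp_loc_integrable)
    fix \<phi> and i :: 'n assume \<phi>: "\<phi> \<in> test_functions U"
    have i: "(\<Sum>j\<in>UNIV. A $ i $ j * partial j \<phi> x) = A \<bullet> outer (axis i 1) (sgrad \<phi> x)" for A :: "real ^ 'n ^ 'n" and x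
      by (simp add: inner_outer inner_commute[of "axis i 1"] inner_axis matrix_vector_mult_def sgrad_def)
    have l: "(\<lambda>k. LINT x|M. snd (Z k) x \<bullet> outer (axis i 1) (sgrad \<phi> x)) \<longlonglongrightarrow> (LINT x|M. P x \<bullet> outer (axis i 1) (sgrad \<phi> x))"
      by (rule lim(2)[OF test_function_Lp(3)[OF dom(1,2) \<phi> p(2)]])
    have "(LINT x|M. (\<Sum>j\<in>UNIV. snd (Z k) x $ i $ j * partial j \<phi> x)) = - (LINT x|M. (- f x) $ i * \<phi> x)" for k
      using Zk(3)[of k] \<phi> unfolding neumann_def is_weak_divergence_def by blast
    note hk = this[unfolded i]
    show "(LINT x|M. (\<Sum>j\<in>UNIV. P x $ i $ j * partial j \<phi> x)) = - (LINT x|M. (- f x) $ i * \<phi> x)"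
      unfolding i using LIMSEQ_unique[OF tendsto_const l[unfolded hk]] by simp
  qed
  moreover have "normal_trace U p B P \<psi> = hN \<psi>" 
    if \<psi>: "\<psi> \<in> Wtr U p" "AE x in surface_measure U. x \<notin> \<Gamma>N \<longrightarrow> \<psi> x = 0" for \<psi>
  proof -
    have h: "normal_trace U p B (snd (Z k)) \<psi> = hN \<psi>" for k using Zk(3)[of k] \<psi> unfolding neumann_def by blast
    show ?thesis
    \<comment> \<open>At a trace both sides are given by Green's formula with the same
      \<open>u\<close> and converge; at any other \<open>\<psi>\<close> the normal trace does not
      depend on the field.\<close>
    proof (cases "\<exists>u G. W1p_pair U p u G \<and> (AE x in surface_measure U. B u x = \<psi> x)")
      case True
      then obtain u G where uG: "W1p_pair U p u G" "AE x in surface_measure U. B u x = \<psi> x" by (elim exE conjE)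
      then have "G \<in> Lp M p" by (simp add: W1p_pair_def)
      note l = tendsto_diff[OF lim(2)[OF this] tendsto_const[of "LINT x|M. f x \<bullet> u x"]]
      have "hN \<psi> = (LINT x|M. snd (Z k) x \<bullet> G x) - (LINT x|M. f x \<bullet> u x)" for k
        using normal_trace_eq[OF Zk(2) _ uG] Zk(3) h[of k] by (simp add: neumann_def)
      note l[folded this]
      moreover have "normal_trace U p B P \<psi> = (LINT x|M. P x \<bullet> G x) - (LINT x|M. f x \<bullet> u x)"
        by (rule normal_trace_eq[OF FP(2) div uG])
      ultimately show ?thesis using LIMSEQ_unique[OF tendsto_const[of "hN \<psi>"]] by metis
    next
      case False
      then show ?thesis using normal_trace_off_range[OF False, of P "snd (Z 0)"] h by simp
    qed
  qed
  ultimately show ?thesis unfolding z E0_iff using FP(2) by (auto simp: neumann_def Dirichlet_fields_def)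
qed

text \<open>The closures cover the frontier and exceed the two sets by null sets only. Consequently
  a trace that vanishes on \<open>\<Gamma>D\<close> vanishes almost everywhere off
  \<open>\<Gamma>N\<close> and is a test function for the Neumann condition.\<close>

lemma AE_surface_in_parts: "AE x in surface_measure U. x \<in> \<Gamma>D \<or> x \<in> \<Gamma>N"
proof -
  have n: "AE x in hausdorff_measure (CARD('n) - 1). x \<notin> closure \<Gamma> - \<Gamma>"
    if op: "openin (top_of_set (frontier U)) \<Gamma>" and e0: "emeasure (hausdorff_measure (CARD('n) - 1)) (closure \<Gamma> - \<Gamma>) = 0" for \<Gamma>
  proof -
    obtain W where "open W" "\<Gamma> = frontier U \<inter> W" using op by (auto simp: openin_open)
    then have "\<Gamma> \<in> sets borel" by auto
    then have "closure \<Gamma> - \<Gamma> \<in> null_sets (hausdorff_measure (CARD('n) - 1))" using e0 by (intro null_setsI) auto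
    then show ?thesis by (rule AE_not_in)
  qed
  have "AE x in hausdorff_measure (CARD('n) - 1). x \<in> frontier U \<longrightarrow> x \<in> \<Gamma>D \<or> x \<in> \<Gamma>N"
    using n[OF \<Gamma>N null(1)] n[OF \<Gamma>D(1) null(2)] by eventually_elim (use cover in blast)
  then show ?thesis unfolding surface_measure_def by (subst AE_restrict_space_iff) auto
qed

theorem E0_bound: "\<exists>c. \<forall>(F, P) \<in> E0. (LINT x|M. F x \<bullet> P x) \<le> c * Xpq_norm U p q (F, P) + c"
\<comment> \<open>Unless the set is empty, a reference pair is fixed once; the constants depend on
  it and on the data, not on the pair to be estimated.\<close>
proof (cases "E0 = {}")
  case False
  then obtain F0 P0 where "(F0, P0) \<in> E0" by (metis ex_in_conv surj_pair)
  then obtain u0 where u0: "W1p_pair U p u0 F0" "dirichlet u0" by (auto simp: E0_iff)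
  then have F0: "F0 \<in> Lp M p" by (simp add: W1p_pair_def)
  obtain C where C: "C \<ge> 0" "\<And>u G w H. W1p_pair U p u G \<Longrightarrow> W1p_pair U p w H \<Longrightarrow> dirichlet u \<Longrightarrow> dirichlet w \<Longrightarrow>
    Lp_norm M p (\<lambda>x. u x - w x) \<le> C * Lp_norm M p (\<lambda>x. G x - H x)" by (rule poincare) (rule that; assumption)
  obtain K where K: "\<And>\<phi>. \<phi> \<in> Wtr U p \<Longrightarrow> \<bar>hN \<phi>\<bar> \<le> K * Wtr_norm U p \<phi>" using hN unfolding Wtr_dual_def by blast
  obtain D where D: "\<And>u. u \<in> W1p U p \<Longrightarrow> Wtr_norm U p (B u) \<le> D * W1p_norm U p u"
    using B unfolding is_trace_operator_def by blast
  define nF where "nF = Lp_norm M p F0"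
  define nf where "nf = Lp_norm M q f"
  \<comment> \<open>The first summand bounds \<open>hN\<close> on the trace of \<open>w\<close>,
    whose Sobolev norm is at most \<open>C + 1\<close> times the norm of \<open>H\<close>; the
    second bounds the pairing of \<open>w\<close> with \<open>f\<close>.\<close>
  define A where "A = \<bar>K\<bar> * \<bar>D\<bar> * (C + 1) + nf * C"
  have nn: "A \<ge> 0" "nF \<ge> 0" "nf \<ge> 0" using C(1) by (auto simp: A_def nF_def nf_def)
  have "(LINT x|M. F x \<bullet> P x) \<le> (A * nF + A + nF) * Xpq_norm U p q (F, P) + (A * nF + A + nF)" if FP: "(F, P) \<in> E0" for F P
  proof -
    obtain u where u: "W1p_pair U p u F" "dirichlet u" and P: "P \<in> Lp M q" "neumann P" using FP by (auto simp: E0_iff)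
    then have F: "F \<in> Lp M p" by (simp add: W1p_pair_def)
    define w where "w = (\<lambda>x. u x - u0 x)"
    define H where "H = (\<lambda>x. F x - F0 x)"
    have wH: "W1p_pair U p w H" unfolding w_def H_def by (rule W1p_pair_diff[OF dom(1) p(1) u(1) u0(1)])
    then have L: "w \<in> Lp M p" "H \<in> Lp M p" and wW: "w \<in> W1p U p" by (auto simp: W1p_pair_def W1p_iff_pair)
    have \<psi>: "B w \<in> Wtr U p" using B wW by (auto simp: is_trace_operator_def)
    have "AE x in surface_measure U. x \<notin> \<Gamma>N \<longrightarrow> B w x = 0"
      using trace_diff[OF dom(1) p(1) B u(1) u0(1)] u(2) u0(2) AE_surface_in_parts
      unfolding dirichlet_def w_def by eventually_elim auto
    then have "hN (B w) = normal_trace U p B P (B w)" using P(2) \<psi> by (simp add: neumann_def)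
    also have "\<dots> = (LINT x|M. P x \<bullet> H x) - (LINT x|M. f x \<bullet> w x)"
      using P by (intro normal_trace_eq wH) (auto simp: neumann_def)
    also have "(LINT x|M. P x \<bullet> H x) = (LINT x|M. F x \<bullet> P x) - (LINT x|M. F0 x \<bullet> P x)"
      using Hoelder_inner(1)[OF F P(1) pq] Hoelder_inner(1)[OF F0 P(1) pq] by (simp add: H_def inner_diff_right inner_commute[of "P _"])
    \<comment> \<open>The quadratic expression in the unknown pair has become three terms, each
      linear in the difference of potentials or in \<open>P\<close>.\<close>
    finally have eq: "(LINT x|M. F x \<bullet> P x) = hN (B w) + (LINT x|M. w x \<bullet> f x) + (LINT x|M. F0 x \<bullet> P x)" by (simp add: inner_commute)
    define h where "h = Lp_norm M p H"
    have h: "h \<ge> 0" "h \<le> Lp_norm M p F + nF" 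
      using Lp_norm_triangle[OF F Lp_scaleR[OF F0 p(2), of "-1"] p(1)] Lp_norm_scaleR[OF p(2), of M "-1" F0] by (auto simp: h_def H_def nF_def)
    have w: "Lp_norm M p w \<le> C * h" unfolding w_def h_def H_def by (rule C(2)[OF u(1) u0(1) u(2) u0(2)])
    have "hN (B w) \<le> K * Wtr_norm U p (B w)" using K[OF \<psi>] by simp
    also have "\<dots> \<le> \<bar>K\<bar> * Wtr_norm U p (B w)" by (intro mult_right_mono) (auto simp: Wtr_norm_def Wtr_seminorm_def)
    also have "\<dots> \<le> \<bar>K\<bar> * (D * W1p_norm U p w)" by (intro mult_left_mono D wW) simp
    also have "\<dots> \<le> \<bar>K\<bar> * (\<bar>D\<bar> * W1p_norm U p w)" by (intro mult_left_mono mult_right_mono) (auto simp: W1p_norm_def)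
    also have "\<dots> \<le> \<bar>K\<bar> * (\<bar>D\<bar> * ((C + 1) * h))"
      unfolding W1p_norm_pair[OF dom(1) wH] using w by (intro mult_left_mono) (auto simp: h_def[symmetric] algebra_simps)
    finally have 1: "hN (B w) \<le> \<bar>K\<bar> * \<bar>D\<bar> * (C + 1) * h" by (simp add: mult.assoc)
    have "(LINT x|M. w x \<bullet> f x) \<le> Lp_norm M p w * nf" using Hoelder_inner(2)[OF L(1) f pq] by (simp add: nf_def)
    also have "\<dots> \<le> (C * h) * nf" using w nn by (intro mult_right_mono)
    finally have 2: "hN (B w) + (LINT x|M. w x \<bullet> f x) \<le> A * h" using 1 by (simp add: A_def algebra_simps)
    also have "\<dots> \<le> A * (Lp_norm M p F + nF)" using h nn by (intro mult_left_mono)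
    finally have "(LINT x|M. F x \<bullet> P x) \<le> A * (Lp_norm M p F + nF) + nF * Lp_norm M q P"
      using Hoelder_inner(2)[OF F0 P(1) pq] unfolding eq nF_def by linarith
    \<comment> \<open>A single constant serves as factor and as summand: \<open>A\<close> and
      \<open>nF\<close> multiply the two norms, and \<open>A * nF\<close> is the constant
      term.\<close>
    also have "\<dots> \<le> (A * nF + A + nF) * Xpq_norm U p q (F, P) + (A * nF + A + nF)"
      using nn by (simp add: Xpq_norm_def algebra_simps add_increasing)
    finally show ?thesis .
  qed
  then show ?thesis by (intro exI[of _ "A * nF + A + nF"]) auto
qed auto

end

section \<open>Compactness and the symmetry constraint\<close>

text \<open>At a fixed mollification scale \<open>r\<close> the error on \<open>S\<close> is at most
  \<open>r * C\<close>, uniformly in \<open>k\<close>. For a fixed kernel the mollified fields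
  converge to 0 at every point, because each value is a pairing with a fixed function of the
  conjugate space; they are also uniformly bounded, so dominated convergence on \<open>S\<close>
  applies.\<close>

lemma rellich_smooth:
  fixes v :: "nat \<Rightarrow> ('n::finite) vfield"
  assumes U: "open U" "bounded U" and pq: "p > 1" "q > 1" "1/p + 1/q = 1" and v: "\<And>k. smooth_field (v k)"
    and C: "\<And>k. Lp_norm (lebesgue_on U) p (v k) \<le> C" "\<And>k. Lp_norm (lebesgue_on U) p (grad (v k)) \<le> C"
    and weak: "\<And>g. g \<in> Lp (lebesgue_on U) q \<Longrightarrow> (\<lambda>k. LINT x|lebesgue_on U. v k x \<bullet> g x) \<longlonglongrightarrow> 0"
    and S: "compact S" "S \<subseteq> U"
  shows "(\<lambda>k. locnorm U p S (v k)) \<longlonglongrightarrow> 0"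
proof -
  let ?M = "lebesgue_on U"
  have p: "p \<ge> 1" "p > 0" "q > 0" using pq by auto
  have C0: "C \<ge> 0" using C(1)[of 0] Lp_norm_nonneg order_trans by blast
  have vL: "v k \<in> Lp ?M p" for k using smooth_field_W1p_pair[OF U p(2) v] by (simp add: W1p_pair_def)
  have vB [measurable]: "v k \<in> borel_measurable borel" for k by (rule borel_measurable_continuous_onI[OF smooth_field_continuous[OF v]])
  have Sb [measurable]: "S \<in> sets borel" using S(1) by (intro borel_closed compact_imp_closed)
  have Ub [measurable]: "U \<in> sets borel" using U by simp
  obtain d where d: "d > 0" "(\<Union>x\<in>S. ball x d) \<subseteq> U" using compact_subset_open_imp_ball_epsilon_subset[OF S(1) U(1) S(2)] by blast
  \<comment> \<open>Truncation to \<open>U\<close> makes the pairing with the kernel an integral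
    over \<open>U\<close>, where the weak convergence is given.\<close>
  define g where "g k x = indicator U x *\<^sub>R v k x" for k x
  have gB [measurable]: "g k \<in> borel_measurable borel" for k unfolding g_def by measurable
  have gi [measurable]: "(\<lambda>y. g k y $ i) \<in> borel_measurable borel" for k i
    by (rule measurable_compose[OF gB borel_measurable_continuous_onI]) (intro continuous_intros)
  have g0: "x \<notin> U \<Longrightarrow> g k x = 0" for k x by (simp add: g_def)
  have gM: "g k \<in> Lp ?M p" for k unfolding g_def by (rule Lp_indicator(1)[OF Ub vL p(2)])
  have gL: "g k \<in> Lp lborel p" for k using lebesgue_on_Lp_borel(1)[OF U(1) gB g0] gM by blast
  have gI: "integrable lborel (g k)" for k
    using lebesgue_on_integral_borel(2)[OF U(1) gB g0] Lp_finite_measure_integrable[OF finite_measure_lebesgue_on_bounded[OF U] gM p(1)] by blast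
  show ?thesis
  proof (rule tendstoI)
    fix e :: real assume e: "e > 0"
    \<comment> \<open>The first bound keeps translates of \<open>S\<close> inside \<open>U\<close>;
      the second makes the mollification error at most \<open>e / 2\<close>.\<close>
    define r where "r = min (d / 2) (e / 2 / (C + 1))"
    have r: "r > 0" "r < d" "r \<le> e / 2 / (C + 1)" using d(1) e C0 by (auto simp: r_def)
    have rC: "r * C \<le> e / 2"
    proof -
      have "r * C \<le> r * (C + 1)" using r(1) by simp
      also have "\<dots> \<le> e / 2" using r(3) C0 by (simp add: pos_le_divide_eq algebra_simps)
      finally show ?thesis .
    qed
    obtain K :: "real ^ 'n \<Rightarrow> real" where K: "mollifier r K" using mollifier_at_0_exists[OF r(1)] by blast
    note Kd = mollifierD[OF K]
    have [measurable]: "K \<in> borel_measurable borel" by (rule Kd)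
    define J where "J k = mollify K (g k)" for k
    have JB [measurable]: "J k \<in> borel_measurable borel" for k unfolding J_def by measurable
    have shift: "Lp_norm lborel p (\<lambda>x. indicator S x *\<^sub>R (g k (x + z) - g k x)) \<le> r * C" if z: "K z \<noteq> 0" for k z
    proof -
      have nz: "norm z \<le> r" using z Kd(3) by (simp add: bounded_support_def)
      have inU: "x + s *\<^sub>R z \<in> U" if "x \<in> S" "0 \<le> s" "s \<le> 1" for x s
      proof -
        have "s * norm z \<le> 1 * norm z" using that by (intro mult_right_mono) auto
        then have "x + s *\<^sub>R z \<in> ball x d" using that nz r by (simp add: dist_norm)
        then show ?thesis using that(1) d(2) by blast
      qed
      have "Lp_norm lborel p (\<lambda>x. indicator S x *\<^sub>R (g k (x + z) - g k x)) = Lp_norm lborel p (\<lambda>x. indicator S x *\<^sub>R (v k x - v k (x + z)))"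
        unfolding Lp_norm_def
      proof (intro arg_cong[where f = "\<lambda>t. t powr (1 / p)"] Bochner_Integration.integral_cong refl)
        fix x show "norm (indicator S x *\<^sub>R (g k (x + z) - g k x)) powr p = norm (indicator S x *\<^sub>R (v k x - v k (x + z))) powr p"
          using inU[of x 0] inU[of x 1] by (cases "x \<in> S") (auto simp: g_def norm_minus_commute)
      qed
      also have "\<dots> \<le> norm z * Lp_norm ?M p (grad (v k))"
        by (rule locnorm_shift_smooth(1)[OF U p(1) v Sb S(2) Ub order_refl]) (use inU[of _ 1] inU in auto)
      also have "\<dots> \<le> r * C" using nz C(2) r(1) by (intro mult_mono) auto
      finally show ?thesis .
    qed
    note err = mollify_Lp_error_on[OF K gL gI p(1) mult_nonneg_nonneg[OF less_imp_le[OF r(1)] C0] Sb shift, folded J_def]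
    obtain Bd where Bd: "Bd \<ge> 0" "\<And>z. \<bar>K z\<bar> \<le> Bd" using bounded_support_imp_bounded[OF Kd(6,3)] by metis
    define N where "N = C * (Bd * Lp_norm ?M q (\<lambda>_. 1 :: real))"
    have ker: "(\<lambda>y. K (y - x) *\<^sub>R axis i (1::real)) \<in> Lp ?M q" "Lp_norm ?M q (\<lambda>y. K (y - x) *\<^sub>R axis i (1::real)) \<le> Bd * Lp_norm ?M q (\<lambda>_. 1 :: real)" for x and i :: 'n
    proof -
      have m: "(\<lambda>y. K (y - x) *\<^sub>R axis i (1::real)) \<in> borel_measurable ?M"
        by (intro borel_imp_lebesgue_on_measurable) measurable
      have "(\<lambda>_. 1 :: real) \<in> Lp ?M q" by (intro continuous_Lp_bounded_domain U p) auto
      from Lp_bounded_mult[OF this Bd(1) p(3) m] show "(\<lambda>y. K (y - x) *\<^sub>R axis i (1::real)) \<in> Lp ?M q" 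
        "Lp_norm ?M q (\<lambda>y. K (y - x) *\<^sub>R axis i (1::real)) \<le> Bd * Lp_norm ?M q (\<lambda>_. 1 :: real)" using Bd by auto
    qed
    have Ji: "J k x $ i = (LINT y|?M. v k y \<bullet> (K (y - x) *\<^sub>R axis i 1))" for k x i
    proof -
      have "J k x $ i = (LINT y|lborel. K (y - x) *\<^sub>R (g k y $ i))"
        unfolding J_def by (subst mollify_component[OF Kd(1,3) gI]) (simp add: mollify_def)
      also have "\<dots> = (LINT y|?M. K (y - x) *\<^sub>R (g k y $ i))"
        by (rule lebesgue_on_integral_borel(1)[OF U(1), symmetric]) (auto simp: g0)
      also have "\<dots> = (LINT y|?M. v k y \<bullet> (K (y - x) *\<^sub>R axis i 1))"
        by (intro Bochner_Integration.integral_cong) (auto simp: g_def space_restrict_space inner_axis)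
      finally show ?thesis .
    qed
    \<comment> \<open>Each component of the mollification at \<open>x\<close> is the pairing of
      \<open>v k\<close> with the kernel centred at \<open>x\<close>, so weak convergence to 0
      applies pointwise.\<close>
    have Jlim: "(\<lambda>k. J k x) \<longlonglongrightarrow> 0" for x
      by (rule vec_tendstoI) (simp only: Ji zero_index weak[OF ker(1)])
    have Jbd: "norm (J k x) \<le> real CARD('n) * N" for k x
    proof -
      have "\<bar>J k x $ i\<bar> \<le> N" for i
      proof -
        have "\<bar>J k x $ i\<bar> \<le> Lp_norm ?M p (v k) * Lp_norm ?M q (\<lambda>y. K (y - x) *\<^sub>R axis i (1::real))"
          unfolding Ji by (rule Hoelder_inner(2)[OF vL ker(1) pq])
        also have "\<dots> \<le> N" unfolding N_def using ker(2) C(1) C0 by (intro mult_mono) auto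
        finally show ?thesis .
      qed
      then have "(\<Sum>i\<in>UNIV. \<bar>J k x $ i\<bar>) \<le> (\<Sum>i\<in>(UNIV::'n set). N)" by (intro sum_mono) auto
      then show ?thesis using norm_le_l1_cart[of "J k x"] by simp
    qed
    have "(\<lambda>k. LINT x|lborel. norm (indicator S x *\<^sub>R J k x) powr p) \<longlonglongrightarrow> (LINT x|(lborel :: (real ^ 'n) measure). (0::real))"
    proof (rule integral_dominated_convergence[where w = "\<lambda>x. indicator S x * (real CARD('n) * N) powr p"])
      show "integrable lborel (\<lambda>x. indicator S x * (real CARD('n) * N) powr p)"
        using emeasure_bounded_finite[OF compact_imp_bounded[OF S(1)]] Sb by (intro integrable_mult_left integrable_real_indicator) auto
      show "AE x in lborel. (\<lambda>k. norm (indicator S x *\<^sub>R J k x) powr p) \<longlonglongrightarrow> 0"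
      proof (rule AE_I2)
        fix x
        have "(\<lambda>k. norm (indicator S x *\<^sub>R J k x)) \<longlonglongrightarrow> 0"
          using tendsto_norm[OF tendsto_scaleR[OF tendsto_const Jlim, of "indicator S x" x]] by simp
        from tendsto_zero_powrI[OF this tendsto_const[of p]] p show "(\<lambda>k. norm (indicator S x *\<^sub>R J k x) powr p) \<longlonglongrightarrow> 0" by simp
      qed
      show "AE x in lborel. norm (norm (indicator S x *\<^sub>R J k x) powr p) \<le> indicator S x * (real CARD('n) * N) powr p" for k
        using Jbd p by (intro AE_I2) (auto simp: indicator_def intro: powr_mono2)
    qed auto
    then have "(\<lambda>k. Lp_norm lborel p (\<lambda>x. indicator S x *\<^sub>R J k x)) \<longlonglongrightarrow> 0"
      by (simp add: Lp_norm_tendsto_iff[OF p(2)])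
    moreover have "e / 2 > 0" using e by simp
    ultimately have "\<forall>\<^sub>F k in sequentially. Lp_norm lborel p (\<lambda>x. indicator S x *\<^sub>R J k x) < e / 2" by (rule order_tendstoD(2))
    then show "\<forall>\<^sub>F k in sequentially. dist (locnorm U p S (v k)) 0 < e"
    proof eventually_elim
      fix k assume k: "Lp_norm lborel p (\<lambda>x. indicator S x *\<^sub>R J k x) < e / 2"
      define a where "a x = indicator S x *\<^sub>R g k x" for x
      define b where "b x = indicator S x *\<^sub>R J k x" for x
      have vS: "(\<lambda>x. indicator S x *\<^sub>R v k x) = a" using S(2) by (auto simp: fun_eq_iff a_def g_def indicator_def)
      have aL: "a \<in> Lp lborel p" using nn_integral_locnorm(2)[OF U(1) Sb S(2) vL vB p(2), of k] by (simp only: vS)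
      have ba: "(\<lambda>x. b x - a x) = (\<lambda>x. indicator S x *\<^sub>R (J k x - g k x))" by (simp add: a_def b_def scaleR_diff_right)
      have baL: "(\<lambda>x. b x - a x) \<in> Lp lborel p" "Lp_norm lborel p (\<lambda>x. b x - a x) \<le> r * C" unfolding ba by (rule err; assumption)+
      have bL: "b \<in> Lp lborel p" using Lp_add[OF baL(1) aL p(1)] by simp
      have "locnorm U p S (v k) = Lp_norm lborel p a"
        using nn_integral_locnorm(3)[OF U(1) Sb S(2) vL vB p(2), of k] by (simp only: vS)
      also have "\<dots> \<le> Lp_norm lborel p (\<lambda>x. a x - b x) + Lp_norm lborel p b"
        using Lp_norm_diff_triangle[OF aL bL Lp_zero p(1)] by simp
      also have "\<dots> < e" using baL(2) rC k Lp_norm_diff_commute[of lborel p a b] unfolding b_def[symmetric] by linarith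
      finally show "dist (locnorm U p S (v k)) 0 < e" by (simp add: locnorm_def)
    qed
  qed
qed

text \<open>Each field is replaced by a smooth one within \<open>1 / Suc k\<close> of it, in norm
  and in gradient. Along the sequence this changes neither the weak limit nor the bounds in an
  essential way, and the error tends to 0 in norm.\<close>

lemma rellich:
  fixes v :: "nat \<Rightarrow> ('n::finite) vfield"
  assumes U: "open U" "bounded U" "lipschitz_boundary U" and pq: "p > 1" "q > 1" "1/p + 1/q = 1" and v: "\<And>k. W1p_pair U p (v k) (H k)"
    and C: "\<And>k. Lp_norm (lebesgue_on U) p (v k) \<le> C" "\<And>k. Lp_norm (lebesgue_on U) p (H k) \<le> C"
    and weak: "\<And>g. g \<in> Lp (lebesgue_on U) q \<Longrightarrow> (\<lambda>k. LINT x|lebesgue_on U. v k x \<bullet> g x) \<longlonglongrightarrow> 0"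
    and S: "compact S" "S \<subseteq> U"
  shows "(\<lambda>k. locnorm U p S (v k)) \<longlonglongrightarrow> 0"
proof -
  let ?M = "lebesgue_on U"
  have p: "p \<ge> 1" "p > 0" using pq by auto
  have vL: "v k \<in> Lp ?M p" "H k \<in> Lp ?M p" for k using v by (auto simp: W1p_pair_def)
  have ex: "\<exists>w. smooth_field w \<and> Lp_norm ?M p (\<lambda>x. w x - v k x) < 1 / Suc k \<and> Lp_norm ?M p (\<lambda>x. grad w x - H k x) < 1 / Suc k" for k
  proof -
    obtain w where w: "\<And>n. smooth_field (w n)" "(\<lambda>n. Lp_norm ?M p (\<lambda>x. w n x - v k x)) \<longlonglongrightarrow> 0"
     "(\<lambda>n. Lp_norm ?M p (\<lambda>x. grad (w n) x - H k x)) \<longlonglongrightarrow> 0"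
      by (rule W1p_smooth_dense[OF U p(1) v[of k]]) (rule that; assumption)
    have "0 < 1 / real (Suc k)" by simp
    from eventually_conj[OF order_tendstoD(2)[OF w(2) this] order_tendstoD(2)[OF w(3) this]]
    obtain n where "Lp_norm ?M p (\<lambda>x. w n x - v k x) < 1 / Suc k \<and> Lp_norm ?M p (\<lambda>x. grad (w n) x - H k x) < 1 / Suc k"
      using eventually_happens'[OF sequentially_bot] by fastforce
    then show ?thesis using w(1) by blast
  qed
  have "\<exists>w. \<forall>k. smooth_field (w k) \<and> Lp_norm ?M p (\<lambda>x. w k x - v k x) < 1 / Suc k \<and> Lp_norm ?M p (\<lambda>x. grad (w k) x - H k x) < 1 / Suc k"
    by (rule choice[OF allI]) (rule ex)
  then obtain w where w: "\<And>k. smooth_field (w k)" "\<And>k. Lp_norm ?M p (\<lambda>x. w k x - v k x) < 1 / Suc k" "\<And>k. Lp_norm ?M p (\<lambda>x. grad (w k) x - H k x) < 1 / Suc k"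
    by (elim exE) (rule that; blast)
  have wL: "w k \<in> Lp ?M p" "grad (w k) \<in> Lp ?M p" for k using smooth_field_W1p_pair[OF U(1,2) p(2) w(1)] by (auto simp: W1p_pair_def)
  have dL: "(\<lambda>x. w k x - v k x) \<in> Lp ?M p" "(\<lambda>x. grad (w k) x - H k x) \<in> Lp ?M p" for k by (intro Lp_diff wL vL p)+
  have small: "1 / real (Suc k) \<le> 1" for k by simp
  note le1 = order_trans[OF less_imp_le[OF w(2)] small] order_trans[OF less_imp_le[OF w(3)] small]
  have d0: "(\<lambda>k. Lp_norm ?M p (\<lambda>x. w k x - v k x)) \<longlonglongrightarrow> 0"
    by (rule tendsto_sandwich[OF _ _ tendsto_const[of 0] LIMSEQ_Suc[OF lim_1_over_n]]) (use less_imp_le[OF w(2)] in auto)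
  have "(\<lambda>k. locnorm U p S (w k)) \<longlonglongrightarrow> 0"
  proof (rule rellich_smooth[OF U(1,2) pq w(1) _ _ _ S])
    show "Lp_norm ?M p (w k) \<le> C + 1" for k
      using Lp_norm_triangle[OF dL(1) vL(1) p(1), of k k] C(1)[of k] le1(1)[of k] by simp
    show "Lp_norm ?M p (grad (w k)) \<le> C + 1" for k
      using Lp_norm_triangle[OF dL(2) vL(2) p(1), of k k] C(2)[of k] le1(2)[of k] by simp
    fix g assume g: "(g :: 'n vfield) \<in> Lp ?M q"
    have "(LINT x|?M. w k x \<bullet> g x) = (LINT x|?M. (w k x - v k x) \<bullet> g x) + (LINT x|?M. v k x \<bullet> g x)" for k
      using Hoelder_inner(1)[OF wL(1) g pq] Hoelder_inner(1)[OF vL(1) g pq] by (simp add: inner_diff_left)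
    moreover have "(\<lambda>k. LINT x|?M. (w k x - v k x) \<bullet> g x) \<longlonglongrightarrow> (LINT x|?M. 0 \<bullet> g x)"
      by (rule Lp_inner_tendsto[OF dL(1) Lp_zero g pq]) (use d0 in simp)
    ultimately show "(\<lambda>k. LINT x|?M. w k x \<bullet> g x) \<longlonglongrightarrow> 0" using tendsto_add[of _ "0::real" sequentially, OF _ weak[OF g]] by simp
  qed
  from tendsto_add[OF this d0] have l: "(\<lambda>k. locnorm U p S (w k) + Lp_norm ?M p (\<lambda>x. w k x - v k x)) \<longlonglongrightarrow> 0" by simp
  have le: "locnorm U p S (v k) \<le> locnorm U p S (w k) + Lp_norm ?M p (\<lambda>x. w k x - v k x)" for k
    using locnorm_diff_le[OF borel_closed[OF compact_imp_closed[OF S(1)]] vL(1) wL(1) p(1), of k k] Lp_norm_diff_commute[of ?M p "v k" "w k"] by simp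
  have nn: "0 \<le> locnorm U p S (v k)" for k by (simp add: locnorm_def)
  show ?thesis by (rule tendsto_sandwich[OF always_eventually always_eventually tendsto_const l]) (use le nn in auto)
qed

text \<open>A vector placed into row \<open>j\<close> of an otherwise zero matrix picks row
  \<open>j\<close> of \<open>A\<close>. So an entry of \<open>F P^T\<close>, a product of row
  \<open>i\<close> of \<open>F\<close> with row \<open>j\<close> of \<open>P\<close>, becomes a
  Frobenius product to which Green's formula applies.\<close>

lemma row_outer_inner: "outer (axis j 1) b \<bullet> A = b \<bullet> A $ j"
proof -
  have "outer (axis j 1) b \<bullet> A = (A *v b) $ j" by (subst inner_commute) (simp add: inner_outer inner_axis')
  also have "\<dots> = b \<bullet> A $ j" by (simp add: matrix_vector_mult_def inner_vec_def mult.commute)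
  finally show ?thesis .
qed

lemma transpose_nth: "transpose A $ i $ j = A $ j $ i"
  by (simp add: transpose_def)

lemma mult_transpose_nth: "(A ** transpose B) $ i $ j = A $ i \<bullet> B $ j"
  by (simp add: matrix_matrix_mult_def transpose_def inner_vec_def)

lemma Lp_row_outer:
  fixes H :: "real ^ 'n \<Rightarrow> real ^ 'm ^ 'k"
  assumes "H \<in> Lp (lebesgue_on U) p" "p > 0"
  shows "(\<lambda>x. outer (axis j 1) (H x $ i)) \<in> Lp (lebesgue_on U) p"
proof -
  have [measurable]: "(\<lambda>x. H x $ i) \<in> borel_measurable (lebesgue_on U)"
    by (rule measurable_compose[OF Lp_measurable[OF assms(1)] borel_measurable_continuous_onI]) (intro continuous_intros)
  show ?thesis
    by (rule Lp_bounded_mult(1)[OF assms(1) _ assms(2), of 1]) (measurable, auto intro!: AE_I2 simp: norm_outer norm_axis_1 Finite_Cartesian_Product.norm_nth_le)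
qed

text \<open>Moving component \<open>i\<close> of \<open>v\<close> to position \<open>j\<close> moves
  row \<open>i\<close> of the gradient to row \<open>j\<close>. This is the field that isolates one
  entry of \<open>F P^T\<close> while remaining a potential with its gradient.\<close>

lemma W1p_pair_component:
  assumes U: "open U" "bounded U" and p: "p \<ge> 1" and v: "W1p_pair U p v H"
  shows "W1p_pair U p (\<lambda>x. v x $ i *\<^sub>R axis j (1::real)) (\<lambda>x. outer (axis j 1) (H x $ i))"
    and "S \<in> sets borel \<Longrightarrow> locnorm U p S (\<lambda>x. v x $ i *\<^sub>R axis j (1::real)) \<le> locnorm U p S v"
proof -
  have p0: "p > 0" using p by simp
  have L: "v \<in> Lp (lebesgue_on U) p" "H \<in> Lp (lebesgue_on U) p" and w: "is_weak_gradient U v H" using v by (auto simp: W1p_pair_def)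
  have [measurable]: "(\<lambda>x. v x $ i) \<in> borel_measurable (lebesgue_on U)"
    by (rule measurable_compose[OF Lp_measurable[OF L(1)] borel_measurable_continuous_onI]) (intro continuous_intros)
  have vL: "(\<lambda>x. v x $ i *\<^sub>R axis j (1::real)) \<in> Lp (lebesgue_on U) p"
    by (rule Lp_bounded_mult(1)[OF L(1) _ p0, of 1]) (measurable, auto intro!: AE_I2 simp: norm_axis_1 component_le_norm_cart)
  have HL: "(\<lambda>x. outer (axis j 1) (H x $ i)) \<in> Lp (lebesgue_on U) p" by (rule Lp_row_outer[OF L(2) p0])
  show "W1p_pair U p (\<lambda>x. v x $ i *\<^sub>R axis j (1::real)) (\<lambda>x. outer (axis j 1) (H x $ i))"
    unfolding W1p_pair_def is_weak_gradient_def
  proof (intro conjI ballI allI vL HL Lp_loc_integrable[OF U vL p] Lp_loc_integrable[OF U HL p])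
    fix \<phi> a b assume "\<phi> \<in> test_functions U"
    then show "(LINT x|lebesgue_on U. (v x $ i *\<^sub>R axis j (1::real)) $ a * partial b \<phi> x) = - (LINT x|lebesgue_on U. outer (axis j 1) (H x $ i) $ a $ b * \<phi> x)"
      using w by (cases "a = j") (auto simp: is_weak_gradient_def outer_def axis_def)
  qed
  show "locnorm U p S (\<lambda>x. v x $ i *\<^sub>R axis j (1::real)) \<le> locnorm U p S v" if S: "S \<in> sets borel"
    using Lp_bounded_mult(2)[OF Lp_indicator(1)[OF S L(1) p0] _ p0 Lp_measurable[OF Lp_indicator(1)[OF S vL p0]], of 1]
    by (auto simp: locnorm_def indicator_def norm_axis_1 component_le_norm_cart)
qed

context mixed_boundary_problem
begin

text \<open>Green's formula with cutoff expresses the integral of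
  \<open>\<phi> G \<bullet> P\<close> through \<open>w\<close> alone, paired with \<open>P\<close>
  and with the fixed divergence. Both terms are bounded by the norm of \<open>w\<close> on the
  support of \<open>\<phi>\<close>, so no strong convergence of \<open>P\<close> or \<open>G\<close>
  enters.\<close>

lemma div_curl:
  assumes wG: "\<And>k. W1p_pair U p (w k) (G k)" and P: "\<And>k. P k \<in> Lp M q" "\<And>k. is_weak_divergence U (P k) (\<lambda>x. - f x)" "\<And>k. Lp_norm M q (P k) \<le> C"
    and \<phi>: "\<phi> \<in> test_functions U" and lim: "(\<lambda>k. locnorm U p (closure {x. \<phi> x \<noteq> 0}) (w k)) \<longlonglongrightarrow> 0"
  shows "(\<lambda>k::nat. LINT x|M. (\<phi> x *\<^sub>R G k x) \<bullet> P k x) \<longlonglongrightarrow> 0"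
proof -
  define S where "S = closure {x. \<phi> x \<noteq> 0}"
  have S: "S \<in> sets borel" by (simp add: S_def)
  have \<phi>s: "smooth \<phi>" by (rule test_functionsD(1)[OF \<phi>])
  have c: "continuous_on UNIV \<phi>" "continuous_on UNIV (sgrad \<phi>)" by (rule smooth_continuous[OF \<phi>s] smooth_sgrad_continuous[OF \<phi>s])+
  obtain A where A: "A \<ge> 0" "\<forall>x\<in>U. \<bar>\<phi> x\<bar> \<le> A" using continuous_bounded_on_domain[OF dom(2) c(1)] by auto
  obtain N where N: "N \<ge> 0" "\<forall>x\<in>U. norm (sgrad \<phi> x) \<le> N" using continuous_bounded_on_domain[OF dom(2) c(2)] by auto
  have \<phi>0: "\<phi> x = 0" "sgrad \<phi> x = 0" if "x \<notin> S" for x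
    using that test_functionsD(5)[OF \<phi>, of x] test_functionsD(6)[OF \<phi>, of _ x] by (auto simp: S_def sgrad_def vec_eq_iff)
  have wL: "w k \<in> Lp M p" "G k \<in> Lp M p" for k using wG by (auto simp: W1p_pair_def)
  note wS = Lp_indicator(1)[OF S wL(1) p(2)]
  note m = bounded_mult_Lp[OF c(1) A(2,1) p(2) wS] and o = bounded_outer_Lp[OF c(2) N(2,1) p(2) wS]
  have "\<bar>LINT x|M. (\<phi> x *\<^sub>R G k x) \<bullet> P k x\<bar> \<le> (N * C + A * Lp_norm M q f) * locnorm U p S (w k)" for k
  proof -
    have o': "outer (w k x) (sgrad \<phi> x) = outer (indicator S x *\<^sub>R w k x) (sgrad \<phi> x)"
      and m': "\<phi> x *\<^sub>R w k x = \<phi> x *\<^sub>R indicator S x *\<^sub>R w k x" for x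
      using \<phi>0[of x] by (cases "x \<in> S"; simp add: outer_def vec_eq_iff)+
    have i: "integrable M (\<lambda>x. (\<phi> x *\<^sub>R G k x) \<bullet> P k x)" "integrable M (\<lambda>x. outer (w k x) (sgrad \<phi> x) \<bullet> P k x)"
      using Hoelder_inner(1)[OF bounded_mult_Lp(1)[OF c(1) A(2,1) p(2) wL(2)] P(1) pq] Hoelder_inner(1)[OF o(1) P(1) pq] unfolding o' by auto
    have "(LINT x|M. (\<phi> x *\<^sub>R G k x) \<bullet> P k x) + (LINT x|M. outer (w k x) (sgrad \<phi> x) \<bullet> P k x) + (LINT x|M. (\<phi> x *\<^sub>R w k x) \<bullet> - f x) = 0"
      using green_formula_cutoff[OF dom pq wG[of k] P(1)[of k] mf P(2) \<phi>] i by (simp add: inner_add_left)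
    moreover have "\<bar>LINT x|M. outer (w k x) (sgrad \<phi> x) \<bullet> P k x\<bar> \<le> (N * locnorm U p S (w k)) * C"
      unfolding o' locnorm_def using Hoelder_inner(2)[OF o(1) P(1) pq, of k k] o(2)[of k] P(3)[of k] N(1)
      by (elim order_trans) (intro mult_mono, auto)
    moreover have "\<bar>LINT x|M. (\<phi> x *\<^sub>R w k x) \<bullet> - f x\<bar> \<le> (A * locnorm U p S (w k)) * Lp_norm M q f"
      unfolding m' locnorm_def using Hoelder_inner(2)[OF m(1) mf pq, of k] m(2)[of k] A(1) Lp_norm_scaleR[OF p(4), of M "-1" f]
      by (elim order_trans) (intro mult_mono, auto)
    ultimately show ?thesis by (simp add: algebra_simps)
  qed
  then show ?thesis by (intro tendsto_0_le[OF lim[folded S_def], of _ "N * C + A * Lp_norm M q f"]) (auto simp: locnorm_def mult.commute)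
qed

text \<open>If the pairings exceeded the expected limit by \<open>e\<close> along a subsequence, the
  corresponding gradients would satisfy one linear constraint in \<open>Dirichlet_fields\<close>.
  Weak closedness gives \<open>F\<close> a potential with too large a pairing, whereas the Poincare
  inequality makes the potential of \<open>F\<close> unique.\<close>

lemma potentials_weakly_converge:
  assumes u: "\<And>k. W1p_pair U p (u k) (Fn k)" "\<And>k. dirichlet (u k)" and w: "W1p_pair U p w F" "dirichlet w"
    and lim: "\<And>G. G \<in> Lp M q \<Longrightarrow> (\<lambda>n. LINT x|M. Fn n x \<bullet> G x) \<longlonglongrightarrow> (LINT x|M. F x \<bullet> G x)" and g: "g \<in> Lp M q"
  shows "(\<lambda>k. LINT x|M. u k x \<bullet> g x) \<longlonglongrightarrow> (LINT x|M. w x \<bullet> g x)"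
proof -
  have F: "F \<in> Lp M p" and wL: "w \<in> Lp M p" using w by (auto simp: W1p_pair_def)
  obtain C where C: "C \<ge> 0" "\<And>u G w H. W1p_pair U p u G \<Longrightarrow> W1p_pair U p w H \<Longrightarrow> dirichlet u \<Longrightarrow> dirichlet w \<Longrightarrow>
    Lp_norm M p (\<lambda>x. u x - w x) \<le> C * Lp_norm M p (\<lambda>x. G x - H x)" by (rule poincare) (rule that; assumption)
  have upper: "\<forall>\<^sub>F k in sequentially. (LINT x|M. u k x \<bullet> g x) < (LINT x|M. w x \<bullet> g x) + e" if e: "e > 0" and g: "g \<in> Lp M q" for e g
  proof (rule ccontr)
    define c where "c = (LINT x|M. w x \<bullet> g x) + e"
    assume "\<not> ?thesis"
    then have "infinite {k. c \<le> (LINT x|M. u k x \<bullet> g x)}"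
      unfolding cofinite_eq_sequentially[symmetric] eventually_cofinite c_def by (simp add: not_less)
    from infinite_enumerate[OF this] obtain r :: "nat \<Rightarrow> nat" where r: "strict_mono r" "\<And>n. c \<le> (LINT x|M. u (r n) x \<bullet> g x)" by auto
    have "Fn (r n) \<in> Dirichlet_fields g c" for n unfolding Dirichlet_fields_def by (intro CollectI exI[of _ "u (r n)"] conjI u r)
    moreover have "(\<lambda>n. LINT x|M. Fn (r n) x \<bullet> G x) \<longlonglongrightarrow> (LINT x|M. F x \<bullet> G x)" if "G \<in> Lp M q" for G
      using LIMSEQ_subseq_LIMSEQ[OF lim[OF that] r(1)] by (simp add: comp_def)
    ultimately have "F \<in> Dirichlet_fields g c" by (rule Dirichlet_fields_weakly_closed[where Fn = "\<lambda>n. Fn (r n)", OF g _ F])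
    then obtain v where v: "W1p_pair U p v F" "dirichlet v" "c \<le> (LINT x|M. v x \<bullet> g x)" by (auto simp: Dirichlet_fields_def)
    have vL: "v \<in> Lp M p" using v by (simp add: W1p_pair_def)
    have "Lp_norm M p (\<lambda>x. v x - w x) \<le> 0"
      using C(2)[OF v(1) w(1) v(2) w(2)] p by (simp add: Lp_norm_def)
    then have "Lp_norm M p (\<lambda>x. v x - w x) = 0" by (simp add: antisym)
    then have "(LINT x|M. (v x - w x) \<bullet> g x) = 0" using Hoelder_inner(2)[OF Lp_diff[OF vL wL p(1)] g pq] by simp
    then have "(LINT x|M. v x \<bullet> g x) = (LINT x|M. w x \<bullet> g x)"
      using Hoelder_inner(1)[OF vL g pq] Hoelder_inner(1)[OF wL g pq] by (simp add: inner_diff_left)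
    then show False using v(3) e by (simp add: c_def)
  qed
  show ?thesis
  proof (rule tendstoI)
    fix e :: real assume e: "e > 0"
    \<comment> \<open>The one-sided estimate for \<open>- g\<close> is the missing lower bound for
      \<open>g\<close>.\<close>
    have mg: "(\<lambda>x. - g x) \<in> Lp M q" using Lp_scaleR[OF g p(4), of "-1"] by simp
    show "\<forall>\<^sub>F k in sequentially. dist (LINT x|M. u k x \<bullet> g x) (LINT x|M. w x \<bullet> g x) < e"
      using upper[OF e g] upper[OF e mg] by eventually_elim (auto simp: dist_real_def)
  qed
qed

abbreviation "E \<equiv> E_set U \<Gamma>D \<Gamma>N p q B f gD hN"

theorem E_weakly_closed:
  assumes Z: "\<And>k. Z k \<in> E" and w: "weakly_converges_Xpq U p q Z z"
  shows "z \<in> E"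
proof -
  have Z0: "Z k \<in> E0" for k using Z[of k] by (auto simp: E_set_def)
  obtain F P where z: "z = (F, P)" by (cases z)
  have FPE0: "(F, P) \<in> E0" using E0_weakly_closed[OF Z0 w] by (simp add: z)
  then obtain u where u: "W1p_pair U p u F" "dirichlet u" and P: "P \<in> Lp M q" by (auto simp: E0_iff)
  have F: "F \<in> Lp M p" using u by (simp add: W1p_pair_def)
  define Fk where "Fk k = fst (Z k)" for k
  define Pk where "Pk k = snd (Z k)" for k
  note lim = weakly_converges_XpqD[OF w pq, unfolded z fst_conv snd_conv, folded Fk_def Pk_def]
  have ZE: "(Fk k, Pk k) \<in> E0" "AE x in M. transpose (Fk k x ** transpose (Pk k x)) = Fk k x ** transpose (Pk k x)" for k
    using Z0[of k] Z[of k] by (auto simp: Fk_def Pk_def E_set_def case_prod_beta)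
  have "\<forall>k. \<exists>u. W1p_pair U p u (Fk k) \<and> dirichlet u" using ZE(1) by (auto simp: E0_iff)
  from choice[OF this] obtain uk where uk: "\<And>k. W1p_pair U p (uk k) (Fk k)" "\<And>k. dirichlet (uk k)" by blast
  have Pk: "Pk k \<in> Lp M q" "is_weak_divergence U (Pk k) (\<lambda>x. - f x)" for k using ZE(1)[of k] by (auto simp: E0_iff neumann_def)
  have FkL: "Fk k \<in> Lp M p" "uk k \<in> Lp M p" for k using uk(1) by (auto simp: W1p_pair_def)
  have bd: "\<exists>c. \<forall>n. \<bar>X n\<bar> \<le> c" if "X \<longlonglongrightarrow> l" for X and l :: real
    using convergent_imp_Bseq[OF convergentI[OF that]] by (auto simp: Bseq_def)
  \<comment> \<open>Weakly convergent sequences are bounded; compactness needs the bound on the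
    gradients, the div-curl argument the one on the fields \<open>Pk\<close>.\<close>
  obtain C1 where C1: "\<And>k. Lp_norm M p (Fk k) \<le> C1" using Lp_weakly_bounded_imp_bounded[OF FkL(1) pq bd[OF lim(1)]] by blast
  obtain C2 where C2: "\<And>k. Lp_norm M q (Pk k) \<le> C2" using Lp_weakly_bounded_imp_bounded[OF Pk(1) pq(2,1) qp bd[OF lim(2)]] by blast
  \<comment> \<open>Subtracting the limit potential produces fields that tend weakly to 0, with
    vanishing trace on \<open>\<Gamma>D\<close> and bounded gradients.\<close>
  define v where "v k = (\<lambda>x. uk k x - u x)" for k
  define H where "H k = (\<lambda>x. Fk k x - F x)" for k
  have vH: "W1p_pair U p (v k) (H k)" for k unfolding v_def H_def by (rule W1p_pair_diff[OF dom(1) p(1) uk(1) u(1)])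
  obtain C where C: "C \<ge> 0" "\<And>u G w H. W1p_pair U p u G \<Longrightarrow> W1p_pair U p w H \<Longrightarrow> dirichlet u \<Longrightarrow> dirichlet w \<Longrightarrow>
    Lp_norm M p (\<lambda>x. u x - w x) \<le> C * Lp_norm M p (\<lambda>x. G x - H x)" by (rule poincare) (rule that; assumption)
  define D where "D = C1 + Lp_norm M p F"
  have HD: "Lp_norm M p (H k) \<le> D" for k
    using Lp_norm_triangle[OF FkL(1) Lp_scaleR[OF F p(2), of "-1"] p(1), of k] Lp_norm_scaleR[OF p(2), of M "-1" F] C1[of k] by (simp add: H_def D_def)
  have "Lp_norm M p (v k) \<le> C * Lp_norm M p (H k)" for k unfolding v_def H_def by (rule C(2)[OF uk(1) u(1) uk(2) u(2)])
  then have vD: "Lp_norm M p (v k) \<le> C * D" for k using mult_left_mono[OF HD C(1)] order_trans by blast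
  have weak: "(\<lambda>k. LINT x|M. v k x \<bullet> g x) \<longlonglongrightarrow> 0" if g: "g \<in> Lp M q" for g
  proof -
    have "(LINT x|M. v k x \<bullet> g x) = (LINT x|M. uk k x \<bullet> g x) - (LINT x|M. u x \<bullet> g x)" for k
      using u(1) uk(1)[of k] by (simp add: v_def inner_diff_left Hoelder_inner(1)[OF _ g pq] W1p_pair_def)
    then show ?thesis using LIM_zero[OF potentials_weakly_converge[OF uk u lim(1) g]] by simp
  qed
  have strong: "(\<lambda>k. locnorm U p S (v k)) \<longlonglongrightarrow> 0" if "compact S" "S \<subseteq> U" for S
  proof (rule rellich[OF dom pq vH _ _ weak that])
    show "Lp_norm M p (v k) \<le> max (C * D) D" "Lp_norm M p (H k) \<le> max (C * D) D" for k using vD[of k] HD[of k] by auto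
  qed
  have conv: "(\<lambda>k. LINT x|M. \<phi> x * (Fk k x $ i \<bullet> Pk k x $ j)) \<longlonglongrightarrow> (LINT x|M. \<phi> x * (F x $ i \<bullet> P x $ j))"
    if \<phi>: "\<phi> \<in> test_functions U" for \<phi> i j
  proof -
    \<comment> \<open>Row \<open>i\<close> of the argument placed in row \<open>j\<close>: paired
      with \<open>P\<close> it gives entry \<open>(i, j)\<close> of the product.\<close>
    let ?R = "\<lambda>H x. outer (axis j 1) (H x $ i)"
    have c: "continuous_on UNIV \<phi>" by (rule smooth_continuous[OF test_functionsD(1)[OF \<phi>]])
    obtain A where A: "A \<ge> 0" "\<forall>x\<in>U. \<bar>\<phi> x\<bar> \<le> A" using continuous_bounded_on_domain[OF dom(2) c] by auto
    note RL = bounded_mult_Lp(1)[OF c A(2,1) p(2) Lp_row_outer[OF _ p(2)]]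
    have S: "compact (closure {x. \<phi> x \<noteq> 0})" "closure {x. \<phi> x \<noteq> 0} \<subseteq> U" "closure {x. \<phi> x \<noteq> 0} \<in> sets borel"
      using test_functionsD(3,4)[OF \<phi>] by auto
    have "(\<lambda>k. locnorm U p (closure {x. \<phi> x \<noteq> 0}) (\<lambda>x. v k x $ i *\<^sub>R axis j (1::real))) \<longlonglongrightarrow> 0"
      using W1p_pair_component(2)[OF dom(1,2) p(1) vH S(3)]
      by (intro tendsto_sandwich[OF always_eventually always_eventually tendsto_const strong[OF S(1,2)]]) (auto simp: locnorm_def)
    from div_curl[OF W1p_pair_component(1)[OF dom(1,2) p(1) vH] Pk C2 \<phi> this]
    have 1: "(\<lambda>k. LINT x|M. (\<phi> x *\<^sub>R ?R (H k) x) \<bullet> Pk k x) \<longlonglongrightarrow> 0" .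
    have 2: "(\<lambda>k. LINT x|M. Pk k x \<bullet> (\<phi> x *\<^sub>R ?R F x)) \<longlonglongrightarrow> (LINT x|M. P x \<bullet> (\<phi> x *\<^sub>R ?R F x))"
      by (rule lim(2)[OF RL[OF F]])
    have HL: "H k \<in> Lp M p" for k using vH by (simp add: W1p_pair_def)
    \<comment> \<open>\<open>Fk k\<close> is split into \<open>H k\<close> and the fixed field
      \<open>F\<close>. The first product tends to 0 by the div-curl lemma; the second is linear in
      \<open>Pk k\<close> and converges weakly.\<close>
    have "(LINT x|M. \<phi> x * (Fk k x $ i \<bullet> Pk k x $ j)) = (LINT x|M. (\<phi> x *\<^sub>R ?R (H k) x) \<bullet> Pk k x) + (LINT x|M. Pk k x \<bullet> (\<phi> x *\<^sub>R ?R F x))" for k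
    proof -
      have "(LINT x|M. \<phi> x * (Fk k x $ i \<bullet> Pk k x $ j)) = (LINT x|M. (\<phi> x *\<^sub>R ?R (H k) x) \<bullet> Pk k x + (\<phi> x *\<^sub>R ?R F x) \<bullet> Pk k x)"
        by (simp add: row_outer_inner H_def inner_diff_left algebra_simps)
      then show ?thesis
        using Hoelder_inner(1)[OF RL[OF HL[of k]] Pk(1)[of k] pq] Hoelder_inner(1)[OF RL[OF F] Pk(1)[of k] pq]
        by (simp add: inner_commute[of "Pk k _"])
    qed
    then show ?thesis using tendsto_add[OF 1 2] by (simp add: inner_commute[of "P _"] row_outer_inner)
  qed
  have int: "integrable M (\<lambda>x. F x $ i \<bullet> P x $ j)" if "F \<in> Lp M p" "P \<in> Lp M q" for F P :: "'n mfield" and i j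
    using Hoelder_inner(1)[OF Lp_row_outer[OF that(1) p(2)] that(2) pq] by (simp add: row_outer_inner)
  \<comment> \<open>Symmetry is an equality of entries, and each entry converges when tested with
    \<open>\<phi>\<close>; the limits agree as distributions and hence almost everywhere.\<close>
  have "AE x in M. F x $ i \<bullet> P x $ j = F x $ j \<bullet> P x $ i" for i j
  proof (rule loc_integrable_weakly_equal[OF dom(1)])
    show "loc_integrable U (\<lambda>x. F x $ i \<bullet> P x $ j)" "loc_integrable U (\<lambda>x. F x $ j \<bullet> P x $ i)"
      by (intro integrable_imp_loc_integrable dom int F P)+
    fix \<phi> assume \<phi>: "\<phi> \<in> test_functions U"
    have [measurable]: "\<phi> \<in> borel_measurable M"
      by (intro borel_imp_lebesgue_on_measurable borel_measurable_continuous_onI smooth_continuous test_functionsD(1)[OF \<phi>])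
    have "(LINT x|M. \<phi> x * (Fk k x $ i \<bullet> Pk k x $ j)) = (LINT x|M. \<phi> x * (Fk k x $ j \<bullet> Pk k x $ i))" for k
    proof (rule integral_cong_AE)
      show "AE x in M. \<phi> x * (Fk k x $ i \<bullet> Pk k x $ j) = \<phi> x * (Fk k x $ j \<bullet> Pk k x $ i)" using ZE(2)[of k]
      proof eventually_elim
        fix x assume "transpose (Fk k x ** transpose (Pk k x)) = Fk k x ** transpose (Pk k x)"
        from arg_cong[OF this, of "\<lambda>A. A $ j $ i"] show "\<phi> x * (Fk k x $ i \<bullet> Pk k x $ j) = \<phi> x * (Fk k x $ j \<bullet> Pk k x $ i)" by (simp only: transpose_nth mult_transpose_nth)
      qed
    qed (use borel_measurable_integrable[OF int[OF FkL(1) Pk(1)]] in measurable)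
    then show "(LINT x|M. F x $ i \<bullet> P x $ j * \<phi> x) = (LINT x|M. F x $ j \<bullet> P x $ i * \<phi> x)"
      using LIMSEQ_unique[OF conv[OF \<phi>, of i j]] conv[OF \<phi>, of j i] by (simp add: mult.commute)
  qed
  then have "AE x in M. \<forall>i\<in>UNIV. \<forall>j\<in>UNIV. F x $ i \<bullet> P x $ j = F x $ j \<bullet> P x $ i" by (intro AE_finite_allI) auto
  then have "AE x in M. transpose (F x ** transpose (P x)) = F x ** transpose (P x)"
    by eventually_elim (simp add: vec_eq_iff transpose_nth mult_transpose_nth)
  then show ?thesis using FPE0 by (simp add: E_set_def z)
qed

end

theorem lemma3p3:
  fixes \<Omega> \<Gamma>D \<Gamma>N :: "(real ^ 'n) set"
    and p q :: real
    and B :: "'n vfield \<Rightarrow> 'n vfield"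
    and f gD :: "'n vfield"
    and hN :: "'n vfield \<Rightarrow> real"
  assumes "open \<Omega>" and "bounded \<Omega>" and "connected \<Omega>" and "lipschitz_boundary \<Omega>"
    and "openin (top_of_set (frontier \<Omega>)) \<Gamma>D" and "openin (top_of_set (frontier \<Omega>)) \<Gamma>N"
    and "\<Gamma>D \<inter> \<Gamma>N = {}" and "closure \<Gamma>D \<union> closure \<Gamma>N = frontier \<Omega>"
    and "emeasure (hausdorff_measure (CARD('n) - 1)) (closure \<Gamma>N - \<Gamma>N) = 0"
    and "emeasure (hausdorff_measure (CARD('n) - 1)) (closure \<Gamma>D - \<Gamma>D) = 0"
    and "\<Gamma>D \<noteq> {}"
    and "1 < p" and "1 < q" and "1 / p + 1 / q = 1"
    and "is_trace_operator \<Omega> p B"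
    and "f \<in> Lp (lebesgue_on \<Omega>) q"
    and "gD \<in> Wtr \<Omega> p"
    and "hN \<in> Wtr_dual \<Omega> p"
  shows "weakly_closed_Xpq \<Omega> p q (E_set \<Omega> \<Gamma>D \<Gamma>N p q B f gD hN)
    \<and> weakly_closed_Xpq \<Omega> p q (E0_set \<Omega> \<Gamma>D \<Gamma>N p q B f gD hN)
    \<and> (\<exists>c. \<forall>(F, P) \<in> E0_set \<Omega> \<Gamma>D \<Gamma>N p q B f gD hN.
          (LINT x|lebesgue_on \<Omega>. F x \<bullet> P x) \<le> c * Xpq_norm \<Omega> p q (F, P) + c)"
proof -
  interpret mixed_boundary_problem \<Omega> \<Gamma>D \<Gamma>N p q B f gD hN by unfold_locales (fact assms)+
  show ?thesis unfolding weakly_closed_Xpq_def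
    by (intro conjI allI impI E0_bound; elim conjE; rule E_weakly_closed E0_weakly_closed; simp)
qed

end
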